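(* There is a randomized Monte Carlo algorithm solving Vector Bin Covering with Few Small Items (with respect to a covering property $\mathcal P$) in time $2^k\cdot n^{O(1)}$, where $k$ is the number of small items and $n$ the input size.
   Context: A covering property $\mathcal P$ is a predicate on vectors in $\mathbb{Q}_{\geqslant 0}^d$ expressing that a bin of unit capacity is covered (e.g. "some coordinate is at least $1$", "all coordinates are at least $1$"); it is monotone (if $x$ satisfies $\mathcal P$ then every coordinate-wise larger vector does) and can be evaluated in polynomial time. A set of items covers a bin w.r.t. $\mathcal P$ if the sum of its items satisfies $\mathcal P$. A set $V'$ of items is 3-covering w.r.t. $\mathcal P$ if every three distinct items of $V'$ cover a bin. Vector Bin Covering with Few Small Items: given a set of $n$ items $V=\{v_1,\dots,v_n\}\subseteq\mathbb{Q}_{\geqslant 0}^d$, a subset $V_S\subseteq V$ of $k$ items (small items) such that $V_L=V\setminus V_S$ is 3-covering w.r.t. $\mathcal P$, and an integer $\ell\in\mathbb{Z}_+$, decide whether $V$ can be partitioned into $\ell$ bins $B_1\cup\dots\cup B_\ell=V$ such that $\sum_{v\in B_i}v$ satisfies $\mathcal P$ for every $i\in[\ell]$. The parameter is $k$. *)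

theory Defs
  imports "HOL-Probability.SPMF" "HOL-Library.Log_Nat"
begin

section \<open>Model of computation\<close>

text \<open>
  Randomized programs over binary trees with natural numbers at the leaves, under the
  logarithmic cost criterion: arithmetic is charged the bit lengths of its operands, and building
  or taking apart a tree node, testing, and tossing a fair coin take unit time (trees are
  immutable, hence shared and never copied). A memory kept as a balanced tree simulates a random
  access machine with logarithmic overhead per step, and conversely, so a running time of the form
  \<open>2^k * n^O(1)\<close> does not depend on the choice between the two.
\<close>

datatype val = Num nat | Tup val val

text \<open>The number of bits needed to write down a tree, up to a constant factor.\<close>

primrec bits :: "val \<Rightarrow> nat" where
  "bits (Num n) = 1 + floorlog 2 n"
| "bits (Tup v w) = 1 + bits v + bits w"

datatype arith = Add | Sub | Mul | Div | Mod | Less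

primrec arith_fun :: "arith \<Rightarrow> nat \<Rightarrow> nat \<Rightarrow> nat" where
  "arith_fun Add a b = a + b"
| "arith_fun Sub a b = a - b"
| "arith_fun Mul a b = a * b"
| "arith_fun Div a b = a div b"
| "arith_fun Mod a b = a mod b"
| "arith_fun Less a b = of_bool (a < b)"

text \<open>
  A program maps an input tree to an output tree. \<open>Comp p q\<close> runs \<open>q\<close> on the result of \<open>p\<close>;
  \<open>Both p q\<close> pairs the results of \<open>p\<close> and \<open>q\<close> on the same input; \<open>Loop c p\<close> transforms its
  input by \<open>p\<close> as long as \<open>c\<close> holds of it.
\<close>

datatype prog =
    Ident
  | Lit nat
  | Head
  | Tail
  | IsTup
  | Arith arith
  | Coin
  | Comp prog prog
  | Both prog prog
  | Cond prog prog prog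
  | Loop prog prog

fun head_of :: "val \<Rightarrow> val" where
  "head_of (Tup v w) = v"
| "head_of (Num n) = Num 0"

fun tail_of :: "val \<Rightarrow> val" where
  "tail_of (Tup v w) = w"
| "tail_of (Num n) = Num 0"

fun is_tup :: "val \<Rightarrow> bool" where
  "is_tup (Tup v w) = True"
| "is_tup (Num n) = False"

fun arith_step :: "arith \<Rightarrow> val \<Rightarrow> val \<times> nat" where
  "arith_step f (Tup (Num a) (Num b)) = (Num (arith_fun f a b), 1 + floorlog 2 a + floorlog 2 b)"
| "arith_step f _ = (Num 0, 1)"

definition truth :: "val \<Rightarrow> bool" where
  "truth v \<longleftrightarrow> v \<noteq> Num 0"

text \<open>
  \<open>run p v\<close> is the distribution of the pair (output, running time) of \<open>p\<close> on input \<open>v\<close>; the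
  missing probability mass is that of divergence.
\<close>

partial_function (spmf) run_loop ::
    "(val \<Rightarrow> (val \<times> nat) spmf) \<Rightarrow> (val \<Rightarrow> (val \<times> nat) spmf) \<Rightarrow> val \<Rightarrow> (val \<times> nat) spmf" where
  "run_loop c p v = do {
     (b, r) \<leftarrow> c v;
     if truth b then do {
       (w, s) \<leftarrow> p v;
       (u, t) \<leftarrow> run_loop c p w;
       return_spmf (u, 1 + r + s + t)
     } else return_spmf (v, 1 + r)
   }"

primrec run :: "prog \<Rightarrow> val \<Rightarrow> (val \<times> nat) spmf" where
  "run Ident = (\<lambda>v. return_spmf (v, 1))"
| "run (Lit n) = (\<lambda>v. return_spmf (Num n, 1 + floorlog 2 n))"
| "run Head = (\<lambda>v. return_spmf (head_of v, 1))"
| "run Tail = (\<lambda>v. return_spmf (tail_of v, 1))"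
| "run IsTup = (\<lambda>v. return_spmf (Num (of_bool (is_tup v)), 1))"
| "run (Arith f) = (\<lambda>v. return_spmf (arith_step f v))"
| "run Coin = (\<lambda>v. do { b \<leftarrow> coin_spmf; return_spmf (Num (of_bool b), 1) })"
| "run (Comp p q) = (\<lambda>v. do {
     (w, s) \<leftarrow> run p v;
     (u, t) \<leftarrow> run q w;
     return_spmf (u, 1 + s + t)
   })"
| "run (Both p q) = (\<lambda>v. do {
     (w, s) \<leftarrow> run p v;
     (u, t) \<leftarrow> run q v;
     return_spmf (Tup w u, 1 + s + t)
   })"
| "run (Cond c p q) = (\<lambda>v. do {
     (b, r) \<leftarrow> run c v;
     (u, t) \<leftarrow> if truth b then run p v else run q v;
     return_spmf (u, 1 + r + t)
   })"
| "run (Loop c p) = run_loop (run c) (run p)"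

primrec coin_free :: "prog \<Rightarrow> bool" where
  "coin_free Ident = True"
| "coin_free (Lit n) = True"
| "coin_free Head = True"
| "coin_free Tail = True"
| "coin_free IsTup = True"
| "coin_free (Arith f) = True"
| "coin_free Coin = False"
| "coin_free (Comp p q) = (coin_free p \<and> coin_free q)"
| "coin_free (Both p q) = (coin_free p \<and> coin_free q)"
| "coin_free (Cond c p q) = (coin_free c \<and> coin_free p \<and> coin_free q)"
| "coin_free (Loop c p) = (coin_free c \<and> coin_free p)"

abbreviation enc_bool :: "bool \<Rightarrow> val" where
  "enc_bool b \<equiv> Num (of_bool b)"

text \<open>
  Since the bound \<open>T\<close> applies to every terminating run and the program terminates with
  probability 1, no sequence of coin tosses leads to a run longer than \<open>T\<close>: it would have a
  prefix of positive probability whose extensions all exceed \<open>T\<close>.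
\<close>

definition runs_within :: "prog \<Rightarrow> val \<Rightarrow> real \<Rightarrow> bool" where
  "runs_within p v T \<longleftrightarrow>
     lossless_spmf (run p v) \<and> (\<forall>(w, t) \<in> set_spmf (run p v). real t \<le> T)"

text \<open>Deterministic decision in time polynomial in the bit size of the input.\<close>

definition poly_time_decidable :: "('a \<Rightarrow> val) \<Rightarrow> 'a set \<Rightarrow> ('a \<Rightarrow> bool) \<Rightarrow> bool" where
  "poly_time_decidable enc X Q \<longleftrightarrow>
     (\<exists>p C c. coin_free p \<and>
        (\<forall>x \<in> X. runs_within p (enc x) (real C * real (bits (enc x)) ^ c) \<and>
                 fst ` set_spmf (run p (enc x)) = {enc_bool (Q x)}))"

text \<open>
  Monte Carlo: worst-case time bound \<open>T\<close>, wrong answer with probability at most 1/3. Nothing is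
  required on inputs outside the set \<open>X\<close> of instances.
\<close>

definition monte_carlo_decides ::
    "prog \<Rightarrow> ('a \<Rightarrow> val) \<Rightarrow> 'a set \<Rightarrow> ('a \<Rightarrow> bool) \<Rightarrow> ('a \<Rightarrow> real) \<Rightarrow> bool" where
  "monte_carlo_decides p enc X Q T \<longleftrightarrow>
     (\<forall>x \<in> X. runs_within p (enc x) (T x) \<and>
              spmf (map_spmf fst (run p (enc x))) (enc_bool (Q x)) \<ge> 2 / 3)"


section \<open>Encoding of inputs\<close>

fun enc_list :: "val list \<Rightarrow> val" where
  "enc_list [] = Num 0"
| "enc_list (v # vs) = Tup v (enc_list vs)"

text \<open>A nonnegative rational, as numerator and denominator in lowest terms.\<close>

definition enc_rat :: "rat \<Rightarrow> val" where
  "enc_rat x = (case quotient_of x of (a, b) \<Rightarrow> Tup (Num (nat a)) (Num (nat b)))"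

definition enc_vec :: "rat list \<Rightarrow> val" where
  "enc_vec x = enc_list (map enc_rat x)"


section \<open>Covering properties\<close>

text \<open>
  A vector with \<open>d\<close> coordinates is a list of length \<open>d\<close>, and a covering property is defined on
  vectors of every dimension at once, so the dimension is part of the input. A property of
  vectors of one fixed dimension is the special case of a predicate that is false on all other
  lists.
\<close>

definition nonneg_vec :: "rat list \<Rightarrow> bool" where
  "nonneg_vec x \<longleftrightarrow> (\<forall>a \<in> set x. 0 \<le> a)"

definition covering_property :: "(rat list \<Rightarrow> bool) \<Rightarrow> bool" where
  "covering_property P \<longleftrightarrow>
     (\<forall>x y. nonneg_vec x \<and> nonneg_vec y \<and> list_all2 (\<le>) x y \<and> P x \<longrightarrow> P y) \<and>
     poly_time_decidable enc_vec {x. nonneg_vec x} P"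

text \<open>Items are referred to by their indices, so different items may be equal vectors.\<close>

definition vec_sum :: "nat \<Rightarrow> rat list list \<Rightarrow> nat set \<Rightarrow> rat list" where
  "vec_sum d vs B = map (\<lambda>j. \<Sum>i\<in>B. vs ! i ! j) [0..<d]"

definition covers :: "(rat list \<Rightarrow> bool) \<Rightarrow> nat \<Rightarrow> rat list list \<Rightarrow> nat set \<Rightarrow> bool" where
  "covers P d vs B \<longleftrightarrow> P (vec_sum d vs B)"

definition three_covering :: "(rat list \<Rightarrow> bool) \<Rightarrow> nat \<Rightarrow> rat list list \<Rightarrow> nat set \<Rightarrow> bool" where
  "three_covering P d vs A \<longleftrightarrow>
     (\<forall>a\<in>A. \<forall>b\<in>A. \<forall>c\<in>A. a \<noteq> b \<and> a \<noteq> c \<and> b \<noteq> c \<longrightarrow> covers P d vs {a, b, c})"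


section \<open>Vector Bin Covering with Few Small Items\<close>

record vbc =
  dim :: nat
  items :: "rat list list"
  small :: "nat set"
  bins :: nat

definition vbc_instance :: "(rat list \<Rightarrow> bool) \<Rightarrow> vbc \<Rightarrow> bool" where
  "vbc_instance P I \<longleftrightarrow>
     (\<forall>v \<in> set (items I). length v = dim I \<and> nonneg_vec v) \<and>
     small I \<subseteq> {..<length (items I)} \<and>
     three_covering P (dim I) (items I) ({..<length (items I)} - small I) \<and>
     bins I > 0"

definition vbc_solvable :: "(rat list \<Rightarrow> bool) \<Rightarrow> vbc \<Rightarrow> bool" where
  "vbc_solvable P I \<longleftrightarrow>
     (\<exists>B :: nat \<Rightarrow> nat set.
        (\<Union>b<bins I. B b) = {..<length (items I)} \<and>
        disjoint_family_on B {..<bins I} \<and>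
        (\<forall>b<bins I. covers P (dim I) (items I) (B b)))"

text \<open>
  The small items are marked by a flag, the number of bins is written in binary, and the dimension
  in unary, because already the sum of an empty bin has that many coordinates.
\<close>

definition enc_vbc :: "vbc \<Rightarrow> val" where
  "enc_vbc I =
     Tup (Num (bins I))
       (Tup (enc_list (replicate (dim I) (Num 0)))
            (enc_list (map (\<lambda>i. Tup (enc_bool (i \<in> small I)) (enc_vec (items I ! i)))
                           [0..<length (items I)])))"

end

theory Submission
  imports Defs "HOL-Computational_Algebra.Polynomial" "HOL-Library.Z2" "HOL-Combinatorics.Permutations" "HOL-Library.Nat_Bijection"
begin

text \<open>
  A bin with at least three large items is covered by any three of them. So for every guess of the
  number of such bins the instance becomes a perfect matching problem on the large items and some
  dummy vertices, in which every edge \<open>uv\<close> carries a set \<open>T\<close> of small items that together with \<open>u\<close>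
  and \<open>v\<close> must cover a bin, and these sets must partition the small items.

  Give every edge and every pair of an edge and a small item a random weight, and let \<open>A\<^sub>I\<close> be the
  symmetric matrix whose entry \<open>uv\<close> is the sum of \<open>t ^ weight(uv, T)\<close> over the admissible \<open>T \<subseteq> I\<close>.
  Modulo 2, the determinant of \<open>A\<^sub>I\<close> is the sum over perfect matchings of the squares of the
  products of their entries, and summing it over all sets \<open>I\<close> of small items cancels the terms
  in which some small item is not used. A large constant added to the weight for every use of a
  small item puts the terms in which some item is used twice into higher degrees, and by the
  isolation lemma the solution of least weight is unique with probability at least 2/3, so that
  an odd coefficient remains.

  The \<open>2 ^ k\<close> matrices are computed by a zeta transform and their determinants by Bird's
  division-free recurrence. All this is arithmetic on natural numbers of polynomial length: \<open>t\<close> is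
  replaced by a number larger than all coefficients, and matrices and vectors are packed into the
  digits of one number.
\<close>


section \<open>Determinants modulo two\<close>

text \<open>The bound allows a single factor \<open>2 ^ k\<close>, so no loop over sets of small
  items may lie inside another. Hence the sums over \<open>T \<subseteq> I\<close> are not taken
  entry by entry: the matrix of one set \<open>T\<close> is packed into one number, and the zeta
  transform adds such numbers in \<open>k\<close> sequential passes over a list of length
  \<open>2 ^ k\<close>. The language of expressions exists to certify this: it tracks how deeply
  exponential loops are nested.

  Modulo 2 the signs disappear and every unwanted term cancels against a partner, but solutions may
  cancel as well; only the uniqueness supplied by isolation prevents this. The error is therefore
  one-sided: an odd coefficient of low degree always proves that a solution exists, and bad weights
  can only hide one.

  Each matching edge is met from both of its ends, which gives the squares. Squaring is additive in
  characteristic 2, so it creates no mixed terms and merely doubles the degrees. Weights sit on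
  edges and on pairs of an edge and an item, because a configuration is determined by the set of
  these, and isolation speaks about sets.\<close>

lemma sum_involution_char2:
  fixes g :: "'b \<Rightarrow> 'a::comm_monoid_add"
  assumes two: "\<And>x::'a. x + x = 0" and fin: "finite S"
    and f: "\<And>x. x \<in> S \<Longrightarrow> f x \<in> S" "\<And>x. x \<in> S \<Longrightarrow> f (f x) = x" "\<And>x. x \<in> S \<Longrightarrow> g (f x) = g x"
  shows "sum g S = sum g {x \<in> S. f x = x}"
  using fin f
proof (induction "card S" arbitrary: S rule: less_induct)
  case less
  show ?case
  proof (cases "\<forall>x\<in>S. f x = x")
    case True
    then have "{x \<in> S. f x = x} = S" by auto
    then show ?thesis by simp
  next
    case False
    then obtain x where x: "x \<in> S" "f x \<noteq> x" by auto
    let ?S = "S - {x, f x}"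
    have fx: "f x \<in> S" "f (f x) = x" using less.prems x by auto
    have "S = insert x (insert (f x) ?S)" using x fx by auto
    then have "sum g S = g x + (g (f x) + sum g ?S)"
      using x less.prems(1) by (metis (no_types, lifting) Diff_iff finite_Diff finite_insert insert_iff singletonI sum.insert)
    also have "\<dots> = (g x + g x) + sum g ?S" using less.prems(4) x by (simp add: add.assoc)
    also have "\<dots> = sum g ?S" by (simp add: two)
    also have "\<dots> = sum g {y \<in> ?S. f y = y}"
    proof (rule less.hyps)
      show "card ?S < card S" using x less.prems(1) by (intro psubset_card_mono) auto
      show "f y \<in> ?S" if "y \<in> ?S" for y
        using that less.prems(2,3)[of y] fx x by auto
    qed (use less.prems in auto)
    also have "{y \<in> ?S. f y = y} = {y \<in> S. f y = y}" using x fx by auto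
    finally show ?thesis .
  qed
qed

text \<open>This is the permanent; where \<open>x + x = 0\<close> it agrees with the
  determinant.\<close>

definition perm_sum :: "(nat \<Rightarrow> nat \<Rightarrow> 'a::comm_semiring_1) \<Rightarrow> nat set \<Rightarrow> 'a" where
  "perm_sum A S = (\<Sum>p | p permutes S. \<Prod>r\<in>S. A r (p r))"

text \<open>Rows \<open>insert i S\<close>, columns \<open>S\<close> and, in place of \<open>i\<close>, the column \<open>j\<close>, which may be repeated.\<close>

definition minor_sum :: "(nat \<Rightarrow> nat \<Rightarrow> 'a::comm_semiring_1) \<Rightarrow> nat \<Rightarrow> nat \<Rightarrow> nat set \<Rightarrow> 'a" where
  "minor_sum A i j S = (\<Sum>p | p permutes insert i S. \<Prod>r\<in>insert i S. A r (if p r = i then j else p r))"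

lemma minor_sum_same: "i \<notin> S \<Longrightarrow> minor_sum A i i S = perm_sum A (insert i S)"
  unfolding minor_sum_def perm_sum_def by (intro sum.cong prod.cong) auto

lemma minor_sum_empty: "minor_sum A i j {} = A i j"
proof -
  have "{p. p permutes {i}} = {id}" by (auto simp: permutes_sing)
  then show ?thesis unfolding minor_sum_def by simp
qed

text \<open>The column \<open>j\<close> is used twice, once for itself and once in place of
  \<open>i\<close>. Exchanging the two copies is an involution on the permutations that has no fixed
  point and preserves the product.\<close>

lemma minor_sum_repeat:
  fixes A :: "nat \<Rightarrow> nat \<Rightarrow> 'a::comm_semiring_1"
  assumes two: "\<And>x::'a. x + x = 0" and S: "finite S" "i \<notin> S" "j \<in> S"
  shows "minor_sum A i j S = 0"
proof -
  let ?t = "Transposition.transpose i j"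
  have ij: "i \<noteq> j" using S by auto
  have "minor_sum A i j S = (\<Sum>p | p \<in> {p. p permutes insert i S} \<and> ?t \<circ> p = p. \<Prod>r\<in>insert i S. A r (if p r = i then j else p r))"
    unfolding minor_sum_def
  proof (rule sum_involution_char2[OF two])
    show "finite {p. p permutes insert i S}" using S by (simp add: finite_permutations)
    fix p assume p: "p \<in> {p. p permutes insert i S}"
    show "?t \<circ> p \<in> {p. p permutes insert i S}"
      using p S by (auto intro: permutes_compose permutes_swap_id)
    show "?t \<circ> (?t \<circ> p) = p" by (simp add: fun_eq_iff)
    show "(\<Prod>r\<in>insert i S. A r (if (?t \<circ> p) r = i then j else (?t \<circ> p) r)) = (\<Prod>r\<in>insert i S. A r (if p r = i then j else p r))"
      using ij by (intro prod.cong) (auto simp: Transposition.transpose_def)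
  qed
  also have "{p \<in> {p. p permutes insert i S}. ?t \<circ> p = p} = {}"
  proof -
    have "False" if p: "p permutes insert i S" "?t \<circ> p = p" for p
    proof -
      obtain x where x: "p x = i" using p(1) permutes_surj by (metis surjD)
      have "?t (p x) = p x" using p(2) by (metis comp_apply)
      then show False using x ij by simp
    qed
    then show ?thesis by blast
  qed
  finally show ?thesis by simp
qed

text \<open>Laplace expansion along the exceptional column \<open>j\<close>: the permutations are
  grouped by the row \<open>l\<close> that is assigned to it. For \<open>l = i\<close> a permanent
  on \<open>S\<close> remains. For \<open>l \<in> S\<close> the remaining rows are
  \<open>insert i (S - {l})\<close> and the remaining columns are \<open>S\<close>, so
  \<open>l\<close> becomes the exceptional column; composing with the transposition of
  \<open>i\<close> and \<open>l\<close> renames it accordingly.\<close>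

lemma minor_sum_expand:
  assumes S: "finite S" "i \<notin> S"
  shows "minor_sum A i j S = A i j * perm_sum A S + (\<Sum>l\<in>S. A l j * minor_sum A i l (S - {l}))"
proof -
  let ?P = "{p. p permutes insert i S}"
  let ?g = "\<lambda>p. \<Prod>r\<in>insert i S. A r (if p r = i then j else p r)"
  have "minor_sum A i j S = (\<Sum>l\<in>insert i S. sum ?g {p \<in> ?P. inv p i = l})"
    unfolding minor_sum_def
  proof (rule sum.group[symmetric])
    show "finite ?P" using S by (simp add: finite_permutations)
    show "(\<lambda>p. inv p i) ` ?P \<subseteq> insert i S" using permutes_inv[of _ "insert i S"] permutes_in_image[of _ "insert i S" i] by auto
  qed (use S in auto)
  also have "\<dots> = (\<Sum>l\<in>insert i S. sum ?g {p \<in> ?P. p l = i})"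
  proof -
    have "inv p i = l \<longleftrightarrow> p l = i" if "p \<in> ?P" for p l
      by (rule permutes_inv_eq[of p "insert i S"]) (use that in simp)
    then have "{p \<in> ?P. inv p i = l} = {p \<in> ?P. p l = i}" for l by blast
    then show ?thesis by simp
  qed
  also have "\<dots> = sum ?g {p \<in> ?P. p i = i} + (\<Sum>l\<in>S. sum ?g {p \<in> ?P. p l = i})"
    using S by simp
  also have "sum ?g {p \<in> ?P. p i = i} = A i j * perm_sum A S"
  proof -
    have "{p \<in> ?P. p i = i} = {p. p permutes S}"
      using S by (auto intro: permutes_superset permutes_subset simp: permutes_not_in)
    moreover have "?g p = A i j * (\<Prod>r\<in>S. A r (p r))" if "p permutes S" for p
    proof -
      have "p i = i" using that S by (simp add: permutes_not_in)
      moreover have "p r \<noteq> i" if "r \<in> S" for r using \<open>p permutes S\<close> S that by (metis permutes_in_image)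
      ultimately show ?thesis using S by simp
    qed
    ultimately show ?thesis by (simp add: perm_sum_def sum_distrib_left)
  qed
  also have "(\<Sum>l\<in>S. sum ?g {p \<in> ?P. p l = i}) = (\<Sum>l\<in>S. A l j * minor_sum A i l (S - {l}))"
  proof (rule sum.cong[OF refl])
    fix l assume l: "l \<in> S"
    let ?t = "Transposition.transpose i l"
    have il: "i \<noteq> l" using l S by auto
    have ins: "insert i S = insert l (insert i (S - {l}))" using l by auto
    have t: "?t permutes insert i S" using l by (auto intro: permutes_swap_id)
    have "sum ?g {p \<in> ?P. p l = i} = (\<Sum>p | p permutes insert i (S - {l}).
        A l j * (\<Prod>r\<in>insert i (S - {l}). A r (if p r = i then l else p r)))"
    proof (rule sum.reindex_bij_witness[where i = "\<lambda>p. ?t \<circ> p" and j = "\<lambda>p. ?t \<circ> p"], goal_cases)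
      case (1 p) then show ?case by (simp add: fun_eq_iff)
    next
      case (2 p)
      then have "?t \<circ> p permutes insert i S" using t by (auto intro: permutes_compose)
      then have "?t \<circ> p permutes insert i (S - {l})"
      proof (rule permutes_superset)
        fix x assume "x \<in> insert i S - insert i (S - {l})"
        then have "x = l" by auto
        then show "(?t \<circ> p) x = x" using 2 by simp
      qed
      then show ?case by simp
    next
      case (3 p) then show ?case by (simp add: fun_eq_iff)
    next
      case (4 p)
      then have "p permutes insert i S" by (auto intro: permutes_subset)
      moreover have "p l = l" using 4 il by (auto simp: permutes_not_in)
      ultimately show ?case using t by (auto intro: permutes_compose)
    next
      case (5 p)
      then have p: "p permutes insert i S" "p l = i" by auto
      have ne: "p r \<noteq> i" if "r \<noteq> l" for r using p that by (metis permutes_inj injD)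
      have "(\<Prod>r\<in>insert i (S - {l}). A r (if (?t \<circ> p) r = i then l else (?t \<circ> p) r))
        = (\<Prod>r\<in>insert i (S - {l}). A r (if p r = i then j else p r))"
      proof (rule prod.cong[OF refl])
        fix r assume "r \<in> insert i (S - {l})"
        then have "p r \<noteq> i" by (intro ne) (use il in auto)
        then show "A r (if (?t \<circ> p) r = i then l else (?t \<circ> p) r) = A r (if p r = i then j else p r)"
          using il by (auto simp: Transposition.transpose_def)
      qed
      moreover have "?g p = A l j * (\<Prod>r\<in>insert i (S - {l}). A r (if p r = i then j else p r))"
        unfolding ins using S il p(2) by (subst prod.insert) auto
      ultimately show ?case by simp
    qed
    then show "sum ?g {p \<in> ?P. p l = i} = A l j * minor_sum A i l (S - {l})"
      by (simp add: minor_sum_def sum_distrib_left)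
  qed
  finally show ?thesis .
qed

text \<open>
  Bird's division-free recurrence for the determinant. In characteristic 2 the entries of the
  iterates are sums of \<open>minor_sum\<close> over index sets, the signs being immaterial.
\<close>

definition bird_step :: "(nat \<Rightarrow> nat \<Rightarrow> 'a::comm_semiring_1) \<Rightarrow> (nat \<Rightarrow> nat \<Rightarrow> 'a) \<Rightarrow> nat \<Rightarrow> nat \<Rightarrow> 'a" where
  "bird_step A X i j = (\<Sum>l<i. X i l * A l j) + (\<Sum>h<i. X h h) * A i j"

primrec bird :: "(nat \<Rightarrow> nat \<Rightarrow> 'a::comm_semiring_1) \<Rightarrow> nat \<Rightarrow> nat \<Rightarrow> nat \<Rightarrow> 'a" where
  "bird A 0 = A"
| "bird A (Suc p) = bird_step A (bird A p)"

text \<open>Bird's recurrence is usually stated with the indices after \<open>i\<close>. Here it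
  runs over those before \<open>i\<close>, so the determinant appears in the last diagonal entry
  instead of the first.\<close>

definition bird_det :: "nat \<Rightarrow> (nat \<Rightarrow> nat \<Rightarrow> 'a::comm_semiring_1) \<Rightarrow> 'a" where
  "bird_det n A = bird A (n - 1) (n - 1) (n - 1)"

text \<open>Induction on \<open>p\<close> by \<open>minor_sum_expand\<close>. The permanents in the
  expansion come from the diagonal sums of the previous iterate, the other terms from the matrix
  product. The product also contains sets \<open>S\<close> with \<open>l \<in> S\<close>, and these
  vanish by \<open>minor_sum_repeat\<close>.\<close>

lemma bird_minors:
  fixes A :: "nat \<Rightarrow> nat \<Rightarrow> 'a::comm_semiring_1"
  assumes two: "\<And>x::'a. x + x = 0"
  shows "bird A p i j = (\<Sum>S | S \<subseteq> {..<i} \<and> card S = p. minor_sum A i j S)"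
proof (induction p arbitrary: i j)
  case 0
  have "{S. S \<subseteq> {..<i} \<and> card S = 0} = {{}}" using finite_subset by fastforce
  then show ?case by (simp add: minor_sum_empty)
next
  case (Suc p)
  have fin: "finite {S. S \<subseteq> {..<i} \<and> card S = q}" for i q :: nat by (rule finite_subset[of _ "Pow {..<i}"]) auto
  let ?Q = "{S. S \<subseteq> {..<i} \<and> card S = Suc p}"
  have "(\<Sum>S\<in>?Q. minor_sum A i j S) = (\<Sum>S\<in>?Q. A i j * perm_sum A S + (\<Sum>l\<in>S. A l j * minor_sum A i l (S - {l})))"
    by (intro sum.cong refl minor_sum_expand) (auto intro: finite_subset)
  also have "\<dots> = (\<Sum>S\<in>?Q. perm_sum A S) * A i j + (\<Sum>S\<in>?Q. \<Sum>l\<in>S. A l j * minor_sum A i l (S - {l}))"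
    by (simp add: sum.distrib sum_distrib_left mult.commute)
  \<comment> \<open>A set of size \<open>Suc p\<close> below \<open>i\<close> is split into its
    maximum \<open>h\<close> and a set of size \<open>p\<close> below \<open>h\<close>; this is why
    the diagonal sum in the recurrence stops before \<open>i\<close>.\<close>
  also have "(\<Sum>S\<in>?Q. perm_sum A S) = (\<Sum>h<i. \<Sum>S | S \<subseteq> {..<h} \<and> card S = p. minor_sum A h h S)"
  proof -
    have "(\<Sum>h<i. \<Sum>S | S \<subseteq> {..<h} \<and> card S = p. minor_sum A h h S) =
       (\<Sum>(h,S)\<in>(SIGMA h:{..<i}. {S. S \<subseteq> {..<h} \<and> card S = p}). minor_sum A h h S)"
      using fin by (subst sum.Sigma) auto
    also have "\<dots> = (\<Sum>S\<in>?Q. perm_sum A S)"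
    proof (rule sum.reindex_bij_witness[where i = "\<lambda>S. (Max S, S - {Max S})" and j = "\<lambda>(h, S). insert h S"], goal_cases)
      case (1 a)
      then obtain h S where a: "a = (h, S)" "h < i" "S \<subseteq> {..<h}" "card S = p" by auto
      have fS: "finite S" and h: "h \<notin> S" using a finite_subset by auto
      have "Max (insert h S) = h" using a fS by (intro Max_eqI) (auto intro: less_imp_le)
      then show ?case using a h by auto
    next
      case (2 a)
      then obtain h S where a: "a = (h, S)" "h < i" "S \<subseteq> {..<h}" "card S = p" by auto
      have fS: "finite S" and h: "h \<notin> S" using a finite_subset by auto
      then show ?case using a by auto
    next
      case (3 S)
      then have fS: "finite S" and ne: "S \<noteq> {}" using finite_subset by auto
      then show ?case by (simp add: insert_absorb)
    next
      case (4 S)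
      then have fS: "finite S" and ne: "S \<noteq> {}" using finite_subset by auto
      have "Max S \<in> S" using fS ne by simp
      moreover have "x < Max S" if "x \<in> S" "x \<noteq> Max S" for x using fS that by (simp add: le_neq_trans)
      ultimately show ?case using 4 fS by auto
    next
      case (5 a)
      then obtain h S where a: "a = (h, S)" "h < i" "S \<subseteq> {..<h}" by auto
      then have "h \<notin> S" by auto
      then show ?case using minor_sum_same[of h S A] a by simp
    qed
    finally show ?thesis by simp
  qed
  also have "(\<Sum>S\<in>?Q. \<Sum>l\<in>S. A l j * minor_sum A i l (S - {l})) = (\<Sum>l<i. (\<Sum>S | S \<subseteq> {..<i} \<and> card S = p. minor_sum A i l S) * A l j)"
  proof -
    have "(\<Sum>l<i. (\<Sum>S | S \<subseteq> {..<i} \<and> card S = p. minor_sum A i l S) * A l j) =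
      (\<Sum>l<i. \<Sum>S | S \<subseteq> {..<i} \<and> card S = p \<and> l \<notin> S. A l j * minor_sum A i l S)"
    proof (rule sum.cong[OF refl])
      fix l
      have "(\<Sum>S | S \<subseteq> {..<i} \<and> card S = p. minor_sum A i l S) = (\<Sum>S | S \<subseteq> {..<i} \<and> card S = p \<and> l \<notin> S. minor_sum A i l S)"
        using fin by (intro sum.mono_neutral_right) (auto intro!: minor_sum_repeat[OF two] intro: finite_subset)
      then show "(\<Sum>S | S \<subseteq> {..<i} \<and> card S = p. minor_sum A i l S) * A l j = (\<Sum>S | S \<subseteq> {..<i} \<and> card S = p \<and> l \<notin> S. A l j * minor_sum A i l S)"
        by (simp add: sum_distrib_left mult.commute)
    qed
    also have "\<dots> = (\<Sum>(l,S)\<in>(SIGMA l:{..<i}. {S. S \<subseteq> {..<i} \<and> card S = p \<and> l \<notin> S}). A l j * minor_sum A i l S)"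
      by (subst sum.Sigma) (auto intro!: finite_subset[OF _ fin[of i p]])
    also have "\<dots> = (\<Sum>(S,l)\<in>(SIGMA S:?Q. S). A l j * minor_sum A i l (S - {l}))"
      by (rule sum.reindex_bij_witness[where i = "\<lambda>(S, l). (l, S - {l})" and j = "\<lambda>(l, S). (insert l S, l)"])
        (auto simp: insert_absorb card_insert_if finite_subset[OF _ finite_lessThan])
    also have "\<dots> = (\<Sum>S\<in>?Q. \<Sum>l\<in>S. A l j * minor_sum A i l (S - {l}))"
      using fin by (subst sum.Sigma) (auto intro: finite_subset)
    finally show ?thesis by simp
  qed
  finally show ?case by (simp add: bird_step_def Suc.IH add.commute)
qed

theorem bird_det_eq_perm_sum:
  fixes A :: "nat \<Rightarrow> nat \<Rightarrow> 'a::comm_semiring_1"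
  assumes two: "\<And>x::'a. x + x = 0" and n: "n > 0"
  shows "bird_det n A = perm_sum A {..<n}"
proof -
  have "{S. S \<subseteq> {..<n - 1} \<and> card S = n - 1} = {{..<n - 1}}"
    using card_subset_eq[of "{..<n - 1}"] by auto
  moreover have "insert (n - 1) {..<n - 1} = {..<n}" using n by auto
  ultimately show ?thesis
    unfolding bird_det_def bird_minors[OF two] by (simp add: minor_sum_same)
qed

text \<open>Perfect matchings of \<open>{..<n}\<close> are represented by involutions without fixed points.\<close>

definition matchings :: "nat \<Rightarrow> (nat \<Rightarrow> nat) set" where
  "matchings n = {p. p permutes {..<n} \<and> (\<forall>u<n. p u \<noteq> u) \<and> (\<forall>u. p (p u) = u)}"

definition lower_ends :: "nat \<Rightarrow> (nat \<Rightarrow> nat) \<Rightarrow> nat set" where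
  "lower_ends n p = {u. u < n \<and> u < p u}"

lemma finite_matchings [simp]: "finite (matchings n)"
  by (rule finite_subset[of _ "{p. p permutes {..<n}}"]) (auto simp: matchings_def finite_permutations)

lemma finite_lower_ends [simp]: "finite (lower_ends n p)"
  by (rule finite_subset[of _ "{..<n}"]) (auto simp: lower_ends_def)

text \<open>By symmetry a permutation and its inverse have the same product and cancel unless they
  coincide, so involutions survive. The zero diagonal removes those with a fixed point. In the
  remaining ones the rows \<open>u\<close> and \<open>p u\<close> contribute the same entry, hence
  the square.\<close>

theorem perm_sum_symmetric:
  fixes A :: "nat \<Rightarrow> nat \<Rightarrow> 'a::comm_semiring_1"
  assumes two: "\<And>x::'a. x + x = 0"
    and sym: "\<And>u v. A u v = A v u" and diag: "\<And>u. A u u = 0"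
  shows "perm_sum A {..<n} = (\<Sum>p\<in>matchings n. \<Prod>u\<in>lower_ends n p. (A u (p u))\<^sup>2)"
proof -
  let ?g = "\<lambda>p. \<Prod>r<n. A r (p r)"
  have "perm_sum A {..<n} = sum ?g {p \<in> {p. p permutes {..<n}}. inv p = p}"
    unfolding perm_sum_def
  proof (rule sum_involution_char2[OF two])
    fix p assume "p \<in> {p. p permutes {..<n}}"
    then have p: "p permutes {..<n}" by simp
    show "inv p \<in> {p. p permutes {..<n}}" using p by (simp add: permutes_inv)
    show "inv (inv p) = p" using p by (simp add: permutes_inv_inv)
    have "?g p = (\<Prod>r<n. A (inv p r) (p (inv p r)))"
      using prod.permute[OF permutes_inv[OF p], of "\<lambda>r. A r (p r)"] by (simp add: o_def)
    also have "\<dots> = ?g (inv p)" using p by (simp add: permutes_inverses sym)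
    finally show "?g (inv p) = ?g p" by simp
  qed (simp add: finite_permutations)
  also have "\<dots> = sum ?g (matchings n)"
  proof (rule sum.mono_neutral_right)
    show "matchings n \<subseteq> {p \<in> {p. p permutes {..<n}}. inv p = p}"
    proof
      fix p assume p: "p \<in> matchings n"
      then have "inv p = p" by (intro inv_unique_comp) (auto simp: matchings_def)
      with p show "p \<in> {p \<in> {p. p permutes {..<n}}. inv p = p}" by (simp add: matchings_def)
    qed
    show "\<forall>p\<in>{p \<in> {p. p permutes {..<n}}. inv p = p} - matchings n. ?g p = 0"
    proof
      fix p assume p: "p \<in> {p \<in> {p. p permutes {..<n}}. inv p = p} - matchings n"
      then have "p permutes {..<n}" "inv p = p" by auto
      then have "p (p u) = u" for u using permutes_inverses(1)[of p "{..<n}" u] by simp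
      then obtain u where "u < n" "p u = u" using p unfolding matchings_def by blast
      then show "?g p = 0" using diag[of u] by (intro prod_zero) (auto intro!: bexI[of _ u])
    qed
  qed (simp add: finite_permutations)
  also have "\<dots> = (\<Sum>p\<in>matchings n. \<Prod>u\<in>lower_ends n p. (A u (p u))\<^sup>2)"
  proof (rule sum.cong[OF refl])
    fix p assume p: "p \<in> matchings n"
    let ?L = "lower_ends n p"
    have pn: "p u < n" if "u < n" for u using p that by (auto simp: matchings_def dest: permutes_in_image[of p "{..<n}" u])
    have "?g p = (\<Prod>u\<in>?L. A u (p u)) * (\<Prod>u\<in>{..<n} - ?L. A u (p u))"
      by (subst prod.subset_diff[of ?L]) (auto simp: lower_ends_def mult.commute)
    also have "(\<Prod>u\<in>{..<n} - ?L. A u (p u)) = (\<Prod>u\<in>?L. A u (p u))"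
    proof (rule prod.reindex_bij_witness[where i = p and j = p])
      have pp: "p (p u) = u" and ne: "u < n \<Longrightarrow> p u \<noteq> u" for u using p unfolding matchings_def by blast+
      show "p u \<in> ?L" "A (p u) (p (p u)) = A u (p u)" "p (p u) = u" if "u \<in> {..<n} - ?L" for u
        using that pn[of u] ne[of u] pp[of u] sym[of u "p u"] by (auto simp: lower_ends_def)
      show "p u \<in> {..<n} - ?L" "p (p u) = u" if "u \<in> ?L" for u
        using that pn[of u] pp[of u] by (simp_all add: lower_ends_def)
    qed
    finally show "?g p = (\<Prod>u\<in>?L. (A u (p u))\<^sup>2)" by (simp add: power2_eq_square prod.distrib)
  qed
  finally show ?thesis .
qed


section \<open>A parity sieve for matchings\<close>

definition edge_poly :: "(nat \<Rightarrow> nat \<Rightarrow> nat set \<Rightarrow> bool) \<Rightarrow> (nat \<Rightarrow> nat \<Rightarrow> nat set \<Rightarrow> 'a) \<Rightarrow> nat set \<Rightarrow> nat \<Rightarrow> nat \<Rightarrow> 'a::comm_semiring_1" where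
  "edge_poly al f I u v = (\<Sum>T | T \<subseteq> I \<and> al u v T. f u v T)"

text \<open>Only the values \<open>f u v\<close> with \<open>u < v\<close> are read: an edge is
  always described from its lower end.\<close>

definition sym_mat :: "(nat \<Rightarrow> nat \<Rightarrow> 'a) \<Rightarrow> nat \<Rightarrow> nat \<Rightarrow> 'a::zero" where
  "sym_mat f u v = (if u < v then f u v else if v < u then f v u else 0)"

text \<open>A configuration: a perfect matching whose edges \<open>u < p u\<close> carry sets of small items.\<close>

definition configs :: "(nat \<Rightarrow> nat \<Rightarrow> nat set \<Rightarrow> bool) \<Rightarrow> nat \<Rightarrow> nat set \<Rightarrow> ((nat \<Rightarrow> nat) \<times> (nat \<Rightarrow> nat set)) set" where
  "configs al n I = (SIGMA p:matchings n. PiE (lower_ends n p) (\<lambda>u. {T. T \<subseteq> I \<and> al u (p u) T}))"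

definition config_weight :: "(nat \<Rightarrow> nat \<Rightarrow> nat set \<Rightarrow> nat) \<Rightarrow> nat \<Rightarrow> (nat \<Rightarrow> nat) \<times> (nat \<Rightarrow> nat set) \<Rightarrow> nat" where
  "config_weight wt n c = (\<Sum>u\<in>lower_ends n (fst c). wt u (fst c u) (snd c u))"

definition config_union :: "nat \<Rightarrow> (nat \<Rightarrow> nat) \<times> (nat \<Rightarrow> nat set) \<Rightarrow> nat set" where
  "config_union n c = (\<Union>u\<in>lower_ends n (fst c). snd c u)"

lemma mem_configs: "c \<in> configs al n I \<longleftrightarrow> fst c \<in> matchings n \<and> snd c \<in> extensional (lower_ends n (fst c)) \<and>
    (\<forall>u\<in>lower_ends n (fst c). snd c u \<subseteq> I \<and> al u (fst c u) (snd c u))"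
  by (cases c) (auto simp: configs_def PiE_iff)

lemma finite_configs: "finite I \<Longrightarrow> finite (configs al n I)"
  unfolding configs_def by (intro finite_SigmaI finite_PiE finite_matchings finite_lower_ends) auto

text \<open>Mixed products occur twice. Without this identity the square of an entry would pair two
  different sets of small items on one edge.\<close>

lemma square_sum_char2:
  fixes f :: "'b \<Rightarrow> 'a::comm_semiring_1"
  assumes two: "\<And>x::'a. x + x = 0"
  shows "(sum f S)\<^sup>2 = (\<Sum>x\<in>S. (f x)\<^sup>2)"
proof (cases "finite S")
  case True
  then show ?thesis
  proof (induction S rule: finite_induct)
    case (insert x S)
    have "(f x + sum f S)\<^sup>2 = (f x)\<^sup>2 + (sum f S)\<^sup>2 + (f x * sum f S + f x * sum f S)"
      by (simp add: power2_eq_square algebra_simps)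
    then show ?case using insert by (simp add: two)
  qed simp
qed simp

lemma prod_monom_1: "finite S \<Longrightarrow> (\<Prod>x\<in>S. monom (1::'a::comm_semiring_1) (f x)) = monom 1 (\<Sum>x\<in>S. f x)"
  by (induction S rule: finite_induct) (auto simp: mult_monom)

lemma bit_poly_two: "x + x = (0 :: bit poly)"
proof (rule poly_eqI)
  fix n
  show "coeff (x + x) n = coeff 0 n" unfolding coeff_add coeff_0 by (cases "coeff x n") simp_all
qed

text \<open>For fixed \<open>I\<close> the determinant lists the configurations with labels inside
  \<open>I\<close>. In the sum over \<open>I\<close> a configuration is counted once for every
  \<open>I\<close> between its union and \<open>K\<close>, which is an even number unless the union
  is \<open>K\<close>. This is inclusion-exclusion without signs.\<close>

theorem sieve:
  fixes wt :: "nat \<Rightarrow> nat \<Rightarrow> nat set \<Rightarrow> nat"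
  assumes n: "n > 0" and K: "finite K"
  shows "(\<Sum>I\<in>Pow K. bird_det n (sym_mat (edge_poly al (\<lambda>u v T. monom (1::bit) (wt u v T)) I)))
    = (\<Sum>c | c \<in> configs al n K \<and> config_union n c = K. monom 1 (2 * config_weight wt n c))"
proof -
  let ?e = "edge_poly al (\<lambda>u v T. monom (1::bit) (wt u v T))"
  have 1: "bird_det n (sym_mat (?e I)) = (\<Sum>c\<in>configs al n I. monom 1 (2 * config_weight wt n c))" if I: "I \<subseteq> K" for I
  proof -
    have fI: "finite {T. T \<subseteq> I \<and> al u v T}" for u v
      by (rule finite_subset[of _ "Pow K"]) (use I K in auto)
    have "bird_det n (sym_mat (?e I)) = perm_sum (sym_mat (?e I)) {..<n}"
      by (rule bird_det_eq_perm_sum[OF bit_poly_two n])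
    also have "\<dots> = (\<Sum>p\<in>matchings n. \<Prod>u\<in>lower_ends n p. (sym_mat (?e I) u (p u))\<^sup>2)"
      by (rule perm_sum_symmetric[OF bit_poly_two]) (auto simp: sym_mat_def)
    also have "\<dots> = (\<Sum>p\<in>matchings n. \<Prod>u\<in>lower_ends n p. \<Sum>T | T \<subseteq> I \<and> al u (p u) T. monom 1 (2 * wt u (p u) T))"
      by (intro sum.cong prod.cong refl)
        (auto simp: sym_mat_def lower_ends_def edge_poly_def square_sum_char2[OF bit_poly_two] monom_power mult.commute)
    also have "\<dots> = (\<Sum>p\<in>matchings n. \<Sum>S\<in>PiE (lower_ends n p) (\<lambda>u. {T. T \<subseteq> I \<and> al u (p u) T}). \<Prod>u\<in>lower_ends n p. monom 1 (2 * wt u (p u) (S u)))"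
      by (intro sum.cong refl prod_sum_PiE) (auto simp: fI)
    also have "\<dots> = (\<Sum>p\<in>matchings n. \<Sum>S\<in>PiE (lower_ends n p) (\<lambda>u. {T. T \<subseteq> I \<and> al u (p u) T}). monom 1 (2 * config_weight wt n (p, S)))"
      by (simp add: prod_monom_1 config_weight_def sum_distrib_left)
    also have "\<dots> = (\<Sum>c\<in>configs al n I. monom 1 (2 * config_weight wt n c))"
      unfolding configs_def by (subst sum.Sigma) (auto intro!: finite_PiE simp: fI)
    finally show ?thesis .
  qed
  have sub: "configs al n I = {c \<in> configs al n K. config_union n c \<subseteq> I}" if "I \<subseteq> K" for I
    unfolding config_union_def set_eq_iff mem_Collect_eq mem_configs UN_subset_iff using that by blast
  let ?g = "\<lambda>c. monom (1::bit) (2 * config_weight wt n c)"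
  have "(\<Sum>I\<in>Pow K. bird_det n (sym_mat (?e I))) = (\<Sum>I\<in>Pow K. \<Sum>c | c \<in> configs al n K \<and> config_union n c \<subseteq> I. ?g c)"
  proof (rule sum.cong[OF refl])
    fix I assume "I \<in> Pow K"
    then have I: "I \<subseteq> K" by simp
    show "bird_det n (sym_mat (?e I)) = (\<Sum>c | c \<in> configs al n K \<and> config_union n c \<subseteq> I. ?g c)"
      unfolding 1[OF I] sub[OF I] ..
  qed
  also have "\<dots> = (\<Sum>c\<in>configs al n K. \<Sum>I | I \<in> Pow K \<and> config_union n c \<subseteq> I. ?g c)"
    by (rule sum.swap_restrict) (use K finite_configs in auto)
  also have "\<dots> = (\<Sum>c\<in>configs al n K. if config_union n c = K then ?g c else 0)"
  proof (rule sum.cong[OF refl])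
    fix c assume c: "c \<in> configs al n K"
    have UK: "config_union n c \<subseteq> K" using c unfolding config_union_def mem_configs UN_subset_iff by blast
    show "(\<Sum>I | I \<in> Pow K \<and> config_union n c \<subseteq> I. ?g c) = (if config_union n c = K then ?g c else 0)"
    proof (cases "config_union n c = K")
      case True
      then have "{I. I \<in> Pow K \<and> config_union n c \<subseteq> I} = {K}" by auto
      then show ?thesis using True by simp
    next
      case False
      then obtain x where x: "x \<in> K" "x \<notin> config_union n c" using UK by auto
      \<comment> \<open>Adding or removing an item that the configuration does not use pairs up the
        sets \<open>I\<close> that contain its union.\<close>
      let ?f = "\<lambda>I. if x \<in> I then I - {x} else insert x I"
      have "(\<Sum>I | I \<in> Pow K \<and> config_union n c \<subseteq> I. ?g c) = (\<Sum>I | I \<in> {I. I \<in> Pow K \<and> config_union n c \<subseteq> I} \<and> ?f I = I. ?g c)"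
        by (rule sum_involution_char2[OF bit_poly_two]) (use x K in auto)
      also have "{I \<in> {I. I \<in> Pow K \<and> config_union n c \<subseteq> I}. ?f I = I} = {}" by auto
      finally show ?thesis using False by simp
    qed
  qed
  also have "\<dots> = (\<Sum>c | c \<in> configs al n K \<and> config_union n c = K. ?g c)"
    using finite_configs[OF K] by (simp add: sum.If_cases Int_def)
  finally show ?thesis .
qed

section \<open>Substituting a large number and reducing modulo 2\<close>

lemma bird_hom:
  assumes "\<And>x y. h (x + y) = h x + h y" "\<And>x y. h (x * y) = h x * h y" "h 0 = 0"
  shows "h (bird A p i j) = bird (\<lambda>i j. h (A i j)) p i j"
proof -
  have s: "h (sum f S) = (\<Sum>x\<in>S. h (f x))" for f :: "nat \<Rightarrow> 'a" and S
    by (induction S rule: infinite_finite_induct) (auto simp: assms)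
  show ?thesis by (induction p arbitrary: i j) (auto simp: bird_step_def assms s)
qed

text \<open>The matrix product and the diagonal term each contribute at most \<open>n\<close>
  products of an old entry with an entry of \<open>A\<close>, so one step enlarges the bound by the
  factor \<open>2 * n * a\<close>.\<close>

lemma bird_le:
  fixes A :: "nat \<Rightarrow> nat \<Rightarrow> nat"
  assumes "\<And>i j. A i j \<le> a" "i < n"
  shows "bird A p i j \<le> a * (2 * n * a) ^ p"
  using assms(2)
proof (induction p arbitrary: i j)
  case 0 then show ?case using assms(1) by simp
next
  case (Suc p)
  let ?b = "a * (2 * n * a) ^ p"
  have "(\<Sum>l<i. bird A p i l * A l j) \<le> (\<Sum>l<i. ?b * a)"
    using Suc assms(1) by (intro sum_mono mult_le_mono) auto
  also have "\<dots> \<le> n * (?b * a)" using Suc.prems by simp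
  finally have 1: "(\<Sum>l<i. bird A p i l * A l j) \<le> n * (?b * a)" .
  have "(\<Sum>h<i. bird A p h h) \<le> (\<Sum>h<i. ?b)"
    using Suc by (intro sum_mono Suc.IH) auto
  also have "\<dots> \<le> n * ?b" using Suc.prems by simp
  finally have "(\<Sum>h<i. bird A p h h) * A i j \<le> n * ?b * a" using assms(1) by (intro mult_le_mono)
  with 1 have "bird A (Suc p) i j \<le> n * (?b * a) + n * ?b * a" by (simp add: bird_step_def)
  also have "\<dots> = a * (2 * n * a) ^ Suc p" by (simp add: algebra_simps)
  finally show ?case .
qed

lemma digit_sum_less:
  fixes a :: "nat \<Rightarrow> nat"
  assumes "\<And>j. j < N \<Longrightarrow> a j < R"
  shows "(\<Sum>j<N. a j * R ^ j) < R ^ N"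
  using assms
proof (induction N)
  case (Suc N)
  have "Suc (a N) * R ^ N \<le> R * R ^ N" using Suc.prems[of N] by (intro mult_le_mono1) auto
  moreover have "(\<Sum>j<N. a j * R ^ j) < R ^ N" using Suc by auto
  ultimately show ?case by simp
qed simp

lemma digit_sum:
  fixes a :: "nat \<Rightarrow> nat"
  assumes "\<And>j. j < N \<Longrightarrow> a j < R" "i < N"
  shows "(\<Sum>j<N. a j * R ^ j) div R ^ i mod R = a i"
  using assms
proof (induction N)
  case (Suc N)
  have R: "R > 0" using Suc.prems(1)[of 0] by auto
  show ?case
  proof (cases "i = N")
    case True
    have "(\<Sum>j<N. a j * R ^ j) < R ^ N" using Suc.prems by (intro digit_sum_less) auto
    then show ?thesis using True R Suc.prems(1)[of N] by simp
  next
    case False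
    then have "i < N" using Suc.prems by auto
    then have "N = i + Suc (N - i - 1)" by simp
    then have N: "R ^ N = R ^ i * (R * R ^ (N - i - 1))" by (metis power_Suc power_add)
    have "(\<Sum>j<Suc N. a j * R ^ j) div R ^ i mod R = ((\<Sum>j<N. a j * R ^ j) div R ^ i + a N * (R * R ^ (N - i - 1))) mod R"
      using R by (simp add: N mult.left_commute[of _ "R ^ i"] add.commute)
    also have "\<dots> = (\<Sum>j<N. a j * R ^ j) div R ^ i mod R"
      by (simp add: mult.left_commute[of _ R])
    finally show ?thesis using Suc \<open>i < N\<close> by simp
  qed
qed simp

text \<open>Kronecker substitution: \<open>poly p 1\<close> is the sum of the coefficients, so each
  of them is a digit below \<open>B\<close> and no carry occurs in the value at
  \<open>B\<close>.\<close>

lemma poly_nat_digit: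
  fixes p :: "nat poly"
  assumes "poly p 1 < B"
  shows "poly p B div B ^ i mod B = coeff p i"
proof -
  have B: "B > 0" using assms by simp
  have le: "coeff p j \<le> poly p 1" for j
  proof (cases "j \<le> degree p")
    case True
    then have "coeff p j \<le> (\<Sum>i\<le>degree p. coeff p i)" by (intro member_le_sum) auto
    then show ?thesis by (simp add: poly_altdef)
  qed (simp add: coeff_eq_0)
  let ?N = "Suc (max i (degree p))"
  have "poly p B = (\<Sum>j\<le>degree p. coeff p j * B ^ j)" by (rule poly_altdef)
  also have "\<dots> = (\<Sum>j<?N. coeff p j * B ^ j)"
    by (rule sum.mono_neutral_left) (auto simp: coeff_eq_0)
  finally have "poly p B = (\<Sum>j<?N. coeff p j * B ^ j)" .
  then show ?thesis using digit_sum[of ?N "coeff p" B i] le_less_trans[OF le assms] by (simp only:)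
qed

lemma of_nat_bit_eq_1: "of_nat n = (1::bit) \<longleftrightarrow> odd n"
  by (induction n) auto

definition mod2 :: "nat poly \<Rightarrow> bit poly" where
  "mod2 p = map_poly of_nat p"

lemma coeff_mod2 [simp]: "coeff (mod2 p) i = of_nat (coeff p i)"
  by (simp add: mod2_def coeff_map_poly)

lemma mod2_hom: "mod2 (p + q) = mod2 p + mod2 q" "mod2 (p * q) = mod2 p * mod2 q" "mod2 0 = 0"
  "mod2 (monom 1 i) = monom 1 i"
  by (rule poly_eqI, simp add: coeff_mult)+

lemma mod2_sum: "mod2 (sum f S) = (\<Sum>x\<in>S. mod2 (f x))"
  by (induction S rule: infinite_finite_induct) (auto simp: mod2_hom)

text \<open>One polynomial \<open>p\<close> over the natural numbers stands behind both sides: its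
  value at \<open>B\<close> is what the algorithm computes, and its reduction modulo 2 is the
  polynomial of \<open>sieve\<close>. Evaluation and reduction are homomorphisms, so by
  \<open>bird_hom\<close> both commute with the recurrence.\<close>

theorem sieve_nat:
  fixes wt :: "nat \<Rightarrow> nat \<Rightarrow> nat set \<Rightarrow> nat" and B :: nat
  assumes n: "n > 0" and B: "even B" "2 ^ k * (2 ^ k * (2 * n * 2 ^ k) ^ n) < B"
  shows "odd ((\<Sum>I\<in>Pow {..<k}. bird_det n (sym_mat (edge_poly al (\<lambda>u v T. B ^ wt u v T) I))) div B ^ x)
    \<longleftrightarrow> odd (card {c \<in> configs al n {..<k}. config_union n c = {..<k} \<and> 2 * config_weight wt n c = x})"
proof -
  let ?e = "\<lambda>I. edge_poly al (\<lambda>u v T. monom (1::nat) (wt u v T)) I"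
  define p where "p = (\<Sum>I\<in>Pow {..<k}. bird_det n (sym_mat (?e I)))"
  have ev: "poly (sym_mat (?e I) u v) b = sym_mat (edge_poly al (\<lambda>u v T. b ^ wt u v T) I) u v" for I u v b
    by (simp add: sym_mat_def edge_poly_def poly_sum poly_monom)
  have pb: "poly p b = (\<Sum>I\<in>Pow {..<k}. bird_det n (sym_mat (edge_poly al (\<lambda>u v T. b ^ wt u v T) I)))" for b
    unfolding p_def bird_det_def poly_sum
    by (intro sum.cong refl, subst bird_hom[where h = "\<lambda>p. poly p b"]) (simp_all only: ev poly_add poly_mult poly_0)
  \<comment> \<open>At the argument 1 all weights disappear: an entry is the number of its
    admissible sets, at most \<open>2 ^ k\<close>, and there are \<open>2 ^ k\<close> determinants.
    This is the origin of the lower bound on \<open>B\<close>.\<close>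
  have "poly p 1 \<le> (\<Sum>I\<in>Pow {..<k}. 2 ^ k * (2 * n * 2 ^ k) ^ n)"
    unfolding pb
  proof (rule sum_mono)
    fix I assume I: "I \<in> Pow {..<k}"
    have "edge_poly al (\<lambda>u v T. 1 ^ wt u v T) I u v \<le> (2::nat) ^ k" for u v
    proof -
      have "card {T. T \<subseteq> I \<and> al u v T} \<le> card (Pow {..<k})" using I by (intro card_mono) auto
      then show ?thesis by (simp add: edge_poly_def card_Pow)
    qed
    then have "sym_mat (edge_poly al (\<lambda>u v T. 1 ^ wt u v T) I) u v \<le> (2::nat) ^ k" for u v by (simp add: sym_mat_def)
    then have "bird_det n (sym_mat (edge_poly al (\<lambda>u v T. 1 ^ wt u v T) I)) \<le> 2 ^ k * (2 * n * 2 ^ k) ^ (n - 1)"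
      unfolding bird_det_def using n by (intro bird_le) auto
    also have "\<dots> \<le> 2 ^ k * (2 * n * 2 ^ k) ^ n" using n by (intro mult_le_mono2 power_increasing) auto
    finally show "bird_det n (sym_mat (edge_poly al (\<lambda>u v T. 1 ^ wt u v T) I)) \<le> 2 ^ k * (2 * n * 2 ^ k) ^ n" .
  qed
  also have "\<dots> = 2 ^ k * (2 ^ k * (2 * n * 2 ^ k) ^ n)" by (simp add: card_Pow)
  also note B(2)
  finally have dig: "poly p B div B ^ x mod B = coeff p x" by (rule poly_nat_digit)
  \<comment> \<open>As \<open>B\<close> is even, reducing the quotient modulo \<open>B\<close> keeps
    its parity, so the test can skip the extraction of the digit.\<close>
  have "odd (poly p B div B ^ x) \<longleftrightarrow> odd (coeff p x)"
    unfolding dig[symmetric] using B(1) by (simp add: even_iff_mod_2_eq_zero mod_mod_cancel)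
  also have "\<dots> \<longleftrightarrow> coeff (mod2 p) x = 1" by (simp add: of_nat_bit_eq_1)
  also have "mod2 p = (\<Sum>I\<in>Pow {..<k}. bird_det n (sym_mat (edge_poly al (\<lambda>u v T. monom (1::bit) (wt u v T)) I)))"
  proof -
    have "mod2 (sym_mat (?e I) u v) = sym_mat (edge_poly al (\<lambda>u v T. monom (1::bit) (wt u v T)) I) u v" for I u v
      by (simp add: sym_mat_def edge_poly_def mod2_sum mod2_hom del: One_nat_def)
    then show ?thesis unfolding p_def mod2_sum bird_det_def
      by (intro sum.cong refl, subst bird_hom[where h = mod2]) (simp_all only: mod2_hom)
  qed
  also have "\<dots> = (\<Sum>c | c \<in> configs al n {..<k} \<and> config_union n c = {..<k}. monom 1 (2 * config_weight wt n c))"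
    by (rule sieve[OF n]) simp
  also have "coeff \<dots> x = of_nat (card {c \<in> configs al n {..<k}. config_union n c = {..<k} \<and> 2 * config_weight wt n c = x})"
  proof -
    have "finite {c \<in> configs al n {..<k}. config_union n c = {..<k}}" using finite_configs[of "{..<k}"] by simp
    then show ?thesis
      by (simp add: coeff_sum sum.If_cases Int_def conj_assoc del: of_nat_eq_1_iff)
  qed
  finally show ?thesis unfolding pb by (simp add: of_nat_bit_eq_1)
qed


section \<open>Isolation by random weights\<close>

definition isolating :: "('b \<Rightarrow> nat) \<Rightarrow> 'b set set \<Rightarrow> bool" where
  "isolating w F \<longleftrightarrow> (\<exists>X\<in>F. \<forall>Y\<in>F. Y \<noteq> X \<longrightarrow> sum w X < sum w Y)"

text \<open>The isolation lemma of Mulmuley, Vazirani and Vazirani. If the minimum is attained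
  twice, some \<open>e\<close> lies in one minimal set and outside another. For fixed
  \<open>e\<close>, the other weights leave at most one value of \<open>w e\<close> for which this
  happens, so each \<open>e\<close> spoils at most \<open>W ^ (card J - 1)\<close> weight
  functions.\<close>

theorem isolation:
  assumes J: "finite J" and F: "F \<subseteq> Pow J" "F \<noteq> {}"
  shows "card {w \<in> PiE J (\<lambda>_. {..<W}). \<not> isolating w F} \<le> card J * W ^ (card J - 1)"
proof -
  let ?P = "PiE J (\<lambda>_. {..<W::nat})"
  have finF: "finite F" by (rule finite_subset[OF F(1)]) (use J in simp)
  have finP: "finite ?P" using J by (intro finite_PiE) auto
  define B where "B e = {w \<in> ?P. \<exists>X\<in>F. \<exists>Y\<in>F. e \<in> X \<and> e \<notin> Y \<and> sum w X = sum w Y \<and> (\<forall>Z\<in>F. sum w X \<le> sum w Z)}" for e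
  have "{w \<in> ?P. \<not> isolating w F} \<subseteq> (\<Union>e\<in>J. B e)"
  proof
    fix w assume w: "w \<in> {w \<in> ?P. \<not> isolating w F}"
    obtain X where X0: "X \<in> F" "Min (sum w ` F) = sum w X" using obtains_MIN[OF finF F(2), of "sum w"] .
    then have X: "X \<in> F" "\<forall>Z\<in>F. sum w X \<le> sum w Z" using finF by (auto intro!: Min_le simp flip: X0(2))
    have "\<not> isolating w F" using w by simp
    then obtain Y where Y: "Y \<in> F" "Y \<noteq> X" "\<not> sum w X < sum w Y" using X(1) unfolding isolating_def by blast
    have eq: "sum w X = sum w Y" using X Y by (intro antisym) simp_all
    have "w \<in> ?P" using w by simp
    from Y(2) consider e where "e \<in> X" "e \<notin> Y" | e where "e \<in> Y" "e \<notin> X" by blast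
    then show "w \<in> (\<Union>e\<in>J. B e)"
    proof cases
      case 1
      then have "e \<in> J" using X F by auto
      moreover have "w \<in> B e" unfolding B_def using 1 X Y(1) eq \<open>w \<in> ?P\<close> by blast
      ultimately show ?thesis by blast
    next
      case 2
      then have "e \<in> J" using Y F by auto
      moreover have "w \<in> B e" unfolding B_def using 2 X(1) Y(1) X(2)[unfolded eq] eq[symmetric] \<open>w \<in> ?P\<close> by blast
      ultimately show ?thesis by blast
    qed
  qed
  then have "card {w \<in> ?P. \<not> isolating w F} \<le> card (\<Union>e\<in>J. B e)"
    using J finP by (intro card_mono) (auto simp: B_def)
  also have "\<dots> \<le> (\<Sum>e\<in>J. card (B e))" by (rule card_UN_le[OF J])
  also have "\<dots> \<le> (\<Sum>e\<in>J. W ^ (card J - 1))"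
  proof (rule sum_mono)
    fix e assume e: "e \<in> J"
    let ?r = "\<lambda>w. restrict w (J - {e})"
    \<comment> \<open>The weight \<open>w e\<close> is the least weight of a set without
      \<open>e\<close>, minus the least weight of a set with \<open>e\<close> when \<open>e\<close>
      itself is not counted. Both depend only on the weights other than \<open>w e\<close>.\<close>
    have "inj_on ?r (B e)"
    proof (rule inj_onI)
      fix w w' assume w: "w \<in> B e" and w': "w' \<in> B e" and eq: "?r w = ?r w'"
      have same: "w x = w' x" if "x \<in> J" "x \<noteq> e" for x
        using fun_cong[OF eq, of x] that by simp
      have s: "sum w A = sum w' A" if "A \<subseteq> J" "e \<notin> A" for A using that by (intro sum.cong) (auto intro!: same)
      obtain X Y where X: "X \<in> F" "Y \<in> F" "e \<in> X" "e \<notin> Y" "sum w X = sum w Y" "\<And>Z. Z \<in> F \<Longrightarrow> sum w X \<le> sum w Z"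
        using w unfolding B_def by blast
      obtain X' Y' where X': "X' \<in> F" "Y' \<in> F" "e \<in> X'" "e \<notin> Y'" "sum w' X' = sum w' Y'" "\<And>Z. Z \<in> F \<Longrightarrow> sum w' X' \<le> sum w' Z"
        using w' unfolding B_def by blast
      have sub: "X \<subseteq> J" "Y \<subseteq> J" "X' \<subseteq> J" "Y' \<subseteq> J" using X X' F by auto
      have split: "sum f A = f e + sum f (A - {e})" if "A \<subseteq> J" "e \<in> A" for A and f :: "'a \<Rightarrow> nat"
        using that J finite_subset by (intro sum.remove) auto
      have "sum w (X - {e}) = sum w' (X - {e})" "sum w (X' - {e}) = sum w' (X' - {e})" "sum w Y = sum w' Y" "sum w Y' = sum w' Y'"
        using sub X X' by (auto intro!: s)
      then have "w e = w' e"
        using X(5) X(6)[OF X'(1)] X(6)[OF X'(2)] X'(5) X'(6)[OF X(1)] X'(6)[OF X(2)]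
          split[OF sub(1) X(3), of w] split[OF sub(1) X(3), of w'] split[OF sub(3) X'(3), of w] split[OF sub(3) X'(3), of w'] by linarith
      with same have "w x = w' x" if "x \<in> J" for x using that by (cases "x = e") auto
      moreover have "w \<in> ?P" "w' \<in> ?P" using w w' by (auto simp: B_def)
      ultimately show "w = w'" by (intro PiE_ext) auto
    qed
    moreover have "?r ` B e \<subseteq> PiE (J - {e}) (\<lambda>_. {..<W})"
    proof (intro image_subsetI)
      fix w assume "w \<in> B e"
      then have "w \<in> ?P" unfolding B_def by blast
      then show "?r w \<in> PiE (J - {e}) (\<lambda>_. {..<W})" unfolding restrict_PiE_iff by auto
    qed
    ultimately have "card (B e) \<le> card (PiE (J - {e}) (\<lambda>_. {..<W}))"
      using J by (intro card_inj_on_le[of ?r] finite_PiE) auto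
    then show "card (B e) \<le> W ^ (card J - 1)" using J e by (simp add: card_PiE)
  qed
  finally show ?thesis by simp
qed

lemma digits_mod:
  fixes r W :: nat
  shows "(\<Sum>j<N. (r div W ^ j mod W) * W ^ j) = r mod W ^ N"
proof (induction N)
  case (Suc N)
  then show ?case unfolding power_Suc2 mod_mult2_eq by (simp add: mult.commute)
qed simp

text \<open>All weights are the base \<open>W\<close> digits of one random number. Numbers below
  \<open>W ^ N\<close> correspond to digit vectors, so a uniform number gives independent uniform
  weights. The restriction to \<open>{..<N}\<close> makes the digit functions extensional.\<close>

corollary isolation_digits:
  fixes W :: nat
  assumes F: "F \<subseteq> Pow {..<N}" "F \<noteq> {}" and W: "W > 0"
  shows "card {r \<in> {..<W ^ N}. \<not> isolating (\<lambda>j. r div W ^ j mod W) F} \<le> N * W ^ (N - 1)"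
proof -
  let ?d = "\<lambda>r. restrict (\<lambda>j. r div W ^ j mod W) {..<N}"
  have iso: "isolating (?d r) F = isolating (\<lambda>j. r div W ^ j mod W) F" for r
  proof -
    have "sum (?d r) X = (\<Sum>j\<in>X. r div W ^ j mod W)" if "X \<in> F" for X
      using that F by (intro sum.cong) auto
    then show ?thesis unfolding isolating_def by simp
  qed
  have "inj_on ?d {..<W ^ N}"
  proof (rule inj_onI)
    fix r s assume r: "r \<in> {..<W ^ N}" "s \<in> {..<W ^ N}" and eq: "?d r = ?d s"
    have "r div W ^ j mod W = s div W ^ j mod W" if "j < N" for j
      using fun_cong[OF eq, of j] that by simp
    then have "(\<Sum>j<N. (r div W ^ j mod W) * W ^ j) = (\<Sum>j<N. (s div W ^ j mod W) * W ^ j)" by simp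
    then show "r = s" using r unfolding digits_mod by simp
  qed
  then have "inj_on ?d {r \<in> {..<W ^ N}. \<not> isolating (\<lambda>j. r div W ^ j mod W) F}" by (rule inj_on_subset) auto
  moreover have "?d ` {r \<in> {..<W ^ N}. \<not> isolating (\<lambda>j. r div W ^ j mod W) F} \<subseteq> {w \<in> PiE {..<N} (\<lambda>_. {..<W}). \<not> isolating w F}"
    using iso W by (auto simp: PiE_iff)
  ultimately have "card {r \<in> {..<W ^ N}. \<not> isolating (\<lambda>j. r div W ^ j mod W) F} \<le> card {w \<in> PiE {..<N} (\<lambda>_. {..<W}). \<not> isolating w F}"
    by (intro card_inj_on_le[of ?d]) (auto intro!: finite_subset[of _ "PiE {..<N} (\<lambda>_. {..<W})"] finite_PiE)
  also have "\<dots> \<le> N * W ^ (N - 1)" using isolation[OF _ F, of W] by simp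
  finally show ?thesis .
qed

section \<open>Configurations as sets of weighted elements\<close>

definition exact :: "nat \<Rightarrow> nat \<Rightarrow> (nat \<Rightarrow> nat) \<times> (nat \<Rightarrow> nat set) \<Rightarrow> bool" where
  "exact n k c \<longleftrightarrow> config_union n c = {..<k} \<and> disjoint_family_on (snd c) (lower_ends n (fst c))"

text \<open>The third argument of \<open>idx\<close> is 0 for the edge itself and
  \<open>Suc i\<close> for the small item \<open>i\<close> placed on it. The edge is listed even
  when its label is empty, so that the matching can be recovered.\<close>

definition elements :: "(nat \<Rightarrow> nat \<Rightarrow> nat \<Rightarrow> nat) \<Rightarrow> nat \<Rightarrow> (nat \<Rightarrow> nat) \<times> (nat \<Rightarrow> nat set) \<Rightarrow> nat set" where
  "elements idx n c = (\<lambda>(u, i). idx u (fst c u) i) ` (SIGMA u:lower_ends n (fst c). insert 0 (Suc ` snd c u))"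

text \<open>
  The summand \<open>Z\<close>, which will exceed the sum of the random weights of an exact configuration, makes
  the weight count the small items with multiplicity, so that a configuration that uses all of them
  is exact if and only if its weight is below \<open>Z * (k + 1)\<close>.
\<close>

definition wt_of :: "(nat \<Rightarrow> nat) \<Rightarrow> (nat \<Rightarrow> nat \<Rightarrow> nat \<Rightarrow> nat) \<Rightarrow> nat \<Rightarrow> nat \<Rightarrow> nat \<Rightarrow> nat set \<Rightarrow> nat" where
  "wt_of w idx Z u v T = w (idx u v 0) + (\<Sum>i\<in>T. w (idx u v (Suc i)) + Z)"

text \<open>\<open>(n + k) * W\<close> bounds the random part of the weight of an exact
  configuration, which has at most \<open>n\<close> edges and uses small items exactly
  \<open>k\<close> times.\<close>

locale isolated_test =
  fixes idx :: "nat \<Rightarrow> nat \<Rightarrow> nat \<Rightarrow> nat" and n k N W Z :: nat and al :: "nat \<Rightarrow> nat \<Rightarrow> nat set \<Rightarrow> bool"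
    and w :: "nat \<Rightarrow> nat"
  assumes inj: "inj_on (\<lambda>(u, v, i). idx u v i) ({..<n} \<times> {..<n} \<times> {..k})"
    and less: "\<And>u v i. u < n \<Longrightarrow> v < n \<Longrightarrow> i \<le> k \<Longrightarrow> idx u v i < N"
    and w: "\<And>j. w j < W" and Z: "(n + k) * W < Z"
begin

abbreviation cfgs where "cfgs \<equiv> configs al n {..<k}"
abbreviation "size_of c \<equiv> (\<Sum>u\<in>lower_ends n (fst c). card (snd c u))"

lemma cfg_lower:
  assumes "c \<in> cfgs" "u \<in> lower_ends n (fst c)"
  shows "u < n" "fst c u < n" "snd c u \<subseteq> {..<k}" "finite (snd c u)"
proof -
  have "fst c permutes {..<n}" using assms(1) unfolding mem_configs matchings_def by blast
  then show "fst c u < n" using assms(2) permutes_in_image[of "fst c" "{..<n}" u] unfolding lower_ends_def by auto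
  show "snd c u \<subseteq> {..<k}" using assms unfolding mem_configs by blast
  then show "finite (snd c u)" by (rule finite_subset) simp
qed (use assms in \<open>simp add: lower_ends_def\<close>)

lemma idx_eq: "u < n \<Longrightarrow> v < n \<Longrightarrow> i \<le> k \<Longrightarrow> u' < n \<Longrightarrow> v' < n \<Longrightarrow> i' \<le> k \<Longrightarrow>
   idx u v i = idx u' v' i' \<longleftrightarrow> u = u' \<and> v = v' \<and> i = i'"
  using inj_on_eq_iff[OF inj, of "(u, v, i)" "(u', v', i')"] by auto

lemma elements_inj_on:
  assumes c: "c \<in> cfgs"
  shows "inj_on (\<lambda>(u, i). idx u (fst c u) i) (SIGMA u:lower_ends n (fst c). insert 0 (Suc ` snd c u))"
proof (rule inj_onI, clarsimp simp del: insert_iff)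
  fix u i u' i' assume u: "u \<in> lower_ends n (fst c)" "i \<in> insert 0 (Suc ` snd c u)"
    and u': "u' \<in> lower_ends n (fst c)" "i' \<in> insert 0 (Suc ` snd c u')"
    and eq: "idx u (fst c u) i = idx u' (fst c u') i'"
  have "i \<le> k" "i' \<le> k" using u u' cfg_lower(3)[OF c] by fastforce+
  then show "u = u' \<and> i = i'" using eq idx_eq cfg_lower[OF c u(1)] cfg_lower[OF c u'(1)] by blast
qed

lemma sum_elements:
  assumes c: "c \<in> cfgs"
  shows "sum f (elements idx n c) = (\<Sum>u\<in>lower_ends n (fst c). f (idx u (fst c u) 0) + (\<Sum>i\<in>snd c u. f (idx u (fst c u) (Suc i))))"
proof -
  have "sum f (elements idx n c) = (\<Sum>(u, i)\<in>(SIGMA u:lower_ends n (fst c). insert 0 (Suc ` snd c u)). f (idx u (fst c u) i))"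
    unfolding elements_def by (subst sum.reindex[OF elements_inj_on[OF c]]) (simp add: case_prod_unfold o_def)
  also have "\<dots> = (\<Sum>u\<in>lower_ends n (fst c). \<Sum>i\<in>insert 0 (Suc ` snd c u). f (idx u (fst c u) i))"
    using cfg_lower(4)[OF c] by (subst sum.Sigma) auto
  also have "\<dots> = (\<Sum>u\<in>lower_ends n (fst c). f (idx u (fst c u) 0) + (\<Sum>i\<in>snd c u. f (idx u (fst c u) (Suc i))))"
    using cfg_lower(4)[OF c] by (intro sum.cong refl) (simp add: sum.reindex)
  finally show ?thesis .
qed

lemma config_weight_split:
  assumes c: "c \<in> cfgs"
  shows "config_weight (wt_of w idx Z) n c = sum w (elements idx n c) + Z * size_of c"
  unfolding config_weight_def wt_of_def sum_elements[OF c]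
  by (simp add: sum.distrib sum_distrib_left mult.commute)

lemma elements_subset:
  assumes c: "c \<in> cfgs" shows "elements idx n c \<subseteq> {..<N}"
proof -
  have "idx u (fst c u) i < N" if "u \<in> lower_ends n (fst c)" "i \<in> insert 0 (Suc ` snd c u)" for u i
    using less[OF cfg_lower(1,2)[OF c that(1)], of i] cfg_lower(3)[OF c that(1)] that(2) by fastforce
  then show ?thesis unfolding elements_def by auto
qed

lemma sum_elements_less:
  assumes c: "c \<in> cfgs" and s: "size_of c = k"
  shows "sum w (elements idx n c) < Z"
proof -
  have "sum w (elements idx n c) \<le> (\<Sum>j\<in>elements idx n c. W)" using w by (intro sum_mono less_imp_le)
  also have "\<dots> = (\<Sum>u\<in>lower_ends n (fst c). W + (\<Sum>i\<in>snd c u. W))" by (rule sum_elements[OF c])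
  also have "\<dots> = (card (lower_ends n (fst c)) + size_of c) * W" by (simp add: sum.distrib sum_distrib_left algebra_simps)
  also have "\<dots> \<le> (n + k) * W"
  proof -
    have "card (lower_ends n (fst c)) \<le> card {..<n}" by (intro card_mono) (auto simp: lower_ends_def)
    then show ?thesis using s by (intro mult_le_mono) auto
  qed
  finally show ?thesis using Z by simp
qed

text \<open>If every item is used, the label sizes add up to \<open>k\<close> exactly when no item
  is used twice; sizes, unlike disjointness, are visible in the weight.\<close>

lemma exact_iff:
  assumes c: "c \<in> cfgs"
  shows "exact n k c \<longleftrightarrow> config_union n c = {..<k} \<and> size_of c = k"
proof (cases "config_union n c = {..<k}")
  case True
  let ?L = "lower_ends n (fst c)"
  have un: "(\<Union>u\<in>?L. snd c u) = {..<k}" using True unfolding config_union_def .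
  have fin: "\<And>u. u \<in> ?L \<Longrightarrow> finite (snd c u)" using cfg_lower(4)[OF c] .
  have "disjoint_family_on (snd c) ?L \<longleftrightarrow> size_of c = k"
  proof
    assume "disjoint_family_on (snd c) ?L"
    then have "card (\<Union>u\<in>?L. snd c u) = size_of c" using fin by (intro card_UN_disjoint') auto
    then show "size_of c = k" by (simp add: un)
  next
    assume s: "size_of c = k"
    show "disjoint_family_on (snd c) ?L"
    proof (rule ccontr)
      assume "\<not> disjoint_family_on (snd c) ?L"
      then obtain u v x where uv: "u \<in> ?L" "v \<in> ?L" "u \<noteq> v" "x \<in> snd c u" "x \<in> snd c v" unfolding disjoint_family_on_def by blast
      \<comment> \<open>An item on two edges is deleted from one of them. The union is unchanged, so
        the smaller total size is still at least \<open>k\<close>.\<close>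
      have "{..<k} = (\<Union>u'\<in>?L. if u' = u then snd c u - {x} else snd c u')"
        unfolding un[symmetric]
      proof (intro equalityI subsetI)
        fix y assume "y \<in> (\<Union>u\<in>?L. snd c u)"
        then obtain a where a: "a \<in> ?L" "y \<in> snd c a" by blast
        show "y \<in> (\<Union>u'\<in>?L. if u' = u then snd c u - {x} else snd c u')"
        proof (cases "a = u \<and> y = x")
          case True
          then show ?thesis using uv by (intro UN_I[of v]) simp_all
        next
          case False
          then show ?thesis using a by (intro UN_I[of a]) auto
        qed
      qed (auto split: if_splits)
      then have "k \<le> (\<Sum>u'\<in>?L. card (if u' = u then snd c u - {x} else snd c u'))"
        using card_UN_le[of ?L "\<lambda>u'. if u' = u then snd c u - {x} else snd c u'"] by (metis card_lessThan finite_lower_ends)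
      also have "\<dots> < size_of c"
      proof (rule sum_strict_mono_ex1)
        have "card (snd c u - {x}) < card (snd c u)" using uv fin by (intro psubset_card_mono) auto
        then show "\<forall>u'\<in>?L. card (if u' = u then snd c u - {x} else snd c u') \<le> card (snd c u')"
          "\<exists>u'\<in>?L. card (if u' = u then snd c u - {x} else snd c u') < card (snd c u')" using uv by auto
      qed simp
      finally show False using s by simp
    qed
  qed
  then show ?thesis unfolding exact_def using True by simp
qed (simp add: exact_def)

text \<open>Isolation yields a unique set of elements, whereas the parity counts configurations. The
  indices show each lower end with its partner and its label; the upper ends follow because the
  matching is an involution.\<close>

lemma elements_inj:
  assumes c: "c \<in> cfgs" and d: "d \<in> cfgs" and eq: "elements idx n c = elements idx n d"
  shows "c = d"
proof -
  have key: "u \<in> lower_ends n (fst d) \<and> fst d u = fst c u \<and> i \<in> insert 0 (Suc ` snd d u)"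
    if c: "c \<in> cfgs" and d: "d \<in> cfgs" and eq: "elements idx n c = elements idx n d"
      and u: "u \<in> lower_ends n (fst c)" "i \<in> insert 0 (Suc ` snd c u)" for u i c d
  proof -
    have "idx u (fst c u) i \<in> elements idx n c" unfolding elements_def by (rule image_eqI[of _ _ "(u, i)"]) (use u in simp_all)
    then have "idx u (fst c u) i \<in> elements idx n d" using eq by simp
    then obtain u' i' where u': "u' \<in> lower_ends n (fst d)" "i' \<in> insert 0 (Suc ` snd d u')" "idx u (fst c u) i = idx u' (fst d u') i'"
      unfolding elements_def by (auto simp del: insert_iff)
    have "i \<le> k" "i' \<le> k" using u u' cfg_lower(3)[OF c u(1)] cfg_lower(3)[OF d u'(1)] by fastforce+
    then have "u = u' \<and> fst c u = fst d u' \<and> i = i'"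
      by (intro idx_eq[THEN iffD1, OF _ _ _ _ _ _ u'(3)] cfg_lower(1,2)[OF c u(1)] cfg_lower(1,2)[OF d u'(1)])
    then show ?thesis using u'(1,2) by (auto simp del: insert_iff)
  qed
  have L: "lower_ends n (fst c) = lower_ends n (fst d)"
    using key[OF c d eq] key[OF d c eq[symmetric]] by blast
  have f: "fst c u = fst d u" if "u \<in> lower_ends n (fst c)" for u using key[OF c d eq that, of 0] by simp
  have s: "snd c u = snd d u" if "u \<in> lower_ends n (fst c)" for u
  proof -
    have "Suc x \<in> insert 0 (Suc ` snd c u) \<longleftrightarrow> Suc x \<in> insert 0 (Suc ` snd d u)" for x
      using key[OF c d eq that, of "Suc x"] key[OF d c eq[symmetric] that[unfolded L], of "Suc x"] by blast
    then show ?thesis by (simp add: image_iff set_eq_iff)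
  qed
  have "snd c = snd d"
    by (rule extensionalityI[of _ "lower_ends n (fst c)"]) (use c d L s in \<open>auto simp: mem_configs\<close>)
  moreover have "fst c = fst d"
  proof
    fix u
    have pc: "fst c permutes {..<n}" "\<And>u. u < n \<Longrightarrow> fst c u \<noteq> u" "\<And>u. fst c (fst c u) = u"
      using c unfolding mem_configs matchings_def by blast+
    have pd: "fst d permutes {..<n}" "\<And>u. u < n \<Longrightarrow> fst d u \<noteq> u" "\<And>u. fst d (fst d u) = u"
      using d unfolding mem_configs matchings_def by blast+
    consider "u \<ge> n" | "u \<in> lower_ends n (fst c)" | "u < n" "fst c u < u"
      using pc(2)[of u] by (force simp: lower_ends_def)
    then show "fst c u = fst d u"
    proof cases
      case 1 then show ?thesis using pc pd by (simp add: permutes_not_in)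
    next
      case 2 then show ?thesis by (rule f)
    next
      case 3
      then have "fst c u \<in> lower_ends n (fst c)" using pc(3) by (auto simp: lower_ends_def)
      from f[OF this] have "fst d (fst c u) = u" using pc(3) by simp
      then show ?thesis using pd(3) by metis
    qed
  qed
  ultimately show ?thesis by (simp add: prod_eq_iff)
qed

text \<open>The factor 2 stems from the squares in the determinant. The weights
  \<open>Z * k + y\<close> with \<open>y < Z\<close> are those that only exact configurations reach
  once all items are used.\<close>

definition "accepts \<longleftrightarrow> (\<exists>y<Z. odd (card {c \<in> cfgs. config_union n c = {..<k} \<and> 2 * config_weight (wt_of w idx Z) n c = 2 * (Z * k + y)}))"

text \<open>Using all items forces a total label size of at least \<open>k\<close>, and a weight
  below \<open>Z * (k + 1)\<close> forces it below \<open>k + 1\<close>. What exceeds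
  \<open>Z * k\<close> is then the random part.\<close>

lemma small_weight:
  assumes c: "c \<in> cfgs" "config_union n c = {..<k}" "config_weight (wt_of w idx Z) n c = Z * k + y" "y < Z"
  shows "exact n k c" "sum w (elements idx n c) = y"
proof -
  have "k = card (\<Union>u\<in>lower_ends n (fst c). snd c u)" using c(2) by (simp add: config_union_def)
  also have "\<dots> \<le> size_of c" by (rule card_UN_le) simp
  finally have 1: "k \<le> size_of c" .
  have "Z * size_of c < Z * Suc k" using c(3,4) unfolding config_weight_split[OF c(1)] by simp
  then have "size_of c < Suc k" by (metis mult_less_cancel1)
  with 1 have s: "size_of c = k" by simp
  then show "exact n k c" using c by (simp add: exact_iff)
  show "sum w (elements idx n c) = y" using c(3) unfolding config_weight_split[OF c(1)] s by simp
qed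

text \<open>An odd number is not 0. This direction holds for all weights, isolating or not.\<close>

theorem accepts_sound:
  assumes accepts shows "\<exists>c\<in>cfgs. exact n k c"
proof -
  obtain y where y: "y < Z" "odd (card {c \<in> cfgs. config_union n c = {..<k} \<and> 2 * config_weight (wt_of w idx Z) n c = 2 * (Z * k + y)})"
    using assms unfolding accepts_def by blast
  then have "{c \<in> cfgs. config_union n c = {..<k} \<and> 2 * config_weight (wt_of w idx Z) n c = 2 * (Z * k + y)} \<noteq> {}"
    by (metis card.empty even_zero)
  then obtain c where "c \<in> cfgs" "config_union n c = {..<k}" "2 * config_weight (wt_of w idx Z) n c = 2 * (Z * k + y)" by blast
  then show ?thesis using small_weight(1)[of c y] y(1) by (intro bexI[of _ c]) simp_all
qed

text \<open>At the degree that belongs to the isolated minimum exactly one configuration is counted: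
  by \<open>small_weight\<close> any other one there is exact with the same random weight, hence has
  the same elements.\<close>

theorem accepts_complete:
  assumes "isolating w (elements idx n ` {c \<in> cfgs. exact n k c})"
  shows accepts
proof -
  obtain c where c: "c \<in> cfgs" "exact n k c"
    and min: "\<And>d. d \<in> cfgs \<Longrightarrow> exact n k d \<Longrightarrow> elements idx n d \<noteq> elements idx n c \<Longrightarrow> sum w (elements idx n c) < sum w (elements idx n d)"
    using assms unfolding isolating_def by auto
  let ?y = "sum w (elements idx n c)"
  have s: "size_of c = k" "config_union n c = {..<k}" using c exact_iff by auto
  have y: "?y < Z" using sum_elements_less[OF c(1) s(1)] .
  have "{d \<in> cfgs. config_union n d = {..<k} \<and> 2 * config_weight (wt_of w idx Z) n d = 2 * (Z * k + ?y)} = {c}"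
  proof (intro equalityI subsetI)
    fix d assume d: "d \<in> {d \<in> cfgs. config_union n d = {..<k} \<and> 2 * config_weight (wt_of w idx Z) n d = 2 * (Z * k + ?y)}"
    then have "exact n k d" "sum w (elements idx n d) = ?y" using small_weight[of d ?y] y by auto
    then have "elements idx n d = elements idx n c" using min[of d] d by auto
    then show "d \<in> {c}" using elements_inj[OF _ c(1)] d by auto
  next
    fix d assume "d \<in> {c}"
    then show "d \<in> {d \<in> cfgs. config_union n d = {..<k} \<and> 2 * config_weight (wt_of w idx Z) n d = 2 * (Z * k + ?y)}"
      using c s config_weight_split[OF c(1)] by simp
  qed
  then show ?thesis unfolding accepts_def using y by (intro exI[of _ ?y]) simp
qed

end


section \<open>Bins as matchings\<close>

text \<open>Vectors are abstracted to a monotone predicate on sets of item indices. The lists fix a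
  numbering of the small items by \<open>[0, k)\<close> and of the large ones by
  \<open>[0, m)\<close>.\<close>

locale bin_cover =
  fixes N l :: nat and cov :: "nat set \<Rightarrow> bool" and sl ll :: "nat list"
  assumes mono: "A \<subseteq> B \<Longrightarrow> B \<subseteq> {..<N} \<Longrightarrow> cov A \<Longrightarrow> cov B"
    and items: "distinct sl" "distinct ll" "set sl \<inter> set ll = {}" "set sl \<union> set ll = {..<N}"
    and three: "a \<in> set ll \<Longrightarrow> b \<in> set ll \<Longrightarrow> c \<in> set ll \<Longrightarrow> a \<noteq> b \<Longrightarrow> a \<noteq> c \<Longrightarrow> b \<noteq> c \<Longrightarrow> cov {a, b, c}"
    and l_pos: "l > 0"
begin

definition solvable :: bool where
  "solvable \<longleftrightarrow> (\<exists>B. (\<Union>b<l. B b) = {..<N} \<and> disjoint_family_on B {..<l} \<and> (\<forall>b<l. cov (B b)))"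

abbreviation "m \<equiv> length ll"
abbreviation "k \<equiv> length sl"

text \<open>The intersection with \<open>{..<m}\<close> discards partners and dummies, so the ends
  of an edge contribute only the large items among them.\<close>

definition chosen :: "nat set \<Rightarrow> nat set \<Rightarrow> nat set" where
  "chosen X T = (!) ll ` (X \<inter> {..<m}) \<union> (!) sl ` T"

lemma packing:
  assumes K: "finite K" "l \<le> card K" and D: "disjoint_family_on D K" "\<And>i. i \<in> K \<Longrightarrow> D i \<subseteq> {..<N}" "\<And>i. i \<in> K \<Longrightarrow> cov (D i)"
  shows solvable
proof -
  obtain g where g: "inj_on g {..<l}" "g ` {..<l} \<subseteq> K"
    using card_le_inj[of "{..<l}" K] K by auto
  define B where "B b = (if b = 0 then {..<N} - (\<Union>b\<in>{0<..<l}. D (g b)) else D (g b))" for b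
  have gK: "g b \<in> K" if "b < l" for b using g(2) that by auto
  have disj: "D (g a) \<inter> D (g b) = {}" if "a < l" "b < l" "a \<noteq> b" for a b
    using D(1) gK that inj_onD[OF g(1), of a b] unfolding disjoint_family_on_def by auto
  have "(\<Union>b<l. B b) = {..<N}"
  proof (intro equalityI subsetI)
    fix x assume "x \<in> (\<Union>b<l. B b)"
    then show "x \<in> {..<N}" using D(2)[OF gK] by (auto simp: B_def split: if_splits)
  next
    fix x assume x: "x \<in> {..<N}"
    show "x \<in> (\<Union>b<l. B b)"
    proof (cases "x \<in> B 0")
      case True then show ?thesis using l_pos by auto
    next
      case False
      then obtain b where "b \<in> {0<..<l}" "x \<in> D (g b)" using x by (auto simp: B_def)
      then show ?thesis by (intro UN_I[of b]) (auto simp: B_def)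
    qed
  qed
  moreover have "disjoint_family_on B {..<l}"
    unfolding disjoint_family_on_def using disj by (auto simp: B_def)
  moreover have "cov (B b)" if b: "b < l" for b
  proof (rule mono[OF _ _ D(3)[OF gK[OF b]]])
    show "D (g b) \<subseteq> B b" using D(2)[OF gK[OF b]] disj[of b] b by (fastforce simp: B_def)
    show "B b \<subseteq> {..<N}" using D(2)[OF gK[OF b]] by (auto simp: B_def)
  qed
  ultimately show ?thesis unfolding solvable_def by blast
qed

text \<open>With more bins than items some bin is empty. The case is separated because the number of
  bins is given in binary, while the matching graph has about two dummies per bin.\<close>

lemma many_bins:
  assumes "N < l"
  shows "solvable \<longleftrightarrow> cov {}"
proof
  assume "cov {}"
  then show solvable by (intro packing[of "{..<l}" "\<lambda>_. {}"]) (auto simp: disjoint_family_on_def)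
next
  assume solvable
  then obtain B where B: "(\<Union>b<l. B b) = {..<N}" "disjoint_family_on B {..<l}" "\<And>b. b < l \<Longrightarrow> cov (B b)"
    unfolding solvable_def by blast
  have "\<exists>b<l. B b = {}"
  proof (rule ccontr)
    assume ne: "\<not> (\<exists>b<l. B b = {})"
    have "finite (B b)" if "b < l" for b using finite_subset[of "B b" "{..<N}"] B(1) that by auto
    moreover from this have "1 \<le> card (B b)" if "b < l" for b using ne that by (simp add: Suc_le_eq card_gt_0_iff)
    ultimately have "l \<le> card (\<Union>b<l. B b)"
      using sum_mono[of "{..<l}" "\<lambda>_. 1" "\<lambda>b. card (B b)"] B(2) by (subst card_UN_disjoint') auto
    then show False using assms B(1) by simp
  qed
  then show "cov {}" using B(3) by metis
qed

lemma chosen_subset: "T \<subseteq> {..<k} \<Longrightarrow> chosen X T \<subseteq> {..<N}"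
  unfolding chosen_def items(4)[symmetric] by auto

lemma chosen_disjoint:
  assumes "X \<inter> Y = {}" "T \<inter> U = {}" "T \<subseteq> {..<k}" "U \<subseteq> {..<k}"
  shows "chosen X T \<inter> chosen Y U = {}"
proof -
  have inj: "inj_on ((!) ll) {..<m}" "inj_on ((!) sl) {..<k}"
    using items(1,2) by (auto intro!: inj_on_nth)
  have "(!) ll ` (X \<inter> {..<m}) \<inter> (!) ll ` (Y \<inter> {..<m}) = (!) ll ` (X \<inter> {..<m} \<inter> (Y \<inter> {..<m}))"
    by (rule inj_on_image_Int[OF inj(1), symmetric]) auto
  also have "X \<inter> {..<m} \<inter> (Y \<inter> {..<m}) = {}" using assms(1) by blast
  finally have "(!) ll ` (X \<inter> {..<m}) \<inter> (!) ll ` (Y \<inter> {..<m}) = {}" by simp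
  moreover have "(!) sl ` T \<inter> (!) sl ` U = {}"
    using inj_on_image_Int[OF inj(2) assms(3,4)] assms(2) by simp
  moreover have "(!) ll ` (X \<inter> {..<m}) \<subseteq> set ll" "(!) ll ` (Y \<inter> {..<m}) \<subseteq> set ll" "(!) sl ` T \<subseteq> set sl" "(!) sl ` U \<subseteq> set sl"
    using assms by auto
  moreover have "(A \<union> C) \<inter> (B \<union> D) = {}"
    if "A \<inter> B = {}" "C \<inter> D = {}" "A \<subseteq> set ll" "B \<subseteq> set ll" "C \<subseteq> set sl" "D \<subseteq> set sl" for A B C D
    using that items(3) by blast
  ultimately show ?thesis unfolding chosen_def by presburger
qed

text \<open>
  The vertices are the large items \<open>[0, m)\<close>, their \<open>m\<close> partners \<open>[m, 2m)\<close>, and \<open>2(l - q)\<close> dummies,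
  where \<open>q\<close> is the number of bins that are covered by three large items. A large item that is
  matched to a partner belongs to none of the other \<open>l - q\<close> bins. The last \<open>3q\<close> partners
  cannot be matched to dummies, which leaves at least \<open>3q\<close> such large items.
\<close>

definition allowed :: "nat \<Rightarrow> nat \<Rightarrow> nat \<Rightarrow> nat set \<Rightarrow> bool" where
  "allowed q u v T = (if v < m \<or> 2 * m \<le> v \<and> (u < m \<or> 2 * m \<le> u) then cov (chosen {u, v} T)
     else if v < 2 * m then u < m else u + 3 * q < 2 * m)"

definition verts :: "nat \<Rightarrow> nat" where "verts q = 2 * m + 2 * (l - q)"

text \<open>No two partners are adjacent, so all \<open>m\<close> of them are matched to large items
  or dummies. Of these \<open>m + 2 * (l - q)\<close> vertices, \<open>2 * (l - q)\<close> remain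
  and are matched among themselves, which gives \<open>l - q\<close> edges that cover bins. The last
  \<open>3 * q\<close> partners are matched to large items outside these edges, and any three of
  those cover a bin.\<close>

lemma solvable_if_config:
  assumes q: "q \<le> l" "3 * q \<le> m" and c: "c \<in> configs (allowed q) (verts q) {..<k}" "exact (verts q) k c"
  shows solvable
proof -
  define p where "p = fst c"
  define S where "S = snd c"
  let ?n = "verts q"
  have perm: "p permutes {..<?n}" and ne: "\<And>u. u < ?n \<Longrightarrow> p u \<noteq> u" and pp: "\<And>u. p (p u) = u"
    using c(1) unfolding mem_configs matchings_def p_def by blast+
  have S: "u < ?n \<Longrightarrow> u < p u \<Longrightarrow> S u \<subseteq> {..<k} \<and> allowed q u (p u) (S u)" for u
    using c(1) unfolding mem_configs p_def S_def lower_ends_def by blast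
  have Sd: "S u \<inter> S v = {}" if "u < ?n" "u < p u" "v < ?n" "v < p v" "u \<noteq> v" for u v
    using c(2) that unfolding exact_def disjoint_family_on_def lower_ends_def S_def p_def by blast
  have pn: "p u < ?n" if "u < ?n" for u using perm that permutes_in_image[of p "{..<?n}" u] by simp
  have inj: "p u = p v \<longleftrightarrow> u = v" for u v using pp by metis
  define LA where "LA = {..<m} \<union> {2 * m..<?n}"
  define F where "F = {m..<2 * m}"
  have cardLA: "card LA = m + 2 * (l - q)"
    unfolding LA_def by (subst card_Un_disjoint) (auto simp: verts_def)
  have V: "{..<?n} = LA \<union> F" "LA \<inter> F = {}" unfolding LA_def F_def verts_def by auto
  have al: "allowed q (min u (p u)) (max u (p u)) (S (min u (p u)))" if "u < ?n" for u
    using S[of u] S[of "p u"] pn[OF that] ne[OF that] that pp by (cases "u < p u") (auto simp: min_def max_def)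
  have FLA: "p x \<in> LA" if "x \<in> F" for x
  proof (rule ccontr)
    have x: "x < ?n" using that by (auto simp: F_def verts_def)
    assume "p x \<notin> LA"
    then have "p x \<in> F" using pn[OF x] V(1) by blast
    then show False using al[OF x] that by (auto simp: F_def allowed_def min_def max_def split: if_splits)
  qed
  have F1: "p x < m" if "x \<in> {2 * m - 3 * q..<2 * m}" for x
  proof (rule ccontr)
    have x: "x < ?n" "x \<in> F" using that q by (auto simp: F_def verts_def)
    assume "\<not> p x < m"
    then have "2 * m \<le> p x" using FLA[OF x(2)] by (auto simp: LA_def)
    then show False using al[OF x(1)] x that by (auto simp: F_def allowed_def min_def max_def split: if_splits)
  qed
  \<comment> \<open>The large items and dummies that are not matched to a partner.\<close>
  define Y where "Y = LA - p ` F"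
  have YLA: "Y \<subseteq> LA" "Y \<subseteq> {..<?n}" using V(1) by (auto simp: Y_def)
  have cardY: "card Y = 2 * (l - q)"
  proof -
    have "card (p ` F) = m" using inj by (subst card_image) (auto simp: F_def inj_on_def)
    then show ?thesis unfolding Y_def using FLA by (subst card_Diff_subset) (auto simp: F_def cardLA)
  qed
  have pY: "p y \<in> Y" if "y \<in> Y" for y
  proof -
    have "p y \<notin> F" using that pp unfolding Y_def by (metis DiffE imageI)
    then have "p y \<in> LA" using pn YLA(2) that V(1) by blast
    moreover have "p y \<notin> p ` F" using that inj V(2) unfolding Y_def by auto
    ultimately show ?thesis unfolding Y_def by blast
  qed
  define C where "C = {u \<in> Y. u < p u}"
  have finY: "finite Y" using YLA(2) finite_subset by blast
  have cardC: "card C = l - q"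
  proof -
    have "Y = C \<union> p ` C"
    proof (intro equalityI subsetI)
      fix y assume y: "y \<in> Y"
      show "y \<in> C \<union> p ` C"
      proof (cases "y < p y")
        case False
        then have "p y < p (p y)" using ne[of y] YLA(2) y pp by auto
        then have "p y \<in> C" using pY[OF y] by (simp add: C_def)
        then show ?thesis using pp by (metis UnI2 imageI)
      qed (simp add: C_def y)
    qed (use pY in \<open>auto simp: C_def\<close>)
    moreover have "C \<inter> p ` C = {}" using pp by (auto simp: C_def)
    moreover have "finite C" using finY by (simp add: C_def)
    moreover have "card (p ` C) = card C" using inj by (intro card_image) (auto simp: inj_on_def)
    ultimately have "card Y = 2 * card C" using card_Un_disjoint[of C "p ` C"] by simp
    then show ?thesis using cardY by simp
  qed
  \<comment> \<open>\<open>f j\<close> is the large item matched to the \<open>j\<close>-th of the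
    last \<open>3 * q\<close> partners; consecutive triples of these items form the other
    \<open>q\<close> bins.\<close>
  define f where "f j = p (2 * m - 3 * q + j)" for j
  have f: "f j < m" "f j \<notin> Y" if "j < 3 * q" for j
  proof -
    show "f j < m" unfolding f_def using that q by (intro F1) auto
    have "2 * m - 3 * q + j \<in> F" using that q by (auto simp: F_def)
    then show "f j \<notin> Y" unfolding f_def Y_def by blast
  qed
  have f_inj: "f i = f j \<longleftrightarrow> i = j" for i j unfolding f_def inj by auto
  define Vt :: "nat + nat \<Rightarrow> nat set" where "Vt = case_sum (\<lambda>u. {u, p u}) (\<lambda>t. {f (3 * t), f (3 * t + 1), f (3 * t + 2)})"
  \<comment> \<open>Triples receive no small items. Small items on edges at partners occur in none
    of the sets; \<open>packing\<close> moves them to the bin for leftovers.\<close>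
  define Tt :: "nat + nat \<Rightarrow> nat set" where "Tt = case_sum S (\<lambda>t. {})"
  let ?K = "Inl ` C \<union> Inr ` {..<q} :: (nat + nat) set"
  have Cn: "u < ?n \<and> u < p u" if "u \<in> C" for u using that YLA by (auto simp: C_def)
  have Tk: "Tt i \<subseteq> {..<k}" if "i \<in> ?K" for i
  proof -
    have "S u \<subseteq> {..<k}" if "u \<in> C" for u using S Cn[OF that] by blast
    then show ?thesis using that by (fastforce simp: Tt_def)
  qed
  show ?thesis
  proof (rule packing[of ?K "\<lambda>i. chosen (Vt i) (Tt i)"])
    show "finite ?K" using finY by (simp add: C_def)
    have "card ?K = card C + q" using finY
      by (subst card_Un_disjoint) (auto simp: C_def card_image)
    then show "l \<le> card ?K" using cardC q by simp
    show "disjoint_family_on (\<lambda>i. chosen (Vt i) (Tt i)) ?K"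
      unfolding disjoint_family_on_def
    proof (intro ballI impI)
      fix i j assume ij: "i \<in> ?K" "j \<in> ?K" "i \<noteq> j"
      have ii: "Vt (Inl u) \<inter> Vt (Inl v) = {} \<and> Tt (Inl u) \<inter> Tt (Inl v) = {}" if "u \<in> C" "v \<in> C" "u \<noteq> v" for u v
      proof -
        have "u \<noteq> p v" using that pp[of v] Cn[of u] Cn[of v] by auto
        moreover have "p u \<noteq> v" using that pp[of u] Cn[of u] Cn[of v] by auto
        ultimately show ?thesis using that Sd[of u v] Cn[of u] Cn[of v] inj by (auto simp: Vt_def Tt_def)
      qed
      have io: "Vt (Inl u) \<inter> Vt (Inr t) = {} \<and> Tt (Inl u) \<inter> Tt (Inr t) = {}" if "u \<in> C" "t < q" for u t
      proof -
        have "u \<in> Y" "p u \<in> Y" using that pY by (auto simp: C_def)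
        moreover have "f (3 * t) \<notin> Y" "f (3 * t + 1) \<notin> Y" "f (3 * t + 2) \<notin> Y" using f that by auto
        ultimately show ?thesis using that by (auto simp: Vt_def Tt_def)
      qed
      have oo: "Vt (Inr t) \<inter> Vt (Inr s) = {} \<and> Tt (Inr t) \<inter> Tt (Inr s) = {}" if "t \<noteq> s" for t s
        using that by (auto simp: Vt_def Tt_def f_inj)
      have "Vt i \<inter> Vt j = {} \<and> Tt i \<inter> Tt j = {}"
      proof (cases i)
        case (Inl u)
        show ?thesis
        proof (cases j)
          case (Inl v)
          then show ?thesis using ij ii[of u v] \<open>i = Inl u\<close> by auto
        next
          case (Inr t)
          then have "u \<in> C" "t < q" using ij \<open>i = Inl u\<close> by auto
          then show ?thesis using io[of u t] \<open>i = Inl u\<close> Inr by simp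
        qed
      next
        case (Inr t)
        show ?thesis
        proof (cases j)
          case (Inl v)
          then have "v \<in> C" "t < q" using ij Inr by auto
          then show ?thesis using io[of v t] Inr Inl by (simp add: Int_commute)
        next
          case (Inr s)
          then show ?thesis using ij oo[of t s] \<open>i = Inr t\<close> by auto
        qed
      qed
      then show "chosen (Vt i) (Tt i) \<inter> chosen (Vt j) (Tt j) = {}" using Tk ij by (intro chosen_disjoint) auto
    qed
    fix i assume i: "i \<in> ?K"
    show "chosen (Vt i) (Tt i) \<subseteq> {..<N}" using Tk[OF i] by (rule chosen_subset)
    show "cov (chosen (Vt i) (Tt i))"
    proof (cases i)
      case (Inl u)
      then have u: "u \<in> C" using i by auto
      then have "u \<in> LA" "p u \<in> LA" "u < p u" using YLA pY[of u] by (auto simp: C_def)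
      moreover have "allowed q u (p u) (S u)" using S[of u] Cn[OF u] by blast
      ultimately show ?thesis using Inl by (auto simp: allowed_def Vt_def Tt_def LA_def split: if_splits)
    next
      case (Inr t)
      then have t: "t < q" using i by auto
      then have fm: "f (3 * t) < m" "f (3 * t + 1) < m" "f (3 * t + 2) < m" using f by auto
      have "cov {ll ! f (3 * t), ll ! f (3 * t + 1), ll ! f (3 * t + 2)}"
        using fm items(2) by (intro three) (auto simp: nth_eq_iff_index_eq f_inj)
      then show ?thesis using Inr fm by (simp add: chosen_def Vt_def Tt_def)
    qed
  qed
qed

text \<open>A configuration on an arbitrary vertex set, grown edge by edge.\<close>

definition realizes :: "nat \<Rightarrow> nat set \<Rightarrow> nat set \<Rightarrow> (nat \<Rightarrow> nat) \<Rightarrow> (nat \<Rightarrow> nat set) \<Rightarrow> bool" where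
  "realizes q V K p S \<longleftrightarrow> (\<forall>u\<in>V. p u \<in> V \<and> p u \<noteq> u \<and> p (p u) = u) \<and> (\<forall>u. u \<notin> V \<longrightarrow> p u = u) \<and>
     (\<forall>u. u < p u \<longrightarrow> allowed q u (p u) (S u)) \<and> (\<forall>u. \<not> u < p u \<longrightarrow> S u = undefined) \<and>
     (\<forall>u v. u < p u \<longrightarrow> v < p v \<longrightarrow> u \<noteq> v \<longrightarrow> S u \<inter> S v = {}) \<and> (\<Union>u\<in>{u. u < p u}. S u) = K"

definition realizable :: "nat \<Rightarrow> nat set \<Rightarrow> nat set \<Rightarrow> bool" where
  "realizable q V K \<longleftrightarrow> (\<exists>p S. realizes q V K p S)"

lemma realizesD:
  assumes "realizes q V K p S"
  shows "u \<in> V \<Longrightarrow> p u \<in> V \<and> p u \<noteq> u \<and> p (p u) = u" "u \<notin> V \<Longrightarrow> p u = u"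
    "u < p u \<Longrightarrow> allowed q u (p u) (S u)" "\<not> u < p u \<Longrightarrow> S u = undefined"
    "u < p u \<Longrightarrow> v < p v \<Longrightarrow> u \<noteq> v \<Longrightarrow> S u \<inter> S v = {}" "(\<Union>u\<in>{u. u < p u}. S u) = K"
  using assms unfolding realizes_def by simp_all

lemma realizable_empty: "realizable q {} {}"
  unfolding realizable_def realizes_def by (intro exI[of _ id] exI[of _ "\<lambda>_. undefined"]) simp

lemma realizable_add:
  assumes "realizable q V K" and uv: "u < v" "u \<notin> V" "v \<notin> V" and T: "allowed q u v T" "T \<inter> K = {}"
  shows "realizable q (V \<union> {u, v}) (K \<union> T)"
proof -
  from assms(1) obtain p S where "realizes q V K p S" unfolding realizable_def by blast
  note 1 = realizesD(1)[OF this] and 2 = realizesD(2)[OF this] and 3 = realizesD(3)[OF this] and 4 = realizesD(4)[OF this]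
    and 5 = realizesD(5)[OF this] and 6 = realizesD(6)[OF this]
  let ?p = "p(u := v, v := u)" and ?S = "S(u := T)"
  have low: "x < ?p x \<longleftrightarrow> x = u \<or> x < p x" for x using uv 2[of u] 2[of v] by auto
  have ps: "x < p x \<Longrightarrow> x \<noteq> u \<and> x \<noteq> v \<and> ?p x = p x" for x using uv 2[of u] 2[of v] by auto
  have TS: "T \<inter> S x = {}" if "x < p x" for x using T(2) 6 that by blast
  show ?thesis unfolding realizable_def realizes_def
  proof (intro exI[of _ ?p] exI[of _ ?S] conjI allI impI ballI)
    fix x assume "x \<in> V \<union> {u, v}"
    then show "?p x \<in> V \<union> {u, v}" "?p x \<noteq> x" "?p (?p x) = x" using 1[of x] uv by auto
  next
    fix x assume "x < ?p x"
    then show "allowed q x (?p x) (?S x)" using 3[of x] ps[of x] T(1) uv unfolding low by auto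
  next
    fix x assume "\<not> x < ?p x"
    then show "?S x = undefined" using 4[of x] unfolding low by auto
  next
    fix x y assume "x < ?p x" "y < ?p y" "x \<noteq> y"
    then show "?S x \<inter> ?S y = {}" using 5[of x y] TS[of x] TS[of y] unfolding low by auto
  next
    have "{x. x < ?p x} = insert u {x. x < p x}" using low by auto
    moreover have "(\<Union>x\<in>{x. x < p x}. ?S x) = K" unfolding 6[symmetric] using ps by (intro SUP_cong) auto
    ultimately have "(\<Union>x\<in>{x. x < ?p x}. ?S x) = ?S u \<union> K" by (simp only: UN_insert)
    then show "(\<Union>x\<in>{x. x < ?p x}. ?S x) = K \<union> T" by (simp only: fun_upd_same Un_commute)
  qed (use 2 in auto)
qed

lemma config_if_realizable:
  assumes "realizable q {..<verts q} {..<k}"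
  shows "\<exists>c\<in>configs (allowed q) (verts q) {..<k}. exact (verts q) k c"
proof -
  from assms obtain p S where "realizes q {..<verts q} {..<k} p S" unfolding realizable_def by blast
  note 1 = realizesD(1)[OF this] and 2 = realizesD(2)[OF this] and 3 = realizesD(3)[OF this] and 4 = realizesD(4)[OF this]
    and 5 = realizesD(5)[OF this] and 6 = realizesD(6)[OF this]
  have pp: "p (p x) = x" for x using 1[of x] 2[of x] by (cases "x < verts q") auto
  have "p permutes {..<verts q}"
  proof (rule bij_imp_permutes)
    show "bij_betw p {..<verts q} {..<verts q}"
      by (rule bij_betw_byWitness[of _ p]) (use pp 1 in auto)
  qed (use 2 in simp)
  then have m: "p \<in> matchings (verts q)" unfolding matchings_def using 1 pp by simp
  have L: "lower_ends (verts q) p = {u. u < p u}" unfolding lower_ends_def using 2 by (metis (no_types, lifting) lessThan_iff less_irrefl)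
  have "(p, S) \<in> configs (allowed q) (verts q) {..<k}"
    unfolding mem_configs using m 3 4 6 by (auto simp: L extensional_def)
  moreover have "exact (verts q) k (p, S)"
    unfolding exact_def config_union_def disjoint_family_on_def using 5 6 by (auto simp: L)
  ultimately show ?thesis by blast
qed

text \<open>The first edge takes all of \<open>T\<close> and the others take nothing, since an edge
  between a large item and its partner admits every label. The last premise covers the case that
  there is no edge to carry \<open>T\<close>.\<close>

lemma realizable_rest:
  assumes "realizable q V K" "finite X" "X \<subseteq> {..<m}" "Y \<subseteq> {m..<2 * m}" "card X = card Y" "V \<inter> (X \<union> Y) = {}"
    "T \<inter> K = {}" "X = {} \<Longrightarrow> T = {}"
  shows "realizable q (V \<union> (X \<union> Y)) (K \<union> T)"
  using assms(2,1,3-)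
proof (induction X arbitrary: V K Y T rule: finite_induct)
  case empty
  then have "Y = {}" using finite_subset by fastforce
  then show ?case using empty by simp
next
  case (insert x X)
  have "Y \<noteq> {}" using insert.prems insert.hyps by auto
  then obtain y where y: "y \<in> Y" by blast
  have finY: "finite Y" using insert.prems finite_subset by blast
  have "y \<notin> X" "y \<noteq> x" using y insert.prems by fastforce+
  have r: "realizable q (V \<union> {x, y}) (K \<union> T)"
    by (rule realizable_add[OF insert.prems(1)]) (use insert.prems y in \<open>auto simp: allowed_def\<close>)
  have "realizable q ((V \<union> {x, y}) \<union> (X \<union> (Y - {y}))) ((K \<union> T) \<union> {})"
    by (rule insert.IH[OF r]) (use insert.prems insert.hyps y finY \<open>y \<notin> X\<close> in auto)
  moreover have "(V \<union> {x, y}) \<union> (X \<union> (Y - {y})) = V \<union> (insert x X \<union> Y)" using y by auto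
  ultimately show ?case by simp
qed

text \<open>\<open>Q\<close> holds the bins with at least three large items. A bin with at most two
  of them becomes an edge, with dummies in place of missing large items. Two dummies are reserved
  for each such bin, and those it does not use are matched to partners. The large items of the bins
  in \<open>Q\<close> are matched to the remaining partners, and the small items of these bins ride
  along.\<close>

lemma config_if_solvable:
  assumes solvable
  shows "\<exists>q. q \<le> l \<and> 3 * q \<le> m \<and> (\<exists>c\<in>configs (allowed q) (verts q) {..<k}. exact (verts q) k c)"
proof -
  obtain B where B: "(\<Union>b<l. B b) = {..<N}" "disjoint_family_on B {..<l}" "\<And>b. b < l \<Longrightarrow> cov (B b)"
    using assms unfolding solvable_def by blast
  define Lb where "Lb b = {x. x < m \<and> ll ! x \<in> B b}" for b
  define Sb where "Sb b = {i. i < k \<and> sl ! i \<in> B b}" for b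
  have fL: "finite (Lb b)" for b by (rule finite_subset[of _ "{..<m}"]) (auto simp: Lb_def)
  have Ldisj: "Lb a \<inter> Lb b = {}" and Sdisj: "Sb a \<inter> Sb b = {}" if "a < l" "b < l" "a \<noteq> b" for a b
    using that B(2) unfolding disjoint_family_on_def Lb_def Sb_def by blast+
  have LU: "(\<Union>b<l. Lb b) = {..<m}"
  proof -
    have "\<exists>b<l. x \<in> Lb b" if "x < m" for x
    proof -
      have "ll ! x \<in> {..<N}" using that items(4) by (metis UnI2 nth_mem)
      then show ?thesis using B(1) that unfolding Lb_def by blast
    qed
    then show ?thesis by (auto simp: Lb_def)
  qed
  have SU: "(\<Union>b<l. Sb b) = {..<k}"
  proof -
    have "\<exists>b<l. x \<in> Sb b" if "x < k" for x
    proof -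
      have "sl ! x \<in> {..<N}" using that items(4) by (metis UnI1 nth_mem)
      then show ?thesis using B(1) that unfolding Sb_def by blast
    qed
    then show ?thesis by (auto simp: Sb_def)
  qed
  have Bb: "chosen X (Sb b) = B b" if "b < l" "X \<inter> {..<m} = Lb b" for b X
  proof
    show "chosen X (Sb b) \<subseteq> B b" unfolding chosen_def that(2) by (auto simp: Lb_def Sb_def)
    show "B b \<subseteq> chosen X (Sb b)"
    proof
      fix y assume y: "y \<in> B b"
      then have "y \<in> set sl \<union> set ll" using B(1) that items(4) by blast
      then show "y \<in> chosen X (Sb b)" unfolding chosen_def that(2)
        using y by (auto simp: Lb_def Sb_def in_set_conv_nth)
    qed
  qed
  define Q where "Q = {b. b < l \<and> 3 \<le> card (Lb b)}"
  define q where "q = card Q"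
  define R where "R = {..<l} - Q"
  have fQ: "finite Q" "Q \<subseteq> {..<l}" by (auto simp: Q_def)
  have ql: "q \<le> l" using card_mono[OF _ fQ(2)] by (simp add: q_def)
  have cR: "card R = l - q" unfolding R_def q_def using fQ by (simp add: card_Diff_subset)
  have total: "(\<Sum>b<l. card (Lb b)) = m"
  proof -
    have "(\<Sum>b<l. card (Lb b)) = card (\<Union>b<l. Lb b)"
      by (rule card_UN_disjoint[symmetric]) (use fL Ldisj in auto)
    then show ?thesis using LU by simp
  qed
  have "3 * q \<le> (\<Sum>b\<in>Q. card (Lb b))" unfolding q_def using sum_bounded_below[of Q 3 "\<lambda>b. card (Lb b)"] by (simp add: Q_def mult.commute)
  moreover have "(\<Sum>b\<in>R. card (Lb b)) + (\<Sum>b\<in>Q. card (Lb b)) = m"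
    unfolding total[symmetric] R_def using fQ(2) by (simp add: sum.subset_diff)
  \<comment> \<open>Hence the partners that are matched to dummies can be taken from the front
    without touching the last \<open>3 * q\<close>.\<close>
  ultimately have c3: "(\<Sum>b\<in>R. card (Lb b)) + 3 * q \<le> m" by simp
  define cc where "cc X = (\<Sum>b\<in>X. card (Lb b))" for X
  \<comment> \<open>The invariant charges every bin of \<open>X\<close> with exactly two dummies and
    with as many partners as it has large items, although a bin with \<open>j\<close> large items
    matches only \<open>j\<close> of its dummies to partners. These numbers agree because the
    \<open>2 - j\<close> other dummies lie on its own edge.\<close>
  have main: "realizable q ((\<Union>b\<in>X. Lb b) \<union> ({m..<m + cc X} \<union> {2 * m..<2 * m + 2 * card X})) (\<Union>b\<in>X. Sb b)"
    if "finite X" "X \<subseteq> R" for X using that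
  proof (induction X rule: finite_induct)
    case empty
    then show ?case using realizable_empty by (simp add: cc_def)
  next
    case (insert b X)
    let ?V = "(\<Union>b\<in>X. Lb b) \<union> ({m..<m + cc X} \<union> {2 * m..<2 * m + 2 * card X})" and ?K = "\<Union>b\<in>X. Sb b"
    have IH: "realizable q ?V ?K" using insert by simp
    have b: "b < l" "card (Lb b) < 3" "b \<in> R" using insert.prems by (auto simp: R_def Q_def)
    have Xl: "a < l \<and> a \<noteq> b" if "a \<in> X" for a using that insert by (auto simp: R_def)
    have cci: "cc (insert b X) = cc X + card (Lb b)" using insert.hyps by (simp add: cc_def)
    have "cc (insert b X) \<le> cc R" unfolding cc_def using insert.prems by (intro sum_mono2) (auto simp: R_def)
    then have ccm: "cc X + card (Lb b) + 3 * q \<le> m" using c3 cci by (simp add: cc_def)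
    have notL: "x \<notin> ?V" if "x \<in> Lb b" for x
    proof -
      have "x < m" using that by (simp add: Lb_def)
      moreover have "x \<notin> Lb a" if "a \<in> X" for a using Ldisj[of a b] Xl[OF that] b \<open>x \<in> Lb b\<close> by blast
      ultimately show ?thesis by auto
    qed
    have XLm: "x \<notin> Lb a" if "m \<le> x" for x a using that by (auto simp: Lb_def)
    have SK: "Sb b \<inter> ?K = {}" using Sdisj[of b] Xl b by blast
    have covb: "cov (chosen Y (Sb b))" if "Y \<inter> {..<m} = Lb b" for Y using B(3)[OF b(1)] Bb[OF b(1) that] by simp
    let ?r = "2 * m + 2 * card X" and ?c = "m + cc X"
    from b(2) consider "card (Lb b) = 0" | "card (Lb b) = 1" | "card (Lb b) = 2" by linarith
    then show ?case
    proof cases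
      case 1
      then have L: "Lb b = {}" using fL by simp
      have "realizable q (?V \<union> {?r, ?r + 1}) (?K \<union> Sb b)"
        by (rule realizable_add[OF IH]) (use XLm ccm SK L covb[of "{?r, ?r + 1}"] in \<open>auto simp: allowed_def\<close>)
      moreover have "?V \<union> {?r, ?r + 1} = (\<Union>b\<in>insert b X. Lb b) \<union> ({m..<m + cc (insert b X)} \<union> {2 * m..<2 * m + 2 * card (insert b X)})"
        using insert.hyps L by (auto simp: cci)
      ultimately show ?thesis by (simp add: Un_commute)
    next
      case 2
      then obtain x where L: "Lb b = {x}" by (auto simp: card_1_singleton_iff)
      have x: "x < m" "x \<notin> ?V" using L notL by (auto simp: Lb_def)
      have 1: "realizable q (?V \<union> {x, ?r}) (?K \<union> Sb b)"
        by (rule realizable_add[OF IH]) (use x XLm ccm SK L covb[of "{x, ?r}"] in \<open>auto simp: allowed_def\<close>)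
      have "realizable q ((?V \<union> {x, ?r}) \<union> {?c, ?r + 1}) ((?K \<union> Sb b) \<union> {})"
        by (rule realizable_add[OF 1]) (use x XLm ccm 2 in \<open>auto simp: allowed_def\<close>)
      moreover have "(?V \<union> {x, ?r}) \<union> {?c, ?r + 1} = (\<Union>b\<in>insert b X. Lb b) \<union> ({m..<m + cc (insert b X)} \<union> {2 * m..<2 * m + 2 * card (insert b X)})"
        using insert.hyps L by (auto simp: cci)
      ultimately show ?thesis by (simp add: Un_commute)
    next
      case 3
      then obtain x y where xy: "Lb b = {x, y}" "x \<noteq> y" by (auto simp: card_2_iff)
      define x' where "x' = min x y"
      define y' where "y' = max x y"
      have L: "Lb b = {x', y'}" "x' < y'" using xy by (auto simp: x'_def y'_def min_def max_def)
      have x: "x' < m" "y' < m" "x' \<notin> ?V" "y' \<notin> ?V" using L notL by (auto simp: Lb_def)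
      have 1: "realizable q (?V \<union> {x', y'}) (?K \<union> Sb b)"
        by (rule realizable_add[OF IH]) (use x XLm ccm SK L covb[of "{x', y'}"] in \<open>auto simp: allowed_def\<close>)
      have 2: "realizable q ((?V \<union> {x', y'}) \<union> {?c, ?r}) ((?K \<union> Sb b) \<union> {})"
        by (rule realizable_add[OF 1]) (use x XLm ccm 3 in \<open>auto simp: allowed_def\<close>)
      have "realizable q (((?V \<union> {x', y'}) \<union> {?c, ?r}) \<union> {?c + 1, ?r + 1}) (((?K \<union> Sb b) \<union> {}) \<union> {})"
        by (rule realizable_add[OF 2]) (use x XLm ccm 3 in \<open>auto simp: allowed_def\<close>)
      moreover have "((?V \<union> {x', y'}) \<union> {?c, ?r}) \<union> {?c + 1, ?r + 1} = (\<Union>b\<in>insert b X. Lb b) \<union> ({m..<m + cc (insert b X)} \<union> {2 * m..<2 * m + 2 * card (insert b X)})"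
        using insert.hyps L 3 by (auto simp: cci)
      ultimately show ?thesis by (simp add: Un_commute)
    qed
  qed
  have RQ: "{..<l} = R \<union> Q" using fQ by (auto simp: R_def)
  \<comment> \<open>After the bins in \<open>R\<close>, the unmatched large items are those of the
    bins in \<open>Q\<close>, and just as many partners are left.\<close>
  let ?V = "(\<Union>b\<in>R. Lb b) \<union> ({m..<m + cc R} \<union> {2 * m..<2 * m + 2 * card R})" and ?K = "\<Union>b\<in>R. Sb b"
  let ?X = "\<Union>b\<in>Q. Lb b" and ?Y = "{m + cc R..<2 * m}" and ?T = "\<Union>b\<in>Q. Sb b"
  have "realizable q ?V ?K" by (rule main) (auto simp: R_def)
  then have "realizable q (?V \<union> (?X \<union> ?Y)) (?K \<union> ?T)"
  proof (rule realizable_rest)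
    show "finite ?X" using fQ fL by simp
    show "?X \<subseteq> {..<m}" by (auto simp: Lb_def)
    show "?Y \<subseteq> {m..<2 * m}" by auto
    have "card ?X = (\<Sum>b\<in>Q. card (Lb b))"
    proof (rule card_UN_disjoint)
      show "\<forall>a\<in>Q. \<forall>b\<in>Q. a \<noteq> b \<longrightarrow> Lb a \<inter> Lb b = {}" using fQ(2) Ldisj by blast
    qed (use fQ fL in auto)
    then show "card ?X = card ?Y" using \<open>(\<Sum>b\<in>R. card (Lb b)) + (\<Sum>b\<in>Q. card (Lb b)) = m\<close> by (simp add: cc_def)
    have "Lb a \<inter> Lb b = {}" "Sb a \<inter> Sb b = {}" if "a \<in> R" "b \<in> Q" for a b
      using that fQ Ldisj[of a b] Sdisj[of a b] by (auto simp: R_def)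
    then have "(\<Union>b\<in>R. Lb b) \<inter> ?X = {}" and ST: "?T \<inter> ?K = {}" by blast+
    moreover have "x < m" if "x \<in> (\<Union>b\<in>R. Lb b) \<union> ?X" for x using that by (auto simp: Lb_def)
    ultimately show "?V \<inter> (?X \<union> ?Y) = {}" using c3 by (fastforce simp: cc_def)
    show "?T \<inter> ?K = {}" by (rule ST)
    show "?T = {}" if "?X = {}"
    proof -
      have "Q = {}" using that by (auto simp: Q_def)
      then show ?thesis by simp
    qed
  qed
  moreover have "?V \<union> (?X \<union> ?Y) = {..<verts q}"
  proof -
    have "(\<Union>b\<in>R. Lb b) \<union> ?X = {..<m}" using LU unfolding RQ by blast
    then have "?V \<union> (?X \<union> ?Y) = {..<m} \<union> ({m..<m + cc R} \<union> {m + cc R..<2 * m} \<union> {2 * m..<2 * m + 2 * (l - q)})"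
      unfolding cR by blast
    also have "\<dots> = {..<verts q}" using c3 unfolding verts_def cc_def by auto
    finally show ?thesis .
  qed
  moreover have "?K \<union> ?T = {..<k}" using SU unfolding RQ by blast
  ultimately have "realizable q {..<verts q} {..<k}" by simp
  then show ?thesis using config_if_realizable ql c3 by (intro exI[of _ q]) simp
qed

end


section \<open>Running times\<close>

text \<open>Almost sure termination with one possible output: the notion for all parts of the
  algorithm except the drawing of the random number.\<close>

definition yields :: "(val \<times> nat) spmf \<Rightarrow> val \<Rightarrow> nat \<Rightarrow> bool" where
  "yields D w T \<longleftrightarrow> lossless_spmf D \<and> (\<forall>r \<in> set_spmf D. fst r = w \<and> snd r \<le> T)"

lemma yields_return: "t \<le> T \<Longrightarrow> yields (return_spmf (w, t)) w T"
  unfolding yields_def by simp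

lemma yields_bind:
  assumes "yields D w S" "\<And>s. s \<le> S \<Longrightarrow> yields (F (w, s)) u T"
  shows "yields (bind_spmf D F) u T"
proof -
  have F: "lossless_spmf (F r)" "\<forall>r' \<in> set_spmf (F r). fst r' = u \<and> snd r' \<le> T" if "r \<in> set_spmf D" for r
  proof -
    have "r = (w, snd r)" "snd r \<le> S" using that assms(1) unfolding yields_def by (cases r, fastforce)+
    then show "lossless_spmf (F r)" "\<forall>r' \<in> set_spmf (F r). fst r' = u \<and> snd r' \<le> T"
      using assms(2)[of "snd r"] unfolding yields_def by metis+
  qed
  then show ?thesis using assms(1) unfolding yields_def
    by (auto simp only: lossless_bind_spmf set_bind_spmf bind_UNION o_apply)
qed

definition computes :: "prog \<Rightarrow> val \<Rightarrow> val \<Rightarrow> nat \<Rightarrow> bool" where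
  "computes p v w T \<longleftrightarrow> yields (run p v) w T"

lemma computes_mono: "computes p v w T \<Longrightarrow> T \<le> T' \<Longrightarrow> computes p v w T'"
  unfolding computes_def yields_def by fastforce

lemma computes_Ident: "computes Ident v v 1"
  and computes_Lit: "computes (Lit n) v (Num n) (1 + floorlog 2 n)"
  and computes_Head: "computes Head v (head_of v) 1"
  and computes_Tail: "computes Tail v (tail_of v) 1"
  and computes_IsTup: "computes IsTup v (Num (of_bool (is_tup v))) 1"
  and computes_Arith: "computes (Arith f) (Tup (Num a) (Num b)) (Num (arith_fun f a b)) (1 + floorlog 2 a + floorlog 2 b)"
  unfolding computes_def by (simp_all add: yields_return)

lemma computes_Comp: "computes p v w S \<Longrightarrow> computes q w u T \<Longrightarrow> computes (Comp p q) v u (1 + S + T)"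
  unfolding computes_def by (auto intro!: yields_bind yields_return)

lemma computes_Both: "computes p v w S \<Longrightarrow> computes q v u T \<Longrightarrow> computes (Both p q) v (Tup w u) (1 + S + T)"
  unfolding computes_def by (auto intro!: yields_bind yields_return)

lemma computes_Cond:
  assumes "computes c v b R" "truth b \<Longrightarrow> computes p v u T" "\<not> truth b \<Longrightarrow> computes q v u T"
  shows "computes (Cond c p q) v u (1 + R + T)"
  using assms unfolding computes_def by (auto intro!: yields_bind yields_return)

lemma computes_Loop_step:
  assumes "computes c v b R" "truth b" "computes p v w S" "computes (Loop c p) w u T"
  shows "computes (Loop c p) v u (1 + R + S + T)"
  using assms unfolding computes_def
  by (simp, subst run_loop.simps) (auto intro!: yields_bind yields_return)

lemma computes_Loop_exit:
  assumes "computes c v b R" "\<not> truth b"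
  shows "computes (Loop c p) v v (1 + R)"
  using assms unfolding computes_def
  by (simp, subst run_loop.simps) (auto intro!: yields_bind yields_return)

lemma truth_Num [simp]: "truth (Num n) \<longleftrightarrow> n \<noteq> 0" by (simp add: truth_def)
lemma truth_Tup [simp]: "truth (Tup a b)" by (simp add: truth_def)

fun unN :: "val \<Rightarrow> nat" where
  "unN (Num n) = n"
| "unN (Tup a b) = 0"

text \<open>Forces a result to be a number, as \<open>unN\<close> does. Without it an arithmetic
  step with a tree as operand would return 0, whereas \<open>ev\<close> reads just that operand as
  0.\<close>

definition cz :: "prog \<Rightarrow> prog" where
  "cz p = Comp p (Cond IsTup (Lit 0) Ident)"

lemma computes_cz:
  assumes "computes p v w T" shows "computes (cz p) v (Num (unN w)) (6 + T)"
proof -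
  have "computes (Cond IsTup (Lit 0) Ident) w (Num (unN w)) (1 + 1 + 1)"
  proof (rule computes_Cond[OF computes_IsTup])
    show "computes (Lit 0) w (Num (unN w)) 1" if "truth (Num (of_bool (is_tup w)))"
      using that computes_Lit[of 0 w] by (cases w) (simp_all add: floorlog_def)
    show "computes Ident w (Num (unN w)) 1" if "\<not> truth (Num (of_bool (is_tup w)))"
      using that computes_Ident[of w] by (cases w) simp_all
  qed
  then show ?thesis unfolding cz_def by (rule computes_mono[OF computes_Comp[OF assms]]) simp
qed

text \<open>Loops keep their state as \<open>Tup j (Tup acc (Tup n env))\<close>; the body sees \<open>Tup j (Tup acc env)\<close>.\<close>

definition forp :: "prog \<Rightarrow> prog" where
  "forp b = Comp (Loop (Comp (Both Head (Comp Tail (Comp Tail Head))) (Arith Less))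
     (Both (Comp (Both Head (Lit 1)) (Arith Add))
       (Both (Comp (Both Head (Both (Comp Tail Head) (Comp Tail (Comp Tail Tail)))) b)
         (Comp Tail (Comp Tail Ident))))) (Comp Tail Head)"

primrec iter :: "(nat \<Rightarrow> 'a \<Rightarrow> 'a) \<Rightarrow> nat \<Rightarrow> 'a \<Rightarrow> 'a" where
  "iter f 0 a = a"
| "iter f (Suc n) a = f n (iter f n a)"

lemma floorlog2_le: "floorlog 2 n \<le> n"
  using floorlog_leD[of 2 n n] less_exp[of n] floorlog_le_iff[of 2 n n] by auto

text \<open>The summand \<open>3 * L\<close> pays for the counter: every round compares it with
  \<open>n\<close> and increments it, at a cost logarithmic in its value.\<close>

lemma computes_forp:
  assumes b: "\<And>j. j < n \<Longrightarrow> computes b (Tup (Num j) (Tup (iter f j a) env)) (f j (iter f j a)) T"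
    and L: "floorlog 2 n \<le> L"
  shows "computes (forp b) (Tup (Num 0) (Tup a (Tup (Num n) env))) (iter f n a) ((n + 1) * (T + 3 * L + 54))"
proof -
  let ?st = "\<lambda>j x. Tup (Num j) (Tup x (Tup (Num n) env))"
  let ?c = "Comp (Both Head (Comp Tail (Comp Tail Head))) (Arith Less)"
  let ?b = "Both (Comp (Both Head (Lit 1)) (Arith Add))
       (Both (Comp (Both Head (Both (Comp Tail Head) (Comp Tail (Comp Tail Tail)))) b)
         (Comp Tail (Comp Tail Ident)))"
  have fl: "floorlog 2 j \<le> L" if "j \<le> n" for j
    using that L floorlog_mono[of j n 2] by simp
  have c: "computes ?c (?st j x) (Num (of_bool (j < n))) (2 * L + 15)" if "j \<le> n" for j x
  proof -
    have h: "computes Head (?st j x) (Num j) 1" using computes_Head[of "?st j x"] by simp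
    have t1: "computes Tail (?st j x) (Tup x (Tup (Num n) env)) 1" using computes_Tail[of "?st j x"] by simp
    have t2: "computes Tail (Tup x (Tup (Num n) env)) (Tup (Num n) env) 1" using computes_Tail[of "Tup x (Tup (Num n) env)"] by simp
    have t3: "computes Head (Tup (Num n) env) (Num n) 1" using computes_Head[of "Tup (Num n) env"] by simp
    show ?thesis
      by (rule computes_mono[OF computes_Comp[OF computes_Both[OF h computes_Comp[OF t1 computes_Comp[OF t2 t3]]] computes_Arith[of Less, simplified]]])
        (use fl[OF that] L in simp)
  qed
  have bd: "computes ?b (?st j (iter f j a)) (?st (Suc j) (iter f (Suc j) a)) (T + L + 34)" if "j < n" for j
  proof -
    let ?s = "?st j (iter f j a)"
    have h: "computes Head ?s (Num j) 1" using computes_Head[of ?s] by simp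
    have t1: "computes Tail ?s (Tup (iter f j a) (Tup (Num n) env)) 1" using computes_Tail[of ?s] by simp
    have t2: "computes Tail (Tup (iter f j a) (Tup (Num n) env)) (Tup (Num n) env) 1"
      using computes_Tail[of "Tup (iter f j a) (Tup (Num n) env)"] by simp
    have h2: "computes Head (Tup (iter f j a) (Tup (Num n) env)) (iter f j a) 1"
      using computes_Head[of "Tup (iter f j a) (Tup (Num n) env)"] by simp
    have t3: "computes Tail (Tup (Num n) env) env 1" using computes_Tail[of "Tup (Num n) env"] by simp
    have l1: "computes (Lit 1) ?s (Num 1) 2" by (rule computes_mono[OF computes_Lit]) (simp add: floorlog_def)
    have ad: "computes (Arith Add) (Tup (Num j) (Num 1)) (Num (Suc j)) (2 + L)"
      using computes_mono[OF computes_Arith[of Add j 1], of "2 + L"] fl[of j] that by (simp add: floorlog_def)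
    have "computes ?b ?s (Tup (Num (Suc j)) (Tup (f j (iter f j a)) (Tup (Num n) env))) (T + L + 34)"
      by (rule computes_mono[OF computes_Both[OF computes_Comp[OF computes_Both[OF h l1] ad]
        computes_Both[OF computes_Comp[OF computes_Both[OF h computes_Both[OF computes_Comp[OF t1 h2] computes_Comp[OF t1 computes_Comp[OF t2 t3]]]] b[OF that]]
          computes_Comp[OF t1 computes_Comp[OF t2 computes_Ident]]]]]) simp
    then show ?thesis by simp
  qed
  have lp: "computes (Loop ?c ?b) (?st (n - i) (iter f (n - i) a)) (?st n (iter f n a)) ((i + 1) * (T + 3 * L + 50) - 1)"
    if "i \<le> n" for i using that
  proof (induction i)
    case 0
    show ?case using computes_mono[OF computes_Loop_exit[OF c[of n]], of "T + 3 * L + 50 - 1"] by simp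
  next
    case (Suc i)
    then have 1: "n - Suc i < n" and 2: "Suc (n - Suc i) = n - i" by auto
    from Suc have IH: "computes (Loop ?c ?b) (?st (Suc (n - Suc i)) (iter f (Suc (n - Suc i)) a)) (?st n (iter f n a)) ((i + 1) * (T + 3 * L + 50) - 1)"
      unfolding 2 by simp
    show ?case
      by (rule computes_mono[OF computes_Loop_step[OF c[of "n - Suc i"] _ bd[OF 1] IH]]) (use 1 in auto)
  qed
  have t: "computes Tail (?st n (iter f n a)) (Tup (iter f n a) (Tup (Num n) env)) 1" using computes_Tail[of "?st n (iter f n a)"] by simp
  have h: "computes Head (Tup (iter f n a) (Tup (Num n) env)) (iter f n a) 1"
      using computes_Head[of "Tup (iter f n a) (Tup (Num n) env)"] by simp
  have lp': "computes (Loop ?c ?b) (?st 0 a) (?st n (iter f n a)) ((n + 1) * (T + 3 * L + 50) - 1)" using lp[of n] by simp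
  show ?thesis
    unfolding forp_def by (rule computes_mono[OF computes_Comp[OF lp' computes_Comp[OF t h]]]) (simp add: algebra_simps)
qed

fun list_of :: "val \<Rightarrow> val list" where
  "list_of (Num n) = []"
| "list_of (Tup v w) = v # list_of w"

lemma list_of_enc_list [simp]: "list_of (enc_list xs) = xs"
  by (induction xs) auto

definition foldp :: "prog \<Rightarrow> prog" where
  "foldp b = Comp (Loop (Comp Head IsTup)
     (Both (Comp Head Tail)
       (Both (Comp (Both (Comp Head Head) Tail) b) (Comp Tail Tail)))) (Comp Tail Head)"

lemma computes_foldp:
  assumes "\<And>i. i < length (list_of l) \<Longrightarrow>
      computes b (Tup (list_of l ! i) (Tup (fold f (take i (list_of l)) a) env))
        (f (list_of l ! i) (fold f (take i (list_of l)) a)) T"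
  shows "computes (foldp b) (Tup l (Tup a env)) (fold f (list_of l) a) ((length (list_of l) + 1) * (T + 25))"
proof -
  let ?c = "Comp Head IsTup"
  let ?b = "Both (Comp Head Tail) (Both (Comp (Both (Comp Head Head) Tail) b) (Comp Tail Tail))"
  \<comment> \<open>\<open>l'\<close> is the leaf at which the spine of the list ends.
    \<open>list_of\<close> forgets its number, hence the existential quantifier.\<close>
  have lp: "\<exists>l'. computes (Loop ?c ?b) (Tup l (Tup a env)) (Tup l' (Tup (fold f (list_of l) a) env)) ((length (list_of l) + 1) * (T + 20))"
    using assms
  proof (induction l arbitrary: a)
    case (Num x)
    have h: "computes Head (Tup (Num x) (Tup a env)) (Num x) 1" using computes_Head[of "Tup (Num x) (Tup a env)"] by simp
    have i: "computes IsTup (Num x) (Num 0) 1" using computes_IsTup[of "Num x"] by simp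
    show ?case
      by (rule exI, simp, rule computes_mono[OF computes_Loop_exit[OF computes_Comp[OF h i]]]) auto
  next
    case (Tup x l)
    let ?s = "Tup (Tup x l) (Tup a env)"
    have h: "computes Head ?s (Tup x l) 1" using computes_Head[of ?s] by simp
    have h2: "computes Head (Tup x l) x 1" using computes_Head[of "Tup x l"] by simp
    have h3: "computes Tail (Tup x l) l 1" using computes_Tail[of "Tup x l"] by simp
    have t: "computes Tail ?s (Tup a env) 1" using computes_Tail[of ?s] by simp
    have t2: "computes Tail (Tup a env) env 1" using computes_Tail[of "Tup a env"] by simp
    have i: "computes IsTup (Tup x l) (Num 1) 1" using computes_IsTup[of "Tup x l"] by simp
    have b: "computes b (Tup x (Tup a env)) (f x a) T" using Tup.prems[of 0] by simp
    have "\<exists>l'. computes (Loop ?c ?b) (Tup l (Tup (f x a) env)) (Tup l' (Tup (fold f (list_of l) (f x a)) env)) ((length (list_of l) + 1) * (T + 20))"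
    proof (rule Tup.IH(2))
      fix i assume "i < length (list_of l)"
      then show "computes b (Tup (list_of l ! i) (Tup (fold f (take i (list_of l)) (f x a)) env))
        (f (list_of l ! i) (fold f (take i (list_of l)) (f x a))) T"
        using Tup.prems[of "Suc i"] by simp
    qed
    then obtain l' where IH: "computes (Loop ?c ?b) (Tup l (Tup (f x a) env)) (Tup l' (Tup (fold f (list_of l) (f x a)) env)) ((length (list_of l) + 1) * (T + 20))"
      by blast
    have bd: "computes ?b ?s (Tup l (Tup (f x a) env)) (T + 16)"
      by (rule computes_mono[OF computes_Both[OF computes_Comp[OF h h3] computes_Both[OF
          computes_Comp[OF computes_Both[OF computes_Comp[OF h h2] t] b] computes_Comp[OF t t2]]]]) simp
    show ?case
      by (rule exI[of _ l'], simp, rule computes_mono[OF computes_Loop_step[OF computes_Comp[OF h i] _ bd IH]]) auto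
  qed
  then obtain l' where lp: "computes (Loop ?c ?b) (Tup l (Tup a env)) (Tup l' (Tup (fold f (list_of l) a) env)) ((length (list_of l) + 1) * (T + 20))" ..
  let ?s = "Tup l' (Tup (fold f (list_of l) a) env)"
  have t: "computes Tail ?s (Tup (fold f (list_of l) a) env) 1" using computes_Tail[of ?s] by simp
  have h: "computes Head (Tup (fold f (list_of l) a) env) (fold f (list_of l) a) 1"
    using computes_Head[of "Tup (fold f (list_of l) a) env"] by simp
  show ?thesis
    unfolding foldp_def by (rule computes_mono[OF computes_Comp[OF lp computes_Comp[OF t h]]]) (simp add: algebra_simps)
qed

definition gcdp :: prog where
  "gcdp = Comp (Loop Tail (Both Tail (Arith Mod))) Head"

text \<open>For \<open>b \<le> a\<close> the remainder satisfies
  \<open>2 * (a mod b) \<le> a\<close>, so a Euclidean step at least halves the product of the pair.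
  The product starts below \<open>2 ^ (2 * M)\<close> once a first step has put the pair in
  order.\<close>

lemma computes_gcdp:
  assumes "a < 2 ^ M" "b < 2 ^ M"
  shows "computes gcdp (Tup (Num a) (Num b)) (Num (gcd a b)) ((2 * M + 4) * (2 * M + 10))"
proof -
  let ?L = "Loop Tail (Both Tail (Arith Mod))"
  have t: "computes Tail (Tup (Num a) (Num b)) (Num b) 1" for a b
    using computes_Tail[of "Tup (Num a) (Num b)"] by simp
  have bd: "computes (Both Tail (Arith Mod)) (Tup (Num a) (Num b)) (Tup (Num b) (Num (a mod b))) (2 * M + 3)"
    if "a < 2 ^ M" "b < 2 ^ M" for a b
  proof -
    have "floorlog 2 a \<le> M" "floorlog 2 b \<le> M" using that by (auto simp: floorlog_le_iff)
    then show ?thesis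
      using computes_mono[OF computes_Both[OF t computes_Arith[of Mod a b]], of "2 * M + 3"] by simp
  qed
  have main: "computes ?L (Tup (Num a) (Num b)) (Tup (Num (gcd a b)) (Num 0)) ((i + 1) * (2 * M + 6))"
    if "a < 2 ^ M" "b \<le> a" "a * b < 2 ^ i" for i a b using that
  proof (induction i arbitrary: a b)
    case 0
    then have "b = 0" by (cases a) auto
    then show ?case using computes_mono[OF computes_Loop_exit[OF t[of a b]], of "2 * M + 6"] by simp
  next
    case (Suc i)
    show ?case
    proof (cases "b = 0")
      case True
      then show ?thesis using computes_mono[OF computes_Loop_exit[OF t[of a b]], of "(Suc i + 1) * (2 * M + 6)"] by simp
    next
      case False
      have "2 * (a mod b) \<le> a"
      proof -
        have "a = a div b * b + a mod b" by simp
        moreover have "1 \<le> a div b" using False Suc.prems(2) by (simp add: Suc_le_eq div_greater_zero_iff)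
        ultimately have "b + a mod b \<le> a" by (metis add_le_mono1 mult_1 mult_le_mono1)
        moreover have "a mod b \<le> b" using False by (simp add: less_imp_le)
        ultimately show ?thesis by simp
      qed
      then have "2 * (b * (a mod b)) \<le> a * b"
        using mult_le_mono1[of "2 * (a mod b)" a b] by (metis mult.assoc mult.commute)
      then have "b * (a mod b) < 2 ^ i" using Suc.prems(3) unfolding power_Suc by linarith
      moreover have "b < 2 ^ M" "a mod b \<le> b" using Suc.prems False by (auto simp: less_imp_le)
      ultimately have IH: "computes ?L (Tup (Num b) (Num (a mod b))) (Tup (Num (gcd a b)) (Num 0)) ((i + 1) * (2 * M + 6))"
        using Suc.IH[of b "a mod b"] by (simp add: gcd_red_nat[symmetric] gcd.commute)
      show ?thesis
        by (rule computes_mono[OF computes_Loop_step[OF t _ bd IH]]) (use Suc.prems False \<open>b < 2 ^ M\<close> in auto)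
    qed
  qed
  have "computes ?L (Tup (Num a) (Num b)) (Tup (Num (gcd a b)) (Num 0)) ((2 * M + 2) * (2 * M + 6))"
  proof (cases "b = 0")
    case True
    then show ?thesis using computes_mono[OF computes_Loop_exit[OF t[of a b]], of "(2 * M + 2) * (2 * M + 6)"] by simp
  next
    case False
    have "b * (a mod b) < 2 ^ M * 2 ^ M"
      using assms False by (intro mult_strict_mono') (auto intro: le_less_trans[OF mod_less_eq_dividend])
    then have "b * (a mod b) < 2 ^ (2 * M)" by (simp add: mult_2 power_add)
    then have 1: "computes ?L (Tup (Num b) (Num (a mod b))) (Tup (Num (gcd a b)) (Num 0)) ((2 * M + 1) * (2 * M + 6))"
      using main[of b "a mod b" "2 * M"] assms False by (simp add: gcd_red_nat[symmetric] gcd.commute less_imp_le)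
    show ?thesis
      by (rule computes_mono[OF computes_Loop_step[OF t _ bd 1]]) (use assms False in auto)
  qed
  from computes_Comp[OF this computes_Head]
  have "computes gcdp (Tup (Num a) (Num b)) (Num (gcd a b)) (1 + (2 * M + 2) * (2 * M + 6) + 1)"
    unfolding gcdp_def by simp
  then show ?thesis by (rule computes_mono) (simp add: algebra_simps)
qed


section \<open>A language of expressions\<close>

text \<open>
  The flag of \<open>For\<close> and \<open>Fold\<close> marks loops that may run \<open>2 ^ k\<close> times; all others run
  polynomially often. The depth \<open>nest\<close> of marked loops is the exponent of \<open>2 ^ k\<close> in the running time.
\<close>

datatype ex =
    V string
  | C nat
  | Ar arith ex ex
  | Hd ex
  | Tl ex
  | Pr ex ex
  | If ex ex ex
  | Let string ex ex
  | For bool string string ex ex ex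
  | Fold bool string string ex ex ex
  | Sum string ex ex
  | Pw ex ex
  | Gcd ex ex
  | Call ex

type_synonym store = "string \<Rightarrow> val"

primrec ev :: "(val \<Rightarrow> val) \<Rightarrow> ex \<Rightarrow> store \<Rightarrow> val" where
  "ev h (V x) = (\<lambda>\<rho>. \<rho> x)"
| "ev h (C n) = (\<lambda>\<rho>. Num n)"
| "ev h (Ar f a b) = (\<lambda>\<rho>. Num (arith_fun f (unN (ev h a \<rho>)) (unN (ev h b \<rho>))))"
| "ev h (Hd a) = (\<lambda>\<rho>. head_of (ev h a \<rho>))"
| "ev h (Tl a) = (\<lambda>\<rho>. tail_of (ev h a \<rho>))"
| "ev h (Pr a b) = (\<lambda>\<rho>. Tup (ev h a \<rho>) (ev h b \<rho>))"
| "ev h (If c a b) = (\<lambda>\<rho>. if truth (ev h c \<rho>) then ev h a \<rho> else ev h b \<rho>)"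
| "ev h (Let x a b) = (\<lambda>\<rho>. ev h b (\<rho>(x := ev h a \<rho>)))"
| "ev h (For g i z n s b) = (\<lambda>\<rho>. iter (\<lambda>j a. ev h b (\<rho>(z := a, i := Num j))) (unN (ev h n \<rho>)) (ev h s \<rho>))"
| "ev h (Fold g x z l s b) = (\<lambda>\<rho>. fold (\<lambda>y a. ev h b (\<rho>(z := a, x := y))) (list_of (ev h l \<rho>)) (ev h s \<rho>))"
| "ev h (Sum i n a) = (\<lambda>\<rho>. Num (\<Sum>j<unN (ev h n \<rho>). unN (ev h a (\<rho>(i := Num j)))))"
| "ev h (Pw a n) = (\<lambda>\<rho>. Num (unN (ev h a \<rho>) ^ unN (ev h n \<rho>)))"
| "ev h (Gcd a b) = (\<lambda>\<rho>. Num (gcd (unN (ev h a \<rho>)) (unN (ev h b \<rho>))))"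
| "ev h (Call a) = (\<lambda>\<rho>. h (ev h a \<rho>))"

abbreviation nv :: "(val \<Rightarrow> val) \<Rightarrow> ex \<Rightarrow> store \<Rightarrow> nat" where
  "nv h e \<rho> \<equiv> unN (ev h e \<rho>)"

text \<open>The conditions under which the time bound is guaranteed: small numbers, few rounds, and
  oracle queries that \<open>D M\<close> permits. Loop bodies have to be safe only for accumulators
  that actually occur. For \<open>Ar\<close> only the operands are bounded, since only they are
  charged; \<open>Sum\<close> and \<open>Pw\<close> also bound their result, which is an
  accumulator.\<close>

primrec sf :: "(val \<Rightarrow> val) \<Rightarrow> (nat \<Rightarrow> val \<Rightarrow> bool) \<Rightarrow> nat \<Rightarrow> nat \<Rightarrow> ex \<Rightarrow> store \<Rightarrow> bool" where
  "sf h D M k (V x) = (\<lambda>\<rho>. True)"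
| "sf h D M k (C n) = (\<lambda>\<rho>. True)"
| "sf h D M k (Ar f a b) = (\<lambda>\<rho>. sf h D M k a \<rho> \<and> sf h D M k b \<rho> \<and> nv h a \<rho> < 2 ^ M \<and> nv h b \<rho> < 2 ^ M)"
| "sf h D M k (Hd a) = sf h D M k a"
| "sf h D M k (Tl a) = sf h D M k a"
| "sf h D M k (Pr a b) = (\<lambda>\<rho>. sf h D M k a \<rho> \<and> sf h D M k b \<rho>)"
| "sf h D M k (If c a b) = (\<lambda>\<rho>. sf h D M k c \<rho> \<and> (if truth (ev h c \<rho>) then sf h D M k a \<rho> else sf h D M k b \<rho>))"
| "sf h D M k (Let x a b) = (\<lambda>\<rho>. sf h D M k a \<rho> \<and> sf h D M k b (\<rho>(x := ev h a \<rho>)))"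
| "sf h D M k (For g i z n s b) = (\<lambda>\<rho>. sf h D M k n \<rho> \<and> sf h D M k s \<rho> \<and>
     nv h n \<rho> \<le> (if g then 2 ^ k else M) \<and>
     (\<forall>j < nv h n \<rho>. sf h D M k b (\<rho>(z := iter (\<lambda>j a. ev h b (\<rho>(z := a, i := Num j))) j (ev h s \<rho>), i := Num j))))"
| "sf h D M k (Fold g x z l s b) = (\<lambda>\<rho>. sf h D M k l \<rho> \<and> sf h D M k s \<rho> \<and>
     length (list_of (ev h l \<rho>)) \<le> (if g then 2 ^ k else M) \<and>
     (\<forall>j < length (list_of (ev h l \<rho>)).
        sf h D M k b (\<rho>(z := fold (\<lambda>y a. ev h b (\<rho>(z := a, x := y))) (take j (list_of (ev h l \<rho>))) (ev h s \<rho>),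
          x := list_of (ev h l \<rho>) ! j))))"
| "sf h D M k (Sum i n a) = (\<lambda>\<rho>. sf h D M k n \<rho> \<and> nv h n \<rho> \<le> M \<and> nv h (Sum i n a) \<rho> < 2 ^ M \<and>
     (\<forall>j < nv h n \<rho>. sf h D M k a (\<rho>(i := Num j))))"
| "sf h D M k (Pw a n) = (\<lambda>\<rho>. sf h D M k a \<rho> \<and> sf h D M k n \<rho> \<and> nv h n \<rho> \<le> M \<and> nv h a \<rho> < 2 ^ M \<and>
     nv h a \<rho> ^ nv h n \<rho> < 2 ^ M)"
| "sf h D M k (Gcd a b) = (\<lambda>\<rho>. sf h D M k a \<rho> \<and> sf h D M k b \<rho> \<and> nv h a \<rho> < 2 ^ M \<and> nv h b \<rho> < 2 ^ M)"
| "sf h D M k (Call a) = (\<lambda>\<rho>. sf h D M k a \<rho> \<and> D M (ev h a \<rho>))"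

primrec nest :: "ex \<Rightarrow> nat" where
  "nest (V x) = 0"
| "nest (C n) = 0"
| "nest (Ar f a b) = max (nest a) (nest b)"
| "nest (Hd a) = nest a"
| "nest (Tl a) = nest a"
| "nest (Pr a b) = max (nest a) (nest b)"
| "nest (If c a b) = max (nest c) (max (nest a) (nest b))"
| "nest (Let x a b) = max (nest a) (nest b)"
| "nest (For g i z n s b) = max (nest n) (max (nest s) (of_bool g + nest b))"
| "nest (Fold g x z l s b) = max (nest l) (max (nest s) (of_bool g + nest b))"
| "nest (Sum i n a) = max (nest n) (nest a)"
| "nest (Pw a n) = max (nest a) (nest n)"
| "nest (Gcd a b) = max (nest a) (nest b)"
| "nest (Call a) = nest a"

primrec var_prog :: "string list \<Rightarrow> string \<Rightarrow> prog" where
  "var_prog [] x = Lit 0"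
| "var_prog (y # ys) x = (if x = y then Head else Comp Tail (var_prog ys x))"

text \<open>The list names the entries of the environment, the innermost first. The environment at
  run time is the nested pair of their values in the same order.\<close>

primrec compile :: "prog \<Rightarrow> ex \<Rightarrow> string list \<Rightarrow> prog" where
  "compile q (V x) = (\<lambda>c. var_prog c x)"
| "compile q (C n) = (\<lambda>c. Lit n)"
| "compile q (Ar f a b) = (\<lambda>c. Comp (Both (cz (compile q a c)) (cz (compile q b c))) (Arith f))"
| "compile q (Hd a) = (\<lambda>c. Comp (compile q a c) Head)"
| "compile q (Tl a) = (\<lambda>c. Comp (compile q a c) Tail)"
| "compile q (Pr a b) = (\<lambda>c. Both (compile q a c) (compile q b c))"
| "compile q (If e a b) = (\<lambda>c. Cond (compile q e c) (compile q a c) (compile q b c))"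
| "compile q (Let x a b) = (\<lambda>c. Comp (Both (compile q a c) Ident) (compile q b (x # c)))"
| "compile q (For g i z n s b) = (\<lambda>c.
     Comp (Both (Lit 0) (Both (compile q s c) (Both (cz (compile q n c)) Ident)))
       (forp (compile q b (i # z # c))))"
| "compile q (Fold g x z l s b) = (\<lambda>c.
     Comp (Both (compile q l c) (Both (compile q s c) Ident)) (foldp (compile q b (x # z # c))))"
| "compile q (Sum i n a) = (\<lambda>c.
     Comp (Both (Lit 0) (Both (Lit 0) (Both (cz (compile q n c)) Ident)))
       (forp (Comp (Both (Comp Tail Head) (cz (Comp (Both Head (Comp Tail Tail)) (compile q a (i # c))))) (Arith Add))))"
| "compile q (Pw a n) = (\<lambda>c.
     Comp (Both (Lit 0) (Both (Lit 1) (Both (cz (compile q n c)) Ident)))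
       (forp (Comp (Both (Comp Tail Head) (cz (Comp (Comp Tail Tail) (compile q a c)))) (Arith Mul))))"
| "compile q (Gcd a b) = (\<lambda>c. Comp (Both (cz (compile q a c)) (cz (compile q b c))) gcdp)"
| "compile q (Call a) = (\<lambda>c. Comp (compile q a c) q)"

section \<open>Correctness and cost of compiled expressions\<close>

fun lookup :: "(string \<times> val) list \<Rightarrow> store" where
  "lookup [] = (\<lambda>x. Num 0)"
| "lookup ((x, v) # env) = (lookup env)(x := v)"

fun pack_env :: "(string \<times> val) list \<Rightarrow> val" where
  "pack_env [] = Num 0"
| "pack_env ((x, v) # env) = Tup v (pack_env env)"

text \<open>The bounds of the form \<open>2 ^ (k * e) * M ^ O(1)\<close>. The condition
  \<open>1 \<le> M\<close> makes powers of \<open>M\<close> monotone in the exponent, so that sums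
  stay in this form.\<close>

definition tb :: "nat \<Rightarrow> (nat \<Rightarrow> nat \<Rightarrow> nat) \<Rightarrow> bool" where
  "tb e T \<longleftrightarrow> (\<exists>K d. \<forall>M k. 1 \<le> M \<longrightarrow> T M k \<le> K * 2 ^ (k * e) * M ^ d)"

lemma tb_const: "tb e (\<lambda>M k. c)"
proof -
  have "c \<le> c * 2 ^ (k * e) * M ^ 0" for M k :: nat by simp
  then show ?thesis unfolding tb_def by blast
qed

lemma tb_M: "tb e (\<lambda>M k. M)"
proof -
  have "M \<le> 1 * 2 ^ (k * e) * M ^ 1" for M k :: nat by simp
  then show ?thesis unfolding tb_def by blast
qed

lemma tb_big: "tb 1 (\<lambda>M k. 2 ^ k)"
proof -
  have "(2::nat) ^ k \<le> 1 * 2 ^ (k * 1) * M ^ 0" for M k :: nat by simp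
  then show ?thesis unfolding tb_def by blast
qed

lemma tb_le: assumes "tb e T" "e \<le> e'" shows "tb e' T"
proof -
  obtain K d where 1: "\<And>M k. 1 \<le> M \<Longrightarrow> T M k \<le> K * 2 ^ (k * e) * M ^ d" using assms(1) unfolding tb_def by blast
  have "T M k \<le> K * 2 ^ (k * e') * M ^ d" if "1 \<le> M" for M k
    by (rule order.trans[OF 1[OF that]]) (use assms(2) in \<open>auto intro!: mult_le_mono power_increasing\<close>)
  then show ?thesis unfolding tb_def by blast
qed

lemma tb_mult: assumes "tb e T" "tb e' S" shows "tb (e + e') (\<lambda>M k. T M k * S M k)"
proof -
  obtain K d where 1: "\<And>M k. 1 \<le> M \<Longrightarrow> T M k \<le> K * 2 ^ (k * e) * M ^ d" using assms(1) unfolding tb_def by blast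
  obtain K' d' where 2: "\<And>M k. 1 \<le> M \<Longrightarrow> S M k \<le> K' * 2 ^ (k * e') * M ^ d'" using assms(2) unfolding tb_def by blast
  have "T M k * S M k \<le> (K * K') * 2 ^ (k * (e + e')) * M ^ (d + d')" if "1 \<le> M" for M k
    using mult_le_mono[OF 1[OF that, of k] 2[OF that, of k]] by (simp add: algebra_simps power_add)
  then show ?thesis unfolding tb_def by blast
qed

lemma tb_mult0: "tb e T \<Longrightarrow> tb 0 S \<Longrightarrow> tb e (\<lambda>M k. T M k * S M k)"
  using tb_mult[of e T 0 S] by simp

lemma tb_pow: "tb 0 T \<Longrightarrow> tb 0 (\<lambda>M k. T M k ^ n)"
  by (induction n) (auto intro: tb_const tb_mult0)

lemma tb_add: assumes "tb e T" "tb e S" shows "tb e (\<lambda>M k. T M k + S M k)"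
proof -
  obtain K d where 1: "\<And>M k. 1 \<le> M \<Longrightarrow> T M k \<le> K * 2 ^ (k * e) * M ^ d" using assms(1) unfolding tb_def by blast
  obtain K' d' where 2: "\<And>M k. 1 \<le> M \<Longrightarrow> S M k \<le> K' * 2 ^ (k * e) * M ^ d'" using assms(2) unfolding tb_def by blast
  have "T M k + S M k \<le> (K + K') * 2 ^ (k * e) * M ^ (d + d')" if "1 \<le> M" for M k
  proof -
    have "K * 2 ^ (k * e) * M ^ d \<le> K * 2 ^ (k * e) * M ^ (d + d')"
      "K' * 2 ^ (k * e) * M ^ d' \<le> K' * 2 ^ (k * e) * M ^ (d + d')"
      using that by (auto intro!: mult_le_mono power_increasing)
    with 1[OF that, of k] 2[OF that, of k] show ?thesis unfolding distrib_right by linarith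
  qed
  then show ?thesis unfolding tb_def by blast
qed

lemma lookup_computes: "\<exists>T. \<forall>env. map fst env = c \<longrightarrow> computes (var_prog c x) (pack_env env) (lookup env x) T"
proof (induction c)
  case Nil
  show ?case using computes_Lit[of 0] by auto
next
  case (Cons y c)
  then obtain T where T: "\<And>env. map fst env = c \<Longrightarrow> computes (var_prog c x) (pack_env env) (lookup env x) T" by blast
  have "computes (var_prog (y # c) x) (pack_env env) (lookup env x) (T + 2)" if e: "map fst env = y # c" for env
  proof -
    obtain v env' where env: "env = (y, v) # env'" "map fst env' = c" using e by (cases env) (auto simp: prod_eq_iff)
    show ?thesis
    proof (cases "x = y")
      case True
      then show ?thesis using computes_mono[OF computes_Head[of "pack_env env"], of "T + 2"] env by simp
    next
      case False
      then show ?thesis using computes_mono[OF computes_Comp[OF computes_Tail[of "pack_env env"]], of _ "lookup env x" T "T + 2"] env T[of env']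
        by simp
    qed
  qed
  then show ?case by blast
qed

text \<open>The bound \<open>T\<close> is uniform in \<open>M\<close>, \<open>k\<close> and the
  environment; it depends on the expression and the variable names only.\<close>

definition cmp_ok :: "(val \<Rightarrow> val) \<Rightarrow> (nat \<Rightarrow> val \<Rightarrow> bool) \<Rightarrow> prog \<Rightarrow> ex \<Rightarrow> string list \<Rightarrow> (nat \<Rightarrow> nat \<Rightarrow> nat) \<Rightarrow> bool" where
  "cmp_ok h D q e c T \<longleftrightarrow> (\<forall>M k env. map fst env = c \<longrightarrow> 1 \<le> M \<longrightarrow> k < M \<longrightarrow> sf h D M k e (lookup env) \<longrightarrow>
      computes (compile q e c) (pack_env env) (ev h e (lookup env)) (T M k))"

lemma cmp_okI: "(\<And>M k env. map fst env = c \<Longrightarrow> 1 \<le> M \<Longrightarrow> k < M \<Longrightarrow> sf h D M k e (lookup env) \<Longrightarrow>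
      computes (compile q e c) (pack_env env) (ev h e (lookup env)) (T M k)) \<Longrightarrow> cmp_ok h D q e c T"
  unfolding cmp_ok_def by blast

lemma cmp_okD: "cmp_ok h D q e c T \<Longrightarrow> map fst env = c \<Longrightarrow> 1 \<le> M \<Longrightarrow> k < M \<Longrightarrow> sf h D M k e (lookup env) \<Longrightarrow>
      computes (compile q e c) (pack_env env) (ev h e (lookup env)) (T M k)"
  unfolding cmp_ok_def by blast

lemma iter_sum: "iter (\<lambda>j a. Num (unN a + f j)) n (Num 0) = Num (\<Sum>j<n. f j)"
  by (induction n) auto

lemma iter_pow: "iter (\<lambda>j a. Num (unN a * b)) n (Num 1) = Num (b ^ n)"
  by (induction n) auto

lemmas tb_intros = tb_add tb_mult0 tb_M tb_const

text \<open>Structural induction. Sequential parts add their bounds and keep the exponent of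
  \<open>2 ^ k\<close>; only a marked loop multiplies by \<open>2 ^ k\<close>, so the exponent is
  the nesting depth.\<close>

theorem compile_correct:
  assumes q: "\<And>M w. 1 \<le> M \<Longrightarrow> D M w \<Longrightarrow> computes q w (h w) (Kq * M ^ dq)"
  shows "\<exists>T. tb (nest e) T \<and> cmp_ok h D q e c T"
proof (induction e arbitrary: c)
  case (V x)
  obtain T where "\<And>env. map fst env = c \<Longrightarrow> computes (var_prog c x) (pack_env env) (lookup env x) T"
    using lookup_computes by blast
  then have "cmp_ok h D q (V x) c (\<lambda>M k. T)" by (auto intro!: cmp_okI)
  then show ?case using tb_const by blast
next
  case (C n)
  have "cmp_ok h D q (C n) c (\<lambda>M k. 1 + floorlog 2 n)" by (auto intro!: cmp_okI computes_Lit[simplified])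
  then show ?case using tb_const by blast
next
  case (Ar f a b)
  from Ar.IH[of c] obtain T S where T: "tb (nest a) T" "cmp_ok h D q a c T" and S: "tb (nest b) S" "cmp_ok h D q b c S" by blast
  have "cmp_ok h D q (Ar f a b) c (\<lambda>M k. T M k + S M k + 2 * M + 20)"
  proof (rule cmp_okI)
    fix M k env assume a: "map fst env = c" "1 \<le> M" "k < M" "sf h D M k (Ar f a b) (lookup env)"
    then have "floorlog 2 (nv h a (lookup env)) \<le> M" "floorlog 2 (nv h b (lookup env)) \<le> M" by (auto simp: floorlog_le_iff)
    moreover have 1: "computes (compile q a c) (pack_env env) (ev h a (lookup env)) (T M k)" by (rule cmp_okD[OF T(2) a(1-3)]) (use a(4) in simp)
    moreover have 2: "computes (compile q b c) (pack_env env) (ev h b (lookup env)) (S M k)" by (rule cmp_okD[OF S(2) a(1-3)]) (use a(4) in simp)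
    ultimately show "computes (compile q (Ar f a b) c) (pack_env env) (ev h (Ar f a b) (lookup env)) (T M k + S M k + 2 * M + 20)"
      using computes_mono[OF computes_Comp[OF computes_Both[OF computes_cz[OF 1] computes_cz[OF 2]] computes_Arith]] by simp
  qed
  moreover have "tb (nest (Ar f a b)) (\<lambda>M k. T M k + S M k + 2 * M + 20)"
    by (intro tb_intros tb_le[OF T(1)] tb_le[OF S(1)]) simp_all
  ultimately show ?case by blast
next
  case (Hd a)
  then obtain T where T: "tb (nest a) T" "cmp_ok h D q a c T" by blast
  have "cmp_ok h D q (Hd a) c (\<lambda>M k. T M k + 2)"
  proof (rule cmp_okI)
    fix M k env assume a: "map fst env = c" "1 \<le> M" "k < M" "sf h D M k (Hd a) (lookup env)"
    have 1: "computes (compile q a c) (pack_env env) (ev h a (lookup env)) (T M k)" by (rule cmp_okD[OF T(2) a(1-3)]) (use a(4) in simp)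
    show "computes (compile q (Hd a) c) (pack_env env) (ev h (Hd a) (lookup env)) (T M k + 2)"
      using computes_Comp[OF 1 computes_Head] by simp
  qed
  moreover have "tb (nest a) (\<lambda>M k. T M k + 2)" by (intro tb_intros T(1))
  ultimately show ?case unfolding nest.simps by blast
next
  case (Tl a)
  then obtain T where T: "tb (nest a) T" "cmp_ok h D q a c T" by blast
  have "cmp_ok h D q (Tl a) c (\<lambda>M k. T M k + 2)"
  proof (rule cmp_okI)
    fix M k env assume a: "map fst env = c" "1 \<le> M" "k < M" "sf h D M k (Tl a) (lookup env)"
    have 1: "computes (compile q a c) (pack_env env) (ev h a (lookup env)) (T M k)" by (rule cmp_okD[OF T(2) a(1-3)]) (use a(4) in simp)
    show "computes (compile q (Tl a) c) (pack_env env) (ev h (Tl a) (lookup env)) (T M k + 2)"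
      using computes_Comp[OF 1 computes_Tail] by simp
  qed
  moreover have "tb (nest a) (\<lambda>M k. T M k + 2)" by (intro tb_intros T(1))
  ultimately show ?case unfolding nest.simps by blast
next
  case (Pr a b)
  from Pr.IH[of c] obtain T S where T: "tb (nest a) T" "cmp_ok h D q a c T" and S: "tb (nest b) S" "cmp_ok h D q b c S" by blast
  have "cmp_ok h D q (Pr a b) c (\<lambda>M k. T M k + S M k + 1)"
  proof (rule cmp_okI)
    fix M k env assume a: "map fst env = c" "1 \<le> M" "k < M" "sf h D M k (Pr a b) (lookup env)"
    have 1: "computes (compile q a c) (pack_env env) (ev h a (lookup env)) (T M k)" by (rule cmp_okD[OF T(2) a(1-3)]) (use a(4) in simp)
    have 2: "computes (compile q b c) (pack_env env) (ev h b (lookup env)) (S M k)" by (rule cmp_okD[OF S(2) a(1-3)]) (use a(4) in simp)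
    show "computes (compile q (Pr a b) c) (pack_env env) (ev h (Pr a b) (lookup env)) (T M k + S M k + 1)"
      using computes_Both[OF 1 2] by simp
  qed
  moreover have "tb (nest (Pr a b)) (\<lambda>M k. T M k + S M k + 1)"
    by (intro tb_intros tb_le[OF T(1)] tb_le[OF S(1)]) simp_all
  ultimately show ?case by blast
next
  case (If e a b)
  from If.IH[of c] obtain R T S where R: "tb (nest e) R" "cmp_ok h D q e c R" and
    T: "tb (nest a) T" "cmp_ok h D q a c T" and S: "tb (nest b) S" "cmp_ok h D q b c S" by blast
  have "cmp_ok h D q (If e a b) c (\<lambda>M k. R M k + (T M k + S M k) + 1)"
  proof (rule cmp_okI)
    fix M k env assume a: "map fst env = c" "1 \<le> M" "k < M" "sf h D M k (If e a b) (lookup env)"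
    have 1: "computes (compile q e c) (pack_env env) (ev h e (lookup env)) (R M k)" by (rule cmp_okD[OF R(2) a(1-3)]) (use a(4) in simp)
    have 2: "computes (compile q a c) (pack_env env) (ev h (If e a b) (lookup env)) (T M k + S M k)" if "truth (ev h e (lookup env))"
      using computes_mono[OF cmp_okD[OF T(2) a(1-3)], of "T M k + S M k"] a(4) that by simp
    have 3: "computes (compile q b c) (pack_env env) (ev h (If e a b) (lookup env)) (T M k + S M k)" if "\<not> truth (ev h e (lookup env))"
      using computes_mono[OF cmp_okD[OF S(2) a(1-3)], of "T M k + S M k"] a(4) that by simp
    show "computes (compile q (If e a b) c) (pack_env env) (ev h (If e a b) (lookup env)) (R M k + (T M k + S M k) + 1)"
      using computes_mono[OF computes_Cond[OF 1 2 3], of "R M k + (T M k + S M k) + 1"] by simp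
  qed
  moreover have "tb (nest (If e a b)) (\<lambda>M k. R M k + (T M k + S M k) + 1)"
    by (intro tb_intros tb_le[OF R(1)] tb_le[OF T(1)] tb_le[OF S(1)]) simp_all
  ultimately show ?case by blast
next
  case (Let x a b)
  from Let.IH(1)[of c] Let.IH(2)[of "x # c"] obtain T S where T: "tb (nest a) T" "cmp_ok h D q a c T"
    and S: "tb (nest b) S" "cmp_ok h D q b (x # c) S" by blast
  have "cmp_ok h D q (Let x a b) c (\<lambda>M k. T M k + S M k + 3)"
  proof (rule cmp_okI)
    fix M k env assume a: "map fst env = c" "1 \<le> M" "k < M" "sf h D M k (Let x a b) (lookup env)"
    have 1: "computes (compile q a c) (pack_env env) (ev h a (lookup env)) (T M k)" by (rule cmp_okD[OF T(2) a(1-3)]) (use a(4) in simp)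
    have 2: "computes (compile q b (x # c)) (pack_env ((x, ev h a (lookup env)) # env)) (ev h b (lookup ((x, ev h a (lookup env)) # env))) (S M k)"
      by (rule cmp_okD[OF S(2)]) (use a in auto)
    show "computes (compile q (Let x a b) c) (pack_env env) (ev h (Let x a b) (lookup env)) (T M k + S M k + 3)"
      using computes_mono[OF computes_Comp[OF computes_Both[OF 1 computes_Ident], of _ _ "S M k"], of _ _ "T M k + S M k + 3"] 2 by simp
  qed
  moreover have "tb (nest (Let x a b)) (\<lambda>M k. T M k + S M k + 3)"
    by (intro tb_intros tb_le[OF T(1)] tb_le[OF S(1)]) simp_all
  ultimately show ?case by blast
next
  case (For g i z n s b)
  from For.IH(1)[of c] For.IH(2)[of c] For.IH(3)[of "i # z # c"] obtain R S T where R: "tb (nest n) R" "cmp_ok h D q n c R"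
    and S: "tb (nest s) S" "cmp_ok h D q s c S" and T: "tb (nest b) T" "cmp_ok h D q b (i # z # c) T" by blast
  let ?W = "\<lambda>M k. R M k + S M k + ((if g then 2 ^ k else M) + 1) * (T M k + 3 * (M + 1) + 54) + 15"
  have "cmp_ok h D q (For g i z n s b) c ?W"
  proof (rule cmp_okI)
    fix M k env assume a: "map fst env = c" "1 \<le> M" "k < M" "sf h D M k (For g i z n s b) (lookup env)"
    let ?r = "lookup env" and ?n = "nv h n (lookup env)"
    let ?f = "\<lambda>j a. ev h b (?r(z := a, i := Num j))"
    have 0: "computes (Lit 0) (pack_env env) (Num 0) 1" using computes_Lit[of 0 "pack_env env"] by (simp add: floorlog_def)
    have 1: "computes (compile q n c) (pack_env env) (ev h n ?r) (R M k)" by (rule cmp_okD[OF R(2) a(1-3)]) (use a(4) in simp)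
    have 2: "computes (compile q s c) (pack_env env) (ev h s ?r) (S M k)" by (rule cmp_okD[OF S(2) a(1-3)]) (use a(4) in simp)
    have n: "?n \<le> (if g then 2 ^ k else M)" using a by simp
    \<comment> \<open>The counter of a marked loop can reach \<open>2 ^ k\<close>; as
      \<open>k < M\<close>, its length stays linear in \<open>M\<close>.\<close>
    have L: "floorlog 2 ?n \<le> M + 1"
    proof (cases g)
      case True
      then have "?n < 2 ^ (M + 1)" using n a(3) power_strict_increasing[of k "M+1" "2::nat"] by simp
      then show ?thesis by (simp add: floorlog_le_iff)
    next
      case False
      then show ?thesis using n floorlog2_le[of ?n] by simp
    qed
    have 3: "computes (compile q b (i # z # c)) (Tup (Num j) (Tup (iter ?f j (ev h s ?r)) (pack_env env))) (?f j (iter ?f j (ev h s ?r))) (T M k)"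
      if "j < ?n" for j
      using cmp_okD[OF T(2), of "(i, Num j) # (z, iter ?f j (ev h s ?r)) # env" M k] a that by simp
    show "computes (compile q (For g i z n s b) c) (pack_env env) (ev h (For g i z n s b) ?r) (?W M k)"
      unfolding compile.simps ev.simps
      by (rule computes_mono[OF computes_Comp[OF computes_Both[OF 0 computes_Both[OF 2 computes_Both[OF computes_cz[OF 1] computes_Ident]]]
          computes_forp[OF 3 L]]]) (use mult_le_mono1[OF add_le_mono1[OF n, of 1], of "T M k + 3 * (M + 1) + 54"] in linarith)+
  qed
  moreover have "tb (nest (For g i z n s b)) ?W"
  proof -
    have 1: "tb (of_bool g) (\<lambda>M k. (if g then 2 ^ k else M) + 1)"
      using tb_add[OF tb_big tb_const, of 1] tb_add[OF tb_M tb_const, of 0 1] by (cases g) simp_all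
    have 2: "tb (nest b) (\<lambda>M k. T M k + 3 * (M + 1) + 54)" by (intro tb_intros T(1))
    show ?thesis
      by (intro tb_add tb_const tb_le[OF tb_mult[OF 1 2]] tb_le[OF R(1)] tb_le[OF S(1)]) simp_all
  qed
  ultimately show ?case by blast
next
  case (Fold g x z l s b)
  from Fold.IH(1)[of c] Fold.IH(2)[of c] Fold.IH(3)[of "x # z # c"] obtain R S T where R: "tb (nest l) R" "cmp_ok h D q l c R"
    and S: "tb (nest s) S" "cmp_ok h D q s c S" and T: "tb (nest b) T" "cmp_ok h D q b (x # z # c) T" by blast
  let ?W = "\<lambda>M k. R M k + S M k + ((if g then 2 ^ k else M) + 1) * (T M k + 25) + 15"
  have "cmp_ok h D q (Fold g x z l s b) c ?W"
  proof (rule cmp_okI)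
    fix M k env assume a: "map fst env = c" "1 \<le> M" "k < M" "sf h D M k (Fold g x z l s b) (lookup env)"
    let ?r = "lookup env" and ?l = "ev h l (lookup env)"
    let ?f = "\<lambda>y a. ev h b (?r(z := a, x := y))"
    have 1: "computes (compile q l c) (pack_env env) ?l (R M k)" by (rule cmp_okD[OF R(2) a(1-3)]) (use a(4) in simp)
    have 2: "computes (compile q s c) (pack_env env) (ev h s ?r) (S M k)" by (rule cmp_okD[OF S(2) a(1-3)]) (use a(4) in simp)
    have n: "length (list_of ?l) \<le> (if g then 2 ^ k else M)" using a by simp
    have 3: "computes (compile q b (x # z # c)) (Tup (list_of ?l ! j) (Tup (fold ?f (take j (list_of ?l)) (ev h s ?r)) (pack_env env)))
       (?f (list_of ?l ! j) (fold ?f (take j (list_of ?l)) (ev h s ?r))) (T M k)"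
      if "j < length (list_of ?l)" for j
      using cmp_okD[OF T(2), of "(x, list_of ?l ! j) # (z, fold ?f (take j (list_of ?l)) (ev h s ?r)) # env" M k] a that by simp
    show "computes (compile q (Fold g x z l s b) c) (pack_env env) (ev h (Fold g x z l s b) ?r) (?W M k)"
      unfolding compile.simps ev.simps
      by (rule computes_mono[OF computes_Comp[OF computes_Both[OF 1 computes_Both[OF 2 computes_Ident]]
          computes_foldp[OF 3]]]) (use mult_le_mono1[OF add_le_mono1[OF n, of 1], of "T M k + 25"] in linarith)+
  qed
  moreover have "tb (nest (Fold g x z l s b)) ?W"
  proof -
    have 1: "tb (of_bool g) (\<lambda>M k. (if g then 2 ^ k else M) + 1)"
      using tb_add[OF tb_big tb_const, of 1] tb_add[OF tb_M tb_const, of 0 1] by (cases g) simp_all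
    have 2: "tb (nest b) (\<lambda>M k. T M k + 25)" by (intro tb_intros T(1))
    show ?thesis
      by (intro tb_add tb_const tb_le[OF tb_mult[OF 1 2]] tb_le[OF R(1)] tb_le[OF S(1)]) simp_all
  qed
  ultimately show ?case by blast
next
  case (Sum i n e)
  from Sum.IH(1)[of c] Sum.IH(2)[of "i # c"] obtain R T where R: "tb (nest n) R" "cmp_ok h D q n c R"
    and T: "tb (nest e) T" "cmp_ok h D q e (i # c) T" by blast
  let ?W = "\<lambda>M k. R M k + (T M k + 5 * M + 99) * (M + 1) + 25"
  have "cmp_ok h D q (Sum i n e) c ?W"
  proof (rule cmp_okI)
    fix M k env assume a: "map fst env = c" "1 \<le> M" "k < M" "sf h D M k (Sum i n e) (lookup env)"
    let ?r = "lookup env" and ?n = "nv h n (lookup env)"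
    let ?v = "\<lambda>j. nv h e (?r(i := Num j))"
    let ?f = "\<lambda>j a. Num (unN a + ?v j)"
    have 0: "computes (Lit 0) (pack_env env) (Num 0) 1" using computes_Lit[of 0 "pack_env env"] by (simp add: floorlog_def)
    have 1: "computes (compile q n c) (pack_env env) (ev h n ?r) (R M k)" by (rule cmp_okD[OF R(2) a(1-3)]) (use a(4) in simp)
    have L: "floorlog 2 ?n \<le> M" using a floorlog2_le[of ?n] by simp
    have 3: "computes (Comp (Both (Comp Tail Head) (cz (Comp (Both Head (Comp Tail Tail)) (compile q e (i # c))))) (Arith Add))
        (Tup (Num j) (Tup (iter ?f j (Num 0)) (pack_env env))) (?f j (iter ?f j (Num 0))) (T M k + 2 * M + 30)" if "j < ?n" for j
    proof -
      let ?s = "Tup (Num j) (Tup (iter ?f j (Num 0)) (pack_env env))"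
      have sums: "iter ?f j (Num 0) = Num (\<Sum>j<j. ?v j)" by (rule iter_sum)
      have le: "(\<Sum>j<j. ?v j) \<le> (\<Sum>j<?n. ?v j)" "?v j \<le> (\<Sum>j<?n. ?v j)"
        using that by (auto intro!: sum_mono2 member_le_sum)
      then have fl: "floorlog 2 (\<Sum>j<j. ?v j) \<le> M" "floorlog 2 (?v j) \<le> M" using a(4) by (auto simp: floorlog_le_iff)
      have h: "computes Head ?s (Num j) 1" using computes_Head[of ?s] by simp
      have t: "computes Tail ?s (Tup (iter ?f j (Num 0)) (pack_env env)) 1" using computes_Tail[of ?s] by simp
      have th: "computes Head (Tup (iter ?f j (Num 0)) (pack_env env)) (iter ?f j (Num 0)) 1"
         using computes_Head[of "Tup (iter ?f j (Num 0)) (pack_env env)"] by simp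
      have tt: "computes Tail (Tup (iter ?f j (Num 0)) (pack_env env)) (pack_env env) 1"
         using computes_Tail[of "Tup (iter ?f j (Num 0)) (pack_env env)"] by simp
      have e: "computes (compile q e (i # c)) (Tup (Num j) (pack_env env)) (ev h e (?r(i := Num j))) (T M k)"
        using cmp_okD[OF T(2), of "(i, Num j) # env" M k] a that by simp
      have ad: "computes (Arith Add) (Tup (iter ?f j (Num 0)) (Num (?v j))) (?f j (iter ?f j (Num 0))) (1 + 2 * M)"
        unfolding sums using computes_mono[OF computes_Arith[of Add "\<Sum>j<j. ?v j" "?v j"], of "1 + 2 * M"] fl by simp
      show ?thesis
        by (rule computes_mono[OF computes_Comp[OF computes_Both[OF computes_Comp[OF t th]
           computes_cz[OF computes_Comp[OF computes_Both[OF h computes_Comp[OF t tt]] e]]] ad]]) simp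
    qed
    have W: "(?n + 1) * (T M k + 2 * M + 30 + 3 * M + 54) \<le> (M + 1) * (T M k + 5 * M + 99)"
      using a by (intro mult_le_mono) auto
    have "computes (compile q (Sum i n e) c) (pack_env env) (iter ?f ?n (Num 0)) (?W M k)"
      unfolding compile.simps
      by (rule computes_mono[OF computes_Comp[OF computes_Both[OF 0 computes_Both[OF 0 computes_Both[OF computes_cz[OF 1] computes_Ident]]]
          computes_forp[OF 3 L]]]) (use W in \<open>simp_all add: mult.commute\<close>)
    then show "computes (compile q (Sum i n e) c) (pack_env env) (ev h (Sum i n e) ?r) (?W M k)" by (simp add: iter_sum)
  qed
  moreover have "tb (nest (Sum i n e)) ?W"
    by (intro tb_intros tb_le[OF R(1)] tb_le[OF T(1)]) simp_all
  ultimately show ?case by blast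
next
  case (Pw b n)
  from Pw.IH[of c] obtain R T where R: "tb (nest n) R" "cmp_ok h D q n c R"
    and T: "tb (nest b) T" "cmp_ok h D q b c T" by blast
  let ?W = "\<lambda>M k. R M k + (T M k + 5 * M + 99) * (M + 1) + 25"
  have "cmp_ok h D q (Pw b n) c ?W"
  proof (rule cmp_okI)
    fix M k env assume a: "map fst env = c" "1 \<le> M" "k < M" "sf h D M k (Pw b n) (lookup env)"
    let ?r = "lookup env" and ?n = "nv h n (lookup env)"
    let ?v = "nv h b ?r"
    let ?f = "\<lambda>j a. Num (unN a * ?v)"
    have 0: "computes (Lit 0) (pack_env env) (Num 0) 1" using computes_Lit[of 0 "pack_env env"] by (simp add: floorlog_def)
    have 01: "computes (Lit 1) (pack_env env) (Num 1) 2"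
      by (rule computes_mono[OF computes_Lit]) (simp add: floorlog_def)
    have 1: "computes (compile q n c) (pack_env env) (ev h n ?r) (R M k)" by (rule cmp_okD[OF R(2) a(1-3)]) (use a(4) in simp)
    have L: "floorlog 2 ?n \<le> M" using a floorlog2_le[of ?n] by simp
    have 3: "computes (Comp (Both (Comp Tail Head) (cz (Comp (Comp Tail Tail) (compile q b c)))) (Arith Mul))
        (Tup (Num j) (Tup (iter ?f j (Num 1)) (pack_env env))) (?f j (iter ?f j (Num 1))) (T M k + 2 * M + 30)" if "j < ?n" for j
    proof -
      let ?s = "Tup (Num j) (Tup (iter ?f j (Num 1)) (pack_env env))"
      have sums: "iter ?f j (Num 1) = Num (?v ^ j)" by (rule iter_pow)
      \<comment> \<open>Intermediate powers are bounded by the final one except for the base 0,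
        where \<open>0 ^ 0 = 1\<close> may exceed the result.\<close>
      have "?v ^ j < 2 ^ M"
      proof (cases "?v = 0")
        case True
        have "?v ^ j \<le> 1" using True by (cases j) auto
        also have "(1::nat) < 2 ^ M" using power_strict_increasing[of 0 M "2::nat"] a(2) by simp
        finally show ?thesis .
      next
        case False
        then have "?v ^ j \<le> ?v ^ ?n" using that by (intro power_increasing) auto
        also have "\<dots> < 2 ^ M" using a(4) by simp
        finally show ?thesis .
      qed
      then have fl: "floorlog 2 (?v ^ j) \<le> M" "floorlog 2 ?v \<le> M" using a(4) by (auto simp: floorlog_le_iff)
      have t: "computes Tail ?s (Tup (iter ?f j (Num 1)) (pack_env env)) 1" using computes_Tail[of ?s] by simp
      have th: "computes Head (Tup (iter ?f j (Num 1)) (pack_env env)) (iter ?f j (Num 1)) 1"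
         using computes_Head[of "Tup (iter ?f j (Num 1)) (pack_env env)"] by simp
      have tt: "computes Tail (Tup (iter ?f j (Num 1)) (pack_env env)) (pack_env env) 1"
         using computes_Tail[of "Tup (iter ?f j (Num 1)) (pack_env env)"] by simp
      have e: "computes (compile q b c) (pack_env env) (ev h b ?r) (T M k)"
        using cmp_okD[OF T(2), of "env" M k] a that by simp
      have ad: "computes (Arith Mul) (Tup (iter ?f j (Num 1)) (Num ?v)) (?f j (iter ?f j (Num 1))) (1 + 2 * M)"
        unfolding sums using computes_mono[OF computes_Arith[of Mul "?v ^ j" "?v"], of "1 + 2 * M"] fl by simp
      show ?thesis
        by (rule computes_mono[OF computes_Comp[OF computes_Both[OF computes_Comp[OF t th]
           computes_cz[OF computes_Comp[OF computes_Comp[OF t tt] e]]] ad]]) simp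
    qed
    have W: "(?n + 1) * (T M k + 2 * M + 30 + 3 * M + 54) \<le> (M + 1) * (T M k + 5 * M + 99)"
      using a by (intro mult_le_mono) auto
    have "computes (compile q (Pw b n) c) (pack_env env) (iter ?f ?n (Num 1)) (?W M k)"
      unfolding compile.simps
      by (rule computes_mono[OF computes_Comp[OF computes_Both[OF 0 computes_Both[OF 01 computes_Both[OF computes_cz[OF 1] computes_Ident]]]
          computes_forp[OF 3 L]]]) (use W in \<open>simp_all add: mult.commute\<close>)
    then show "computes (compile q (Pw b n) c) (pack_env env) (ev h (Pw b n) ?r) (?W M k)" by (simp only: iter_pow ev.simps)
  qed
  moreover have "tb (nest (Pw b n)) ?W"
    by (intro tb_intros tb_le[OF R(1)] tb_le[OF T(1)]) simp_all
  ultimately show ?case by blast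
next
  case (Gcd a b)
  from Gcd.IH[of c] obtain T S where T: "tb (nest a) T" "cmp_ok h D q a c T" and S: "tb (nest b) S" "cmp_ok h D q b c S" by blast
  have "cmp_ok h D q (Gcd a b) c (\<lambda>M k. T M k + S M k + (2 * M + 4) * (2 * M + 10) + 20)"
  proof (rule cmp_okI)
    fix M k env assume a: "map fst env = c" "1 \<le> M" "k < M" "sf h D M k (Gcd a b) (lookup env)"
    have 1: "computes (compile q a c) (pack_env env) (ev h a (lookup env)) (T M k)" by (rule cmp_okD[OF T(2) a(1-3)]) (use a(4) in simp)
    have 2: "computes (compile q b c) (pack_env env) (ev h b (lookup env)) (S M k)" by (rule cmp_okD[OF S(2) a(1-3)]) (use a(4) in simp)
    show "computes (compile q (Gcd a b) c) (pack_env env) (ev h (Gcd a b) (lookup env)) (T M k + S M k + (2 * M + 4) * (2 * M + 10) + 20)"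
      using computes_mono[OF computes_Comp[OF computes_Both[OF computes_cz[OF 1] computes_cz[OF 2]] computes_gcdp],
        of M "T M k + S M k + (2 * M + 4) * (2 * M + 10) + 20"] a by simp
  qed
  moreover have "tb (nest (Gcd a b)) (\<lambda>M k. T M k + S M k + (2 * M + 4) * (2 * M + 10) + 20)"
    by (intro tb_intros tb_le[OF T(1)] tb_le[OF S(1)]) simp_all
  ultimately show ?case by blast
next
  case (Call a)
  then obtain T where T: "tb (nest a) T" "cmp_ok h D q a c T" by blast
  have "cmp_ok h D q (Call a) c (\<lambda>M k. T M k + Kq * M ^ dq + 1)"
  proof (rule cmp_okI)
    fix M k env assume a: "map fst env = c" "1 \<le> M" "k < M" "sf h D M k (Call a) (lookup env)"
    have 1: "computes (compile q a c) (pack_env env) (ev h a (lookup env)) (T M k)" by (rule cmp_okD[OF T(2) a(1-3)]) (use a(4) in simp)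
    have 2: "computes q (ev h a (lookup env)) (h (ev h a (lookup env))) (Kq * M ^ dq)" using q a by simp
    show "computes (compile q (Call a) c) (pack_env env) (ev h (Call a) (lookup env)) (T M k + Kq * M ^ dq + 1)"
      using computes_Comp[OF 1 2] by simp
  qed
  moreover have "tb (nest a) (\<lambda>M k. T M k + Kq * M ^ dq + 1)"
    by (intro tb_intros T(1) tb_le[OF tb_pow]) simp_all
  ultimately show ?case unfolding nest.simps by blast
qed


section \<open>Evaluating the determinant\<close>

abbreviation ex_add (infixl "+." 65) where "a +. b \<equiv> Ar Add a b"
abbreviation ex_sub (infixl "-." 65) where "a -. b \<equiv> Ar Sub a b"
abbreviation ex_mul (infixl "*." 70) where "a *. b \<equiv> Ar Mul a b"
abbreviation ex_div (infixl "'/." 70) where "a /. b \<equiv> Ar Div a b"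
abbreviation ex_mod (infixl "%." 70) where "a %. b \<equiv> Ar Mod a b"
abbreviation ex_less (infix "<." 50) where "a <. b \<equiv> Ar Less a b"

definition digit_ex :: "ex \<Rightarrow> ex \<Rightarrow> ex \<Rightarrow> ex" where
  "digit_ex x b i = (x /. Pw b i) %. b"

definition digit :: "nat \<Rightarrow> nat \<Rightarrow> nat \<Rightarrow> nat" where
  "digit b i x = x div b ^ i mod b"

lemma nv_digit [simp]: "nv h (digit_ex x b i) \<rho> = digit (nv h b \<rho>) (nv h i \<rho>) (nv h x \<rho>)"
  by (simp add: digit_ex_def digit_def)

lemma ev_digit [simp]: "ev h (digit_ex x b i) \<rho> = Num (digit (nv h b \<rho>) (nv h i \<rho>) (nv h x \<rho>))"
  by (simp add: digit_ex_def digit_def)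

lemma sf_digit:
  assumes "sf h D M k x \<rho>" "sf h D M k b \<rho>" "sf h D M k i \<rho>" "nv h x \<rho> < 2 ^ M" "nv h i \<rho> \<le> M"
     "nv h b \<rho> ^ nv h i \<rho> < 2 ^ M" "nv h b \<rho> < 2 ^ M"
  shows "sf h D M k (digit_ex x b i) \<rho>"
  using assms by (auto simp: digit_ex_def intro: le_less_trans[OF div_le_dividend])

definition entry_ex :: "string \<Rightarrow> ex \<Rightarrow> ex \<Rightarrow> ex" where
  "entry_ex X i j = digit_ex (V X) (V ''R'') (i *. V ''N'' +. j)"

definition step_ex :: ex where
  "step_ex = Sum ''i'' (V ''v'') (Sum ''j'' (V ''v'')
     ((Sum ''h'' (V ''i'') (entry_ex ''X'' (V ''i'') (V ''h'') *. entry_ex ''x'' (V ''h'') (V ''j'')) +.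
       Sum ''h'' (V ''i'') (entry_ex ''X'' (V ''h'') (V ''h'')) *. entry_ex ''x'' (V ''i'') (V ''j''))
      *. Pw (V ''R'') (V ''i'' *. V ''N'' +. V ''j'')))"

definition bird_ex :: ex where
  "bird_ex = Let ''X'' (For False ''p'' ''X'' (V ''v'' -. C 1) (V ''x'') step_ex)
     (entry_ex ''X'' (V ''v'' -. C 1) (V ''v'' -. C 1))"

text \<open>Entry \<open>(i, j)\<close> is the digit of index \<open>i * N + j\<close> in base
  \<open>R\<close>. The stride \<open>N\<close> is common to all dimensions \<open>v \<le> N\<close>
  that occur.\<close>

definition pack_mat :: "nat \<Rightarrow> nat \<Rightarrow> nat \<Rightarrow> (nat \<Rightarrow> nat \<Rightarrow> nat) \<Rightarrow> nat" where
  "pack_mat R N v A = (\<Sum>i<v. \<Sum>j<v. A i j * R ^ (i * N + j))"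

text \<open>Padding with zeros to \<open>N\<close> rows and columns turns the double sum into a
  plain digit expansion of length \<open>N * N\<close>, to which \<open>digit_sum\<close>
  applies.\<close>

lemma pack_mat_flat:
  assumes "v \<le> N"
  shows "pack_mat R N v A = (\<Sum>x<N * N. (if x div N < v \<and> x mod N < v then A (x div N) (x mod N) else 0) * R ^ x)"
proof -
  let ?f = "\<lambda>x. (if x div N < v \<and> x mod N < v then A (x div N) (x mod N) else 0) * R ^ x"
  have "(\<Sum>x<N * N. ?f x) = (\<Sum>i<N. sum ?f {i * N..<i * N + N})" by (rule sum.nat_group[symmetric])
  also have "\<dots> = (\<Sum>i<N. \<Sum>j<N. ?f (i * N + j))"
  proof (rule sum.cong[OF refl])
    fix i
    show "sum ?f {i * N..<i * N + N} = (\<Sum>j<N. ?f (i * N + j))"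
      using sum.atLeastLessThan_shift_0[of ?f "i * N" "i * N + N"] by (simp add: lessThan_atLeast0 o_def)
  qed
  also have "\<dots> = (\<Sum>i<N. \<Sum>j<N. if i < v \<and> j < v then A i j * R ^ (i * N + j) else 0)"
    by (intro sum.cong refl) simp
  also have "\<dots> = (\<Sum>i<N. if i < v then (\<Sum>j<N. if j < v then A i j * R ^ (i * N + j) else 0) else 0)"
    by (intro sum.cong refl) simp
  also have "\<dots> = (\<Sum>i<v. \<Sum>j<v. A i j * R ^ (i * N + j))"
  proof -
    have "{..<N} \<inter> {j. j < v} = {..<v}" using assms by auto
    then show ?thesis by (simp add: sum.If_cases)
  qed
  finally show ?thesis by (simp add: pack_mat_def)
qed

lemma digit_pack_mat:
  assumes "v \<le> N" "\<And>i j. i < v \<Longrightarrow> j < v \<Longrightarrow> A i j < R" "i < v" "j < v"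
  shows "digit R (i * N + j) (pack_mat R N v A) = A i j"
proof -
  have "i * N + j < Suc i * N" using assms by simp
  also have "\<dots> \<le> N * N" using assms by (intro mult_le_mono1) simp
  finally have "i * N + j < N * N" .
  moreover have "0 < R" using assms(2)[OF assms(3,4)] by simp
  moreover have "(i * N + j) div N = i" "(i * N + j) mod N = j" using assms by auto
  ultimately show ?thesis
    unfolding digit_def pack_mat_flat[OF assms(1)] by (subst digit_sum) (use assms in auto)
qed

lemma pack_mat_less:
  assumes "v \<le> N" "\<And>i j. i < v \<Longrightarrow> j < v \<Longrightarrow> A i j < R" "R > 0"
  shows "pack_mat R N v A < R ^ (N * N)"
  unfolding pack_mat_flat[OF assms(1)] by (rule digit_sum_less) (use assms in auto)

text \<open>By \<open>bird_le\<close> the entries of iterate \<open>p\<close> stay below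
  \<open>(2 * N * a) ^ Suc p\<close>. The condition on \<open>R\<close> therefore keeps all iterates
  up to \<open>N\<close> within one digit per entry.\<close>

locale packed_bird =
  fixes M N R v a :: nat and A :: "nat \<Rightarrow> nat \<Rightarrow> nat"
  assumes v: "0 < v" "v \<le> N" and A: "\<And>i j. A i j \<le> a" and R: "(2 * N * a) ^ (N + 1) \<le> R" "0 < a"
    and M: "N * N + N \<le> M" "R ^ (N * N) < 2 ^ M"
begin

lemma R_pos: "0 < R"
  using R v by (metis gr0I le_zero_eq mult_is_0 not_less power_eq_0_iff zero_neq_numeral)

lemma bird_less:
  assumes "p \<le> N" "i < v" shows "bird A p i j < R"
proof -
  have "bird A p i j \<le> a * (2 * N * a) ^ p" using assms v A by (intro bird_le) auto
  also have "\<dots> < (2 * N * a) ^ Suc p" using R v by simp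
  also have "\<dots> \<le> (2 * N * a) ^ (N + 1)" using assms R v by (intro power_increasing) auto
  also note R(1)
  finally show ?thesis .
qed

lemma A_less: "i < v \<Longrightarrow> A i j < R"
  using bird_less[of 0 i j] by simp

definition X :: "nat \<Rightarrow> nat" where "X p = pack_mat R N v (bird A p)"

lemma X_less: "p \<le> N \<Longrightarrow> X p < 2 ^ M"
  unfolding X_def using pack_mat_less[OF v(2) bird_less R_pos] M(2) by (meson order.strict_trans)

lemma digit_X: "p \<le> N \<Longrightarrow> i < v \<Longrightarrow> j < v \<Longrightarrow> digit R (i * N + j) (X p) = bird A p i j"
  unfolding X_def by (rule digit_pack_mat[OF v(2) bird_less]) auto

lemma digit_A: "i < v \<Longrightarrow> j < v \<Longrightarrow> digit R (i * N + j) (X 0) = A i j"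
  using digit_X[of 0 i j] by simp

lemma index_less: "i < v \<Longrightarrow> j < v \<Longrightarrow> i * N + j < N * N"
proof -
  assume "i < v" "j < v"
  then have "i * N + j < Suc i * N" using v by simp
  also have "\<dots> \<le> N * N" using \<open>i < v\<close> v by (intro mult_le_mono1) simp
  finally show ?thesis .
qed

lemma R_pow_less: "e \<le> N * N \<Longrightarrow> R ^ e < 2 ^ M"
  using le_less_trans[OF power_increasing[of e "N * N" R] M(2)] R_pos by simp

lemma R_less: "R < 2 ^ M"
  using R_pow_less[of 1] v by (simp add: Suc_le_eq)

lemma small_less: "x \<le> M \<Longrightarrow> x < 2 ^ M"
  by (rule le_less_trans[OF _ less_exp])

definition store :: "store \<Rightarrow> bool" where
  "store \<rho> \<longleftrightarrow> \<rho> ''N'' = Num N \<and> \<rho> ''R'' = Num R \<and> \<rho> ''v'' = Num v \<and> \<rho> ''x'' = Num (X 0)"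

lemma sf_entry:
  assumes "\<rho> x = Num (X p)" "p \<le> N" "\<rho> ''N'' = Num N" "\<rho> ''R'' = Num R" "ev h i \<rho> = Num i'" "ev h j \<rho> = Num j'" "i' < v" "j' < v"
    "sf h D M k i \<rho>" "sf h D M k j \<rho>"
  shows "sf h D M k (entry_ex x i j) \<rho>"
proof -
  have 1: "i' * N + j' < N * N" "i' * N \<le> i' * N + j'" using index_less assms(7,8) by auto
  then have 2: "i' * N + j' \<le> M" "i' * N \<le> M" "N \<le> M" "i' \<le> M" "j' \<le> M" using M(1) assms(7,8) v by linarith+
  show ?thesis unfolding entry_ex_def
    by (rule sf_digit) (use assms 2 1 X_less R_less R_pow_less small_less in auto)
qed

lemma step:
  assumes "store \<rho>" "\<rho> ''X'' = Num (X p)" "p < N"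
  shows "ev h step_ex \<rho> = Num (X (Suc p))" "sf h D M k step_ex \<rho>"
proof -
  have st: "\<rho> ''N'' = Num N" "\<rho> ''R'' = Num R" "\<rho> ''v'' = Num v" "\<rho> ''x'' = Num (X 0)" using assms(1) by (auto simp: store_def)
  let ?\<rho> = "\<lambda>i j. \<rho>(''i'' := Num i, ''j'' := Num j)"
  let ?s1 = "Sum ''h'' (V ''i'') (entry_ex ''X'' (V ''i'') (V ''h'') *. entry_ex ''x'' (V ''h'') (V ''j''))"
  let ?s2 = "Sum ''h'' (V ''i'') (entry_ex ''X'' (V ''h'') (V ''h''))"
  let ?e = "(?s1 +. ?s2 *. entry_ex ''x'' (V ''i'') (V ''j''))"
  let ?t = "?e *. Pw (V ''R'') (V ''i'' *. V ''N'' +. V ''j'')"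
  note dX = digit_X[OF less_imp_le[OF assms(3)]]
  have s1: "nv h ?s1 (?\<rho> i j) = (\<Sum>l<i. bird A p i l * A l j)" if "i < v" "j < v" for i j
    using st assms(2) that by (auto simp: entry_ex_def dX digit_A intro!: sum.cong)
  have s2: "nv h ?s2 (?\<rho> i j) = (\<Sum>l<i. bird A p l l)" if "i < v" "j < v" for i j
    using st assms(2) that by (auto simp: entry_ex_def dX intro!: sum.cong)
  have nv_e: "nv h ?e (?\<rho> i j) = bird A (Suc p) i j" if "i < v" "j < v" for i j
    using s1[OF that] s2[OF that] st that by (simp add: entry_ex_def digit_A bird_step_def)
  have nv_t: "nv h ?t (?\<rho> i j) = bird A (Suc p) i j * R ^ (i * N + j)" if "i < v" "j < v" for i j
    using nv_e[OF that] st by simp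
  have inner: "nv h (Sum ''j'' (V ''v'') ?t) (\<rho>(''i'' := Num i)) = (\<Sum>j<v. bird A (Suc p) i j * R ^ (i * N + j))" if "i < v" for i
    using nv_t[OF that] st by (simp del: ev.simps(3,12) bird.simps)
  show 1: "ev h step_ex \<rho> = Num (X (Suc p))"
    using inner st unfolding step_ex_def X_def pack_mat_def by (simp del: ev.simps(3,12) bird.simps)
  have X: "(\<Sum>i<v. \<Sum>j<v. bird A (Suc p) i j * R ^ (i * N + j)) < 2 ^ M"
    using X_less[of "Suc p"] assms(3) unfolding X_def pack_mat_def by simp
  have Xi: "(\<Sum>j<v. bird A (Suc p) i j * R ^ (i * N + j)) < 2 ^ M" if "i < v" for i
    by (rule le_less_trans[OF _ X], rule member_le_sum[of i _ "\<lambda>i. \<Sum>j<v. bird A (Suc p) i j * R ^ (i * N + j)"]) (use that in auto)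
  have sft: "sf h D M k ?t (?\<rho> i j)" if ij: "i < v" "j < v" for i j
  proof -
    have lt: "bird A (Suc p) i j < 2 ^ M" using bird_less[of "Suc p" i j] R_less assms(3) ij by simp
    have i: "i \<le> M" "j \<le> M" "N \<le> M" "i * N + j \<le> N * N" "i * N + j \<le> M" "i * N \<le> M" using ij v M(1) index_less[OF ij] by auto
    have le: "(\<Sum>l<i. bird A p i l * A l j) \<le> bird A (Suc p) i j" "(\<Sum>l<i. bird A p l l) * A i j \<le> bird A (Suc p) i j"
      by (simp_all add: bird_step_def)
    have b: "bird A p x y < 2 ^ M" "A x y < 2 ^ M" if "x < v" for x y
      using bird_less[of p x y] A_less[of x y] R_less assms(3) that by auto
    \<comment> \<open>This factor needs a bound of its own: its product with \<open>A i j\<close> is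
      bounded by an entry of the next iterate, but \<open>A i j\<close> may be 0.\<close>
    have sum2: "(\<Sum>l<i. bird A p l l) < 2 ^ M"
    proof -
      have "(\<Sum>l<i. bird A p l l) \<le> (\<Sum>l<i. a * (2 * N * a) ^ p)" using ij v A by (intro sum_mono bird_le) auto
      also have "\<dots> \<le> N * (a * (2 * N * a) ^ p)" using ij v by simp
      also have "\<dots> \<le> (2 * N * a) ^ Suc p" by simp
      also have "\<dots> \<le> (2 * N * a) ^ (N + 1)" using assms(3) R v by (intro power_increasing) auto
      also have "\<dots> < 2 ^ M" using R(1) R_less by simp
      finally show ?thesis .
    qed
    have S1: "sf h D M k ?s1 (?\<rho> i j)"
      using st assms(2,3) ij i le(1) lt s1[OF ij] b
      by (auto simp: entry_ex_def[symmetric] dX digit_A intro!: sf_entry simp del: bird.simps) (auto simp: entry_ex_def dX digit_A)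
    have S2: "sf h D M k ?s2 (?\<rho> i j)"
      using st assms(2,3) ij i sum2 s2[OF ij]
      by (auto intro!: sf_entry simp del: bird.simps)
    have S3: "sf h D M k (entry_ex ''x'' (V ''i'') (V ''j'')) (?\<rho> i j)"
      using st ij by (auto intro!: sf_entry[where p = 0])
    show ?thesis
      unfolding sf.simps ev.simps using S1 S2 S3 s1[OF ij] s2[OF ij] nv_e[OF ij] st le lt i sum2 b ij R_less R_pow_less small_less
      by (simp add: entry_ex_def digit_A del: bird.simps)
  qed
  show "sf h D M k step_ex \<rho>"
    using 1 X inner Xi sft st v M(1) unfolding step_ex_def by (auto simp del: ev.simps(3,12) sf.simps(3) bird.simps simp: nv_t)
qed

theorem bird_ex:
  assumes "store \<rho>"
  shows "ev h bird_ex \<rho> = Num (bird_det v A)" "sf h D M k bird_ex \<rho>"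
proof -
  have st: "\<rho> ''N'' = Num N" "\<rho> ''R'' = Num R" "\<rho> ''v'' = Num v" "\<rho> ''x'' = Num (X 0)" using assms by (auto simp: store_def)
  let ?f = "\<lambda>j a. ev h step_ex (\<rho>(''X'' := a, ''p'' := Num j))"
  have store: "store (\<rho>(''X'' := a, ''p'' := b))" for a b using assms by (simp add: store_def)
  have it: "iter ?f p (Num (X 0)) = Num (X p)" if "p \<le> N" for p
    using that by (induction p) (auto intro!: step(1)[OF store])
  have v1: "v - 1 \<le> N" "v - 1 < N" "v - 1 < v" "v - Suc 0 \<le> N" using v by auto
  have vM: "v < 2 ^ M" "v \<le> M" "Suc 0 < 2 ^ M" using small_less v M(1) by (auto intro: order.strict_trans1[OF _ small_less[of v]])
  show "ev h bird_ex \<rho> = Num (bird_det v A)"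
    using st it[OF v1(4)] v1 digit_X[of "v - 1" "v - 1" "v - 1"] by (simp add: bird_ex_def entry_ex_def bird_det_def)
  have "sf h D M k (entry_ex ''X'' (V ''v'' -. C 1) (V ''v'' -. C 1)) (\<rho>(''X'' := Num (X (v - 1))))"
    using st v1 vM by (auto intro!: sf_entry[where p = "v - 1"])
  moreover have "sf h D M k step_ex (\<rho>(''X'' := Num (X j), ''p'' := Num j))" if "j < N" for j
    by (rule step(2)[OF store]) (use that in simp_all)
  ultimately show "sf h D M k bird_ex \<rho>"
    using st it v1 vM by (simp add: bird_ex_def)
qed

end


section \<open>All subsets of small items at once\<close>

fun evens :: "'a list \<Rightarrow> 'a list" where
  "evens (a # b # xs) = a # evens xs"
| "evens _ = []"

fun pair_sums :: "nat list \<Rightarrow> nat list" where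
  "pair_sums (a # b # xs) = (a + b) # pair_sums xs"
| "pair_sums _ = []"

text \<open>One round of the zeta transform, for the item encoded by the lowest bit of the position.
  Instead of working in place it moves that bit to the top of the index, so every round combines
  neighbours and needs sequential access only. After \<open>k\<close> rounds each bit has been
  treated once.\<close>

definition zeta_step :: "nat list \<Rightarrow> nat list" where
  "zeta_step xs = evens xs @ pair_sums xs"

definition table :: "nat \<Rightarrow> (nat \<Rightarrow> nat) \<Rightarrow> nat list" where
  "table r F = map F [0..<2 ^ r]"

lemma even_append: "even (length xs) \<Longrightarrow> evens (xs @ ys) = evens xs @ evens ys"
  "even (length xs) \<Longrightarrow> pair_sums (xs @ ys) = pair_sums xs @ pair_sums ys" for xs ys :: "nat list"
  by (induction xs rule: evens.induct) auto

lemma evens_map: "evens (map F [0..<2 * n]) = map (\<lambda>j. F (2 * j)) [0..<n]"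
  and pair_sums_map: "pair_sums (map F [0..<2 * n]) = map (\<lambda>j. F (2 * j) + F (2 * j + 1)) [0..<n]"
  by (induction n) (auto simp: even_append)

text \<open>After some rounds the list is a concatenation of tables, one for each choice of which
  treated items belong to \<open>I\<close>. The next item splits each table: if it is not in
  \<open>I\<close>, only the sets without it count; if it is in \<open>I\<close>, both kinds are
  added.\<close>

definition refine :: "(nat \<Rightarrow> nat) list \<Rightarrow> (nat \<Rightarrow> nat) list" where
  "refine Fs = map (\<lambda>F j. F (2 * j)) Fs @ map (\<lambda>F j. F (2 * j) + F (2 * j + 1)) Fs"

lemma in_refine: "G \<in> set (refine Fs) \<longleftrightarrow> (\<exists>H\<in>set Fs. G = (\<lambda>j. H (2 * j)) \<or> G = (\<lambda>j. H (2 * j) + H (2 * j + 1)))"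
  by (auto simp: refine_def)

lemma zeta_step_tables: "zeta_step (concat (map (table (Suc r)) Fs)) = concat (map (table r) (refine Fs))"
proof -
  have "evens (concat (map (table (Suc r)) Fs)) = concat (map (\<lambda>F. table r (\<lambda>j. F (2 * j))) Fs)"
    by (induction Fs) (auto simp: even_append table_def evens_map)
  moreover have "pair_sums (concat (map (table (Suc r)) Fs)) = concat (map (\<lambda>F. table r (\<lambda>j. F (2 * j) + F (2 * j + 1))) Fs)"
    by (induction Fs) (auto simp: even_append table_def pair_sums_map)
  ultimately show ?thesis by (simp add: zeta_step_def refine_def o_def)
qed

lemma zeta_tables: "i \<le> k \<Longrightarrow> (zeta_step ^^ i) (table k F) = concat (map (table (k - i)) ((refine ^^ i) [F]))"
proof (induction i)
  case (Suc i)
  then have "k - i = Suc (k - Suc i)" by simp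
  with Suc show ?case using zeta_step_tables[of "k - Suc i" "(refine ^^ i) [F]"] by simp
qed simp

lemma length_zeta: "i \<le> k \<Longrightarrow> length ((zeta_step ^^ i) (table k F)) = 2 ^ k"
proof -
  assume i: "i \<le> k"
  have "length ((refine ^^ i) [F]) = 2 ^ i" by (induction i) (auto simp: refine_def)
  then have "length ((zeta_step ^^ i) (table k F)) = 2 ^ i * 2 ^ (k - i)"
    unfolding zeta_tables[OF i] by (simp add: length_concat o_def table_def sum_list_triv)
  then show ?thesis using i by (simp flip: power_add)
qed

lemma sum_double: "(\<Sum>j<2 * n. F j) = (\<Sum>j<n. F (2 * j) + F (2 * j + 1))" for F :: "nat \<Rightarrow> nat"
  by (induction n) auto

text \<open>Neither half of a refinement has a larger total than the table it comes from, so all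
  intermediate numbers are bounded by the total of the initial table.\<close>

lemma zeta_le:
  assumes "i \<le> k" "x \<in> set ((zeta_step ^^ i) (table k F))"
  shows "x \<le> (\<Sum>j<2 ^ k. F j)"
proof -
  have *: "G \<in> set ((refine ^^ i) [F]) \<Longrightarrow> (\<Sum>j<2 ^ (k - i). G j) \<le> (\<Sum>j<2 ^ k. F j)" for G
    using assms(1)
  proof (induction i arbitrary: G)
    case (Suc i)
    then obtain H where H: "H \<in> set ((refine ^^ i) [F])" "G = (\<lambda>j. H (2 * j)) \<or> G = (\<lambda>j. H (2 * j) + H (2 * j + 1))"
      using in_refine[of G "(refine ^^ i) [F]"] by auto
    have "(\<Sum>j<2 ^ (k - Suc i). G j) \<le> (\<Sum>j<2 ^ (k - Suc i). H (2 * j) + H (2 * j + 1))"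
      using H(2) by (intro sum_mono) auto
    also have "\<dots> = (\<Sum>j<2 ^ (k - i). H j)"
    proof -
      have "k - i = Suc (k - Suc i)" using Suc.prems by simp
      then show ?thesis by (simp only: power_Suc sum_double)
    qed
    also have "\<dots> \<le> (\<Sum>j<2 ^ k. F j)" using Suc.IH[OF H(1)] Suc.prems by simp
    finally show ?case .
  qed simp
  obtain G where G: "G \<in> set ((refine ^^ i) [F])" "x \<in> set (table (k - i) G)"
    using assms(2) unfolding zeta_tables[OF assms(1)] by auto
  then obtain j where "j < 2 ^ (k - i)" "x = G j" by (auto simp: table_def)
  then have "x \<le> (\<Sum>j<2 ^ (k - i). G j)" by (auto intro: member_le_sum)
  with *[OF G(1)] show ?thesis by simp
qed

lemma Pow_lessThan_Suc: "Pow {..<Suc k} = (`) Suc ` Pow {..<k} \<union> (\<lambda>S. insert 0 (Suc ` S)) ` Pow {..<k}"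
proof (intro equalityI subsetI)
  fix S assume S: "S \<in> Pow {..<Suc k}"
  let ?S = "{x. Suc x \<in> S}"
  have "?S \<in> Pow {..<k}" using S by auto
  moreover have "S = (if 0 \<in> S then insert 0 (Suc ` ?S) else Suc ` ?S)"
  proof (intro set_eqI)
    fix x show "x \<in> S \<longleftrightarrow> x \<in> (if 0 \<in> S then insert 0 (Suc ` ?S) else Suc ` ?S)" by (cases x) auto
  qed
  ultimately show "S \<in> (`) Suc ` Pow {..<k} \<union> (\<lambda>S. insert 0 (Suc ` S)) ` Pow {..<k}"
    by (cases "0 \<in> S") auto
qed auto

lemma sum_Pow_Suc:
  fixes f :: "nat set \<Rightarrow> nat"
  shows "(\<Sum>S\<in>Pow {..<Suc k}. f S) = (\<Sum>S\<in>Pow {..<k}. f (Suc ` S)) + (\<Sum>S\<in>Pow {..<k}. f (insert 0 (Suc ` S)))"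
proof -
  have inj: "inj_on ((`) Suc) (Pow {..<k})" by (meson inj_Suc inj_image_eq_iff inj_onI)
  have inj2: "inj_on (\<lambda>S. insert 0 (Suc ` S)) (Pow {..<k})"
  proof (rule inj_onI)
    fix S T assume "insert 0 (Suc ` S) = insert 0 (Suc ` T)"
    then have "Suc ` S = Suc ` T" by (subst (asm) insert_ident) auto
    then show "S = T" by (meson inj_Suc inj_image_eq_iff)
  qed
  have "(\<Sum>S\<in>Pow {..<Suc k}. f S) = (\<Sum>S\<in>(`) Suc ` Pow {..<k}. f S) + (\<Sum>S\<in>(\<lambda>S. insert 0 (Suc ` S)) ` Pow {..<k}. f S)"
    unfolding Pow_lessThan_Suc by (rule sum.union_disjoint) auto
  then show ?thesis by (simp add: sum.reindex[OF inj] sum.reindex[OF inj2])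
qed

lemma encode_Suc: "finite S \<Longrightarrow> set_encode (Suc ` S) = 2 * set_encode S"
  by (auto simp: set_encode_def sum.reindex sum_distrib_left)

definition subset_sum :: "(nat \<Rightarrow> nat) \<Rightarrow> nat set \<Rightarrow> nat" where
  "subset_sum F I = (\<Sum>S\<in>Pow I. F (set_encode S))"

lemma image_Pow_Suc: "Pow (Suc ` I) = (`) Suc ` Pow I"
  by (rule image_Pow_surj[symmetric]) simp

lemma subset_sum_Suc:
  assumes "I \<subseteq> {..<k}"
  shows "subset_sum F (Suc ` I) = subset_sum (\<lambda>j. F (2 * j)) I"
    "subset_sum F (insert 0 (Suc ` I)) = subset_sum (\<lambda>j. F (2 * j) + F (2 * j + 1)) I"
proof -
  have fin: "finite S" if "S \<subseteq> I" for S
    by (rule finite_subset[of S "{..<k}"]) (use that assms in auto)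
  have inj: "inj_on ((`) Suc) (Pow I)" by (meson inj_Suc inj_image_eq_iff inj_onI)
  have inj2: "inj_on (\<lambda>S. insert 0 S) (Pow (Suc ` I))"
  proof (rule inj_onI)
    fix S T assume "S \<in> Pow (Suc ` I)" "T \<in> Pow (Suc ` I)" "insert 0 S = insert 0 T"
    moreover from this have "0 \<notin> S" "0 \<notin> T" by auto
    ultimately show "S = T" by (simp add: insert_ident)
  qed
  show 1: "subset_sum F (Suc ` I) = subset_sum (\<lambda>j. F (2 * j)) I"
    unfolding subset_sum_def image_Pow_Suc sum.reindex[OF inj] using fin by (intro sum.cong refl) (simp add: encode_Suc)
  have "subset_sum F (insert 0 (Suc ` I)) = (\<Sum>S\<in>Pow (Suc ` I) \<union> insert 0 ` Pow (Suc ` I). F (set_encode S))"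
    unfolding subset_sum_def Pow_insert ..
  also have "\<dots> = (\<Sum>S\<in>Pow (Suc ` I). F (set_encode S)) + (\<Sum>S\<in>insert 0 ` Pow (Suc ` I). F (set_encode S))"
    using fin[of I] by (intro sum.union_disjoint) auto
  also have "(\<Sum>S\<in>insert 0 ` Pow (Suc ` I). F (set_encode S)) = (\<Sum>S\<in>Pow I. F (2 * set_encode S + 1))"
  proof -
    have "(\<Sum>S\<in>insert 0 ` Pow (Suc ` I). F (set_encode S)) = (\<Sum>S\<in>Pow (Suc ` I). F (set_encode (insert 0 S)))"
      by (simp add: sum.reindex[OF inj2])
    also have "\<dots> = (\<Sum>S\<in>Pow I. F (set_encode (insert 0 (Suc ` S))))"
      by (simp add: image_Pow_Suc sum.reindex[OF inj])
    also have "\<dots> = (\<Sum>S\<in>Pow I. F (2 * set_encode S + 1))"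
      using fin by (intro sum.cong refl) (simp add: encode_Suc)
    finally show ?thesis .
  qed
  finally show "subset_sum F (insert 0 (Suc ` I)) = subset_sum (\<lambda>j. F (2 * j) + F (2 * j + 1)) I"
    using 1 by (simp add: subset_sum_def sum.distrib)
qed

text \<open>The rounds shuffle the positions, so the result is described by sums over all its
  entries. The algorithm uses nothing else, since it adds up the determinants over all
  \<open>I\<close>.\<close>

theorem zeta_sum:
  fixes g :: "nat \<Rightarrow> nat"
  shows "sum_list (map g ((zeta_step ^^ k) (table k F))) = (\<Sum>I\<in>Pow {..<k}. g (subset_sum F I))"
proof -
  have "sum_list (map (\<lambda>G. g (G 0)) ((refine ^^ k) Fs)) = (\<Sum>F\<leftarrow>Fs. \<Sum>I\<in>Pow {..<k}. g (subset_sum F I))" for Fs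
  proof (induction k arbitrary: Fs)
    case 0
    then show ?case by (simp add: subset_sum_def)
  next
    case (Suc k)
    have "sum_list (map (\<lambda>G. g (G 0)) ((refine ^^ Suc k) Fs)) = (\<Sum>F\<leftarrow>refine Fs. \<Sum>I\<in>Pow {..<k}. g (subset_sum F I))"
      unfolding funpow_Suc_right o_def by (rule Suc.IH)
    also have "\<dots> = (\<Sum>F\<leftarrow>Fs. (\<Sum>I\<in>Pow {..<k}. g (subset_sum F (Suc ` I))) + (\<Sum>I\<in>Pow {..<k}. g (subset_sum F (insert 0 (Suc ` I)))))"
      by (simp add: refine_def o_def subset_sum_Suc[where k = k] sum_list_addf)
    finally show ?case by (simp add: sum_Pow_Suc)
  qed
  moreover have "concat (map (table 0) Fs) = map (\<lambda>G. G 0) Fs" for Fs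
    by (induction Fs) (auto simp: table_def)
  ultimately show ?thesis unfolding zeta_tables[OF order.refl] by (simp add: o_def)
qed

text \<open>\<open>zeta_sum\<close> for the indicator function of \<open>x\<close> turns a statement
  about sums into one about membership.\<close>

corollary zeta_elements:
  assumes "x \<in> set ((zeta_step ^^ k) (table k F))"
  shows "\<exists>I\<subseteq>{..<k}. x = subset_sum F I"
proof (rule ccontr)
  assume neg: "\<not> (\<exists>I\<subseteq>{..<k}. x = subset_sum F I)"
  let ?g = "\<lambda>y. of_bool (y = x) :: nat"
  have "sum_list (map ?g ((zeta_step ^^ k) (table k F))) = 0"
    unfolding zeta_sum using neg by (auto simp: sum_eq_0_iff)
  then show False using assms by auto
qed

section \<open>The zeta transform as an expression\<close>

abbreviation nums :: "nat list \<Rightarrow> val" where "nums xs \<equiv> enc_list (map Num xs)"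

text \<open>The accumulator holds a flag for a half-read pair and the two output lists in reverse
  order. The first component of a half-read pair is found at the head of the list of even positions.
  The last two folds undo the reversal and append the lists.\<close>

definition zeta_ex :: ex where
  "zeta_ex = Let ''p'' (Fold True ''x'' ''p'' (V ''t'') (Pr (C 0) (Pr (C 0) (C 0)))
      (If (Hd (V ''p''))
        (Pr (C 0) (Pr (Hd (Tl (V ''p''))) (Pr (V ''x'' +. Hd (Hd (Tl (V ''p'')))) (Tl (Tl (V ''p''))))))
        (Pr (C 1) (Pr (Pr (V ''x'') (Hd (Tl (V ''p'')))) (Tl (Tl (V ''p'')))))))
    (Fold True ''x'' ''a'' (Hd (Tl (V ''p''))) (Fold True ''x'' ''a'' (Tl (Tl (V ''p''))) (C 0) (Pr (V ''x'') (V ''a'')))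
      (Pr (V ''x'') (V ''a'')))"

lemma fold_Tup: "fold Tup xs (enc_list ys) = enc_list (rev xs @ ys)"
  by (induction xs arbitrary: ys) (simp_all flip: enc_list.simps)

definition split_fun :: "val \<Rightarrow> val \<Rightarrow> val" where
  "split_fun y a = (if truth (head_of a)
     then Tup (Num 0) (Tup (head_of (tail_of a)) (Tup (Num (unN y + unN (head_of (head_of (tail_of a))))) (tail_of (tail_of a))))
     else Tup (Num 1) (Tup (Tup y (head_of (tail_of a))) (tail_of (tail_of a))))"

lemma fold_split:
  "even (length xs) \<Longrightarrow> fold split_fun (map Num xs) (Tup (Num 0) (Tup (enc_list e) (enc_list s))) =
     Tup (Num 0) (Tup (enc_list (rev (map Num (evens xs)) @ e)) (enc_list (rev (map Num (pair_sums xs)) @ s)))"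
proof (induction xs arbitrary: e s rule: evens.induct)
  case (1 a b xs)
  have "fold split_fun (map Num (a # b # xs)) (Tup (Num 0) (Tup (enc_list e) (enc_list s))) =
    fold split_fun (map Num xs) (Tup (Num 0) (Tup (enc_list (Num a # e)) (enc_list (Num (a + b) # s))))"
    by (simp add: split_fun_def add.commute)
  also have "\<dots> = Tup (Num 0) (Tup (enc_list (rev (map Num (evens xs)) @ Num a # e)) (enc_list (rev (map Num (pair_sums xs)) @ Num (a + b) # s)))"
    using 1 by (intro "1.IH") simp
  finally show ?case by simp
qed auto

lemma length_evens: "even (length xs) \<Longrightarrow> length (evens xs) = length xs div 2"
  by (induction xs rule: evens.induct) simp_all

lemma length_pair_sums: "even (length ys) \<Longrightarrow> length (pair_sums ys) = length ys div 2"
  by (induction ys rule: pair_sums.induct) simp_all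

lemma zeta_ex:
  assumes t: "\<rho> ''t'' = nums xs" and ev: "even (length xs)" and len: "length xs \<le> 2 ^ k" and small: "\<And>x. x \<in> set xs \<Longrightarrow> x < 2 ^ M"
  shows "ev h zeta_ex \<rho> = nums (zeta_step xs)" "sf h D M k zeta_ex \<rho>"
proof -
  let ?a = "Tup (Num 0) (Tup (enc_list []) (enc_list []))"
  have st: "fold split_fun (map Num xs) ?a = Tup (Num 0) (Tup (enc_list (rev (map Num (evens xs)))) (enc_list (rev (map Num (pair_sums xs)))))"
    using fold_split[OF ev, of "[]" "[]"] by simp
  have b: "(\<lambda>y a. ev h (If (Hd (V ''p''))
        (Pr (C 0) (Pr (Hd (Tl (V ''p''))) (Pr (V ''x'' +. Hd (Hd (Tl (V ''p'')))) (Tl (Tl (V ''p''))))))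
        (Pr (C 1) (Pr (Pr (V ''x'') (Hd (Tl (V ''p'')))) (Tl (Tl (V ''p'')))))) (\<rho>(''p'' := a, ''x'' := y))) = split_fun"
    by (auto simp: split_fun_def fun_eq_iff)
  have f: "(\<lambda>y a. ev h (Pr (V ''x'') (V ''a'')) (\<rho>'(''a'' := a, ''x'' := y))) = Tup" for \<rho>'
    by (auto simp: fun_eq_iff)
  \<comment> \<open>The addition reads the head of the list of even positions, so safety needs a
    bound for it after every prefix of the input, also one of odd length.\<close>
  have inv: "\<exists>c e s. fold split_fun (map Num ys) ?a = Tup c (Tup (nums e) s) \<and> (\<forall>x\<in>set e. x < 2 ^ M)"
    if "set ys \<subseteq> set xs" for ys using that
  proof (induction ys rule: rev_induct)
    case Nil
    show ?case by (intro exI[of _ "Num 0"] exI[of _ "[]"]) simp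
  next
    case (snoc y ys)
    then obtain c e s where e: "fold split_fun (map Num ys) ?a = Tup c (Tup (nums e) s)" "\<forall>x\<in>set e. x < 2 ^ M" by auto
    have step: "fold split_fun (map Num (ys @ [y])) ?a = split_fun (Num y) (Tup c (Tup (nums e) s))"
      unfolding e(1)[symmetric] by (simp only: map_append list.map fold_append fold_simps o_apply)
    show ?case
    proof (cases "truth c")
      case True
      then show ?thesis unfolding step using e(2) by (auto simp: split_fun_def)
    next
      case False
      have "\<forall>x\<in>set (y # e). x < 2 ^ M" using e snoc.prems small by auto
      moreover have "fold split_fun (map Num (ys @ [y])) ?a = Tup (Num 1) (Tup (nums (y # e)) s)"
        unfolding step using False by (simp add: split_fun_def)
      ultimately show ?thesis by blast
    qed
  qed
  have small_head: "unN (head_of (head_of (tail_of (fold split_fun (take j (map Num xs)) ?a)))) < 2 ^ M" for j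
  proof -
    obtain c e s where e: "fold split_fun (map Num (take j xs)) ?a = Tup c (Tup (nums e) s)" "\<forall>x\<in>set e. x < 2 ^ M"
      using inv[of "take j xs"] set_take_subset by fast
    then show ?thesis by (cases e) (auto simp: take_map)
  qed
  show "ev h zeta_ex \<rho> = nums (zeta_step xs)"
    unfolding zeta_ex_def ev.simps(8,10) b f using t st fold_Tup[of _ "[]"] fold_Tup
    by (simp add: zeta_step_def)
  show "sf h D M k zeta_ex \<rho>"
    unfolding zeta_ex_def sf.simps(8,10) ev.simps(8,10) b f
    using t st small_head small len length_evens[OF ev] length_pair_sums[OF ev] by simp
qed


section \<open>The matching test\<close>

text \<open>Rebuilds the input of the oracle from numerators over the common denominator
  \<open>D\<close>. Dividing by the gcd yields the lowest terms that the encoding prescribes. Digit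
  0 is the last coordinate, because a list is built from its end.\<close>

definition unpack_ex :: ex where
  "unpack_ex = For False ''j'' ''a'' (V ''d'') (C 0)
     (Let ''c'' (digit_ex (V ''X'') (V ''R1'') (V ''j'')) (Let ''g'' (Gcd (V ''c'') (V ''D''))
       (Pr (Pr (V ''c'' /. V ''g'') (V ''D'' /. V ''g'')) (V ''a''))))"

definition bit_ex :: ex where "bit_ex = digit_ex (V ''b'') (C 2) (V ''i'')"

text \<open>Packed vectors are added as plain numbers. \<open>LV\<close> has only \<open>m\<close>
  nonzero places, so partners and dummies contribute the digit 0.\<close>

definition cov_ex :: "string \<Rightarrow> string \<Rightarrow> ex" where
  "cov_ex u w = Let ''X'' (Sum ''i'' (V ''k'') (bit_ex *. digit_ex (V ''SV'') (V ''R2'') (V ''i''))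
      +. (digit_ex (V ''LV'') (V ''R2'') (V u) +. digit_ex (V ''LV'') (V ''R2'') (V w))) (Call unpack_ex)"

definition allowed_ex :: "string \<Rightarrow> string \<Rightarrow> ex" where
  "allowed_ex u w = If (V w <. V ''m'') (cov_ex u w) (If (V w <. C 2 *. V ''m'') (V u <. V ''m'')
     (If (V u <. V ''m'') (cov_ex u w) (If (V u <. C 2 *. V ''m'') (V u +. C 3 *. V ''q'' <. C 2 *. V ''m'') (cov_ex u w))))"

definition weight_ex :: "string \<Rightarrow> string \<Rightarrow> ex \<Rightarrow> ex" where
  "weight_ex u w i = digit_ex (V ''r'') (V ''W'') ((V u *. V ''N'' +. V w) *. (V ''n'' +. C 1) +. i)"

definition edge_ex :: "string \<Rightarrow> string \<Rightarrow> ex" where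
  "edge_ex u w = If (allowed_ex u w)
     (Pw (V ''B'') (weight_ex u w (C 0) +. Sum ''i'' (V ''k'') (bit_ex *. (weight_ex u w (C 1 +. V ''i'') +. V ''Z''))))
     (C 0)"

definition matrix_ex :: ex where
  "matrix_ex = Sum ''u'' (V ''v'') (Sum ''w'' (V ''v'')
     (If (V ''u'' <. V ''w'') (edge_ex ''u'' ''w'') (If (V ''w'' <. V ''u'') (edge_ex ''w'' ''u'') (C 0))
       *. Pw (V ''R'') (V ''u'' *. V ''N'' +. V ''w'')))"

text \<open>The table of matrices is filled from its last entry to its first, hence
  \<open>b = K - 1 - j\<close>. The final sum counts the degrees whose coefficient is odd.\<close>

definition test_ex :: ex where
  "test_ex = Let ''v'' (C 2 *. V ''m'' +. C 2 *. (V ''l'' -. V ''q''))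
    (Let ''t'' (For True ''j'' ''a'' (V ''K'') (C 0) (Let ''b'' (V ''K'' -. C 1 -. V ''j'') (Pr matrix_ex (V ''a''))))
    (Let ''t'' (For False ''i'' ''t'' (V ''k'') (V ''t'') zeta_ex)
    (Let ''S'' (Fold True ''x'' ''a'' (V ''t'') (C 0) (V ''a'' +. bird_ex))
      (Sum ''y'' (V ''Z'') (V ''S'' /. Pw (V ''B'') (C 2 *. (V ''Z'' *. V ''k'' +. V ''y'')) %. C 2)))))"

section \<open>Values and safety of the test for one guess\<close>

lemma set_decode_subset: "b < 2 ^ k \<Longrightarrow> set_decode b \<subseteq> {..<k}"
proof
  fix i assume b: "b < 2 ^ k" and "i \<in> set_decode b"
  then have "b div 2 ^ i \<noteq> 0" by (auto simp: set_decode_def intro!: Nat.gr0I)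
  then have "2 ^ i \<le> b" by (simp add: div_eq_0_iff)
  then have "(2::nat) ^ i < 2 ^ k" using b by (rule le_less_trans)
  then show "i \<in> {..<k}" using power_less_imp_less_exp[of "2::nat" i k] by simp
qed

lemma digit_2: "digit 2 i b = of_bool (i \<in> set_decode b)"
  by (auto simp: digit_def set_decode_def odd_iff_mod_2_eq_one)

lemma sum_digit_2: "b < 2 ^ k \<Longrightarrow> (\<Sum>i<k. digit 2 i b * f i) = (\<Sum>i\<in>set_decode b. f i)"
proof -
  assume b: "b < 2 ^ k"
  have "(\<Sum>i<k. digit 2 i b * f i) = (\<Sum>i\<in>{..<k} \<inter> set_decode b. f i)"
    unfolding digit_2 by (simp add: sum.inter_restrict of_bool_def if_distrib[of "\<lambda>x. x * _"] cong: if_cong)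
  also have "{..<k} \<inter> set_decode b = set_decode b" using set_decode_subset[OF b] by blast
  finally show ?thesis .
qed

lemma digit_less: "b > 0 \<Longrightarrow> digit b i x < b" by (simp add: digit_def)

locale core =
  fixes h :: "val \<Rightarrow> val" and Dd :: "nat \<Rightarrow> val \<Rightarrow> bool" and M r l d n k m D R1 R2 SV LV W Z :: nat and cv :: "nat \<Rightarrow> nat \<Rightarrow> nat set \<Rightarrow> bool"
begin

text \<open>As \<open>m\<close> and \<open>l\<close> are at most \<open>n\<close>, \<open>N\<close>
  bounds the number of vertices for every \<open>q\<close>, and \<open>NW\<close> the number of
  weights. \<open>B\<close> is the bound of \<open>sieve_nat\<close> for \<open>N\<close> vertices,
  doubled to be even and strictly larger. \<open>E\<close> is the largest weight of one edge,
  \<open>AM\<close> bounds an entry summed over \<open>2 ^ k\<close> sets, and \<open>R\<close> is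
  the base that \<open>packed_bird\<close> asks for.\<close>

definition "N = 4 * n"
definition "NW = N * N * (n + 1)"
definition "B = 2 * 2 ^ k * 2 ^ k * (2 * N * 2 ^ k) ^ N"
definition "E = W + k * (W + Z)"
definition "AM = 2 ^ k * B ^ E"
definition "R = (2 * N * AM) ^ (N + 1)"

definition idx :: "nat \<Rightarrow> nat \<Rightarrow> nat \<Rightarrow> nat" where "idx u w i = (u * N + w) * (n + 1) + i"
definition wv :: "nat \<Rightarrow> nat" where "wv j = digit W j r"
abbreviation wt where "wt \<equiv> wt_of wv idx Z"
definition csum :: "nat \<Rightarrow> nat \<Rightarrow> nat set \<Rightarrow> nat" where
  "csum u w T = (\<Sum>i\<in>T. digit R2 i SV) + (digit R2 u LV + digit R2 w LV)"
definition al :: "nat \<Rightarrow> nat \<Rightarrow> nat \<Rightarrow> nat set \<Rightarrow> bool" where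
  "al q u w T = (if w < m \<or> 2 * m \<le> w \<and> (u < m \<or> 2 * m \<le> u) then cv u w T
     else if w < 2 * m then u < m else u + 3 * q < 2 * m)"
definition vs :: "nat \<Rightarrow> nat" where "vs q = 2 * m + 2 * (l - q)"

definition base_vars :: "(string \<times> nat) list" where
  "base_vars = [(''r'', r), (''l'', l), (''d'', d), (''n'', n), (''k'', k), (''m'', m), (''D'', D), (''R1'', R1), (''R2'', R2),
     (''SV'', SV), (''LV'', LV), (''N'', N), (''W'', W), (''Z'', Z), (''B'', B), (''R'', R), (''K'', 2 ^ k)]"

definition base :: "store \<Rightarrow> bool" where
  "base \<rho> \<longleftrightarrow> (\<forall>(x, v) \<in> set base_vars. \<rho> x = Num v)"

lemma baseD:
  assumes "base \<rho>"
  shows "\<rho> ''r'' = Num r" "\<rho> ''l'' = Num l" "\<rho> ''d'' = Num d" "\<rho> ''n'' = Num n" "\<rho> ''k'' = Num k" "\<rho> ''m'' = Num m"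
     "\<rho> ''D'' = Num D" "\<rho> ''R1'' = Num R1" "\<rho> ''R2'' = Num R2" "\<rho> ''SV'' = Num SV" "\<rho> ''LV'' = Num LV" "\<rho> ''N'' = Num N" "\<rho> ''W'' = Num W"
     "\<rho> ''Z'' = Num Z" "\<rho> ''B'' = Num B" "\<rho> ''R'' = Num R" "\<rho> ''K'' = Num (2 ^ k)"
  using assms by (simp_all add: base_def base_vars_def)

lemma base_upd: "base \<rho> \<Longrightarrow> list_all (\<lambda>(y, v). y \<noteq> x) base_vars \<Longrightarrow> base (\<rho>(x := v))"
  unfolding base_def list_all_iff by auto

end

text \<open>\<open>cover\<close> is the only contact with the covering property: it describes the
  oracle call on a packed sum, so everything built on this locale is about numbers.\<close>

locale core_bounds = core +
  assumes pos: "0 < l" "0 < n" "0 < W" "0 < R2" and Z_large: "(N + k) * W < Z" and le: "m \<le> n" "k \<le> n" "l \<le> n"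
    and Mcount: "2 * (Z * (k + 1)) \<le> M" "E \<le> M" "3 * NW + N \<le> M" "d \<le> M" "4 * NW \<le> M" "10 \<le> M"
    and Mbig: "2 ^ k * R ^ (N * N) < 2 ^ M" "B ^ (2 * (Z * (k + 1))) < 2 ^ M" "r < 2 ^ M" "W ^ NW < 2 ^ M"
      "R2 ^ N < 2 ^ M" "SV < 2 ^ M" "LV < 2 ^ M" "(k + 2) * R2 < 2 ^ M"
    and cover: "\<And>u w T \<rho>. u < w \<Longrightarrow> w < N \<Longrightarrow> T \<subseteq> {..<k} \<Longrightarrow> base \<rho> \<Longrightarrow> \<rho> ''X'' = Num (csum u w T) \<Longrightarrow>
      ev h (Call unpack_ex) \<rho> = enc_bool (cv u w T) \<and> sf h Dd M k (Call unpack_ex) \<rho>"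
begin

lemma small: "x \<le> M \<Longrightarrow> x < 2 ^ M"
  by (rule le_less_trans[OF _ less_exp])

lemma N_le: "N \<le> N * N" "N * N \<le> NW" "N \<le> NW" "N * N + N \<le> M" "N \<le> M" "n < N" "m < N" "k < N" "l < N" "NW \<le> M" "NW > 0" "N > 0"
proof -
  show 1: "N \<le> N * N" "N * N \<le> NW" "n < N" using pos by (auto simp: N_def NW_def)
  then show "N \<le> NW" "N * N + N \<le> M" "N \<le> M" "m < N" "k < N" "l < N" "NW \<le> M" "NW > 0" "N > 0" using Mcount le by linarith+
qed

lemma kM: "k < M" using N_le by linarith

lemma idx_less: "u < N \<Longrightarrow> w < N \<Longrightarrow> i \<le> n \<Longrightarrow> idx u w i < NW"
proof -
  assume a: "u < N" "w < N" "i \<le> n"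
  then have "u * N + w < Suc u * N" by simp
  also have "\<dots> \<le> N * N" using a by (intro mult_le_mono1) simp
  finally have "Suc (u * N + w) * (n + 1) \<le> NW" unfolding NW_def by (intro mult_le_mono1) simp
  then show ?thesis using a by (simp add: idx_def)
qed

lemma idx_parts:
  assumes "u < N" "w < N"
  shows "u * N + w < 2 ^ M" "(u * N + w) * (n + 1) < 2 ^ M" "u * N < 2 ^ M" "u < 2 ^ M" "w < 2 ^ M" "u * N + w \<le> N * N" "u * N + w \<le> M"
proof -
  have 1: "(u * N + w) * (n + 1) < NW" using idx_less[OF assms, of 0] by (simp add: idx_def)
  have 2: "u * N + w \<le> (u * N + w) * (n + 1)" by simp
  have 3: "u * N + w < N * N"
  proof -
    have "u * N + w < Suc u * N" using assms by simp
    also have "\<dots> \<le> N * N" using assms by (intro mult_le_mono1) simp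
    finally show ?thesis .
  qed
  show "u * N + w < 2 ^ M" "(u * N + w) * (n + 1) < 2 ^ M" "u * N < 2 ^ M" "u < 2 ^ M" "w < 2 ^ M"
    by (rule small, use 1 2 N_le assms in linarith)+
  show "u * N + w \<le> N * N" "u * N + w \<le> M" using 3 N_le by linarith+
qed

lemma room: "(1::nat) < 2 ^ M" "Suc 0 < 2 ^ M" "(2::nat) < 2 ^ M" "(3::nat) < 2 ^ M" "n < 2 ^ M" "Suc n < 2 ^ M" "N < 2 ^ M" "m < 2 ^ M" "2 * m < 2 ^ M" "k < 2 ^ M" "l < 2 ^ M" "W < 2 ^ M" "Z < 2 ^ M"
proof -
  have "W \<le> E" by (simp add: E_def)
  moreover have "Z \<le> 2 * (Z * (k + 1))" by simp
  moreover have "2 * m \<le> N" using le by (simp add: N_def)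
  ultimately show "(1::nat) < 2 ^ M" "Suc 0 < 2 ^ M" "(2::nat) < 2 ^ M" "(3::nat) < 2 ^ M" "n < 2 ^ M" "Suc n < 2 ^ M" "N < 2 ^ M" "m < 2 ^ M" "2 * m < 2 ^ M" "k < 2 ^ M" "l < 2 ^ M" "W < 2 ^ M" "Z < 2 ^ M"
    using Mcount N_le by (auto intro!: small)
qed

lemma B_pos: "0 < B" using N_le by (simp add: B_def)
lemma AM_pos: "0 < AM" using B_pos by (simp add: AM_def)
lemma R_pos: "0 < R" using AM_pos N_le by (simp add: R_def)

lemma BE_le: "B ^ E \<le> R" "AM \<le> R"
proof -
  have "AM \<le> 2 * N * AM" using N_le by simp
  also have "\<dots> = (2 * N * AM) ^ 1" by simp
  also have "\<dots> \<le> R" unfolding R_def using N_le AM_pos by (intro power_increasing) auto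
  finally show "AM \<le> R" .
  moreover have "B ^ E \<le> AM" by (simp add: AM_def)
  ultimately show "B ^ E \<le> R" by simp
qed

lemma R_pow: "e \<le> N * N \<Longrightarrow> R ^ e < 2 ^ M" "R < 2 ^ M" "2 ^ k * R < 2 ^ M"
proof -
  have 1: "R ^ e \<le> R ^ (N * N)" if "e \<le> N * N" for e using that R_pos by (intro power_increasing) auto
  have 2: "R ^ (N * N) \<le> 2 ^ k * R ^ (N * N)" by simp
  show 3: "e \<le> N * N \<Longrightarrow> R ^ e < 2 ^ M" for e using 1[of e] 2 Mbig(1) by linarith
  show "R < 2 ^ M" using 3[of 1] N_le by simp
  have "2 ^ k * R ^ 1 \<le> 2 ^ k * R ^ (N * N)" using N_le by (intro mult_le_mono2 1) simp
  then show "2 ^ k * R < 2 ^ M" using Mbig(1) by (simp only: power_one_right)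
qed

lemma B_pow: "e \<le> E \<Longrightarrow> B ^ e \<le> B ^ E" "B ^ E < 2 ^ M" "B < 2 ^ M"
proof -
  show "e \<le> E \<Longrightarrow> B ^ e \<le> B ^ E" using B_pos by (intro power_increasing) auto
  show "B ^ E < 2 ^ M" using BE_le R_pow by simp
  have "B ^ 1 \<le> B ^ E" using B_pos pos by (intro power_increasing) (auto simp: E_def)
  then show "B < 2 ^ M" using \<open>B ^ E < 2 ^ M\<close> by simp
qed

lemma wt_le: "T \<subseteq> {..<k} \<Longrightarrow> wt u w T \<le> E" and wt_part_le: "T \<subseteq> {..<k} \<Longrightarrow> (\<Sum>i\<in>T. wv (idx u w (Suc i)) + Z) \<le> E"
proof -
  assume T: "T \<subseteq> {..<k}"
  have wv: "wv j \<le> W" for j using digit_less[OF pos(3)] by (simp add: wv_def less_imp_le)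
  have "(\<Sum>i\<in>T. wv (idx u w (Suc i)) + Z) \<le> (\<Sum>i\<in>T. W + Z)" using wv by (intro sum_mono add_mono) auto
  also have "\<dots> \<le> k * (W + Z)" using card_mono[OF _ T] by (simp add: mult_le_mono1)
  finally show "wt u w T \<le> E" "(\<Sum>i\<in>T. wv (idx u w (Suc i)) + Z) \<le> E" using wv[of "idx u w 0"] by (auto simp: wt_of_def E_def)
qed

lemma bit_ex: "nv h bit_ex \<rho> = digit 2 (unN (\<rho> ''i'')) (unN (\<rho> ''b''))"
  by (simp add: bit_ex_def)

lemma sf_bit: "\<rho> ''i'' = Num i \<Longrightarrow> \<rho> ''b'' = Num b \<Longrightarrow> i < k \<Longrightarrow> b < 2 ^ k \<Longrightarrow> sf h Dd M k bit_ex \<rho>"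
  unfolding bit_ex_def
proof (rule sf_digit)
  assume a: "\<rho> ''i'' = Num i" "\<rho> ''b'' = Num b" "i < k" "b < 2 ^ k"
  have p: "(2::nat) ^ i < 2 ^ M" "(2::nat) ^ k < 2 ^ M" using a kM by (auto intro!: power_strict_increasing)
  show "nv h (V ''b'') \<rho> < 2 ^ M" using a(2,4) less_trans[OF a(4) p(2)] by simp
  show "nv h (V ''i'') \<rho> \<le> M" "nv h (C 2) \<rho> ^ nv h (V ''i'') \<rho> < 2 ^ M" "nv h (C 2) \<rho> < 2 ^ M"
    using a p kM room by auto
qed simp_all

lemma sf_weight:
  assumes "base \<rho>" "\<rho> u = Num u'" "\<rho> w = Num w'" "u' < N" "w' < N" "nv h i \<rho> \<le> n" "sf h Dd M k i \<rho>"
  shows "sf h Dd M k (weight_ex u w i) \<rho>" "nv h (weight_ex u w i) \<rho> = wv (idx u' w' (nv h i \<rho>))"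
proof -
  note b = baseD[OF assms(1)]
  show "nv h (weight_ex u w i) \<rho> = wv (idx u' w' (nv h i \<rho>))"
    using assms(2,3) b by (simp add: weight_ex_def wv_def idx_def)
  have lt: "idx u' w' (nv h i \<rho>) < NW" using assms by (intro idx_less) auto
  then have "W ^ idx u' w' (nv h i \<rho>) \<le> W ^ NW" using pos by (intro power_increasing) auto
  then have p: "W ^ idx u' w' (nv h i \<rho>) < 2 ^ M" using Mbig(4) by simp
  have "nv h i \<rho> < 2 ^ M" using assms(6) room(5) by simp
  then show "sf h Dd M k (weight_ex u w i) \<rho>"
    unfolding weight_ex_def
    by (intro sf_digit) (use assms b lt p Mbig room idx_parts[OF assms(4,5)] N_le in \<open>auto simp: idx_def\<close>)
qed

lemma cov_ex:
  assumes "base \<rho>" "\<rho> u = Num u'" "\<rho> w = Num w'" "u' < w'" "w' < N" "\<rho> ''b'' = Num b" "b < 2 ^ k" "u \<noteq> ''i''" "w \<noteq> ''i''"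
  shows "ev h (cov_ex u w) \<rho> = enc_bool (cv u' w' (set_decode b))" "sf h Dd M k (cov_ex u w) \<rho>"
proof -
  note b = baseD[OF assms(1)]
  let ?s = "Sum ''i'' (V ''k'') (bit_ex *. digit_ex (V ''SV'') (V ''R2'') (V ''i''))"
  let ?e = "?s +. (digit_ex (V ''LV'') (V ''R2'') (V u) +. digit_ex (V ''LV'') (V ''R2'') (V w))"
  have s: "nv h ?s \<rho> = (\<Sum>i\<in>set_decode b. digit R2 i SV)"
    using b assms sum_digit_2[OF assms(7), of "\<lambda>i. digit R2 i SV"] by (simp add: bit_ex)
  have e: "ev h ?e \<rho> = Num (csum u' w' (set_decode b))" using s assms(2,3) b by (simp add: csum_def)
  have u: "u' < N" using assms by simp
  have T: "set_decode b \<subseteq> {..<k}" using assms by (intro set_decode_subset)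
  have dl: "digit R2 i x < R2" for i x by (rule digit_less[OF pos(4)])
  have "(\<Sum>i\<in>set_decode b. digit R2 i SV) \<le> (\<Sum>i\<in>set_decode b. R2)" using dl by (intro sum_mono less_imp_le)
  also have "\<dots> \<le> k * R2" using card_mono[OF _ T] by simp
  finally have sl: "(\<Sum>i\<in>set_decode b. digit R2 i SV) < 2 ^ M" using Mbig(8) by simp
  have "digit R2 u' LV + digit R2 w' LV \<le> R2 + R2" using dl by (intro add_mono less_imp_le)
  then have dd: "digit R2 u' LV + digit R2 w' LV < 2 ^ M" using Mbig(8) by simp
  have R2p: "R2 ^ x < 2 ^ M" "x \<le> M" if "x < N" for x
  proof -
    have "R2 ^ x \<le> R2 ^ N" using pos that by (intro power_increasing) auto
    then show "R2 ^ x < 2 ^ M" using Mbig(5) by simp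
    show "x \<le> M" using that N_le by simp
  qed
  have R2M: "R2 < 2 ^ M" "digit R2 x y < 2 ^ M" for x y using R2p(1)[of 1] N_le dl[of x y] pos by (auto simp: N_def)
  have d2: "digit 2 x y < 2 ^ M" for x y using digit_less[of 2 x y] room(3) by simp
  have "sf h Dd M k (bit_ex *. digit_ex (V ''SV'') (V ''R2'') (V ''i'')) (\<rho>(''i'' := Num j))" if "j < k" for j
    using that b assms(6,7) Mbig R2p[of j] R2M d2 N_le(8) by (auto intro!: sf_bit sf_digit simp: bit_ex)
  moreover have "nv h ?s \<rho> < 2 ^ M" using s sl by simp
  ultimately have sfs: "sf h Dd M k ?s \<rho>" using b kM by (simp del: ev.simps(11))
  have "sf h Dd M k ?e \<rho>"
    unfolding sf.simps(3) using sfs s sl dd b assms(2,3,5) u R2p R2M Mbig by (auto intro!: sf_digit)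
  moreover have X: "base (\<rho>(''X'' := Num (csum u' w' (set_decode b))))" using assms(1) by (rule base_upd) (simp add: base_vars_def)
  ultimately show "ev h (cov_ex u w) \<rho> = enc_bool (cv u' w' (set_decode b))" "sf h Dd M k (cov_ex u w) \<rho>"
    using cover[OF assms(4,5) T X] unfolding cov_ex_def ev.simps(8) sf.simps(8) e by auto
qed

lemma allowed_ex:
  assumes "base \<rho>" "\<rho> u = Num u'" "\<rho> w = Num w'" "u' < w'" "w' < N" "\<rho> ''b'' = Num b" "b < 2 ^ k" "u \<noteq> ''i''" "w \<noteq> ''i''"
    "\<rho> ''q'' = Num q" "3 * q \<le> m"
  shows "ev h (allowed_ex u w) \<rho> = enc_bool (al q u' w' (set_decode b))" "sf h Dd M k (allowed_ex u w) \<rho>"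
proof -
  note b = baseD[OF assms(1)]
  note c = cov_ex[OF assms(1-9)]
  show "ev h (allowed_ex u w) \<rho> = enc_bool (al q u' w' (set_decode b))"
    using assms(2,3,4,10) b c(1) by (auto simp: allowed_ex_def al_def)
  have "u' + 3 * q \<le> M" using assms le N_le Mcount(5) unfolding N_def NW_def by linarith
  then have "u' + 3 * q < 2 ^ M" "3 * q < 2 ^ M" "u' < 2 ^ M" "q < 2 ^ M" by (auto intro!: small)
  moreover have "w' < 2 ^ M" using assms(5) N_le by (intro small) simp
  ultimately show "sf h Dd M k (allowed_ex u w) \<rho>"
    using assms(2,3,10) b c(2) room by (auto simp: allowed_ex_def)
qed

text \<open>The share of a single set \<open>T\<close> in the matrix; the sum over the subsets of
  \<open>I\<close> is left to the zeta transform.\<close>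

definition entry :: "nat \<Rightarrow> nat set \<Rightarrow> nat \<Rightarrow> nat \<Rightarrow> nat" where
  "entry q T = sym_mat (\<lambda>u w. if al q u w T then B ^ wt u w T else 0)"

lemma edge_ex:
  assumes "base \<rho>" "\<rho> u = Num u'" "\<rho> w = Num w'" "u' < w'" "w' < N" "\<rho> ''b'' = Num b" "b < 2 ^ k" "u \<noteq> ''i''" "w \<noteq> ''i''"
    "\<rho> ''q'' = Num q" "3 * q \<le> m"
  shows "ev h (edge_ex u w) \<rho> = Num (entry q (set_decode b) u' w')" "sf h Dd M k (edge_ex u w) \<rho>"
proof -
  note b = baseD[OF assms(1)]
  let ?T = "set_decode b"
  have T: "?T \<subseteq> {..<k}" using assms by (intro set_decode_subset)
  have u: "u' < N" using assms by simp
  let ?s = "Sum ''i'' (V ''k'') (bit_ex *. (weight_ex u w (C 1 +. V ''i'') +. V ''Z''))"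
  let ?e = "weight_ex u w (C 0) +. ?s"
  have w: "sf h Dd M k (weight_ex u w (C 1 +. V ''i'')) (\<rho>(''i'' := Num j))"
    "nv h (weight_ex u w (C 1 +. V ''i'')) (\<rho>(''i'' := Num j)) = wv (idx u' w' (Suc j))" if "j < k" for j
  proof -
    have j: "j < 2 ^ M" "Suc j \<le> n" using that room le by auto
    have bs: "base (\<rho>(''i'' := Num j))" using assms(1) by (rule base_upd) (simp add: base_vars_def)
    show "sf h Dd M k (weight_ex u w (C 1 +. V ''i'')) (\<rho>(''i'' := Num j))"
      "nv h (weight_ex u w (C 1 +. V ''i'')) (\<rho>(''i'' := Num j)) = wv (idx u' w' (Suc j))"
      using sf_weight[OF bs, of u u' w w' "C 1 +. V ''i''"] assms u j room by auto
  qed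
  have w0: "sf h Dd M k (weight_ex u w (C 0)) \<rho>" "nv h (weight_ex u w (C 0)) \<rho> = wv (idx u' w' 0)"
    using sf_weight[OF assms(1), of u u' w w' "C 0"] assms u by auto
  have s: "nv h ?s \<rho> = (\<Sum>i\<in>?T. wv (idx u' w' (Suc i)) + Z)"
    using b assms(6) w(2) sum_digit_2[OF assms(7), of "\<lambda>i. wv (idx u' w' (Suc i)) + Z"] by (simp add: bit_ex)
  have e: "nv h ?e \<rho> = wt u' w' ?T" using s w0(2) by (simp add: wt_of_def)
  show "ev h (edge_ex u w) \<rho> = Num (entry q ?T u' w')"
    using allowed_ex(1)[OF assms] e b assms(4) unfolding edge_ex_def by (simp add: entry_def sym_mat_def)
  have wE: "wv x \<le> E" for x using digit_less[OF pos(3), of x r] by (simp add: wv_def E_def)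
  have EM: "x < 2 ^ M" if "x \<le> E" for x using that Mcount(2) by (intro small) simp
  have wZ: "wv x + Z < 2 ^ M" for x
  proof -
    have "wv x + Z \<le> W + Z" using digit_less[OF pos(3), of x r] by (simp add: wv_def)
    moreover have "W + Z < 2 ^ M"
    proof (rule small)
      have "1 \<le> N + k" using N_le by simp
      from mult_le_mono1[OF this, of W] have "W \<le> Z" using Z_large by (simp only: mult_1)
      moreover have "2 * Z \<le> 2 * (Z * (k + 1))" by simp
      ultimately show "W + Z \<le> M" using Mcount(1) by linarith
    qed
    ultimately show ?thesis by simp
  qed
  have d2: "digit 2 x y < 2 ^ M" for x y using digit_less[of 2 x y] room(3) by simp
  have "sf h Dd M k (bit_ex *. (weight_ex u w (C 1 +. V ''i'') +. V ''Z'')) (\<rho>(''i'' := Num j))" if "j < k" for j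
    using that w[OF that] b assms(6,7) d2 wZ EM wE room by (auto intro!: sf_bit simp: bit_ex)
  moreover have "nv h ?s \<rho> < 2 ^ M" using s wt_part_le[OF T] EM by simp
  ultimately have sfs: "sf h Dd M k ?s \<rho>" using b kM by (simp del: ev.simps(11))
  have sfe: "sf h Dd M k ?e \<rho>" unfolding sf.simps(3) using sfs w0 s wt_part_le[OF T] EM wE by simp
  have "nv h ?e \<rho> \<le> M" "B ^ nv h ?e \<rho> < 2 ^ M"
    unfolding e using order.trans[OF wt_le[OF T, of u' w'] Mcount(2)] le_less_trans[OF B_pow(1)[OF wt_le[OF T, of u' w']] B_pow(2)] by blast+
  then have "sf h Dd M k (Pw (V ''B'') ?e) \<rho>" using sfe b B_pow(3) by (simp del: ev.simps(3) sf.simps(3))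
  then show "sf h Dd M k (edge_ex u w) \<rho>"
    unfolding edge_ex_def using allowed_ex[OF assms] by simp
qed

lemma entry_le: "entry q (set_decode b) i j \<le> B ^ E" if "b < 2 ^ k"
proof -
  have "(if al q u w (set_decode b) then B ^ wt u w (set_decode b) else 0) \<le> B ^ E" for u w
    using B_pow(1)[OF wt_le[OF set_decode_subset[OF that]]] by simp
  then show ?thesis by (simp add: entry_def sym_mat_def)
qed

definition fm :: "nat \<Rightarrow> nat \<Rightarrow> nat" where
  "fm q b = pack_mat R N (vs q) (entry q (set_decode b))"

lemma vs: "q \<le> l \<Longrightarrow> 3 * q \<le> m \<Longrightarrow> 0 < vs q \<and> vs q \<le> N"
  using pos le by (auto simp: vs_def N_def)

lemma entry_less: "b < 2 ^ k \<Longrightarrow> entry q (set_decode b) i j < R"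
proof -
  assume "b < 2 ^ k"
  then have "entry q (set_decode b) i j \<le> B ^ E" by (rule entry_le)
  also have "B ^ E \<le> AM" by (simp add: AM_def)
  also have "AM < 2 * N * AM" using N_le AM_pos by simp
  also have "\<dots> = (2 * N * AM) ^ 1" by simp
  also have "\<dots> \<le> R" unfolding R_def using N_le AM_pos by (intro power_increasing) auto
  finally show ?thesis .
qed

lemma fm_less: "q \<le> l \<Longrightarrow> 3 * q \<le> m \<Longrightarrow> b < 2 ^ k \<Longrightarrow> fm q b < R ^ (N * N)"
  unfolding fm_def using vs[of q] by (intro pack_mat_less entry_less R_pos) auto

lemma matrix_ex:
  assumes "base \<rho>" "\<rho> ''b'' = Num b" "b < 2 ^ k" "\<rho> ''q'' = Num q" "3 * q \<le> m" "q \<le> l" "\<rho> ''v'' = Num (vs q)"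
  shows "ev h matrix_ex \<rho> = Num (fm q b)" "sf h Dd M k matrix_ex \<rho>"
proof -
  note b = baseD[OF assms(1)]
  have v: "vs q \<le> N" using vs assms by simp
  let ?f = "\<lambda>u w. entry q (set_decode b) u w"
  let ?e = "If (V ''u'' <. V ''w'') (edge_ex ''u'' ''w'') (If (V ''w'' <. V ''u'') (edge_ex ''w'' ''u'') (C 0))"
  let ?t = "?e *. Pw (V ''R'') (V ''u'' *. V ''N'' +. V ''w'')"
  let ?\<rho> = "\<lambda>u w. \<rho>(''u'' := Num u, ''w'' := Num w)"
  have bs: "base (?\<rho> u w)" for u w using assms(1) by (intro base_upd) (simp_all add: base_vars_def)
  have ex: "ev h ?e (?\<rho> u w) = Num (?f u w)" "sf h Dd M k ?e (?\<rho> u w)" if "u < vs q" "w < vs q" for u w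
  proof -
    have uw: "u < N" "w < N" using that v by auto
    have uwM: "u < 2 ^ M" "w < 2 ^ M" using idx_parts[OF uw] by auto
    note e = edge_ex[OF bs]
    have 1: "ev h (edge_ex ''u'' ''w'') (?\<rho> u w) = Num (?f u w)" "sf h Dd M k (edge_ex ''u'' ''w'') (?\<rho> u w)" if "u < w"
      using e[of u w "''u''" u "''w''" w b q] that assms uw by auto
    have 2: "ev h (edge_ex ''w'' ''u'') (?\<rho> u w) = Num (?f u w)" "sf h Dd M k (edge_ex ''w'' ''u'') (?\<rho> u w)" if "w < u"
      using e[of u w "''w''" w "''u''" u b q] that assms uw by (auto simp: entry_def sym_mat_def)
    show "ev h ?e (?\<rho> u w) = Num (?f u w)" using 1(1) 2(1) by (auto simp: entry_def sym_mat_def)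
    show "sf h Dd M k ?e (?\<rho> u w)" using 1(2) 2(2) uwM by auto
  qed
  have tv: "nv h ?t (?\<rho> u w) = ?f u w * R ^ (u * N + w)" if "u < vs q" "w < vs q" for u w
    unfolding ev.simps(3) ex[OF that] using b by simp
  have inner: "nv h (Sum ''w'' (V ''v'') ?t) (\<rho>(''u'' := Num u)) = (\<Sum>w<vs q. ?f u w * R ^ (u * N + w))" if "u < vs q" for u
    using tv[OF that] assms(7) by (simp del: ev.simps(3))
  show 1: "ev h matrix_ex \<rho> = Num (fm q b)"
    unfolding matrix_ex_def fm_def pack_mat_def using inner assms(7) by (simp del: ev.simps(3))
  have fM: "fm q b < 2 ^ M" using fm_less[OF assms(6,5,3)] R_pow(1)[of "N * N"] by simp
  have X: "(\<Sum>u<vs q. \<Sum>w<vs q. ?f u w * R ^ (u * N + w)) < 2 ^ M"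
    using fM unfolding fm_def pack_mat_def .
  have Xi: "(\<Sum>w<vs q. ?f u w * R ^ (u * N + w)) < 2 ^ M" if "u < vs q" for u
    by (rule le_less_trans[OF _ X], rule member_le_sum[of u _ "\<lambda>u. \<Sum>w<vs q. ?f u w * R ^ (u * N + w)"]) (use that in auto)
  have sft: "sf h Dd M k ?t (?\<rho> u w)" if "u < vs q" "w < vs q" for u w
  proof -
    have uw: "u < N" "w < N" using that v by auto
    have "?f u w < 2 ^ M" using entry_less[OF assms(3), of q u w] R_pow(2) by simp
    then show ?thesis unfolding sf.simps(3) ex(1)[OF that]
      using ex(2)[OF that] b idx_parts[OF uw] R_pow(1)[OF idx_parts(6)[OF uw]] R_pow(2) room(7) by simp
  qed
  show "sf h Dd M k matrix_ex \<rho>"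
    using 1 X inner Xi sft assms(7) v N_le(5) tv unfolding matrix_ex_def by (auto simp del: ev.simps(3) sf.simps(3))
qed

definition ep :: "nat \<Rightarrow> nat set \<Rightarrow> nat \<Rightarrow> nat \<Rightarrow> nat" where
  "ep q I = sym_mat (edge_poly (al q) (\<lambda>u w T. B ^ wt u w T) I)"

text \<open>Packing is linear, so one addition of numbers in the zeta transform adds two whole
  matrices.\<close>

lemma subset_sum_fm:
  assumes "I \<subseteq> {..<k}" shows "subset_sum (fm q) I = pack_mat R N (vs q) (ep q I)"
proof -
  have fin: "finite S" if "S \<subseteq> I" for S by (rule finite_subset[of S "{..<k}"]) (use that assms in auto)
  have fI: "finite I" using fin by simp
  have ep: "ep q I i j = (\<Sum>S\<in>Pow I. entry q S i j)" for i j
  proof -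
    have "edge_poly (al q) (\<lambda>u w T. B ^ wt u w T) I u w = (\<Sum>S\<in>Pow I. if al q u w S then B ^ wt u w S else 0)" for u w
    proof -
      have "{T. T \<subseteq> I \<and> al q u w T} = {T \<in> Pow I. al q u w T}" by auto
      then show ?thesis unfolding edge_poly_def using fI sum.inter_filter[of "Pow I" "\<lambda>S. B ^ wt u w S" "al q u w"] by simp
    qed
    then show ?thesis by (simp add: ep_def entry_def sym_mat_def)
  qed
  have "subset_sum (fm q) I = (\<Sum>S\<in>Pow I. pack_mat R N (vs q) (entry q S))"
    unfolding subset_sum_def fm_def by (intro sum.cong refl) (simp add: fin set_encode_inverse)
  also have "\<dots> = (\<Sum>i<vs q. \<Sum>S\<in>Pow I. \<Sum>j<vs q. entry q S i j * R ^ (i * N + j))"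
    unfolding pack_mat_def by (rule sum.swap)
  also have "\<dots> = pack_mat R N (vs q) (ep q I)"
    unfolding pack_mat_def ep sum_distrib_right by (intro sum.cong refl sum.swap)
  finally show ?thesis .
qed

lemma ep_le: "I \<subseteq> {..<k} \<Longrightarrow> ep q I i j \<le> AM"
proof -
  assume I: "I \<subseteq> {..<k}"
  have "edge_poly (al q) (\<lambda>u w T. B ^ wt u w T) I u w \<le> AM" for u w
  proof -
    have "edge_poly (al q) (\<lambda>u w T. B ^ wt u w T) I u w \<le> (\<Sum>T | T \<subseteq> I \<and> al q u w T. B ^ E)"
      unfolding edge_poly_def using I by (intro sum_mono B_pow(1) wt_le) auto
    also have "\<dots> = card {T. T \<subseteq> I \<and> al q u w T} * B ^ E" by simp
    also have "card {T. T \<subseteq> I \<and> al q u w T} \<le> card (Pow {..<k})" using I by (intro card_mono) auto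
    finally show ?thesis by (simp add: AM_def card_Pow)
  qed
  then show ?thesis by (simp add: ep_def sym_mat_def)
qed

lemma packed: "I \<subseteq> {..<k} \<Longrightarrow> q \<le> l \<Longrightarrow> 3 * q \<le> m \<Longrightarrow> packed_bird M N R (vs q) AM (ep q I)"
  using vs[of q] ep_le R_pow(1)[of "N * N"] AM_pos N_le by unfold_locales (auto simp: R_def)

definition total :: "nat \<Rightarrow> nat" where
  "total q = (\<Sum>I\<in>Pow {..<k}. bird_det (vs q) (ep q I))"

lemma test_ex:
  assumes "base \<rho>" "\<rho> ''q'' = Num q" "3 * q \<le> m" "q \<le> l"
  shows "ev h test_ex \<rho> = Num (\<Sum>y<Z. total q div B ^ (2 * (Z * k + y)) mod 2)" "sf h Dd M k test_ex \<rho>"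
proof -
  note b = baseD[OF assms(1)]
  let ?\<rho>1 = "\<rho>(''v'' := Num (vs q))"
  let ?tab = "For True ''j'' ''a'' (V ''K'') (C 0) (Let ''b'' (V ''K'' -. C 1 -. V ''j'') (Pr matrix_ex (V ''a'')))"
  have k2: "(2::nat) ^ k < 2 ^ M" using kM by (intro power_strict_increasing) auto
  have mat: "ev h matrix_ex (\<rho>(''v'' := Num (vs q), ''a'' := a, ''j'' := Num j, ''b'' := Num (2 ^ k - 1 - j))) = Num (fm q (2 ^ k - 1 - j))"
    "sf h Dd M k matrix_ex (\<rho>(''v'' := Num (vs q), ''a'' := a, ''j'' := Num j, ''b'' := Num (2 ^ k - 1 - j)))" if "j < 2 ^ k" for a j
  proof -
    let ?r = "\<rho>(''v'' := Num (vs q), ''a'' := a, ''j'' := Num j, ''b'' := Num (2 ^ k - 1 - j))"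
    have "base ?r" using assms(1) by (intro base_upd) (simp_all add: base_vars_def)
    then show "ev h matrix_ex ?r = Num (fm q (2 ^ k - 1 - j))" "sf h Dd M k matrix_ex ?r"
      using matrix_ex[of ?r "2 ^ k - 1 - j" q] assms by simp_all
  qed
  let ?F = "fm q"
  let ?bd = "\<lambda>j a. ev h (Let ''b'' (V ''K'' -. C 1 -. V ''j'') (Pr matrix_ex (V ''a''))) (?\<rho>1(''a'' := a, ''j'' := Num j))"
  have bd: "?bd j a = Tup (Num (?F (2 ^ k - 1 - j))) a" if "j < 2 ^ k" for j a
    using mat(1)[OF that] b by simp
  \<comment> \<open>After \<open>j\<close> rounds the list consists of the last \<open>j\<close>
    entries of the table.\<close>
  have tabj: "iter ?bd j (Num 0) = nums (map ?F [2 ^ k - j..<2 ^ k])" if "j \<le> 2 ^ k" for j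
    using that
  proof (induction j)
    case (Suc j)
    have "[2 ^ k - Suc j..<2 ^ k] = (2 ^ k - Suc j) # [2 ^ k - j..<2 ^ k]"
      using Suc.prems upt_conv_Cons[of "2 ^ k - Suc j" "2 ^ k"] by (simp add: Suc_diff_Suc)
    then have eq: "[2 ^ k - Suc j..<2 ^ k] = (2 ^ k - 1 - j) # [2 ^ k - j..<2 ^ k]" by simp
    have j: "j < 2 ^ k" using Suc.prems by simp
    have IH: "iter ?bd j (Num 0) = nums (map ?F [2 ^ k - j..<2 ^ k])" by (rule Suc.IH[OF less_imp_le[OF j]])
    show ?case unfolding iter.simps IH bd[OF j] eq by simp
  qed simp
  have tab: "ev h ?tab ?\<rho>1 = nums (table k ?F)"
  proof -
    have "nv h (V ''K'') ?\<rho>1 = 2 ^ k" using b by simp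
    then show ?thesis unfolding ev.simps(9) using tabj[of "2 ^ k"] by (simp only: ev.simps(2) order.refl diff_self_eq_0 table_def)
  qed
  have sftab: "sf h Dd M k ?tab ?\<rho>1"
  proof -
    have "sf h Dd M k (Let ''b'' (V ''K'' -. C 1 -. V ''j'') (Pr matrix_ex (V ''a''))) (?\<rho>1(''a'' := a, ''j'' := Num j))" if "j < 2 ^ k" for a j
      using mat(2)[OF that] b k2 less_trans[OF that k2] le_less_trans[OF diff_le_self k2, of "Suc 0"] room by simp
    then show ?thesis using b by simp
  qed
  let ?\<rho>2 = "?\<rho>1(''t'' := nums (table k ?F))"
  let ?z = "\<lambda>i t. ev h zeta_ex (?\<rho>2(''t'' := t, ''i'' := Num i))"
  let ?L = "\<lambda>i. (zeta_step ^^ i) (table k ?F)"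
  have Lsmall: "x < 2 ^ M" if "i \<le> k" "x \<in> set (?L i)" for i x
  proof -
    have "x \<le> (\<Sum>j<2 ^ k. ?F j)" using zeta_le[OF that] .
    also have "\<dots> \<le> (\<Sum>j<(2::nat) ^ k. R ^ (N * N))" using fm_less[OF assms(4,3)] by (intro sum_mono less_imp_le) auto
    also have "\<dots> = 2 ^ k * R ^ (N * N)" by simp
    finally show ?thesis using Mbig(1) by simp
  qed
  have Leven: "even (length (?L i))" if "i < k" for i using that by (simp add: length_zeta)
  have zev: "?z i (nums (?L i)) = nums (?L (Suc i))" and zsf: "sf h Dd M k zeta_ex (?\<rho>2(''t'' := nums (?L i), ''i'' := Num i))" if "i < k" for i
  proof -
    let ?r = "?\<rho>2(''t'' := nums (?L i), ''i'' := Num i)"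
    have t: "?r ''t'' = nums (?L i)" by simp
    have len: "length (?L i) \<le> 2 ^ k" using length_zeta[of i k ?F] that by simp
    have sm: "x \<in> set (?L i) \<Longrightarrow> x < 2 ^ M" for x by (rule Lsmall[OF less_imp_le[OF that]])
    have "ev h zeta_ex ?r = nums (zeta_step (?L i))" by (rule zeta_ex(1)[where \<rho> = ?r, OF t Leven[OF that] len sm])
    then show "ev h zeta_ex ?r = nums (?L (Suc i))" by (simp only: funpow.simps o_apply)
    show "sf h Dd M k zeta_ex ?r" by (rule zeta_ex(2)[where \<rho> = ?r, OF t Leven[OF that] len sm])
  qed
  have zit: "iter ?z i (nums (table k ?F)) = nums (?L i)" if "i \<le> k" for i
    using that
  proof (induction i)
    case (Suc i)
    then have i: "i < k" by simp
    show ?case unfolding iter.simps Suc.IH[OF less_imp_le[OF i]] by (rule zev[OF i])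
  qed simp
  have z: "ev h (For False ''i'' ''t'' (V ''k'') (V ''t'') zeta_ex) ?\<rho>2 = nums (?L k)"
  proof -
    have "nv h (V ''k'') ?\<rho>2 = k" "ev h (V ''t'') ?\<rho>2 = nums (table k ?F)" using b by simp_all
    then show ?thesis unfolding ev.simps(9) using zit[of k] by (simp only: order.refl)
  qed
  have sfz: "sf h Dd M k (For False ''i'' ''t'' (V ''k'') (V ''t'') zeta_ex) ?\<rho>2"
  proof -
    have "nv h (V ''k'') ?\<rho>2 = k" "ev h (V ''t'') ?\<rho>2 = nums (table k ?F)" using b by simp_all
    then show ?thesis unfolding sf.simps(9) using zit zsf kM by (simp only: sf.simps(1) less_imp_le if_False) simp
  qed
  let ?\<rho>3 = "?\<rho>2(''t'' := nums (?L k))"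
  \<comment> \<open>The expression depends on the number \<open>x\<close> only through this
    function, so \<open>zeta_sum\<close> can be applied to the fold over the transformed
    list.\<close>
  define g where "g x = nv h bird_ex (?\<rho>3(''a'' := Num 0, ''x'' := Num x))" for x
  have bird: "ev h bird_ex (?\<rho>3(''a'' := a, ''x'' := Num (subset_sum ?F I))) = Num (bird_det (vs q) (ep q I))"
    "sf h Dd M k bird_ex (?\<rho>3(''a'' := a, ''x'' := Num (subset_sum ?F I)))" if "I \<subseteq> {..<k}" for a I
  proof -
    interpret packed_bird M N R "vs q" AM "ep q I" using packed[OF that assms(4,3)] .
    have "store (?\<rho>3(''a'' := a, ''x'' := Num (subset_sum ?F I)))"
      using b by (simp add: store_def X_def subset_sum_fm[OF that])
    then show "ev h bird_ex (?\<rho>3(''a'' := a, ''x'' := Num (subset_sum ?F I))) = Num (bird_det (vs q) (ep q I))"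
      "sf h Dd M k bird_ex (?\<rho>3(''a'' := a, ''x'' := Num (subset_sum ?F I)))" by (rule bird_ex)+
  qed
  have g: "g (subset_sum ?F I) = bird_det (vs q) (ep q I)" if "I \<subseteq> {..<k}" for I
    unfolding g_def bird(1)[OF that] by simp
  have gx: "ev h bird_ex (?\<rho>3(''a'' := a, ''x'' := Num x)) = Num (g x)" "sf h Dd M k bird_ex (?\<rho>3(''a'' := a, ''x'' := Num x))" if "x \<in> set (?L k)" for a x
    using zeta_elements[OF that] bird g by auto
  let ?S = "Fold True ''x'' ''a'' (V ''t'') (C 0) (V ''a'' +. bird_ex)"
  let ?fs = "\<lambda>y a. ev h (V ''a'' +. bird_ex) (?\<rho>3(''a'' := a, ''x'' := y))"
  have fs: "fold ?fs (map Num xs) (Num 0) = Num (sum_list (map g xs))" if "set xs \<subseteq> set (?L k)" for xs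
    using that
  proof (induction xs rule: rev_induct)
    case (snoc x xs)
    have "x \<in> set (?L k)" using snoc.prems by simp
    from gx(1)[OF this] show ?case using snoc by (simp del: fun_upd_apply) (simp add: fun_upd_apply)
  qed simp
  have tot: "sum_list (map g (?L k)) = total q"
    unfolding zeta_sum total_def using g by (intro sum.cong) auto
  have S: "ev h ?S ?\<rho>3 = Num (total q)"
    using fs[of "?L k"] tot by simp
  have totM: "total q < 2 ^ M"
  proof -
    have "bird_det (vs q) (ep q I) \<le> R" if "I \<in> Pow {..<k}" for I
    proof -
      have I: "I \<subseteq> {..<k}" using that by simp
      have "vs q - 1 \<le> N" "vs q - 1 < vs q" using vs[OF assms(4,3)] by auto
      from packed_bird.bird_less[OF packed[OF I assms(4,3)] this] show ?thesis unfolding bird_det_def by (rule less_imp_le)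
    qed
    then have "total q \<le> (\<Sum>I\<in>Pow {..<k}. R)" unfolding total_def by (rule sum_mono)
    also have "\<dots> = 2 ^ k * R" by (simp add: card_Pow)
    finally show ?thesis using R_pow(3) by simp
  qed
  have sfS: "sf h Dd M k ?S ?\<rho>3"
  proof -
    have pre: "fold ?fs (take j (map Num (?L k))) (Num 0) = Num (sum_list (map g (take j (?L k))))" for j
      using fs[of "take j (?L k)"] by (simp add: take_map set_take_subset del: fun_upd_apply)
    have le: "sum_list (map g (take j (?L k))) \<le> total q" for j
      unfolding tot[symmetric] by (subst (2) append_take_drop_id[of j, symmetric], unfold map_append sum_list_append) simp
    have "g (?L k ! j) < 2 ^ M" if "j < length (?L k)" for j
    proof -
      have "g (?L k ! j) \<le> sum_list (map g (?L k))" using that by (intro member_le_sum_list) auto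
      then show ?thesis using totM tot by simp
    qed
    then show ?thesis
      using pre le_less_trans[OF le totM] gx length_zeta[of k k ?F] by (simp del: fun_upd_apply) (simp add: fun_upd_apply)
  qed
  let ?\<rho>4 = "?\<rho>3(''S'' := Num (total q))"
  let ?y = "Sum ''y'' (V ''Z'') (V ''S'' /. Pw (V ''B'') (C 2 *. (V ''Z'' *. V ''k'' +. V ''y'')) %. C 2)"
  have v: "ev h (C 2 *. V ''m'' +. C 2 *. (V ''l'' -. V ''q'')) \<rho> = Num (vs q)" using b assms by (simp add: vs_def)
  have qM: "q < 2 ^ M" "l - q < 2 ^ M" "2 * (l - q) < 2 ^ M"
    using assms le N_le by (auto intro!: small simp: N_def)
  show "ev h test_ex \<rho> = Num (\<Sum>y<Z. total q div B ^ (2 * (Z * k + y)) mod 2)"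
    unfolding test_ex_def ev.simps(8) v tab z S using b by simp
  have "sf h Dd M k ?y ?\<rho>4"
  proof -
    have y: "2 * (Z * k + y) \<le> M" "B ^ (2 * (Z * k + y)) < 2 ^ M" "Z * k + y < 2 ^ M" "Z * k < 2 ^ M" "y < 2 ^ M" if "y < Z" for y
    proof -
      have 1: "2 * (Z * k + y) \<le> 2 * (Z * (k + 1))" using that by simp
      then have "B ^ (2 * (Z * k + y)) \<le> B ^ (2 * (Z * (k + 1)))" using B_pos by (intro power_increasing) auto
      then show "B ^ (2 * (Z * k + y)) < 2 ^ M" using Mbig(2) by simp
      show "2 * (Z * k + y) \<le> M" using 1 Mcount(1) by linarith
      then show "Z * k + y < 2 ^ M" "Z * k < 2 ^ M" "y < 2 ^ M" by (auto intro!: small)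
    qed
    have "(\<Sum>y<Z. total q div B ^ (2 * (Z * k + y)) mod 2) \<le> (\<Sum>y<Z. 1)" by (intro sum_mono) simp
    then have "(\<Sum>y<Z. total q div B ^ (2 * (Z * k + y)) mod 2) < 2 ^ M" using room(13) by simp
    moreover have "total q div x < 2 ^ M" for x using totM div_le_dividend le_less_trans by blast
    moreover have "Z \<le> M" using Mcount(1) by simp
    ultimately show ?thesis using b y room B_pow(3) totM by simp
  qed
  moreover have "sf h Dd M k (C 2 *. V ''m'' +. C 2 *. (V ''l'' -. V ''q'')) \<rho>"
    using b assms qM room by simp
  ultimately show "sf h Dd M k test_ex \<rho>"
    unfolding test_ex_def sf.simps(8) v tab z S using sftab sfz sfS by simp
qed

end

text \<open>The binary logarithm, rounded up. Making \<open>W\<close> a power of two makes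
  \<open>W ^ NW\<close> one too, so that the random number can be drawn exactly uniformly by coin
  tosses.\<close>

definition lg :: "nat \<Rightarrow> nat" where
  "lg Q = iter (\<lambda>i a. if 2 ^ a < Q then a + 1 else a) Q 0"

lemma lg: "Q \<le> 2 ^ lg Q" "lg Q \<le> Q" "0 < Q \<Longrightarrow> 2 ^ lg Q \<le> 2 * Q"
  and lg_iter: "j \<le> Q \<Longrightarrow> iter (\<lambda>i a. if 2 ^ a < Q then a + 1 else a) j 0 \<le> j \<and> 2 ^ iter (\<lambda>i a. if 2 ^ a < Q then a + 1 else a) j 0 \<le> max 1 (2 * Q)"
proof -
  let ?i = "\<lambda>j. iter (\<lambda>i a. if 2 ^ a < Q then a + 1 else a) j (0::nat)"
  have 1: "?i j \<le> j" "2 ^ ?i j \<le> max 1 (2 * Q)" "?i j = j \<or> Q \<le> 2 ^ ?i j" for j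
    by (induction j) auto
  show "lg Q \<le> Q" unfolding lg_def by (rule 1)
  show "Q \<le> 2 ^ lg Q" using 1(3)[of Q] less_exp[of Q] unfolding lg_def by auto
  show "2 ^ lg Q \<le> 2 * Q" if "0 < Q" using 1(2)[of Q] that unfolding lg_def by auto
  show "?i j \<le> j \<and> 2 ^ ?i j \<le> max 1 (2 * Q)" using 1 by blast
qed

definition lg_ex :: ex where
  "lg_ex = For False ''i'' ''a'' (V ''Q'') (C 0) (If (Pw (C 2) (V ''a'') <. V ''Q'') (V ''a'' +. C 1) (V ''a''))"

lemma lg_ex:
  assumes "\<rho> ''Q'' = Num Q" "2 * Q + 10 \<le> M"
  shows "ev h lg_ex \<rho> = Num (lg Q)" "sf h D M k lg_ex \<rho>"
proof -
  let ?f = "\<lambda>j a. ev h (If (Pw (C 2) (V ''a'') <. V ''Q'') (V ''a'' +. C 1) (V ''a'')) (\<rho>(''a'' := a, ''i'' := Num j))"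
  let ?i = "\<lambda>j. iter (\<lambda>i a. if 2 ^ a < Q then a + 1 else a) j (0::nat)"
  have it: "iter ?f j (Num 0) = Num (?i j)" for j
  proof (induction j)
    case (Suc j)
    show ?case unfolding iter.simps(2) Suc.IH using assms by simp
  qed simp
  show "ev h lg_ex \<rho> = Num (lg Q)"
  proof -
    have "nv h (V ''Q'') \<rho> = Q" using assms by simp
    then show ?thesis unfolding lg_ex_def ev.simps(9) lg_def using it by (simp only: ev.simps(2))
  qed
  have sm: "x < 2 ^ M" if "x \<le> M" for x using le_less_trans[OF that less_exp] .
  have s: "sf h D M k (If (Pw (C 2) (V ''a'') <. V ''Q'') (V ''a'' +. C 1) (V ''a'')) (\<rho>(''a'' := Num (?i j), ''i'' := Num j))" if "j < Q" for j
  proof -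
    have "?i j \<le> M" "?i j < M" "2 ^ ?i j \<le> M" "Q \<le> M" "(2::nat) \<le> M" "Suc 0 \<le> M" using lg_iter[of j Q] that assms(2) by auto
    then show ?thesis using assms(1) sm by simp
  qed
  have nQ: "nv h (V ''Q'') \<rho> = Q" using assms by simp
  show "sf h D M k lg_ex \<rho>" unfolding lg_ex_def sf.simps(9) ev.simps(2) nQ it
  proof (intro conjI allI impI)
    show "sf h D M k (If (Pw (C 2) (V ''a'') <. V ''Q'') (V ''a'' +. C 1) (V ''a'')) (\<rho>(''a'' := Num (?i j), ''i'' := Num j))" if "j < Q" for j
      by (rule s[OF that])
  qed (use assms(2) in simp_all)
qed

text \<open>The two conditionals discard \<open>q > l\<close> and \<open>3 * q > m\<close>, so that
  \<open>l - q\<close> is never truncated when a test is run.\<close>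

definition core_ex :: ex where
  "core_ex =
    Let ''N'' (C 4 *. V ''n'')
    (Let ''Q'' (C 3 *. (V ''N'' *. V ''N'' *. (V ''n'' +. C 1)))
    (Let ''W'' (Pw (C 2) lg_ex)
    (Let ''Z'' ((V ''N'' +. V ''k'' +. C 1) *. V ''W'')
    (Let ''B'' (C 2 *. Pw (C 2) (V ''k'') *. Pw (C 2) (V ''k'') *. Pw (C 2 *. V ''N'' *. Pw (C 2) (V ''k'')) (V ''N''))
    (Let ''R'' (Pw (C 2 *. V ''N'' *. (Pw (C 2) (V ''k'') *. Pw (V ''B'') (V ''W'' +. V ''k'' *. (V ''W'' +. V ''Z'')))) (V ''N'' +. C 1))
    (Let ''K'' (Pw (C 2) (V ''k''))
      (C 0 <. Sum ''q'' (V ''n'' +. C 1) (If (V ''l'' <. V ''q'') (C 0) (If (V ''m'' <. C 3 *. V ''q'') (C 0) test_ex)))))))))"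

locale core_run = core_bounds +
  assumes W_def: "W = 2 ^ lg (3 * NW)" and Z_def: "Z = (N + k + 1) * W" and Mmore: "(n + 1) * Z \<le> M" "6 * NW + 10 \<le> M"
begin

definition accept :: bool where
  "accept \<longleftrightarrow> (\<exists>q\<le>l. 3 * q \<le> m \<and> (\<exists>y<Z. odd (total q div B ^ (2 * (Z * k + y)))))"

definition input_vars :: "(string \<times> nat) list" where
  "input_vars = [(''r'', r), (''l'', l), (''d'', d), (''n'', n), (''k'', k), (''m'', m), (''D'', D), (''R1'', R1), (''R2'', R2),
     (''SV'', SV), (''LV'', LV)]"

lemma B_parts: "(2 * N * 2 ^ k) ^ N \<le> B" "2 * 2 ^ k * 2 ^ k \<le> B" "2 * N * 2 ^ k \<le> B" "2 ^ k \<le> B" "2 * 2 ^ k \<le> B"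
proof -
  have p: "0 < (2 * N * 2 ^ k) ^ N" using N_le by simp
  have 0: "2 * N * 2 ^ k \<le> (2 * N * 2 ^ k) ^ N" using power_increasing[of 1 N "2 * N * 2 ^ k"] N_le by simp
  show 1: "(2 * N * 2 ^ k) ^ N \<le> B" unfolding B_def by simp
  show 2: "2 * 2 ^ k * 2 ^ k \<le> B" unfolding B_def using mult_le_mono2[OF Suc_leI[OF p], of "2 * 2 ^ k * 2 ^ k"]
    by (simp only: mult_1_right One_nat_def[symmetric])
  show "2 * N * 2 ^ k \<le> B" using 0 1 by simp
  have "(1::nat) \<le> 2 ^ k" by simp
  then have "2 * 2 ^ k * 1 \<le> 2 * 2 ^ k * (2::nat) ^ k" by (intro mult_le_mono) auto
  then show "2 * 2 ^ k \<le> B" using 2 by linarith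
  then show "2 ^ k \<le> B" by simp
qed

theorem core_ex:
  assumes "\<forall>(x, v) \<in> set input_vars. \<rho> x = Num v"
  shows "ev h core_ex \<rho> = enc_bool accept" "sf h Dd M k core_ex \<rho>"
proof -
  have b: "\<rho> ''r'' = Num r" "\<rho> ''l'' = Num l" "\<rho> ''d'' = Num d" "\<rho> ''n'' = Num n" "\<rho> ''k'' = Num k" "\<rho> ''m'' = Num m"
     "\<rho> ''D'' = Num D" "\<rho> ''R1'' = Num R1" "\<rho> ''R2'' = Num R2" "\<rho> ''SV'' = Num SV" "\<rho> ''LV'' = Num LV"
    using assms by (simp_all add: input_vars_def)
  let ?\<rho>1 = "\<rho>(''N'' := Num N)"
  let ?\<rho>2 = "?\<rho>1(''Q'' := Num (3 * NW))"
  let ?\<rho>3 = "?\<rho>2(''W'' := Num W)"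
  let ?\<rho>4 = "?\<rho>3(''Z'' := Num Z)"
  let ?\<rho>5 = "?\<rho>4(''B'' := Num B)"
  let ?\<rho>6 = "?\<rho>5(''R'' := Num R)"
  let ?\<rho>7 = "?\<rho>6(''K'' := Num (2 ^ k))"
  have lgM: "2 * (3 * NW) + 10 \<le> M" using Mmore by simp
  have 1: "ev h (C 4 *. V ''n'') \<rho> = Num N" using b by (simp add: N_def)
  have 2: "ev h (C 3 *. (V ''N'' *. V ''N'' *. (V ''n'' +. C 1))) ?\<rho>1 = Num (3 * NW)" using b by (simp add: NW_def)
  note lgx = lg_ex[of ?\<rho>2 "3 * NW", OF _ lgM, simplified]
  have 3: "ev h (Pw (C 2) lg_ex) ?\<rho>2 = Num W" using lgx(1) by (simp add: W_def)
  have 4: "ev h ((V ''N'' +. V ''k'' +. C 1) *. V ''W'') ?\<rho>3 = Num Z" using b by (simp add: Z_def)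
  have 5: "ev h (C 2 *. Pw (C 2) (V ''k'') *. Pw (C 2) (V ''k'') *. Pw (C 2 *. V ''N'' *. Pw (C 2) (V ''k'')) (V ''N'')) ?\<rho>4 = Num B"
    using b by (simp add: B_def)
  have 6: "ev h (Pw (C 2 *. V ''N'' *. (Pw (C 2) (V ''k'') *. Pw (V ''B'') (V ''W'' +. V ''k'' *. (V ''W'' +. V ''Z'')))) (V ''N'' +. C 1)) ?\<rho>5 = Num R"
    using b by (simp add: R_def AM_def E_def)
  have 7: "ev h (Pw (C 2) (V ''k'')) ?\<rho>6 = Num (2 ^ k)" using b by simp
  have base: "base (?\<rho>7(''q'' := Num q))" for q using b by (simp add: base_def base_vars_def)
  let ?t = "If (V ''l'' <. V ''q'') (C 0) (If (V ''m'' <. C 3 *. V ''q'') (C 0) test_ex)"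
  let ?v = "\<lambda>q. if q \<le> l \<and> 3 * q \<le> m then (\<Sum>y<Z. total q div B ^ (2 * (Z * k + y)) mod 2) else 0"
  have t: "nv h ?t (?\<rho>7(''q'' := Num q)) = ?v q" for q
    using b test_ex(1)[OF base[of q], of q] by (auto simp: not_less)
  have sft: "sf h Dd M k ?t (?\<rho>7(''q'' := Num q))" if "q < n + 1" for q
  proof -
    have "q \<le> M" "3 * q \<le> M" "l \<le> M" "m \<le> M" using that N_le Mcount(5) unfolding N_def NW_def by linarith+
    then have "q < 2 ^ M" "3 * q < 2 ^ M" "l < 2 ^ M" "m < 2 ^ M" "(3::nat) < 2 ^ M" using room by (auto intro!: small)
    then show ?thesis using b test_ex(2)[OF base[of q], of q] by (auto simp: not_less)
  qed
  have tot: "(\<Sum>q<n + 1. ?v q) < 2 ^ M"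
  proof -
    have "?v q \<le> Z" for q
    proof -
      have "(\<Sum>y<Z. total q div B ^ (2 * (Z * k + y)) mod 2) \<le> (\<Sum>y<Z. 1)" by (intro sum_mono) simp
      then show ?thesis by simp
    qed
    then have "(\<Sum>q<n + 1. ?v q) \<le> (\<Sum>q<n + 1. Z)" by (intro sum_mono)
    then have "(\<Sum>q<n + 1. ?v q) \<le> M" using Mmore by simp
    then show ?thesis by (rule small)
  qed
  have s: "nv h (Sum ''q'' (V ''n'' +. C 1) ?t) ?\<rho>7 = (\<Sum>q<n + 1. ?v q)"
    unfolding ev.simps(11) unN.simps t using b by simp
  have acc: "0 < (\<Sum>q<n + 1. ?v q) \<longleftrightarrow> accept"
  proof -
    have "(\<Sum>q<n + 1. ?v q) = 0 \<longleftrightarrow> (\<forall>q<n + 1. ?v q = 0)" by (subst sum_eq_0_iff) auto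
    also have "\<dots> \<longleftrightarrow> (\<forall>q<n + 1. q \<le> l \<longrightarrow> 3 * q \<le> m \<longrightarrow> (\<forall>y<Z. even (total q div B ^ (2 * (Z * k + y)))))"
      by (auto simp: sum_eq_0_iff even_iff_mod_2_eq_zero)
    also have "\<dots> \<longleftrightarrow> \<not> accept" unfolding accept_def using le(3) by fastforce
    finally have X: "(\<Sum>q<n + 1. ?v q) = 0 \<longleftrightarrow> \<not> accept" .
    show ?thesis by (simp only: neq0_conv[symmetric] X not_not)
  qed
  show "ev h core_ex \<rho> = enc_bool accept"
    unfolding core_ex_def ev.simps(8) 1 2 3 4 5 6 7 unfolding ev.simps(3) s using acc by simp
  have s0: "sf h Dd M k (C 0 <. Sum ''q'' (V ''n'' +. C 1) ?t) ?\<rho>7"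
  proof -
    have "sf h Dd M k (Sum ''q'' (V ''n'' +. C 1) ?t) ?\<rho>7"
      unfolding sf.simps(11) s
    proof (intro conjI allI impI)
      have n1: "nv h (V ''n'' +. C 1) ?\<rho>7 = n + 1" using b by simp
      show "sf h Dd M k (V ''n'' +. C 1) ?\<rho>7" using b room by simp
      show "nv h (V ''n'' +. C 1) ?\<rho>7 \<le> M" unfolding n1 using N_le by simp
      show "sf h Dd M k ?t (?\<rho>7(''q'' := Num q))" if "q < nv h (V ''n'' +. C 1) ?\<rho>7" for q
        using sft that unfolding n1 by blast
    qed (rule tot)
    moreover have "nv h (C 0) ?\<rho>7 < 2 ^ M" "sf h Dd M k (C 0) ?\<rho>7" by simp_all
    ultimately show ?thesis unfolding sf.simps(3) s using tot by blast
  qed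
  have p2: "(2::nat) ^ k < 2 ^ M" using kM by (intro power_strict_increasing) auto
  have e1: "W + Z < 2 ^ M" "k * (W + Z) < 2 ^ M" "E < 2 ^ M"
  proof -
    have "Z \<le> 2 * (Z * (k + 1))" by simp
    have "1 \<le> N + k" using N_le by simp
    from mult_le_mono1[OF this, of W] have "W \<le> Z" using Z_large by (simp only: mult_1)
    moreover have "2 * Z \<le> 2 * (Z * (k + 1))" by simp
    ultimately show "W + Z < 2 ^ M" using Mcount(1) by (intro small) linarith
    show "k * (W + Z) < 2 ^ M" "E < 2 ^ M" using Mcount(2) by (auto intro!: small simp: E_def)
  qed
  have e2: "x < 2 ^ M" if "x \<le> B" for x using that B_pow(3) by simp
  have e3: "AM < 2 ^ M" "2 * N * AM < 2 ^ M" "2 * N < 2 ^ M" "2 * N * AM \<le> R"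
  proof -
    have "(2 * N * AM) ^ 1 \<le> R" unfolding R_def using N_le AM_pos by (intro power_increasing) auto
    then show "2 * N * AM \<le> R" by simp
    then show "2 * N * AM < 2 ^ M" using R_pow(2) by simp
    show "AM < 2 ^ M" using BE_le(2) R_pow(2) by simp
    show "2 * N < 2 ^ M" using N_le(1,4) by (intro small) linarith
  qed
  have e4: "N * N < 2 ^ M" "N * N * Suc n < 2 ^ M" "3 * NW < 2 ^ M" "N + k < 2 ^ M" "Suc (N + k) < 2 ^ M" "Suc N < 2 ^ M" "Suc N \<le> M" "4 < (2::nat) ^ M" "lg (3 * NW) \<le> M"
  proof -
    have "N + k + 1 \<le> M" "3 * NW \<le> M" "N * N \<le> M" using N_le Mcount by linarith+
    moreover have "N * N * Suc n = NW" by (simp add: NW_def)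
    ultimately show "N * N < 2 ^ M" "N * N * Suc n < 2 ^ M" "3 * NW < 2 ^ M" "N + k < 2 ^ M" "Suc (N + k) < 2 ^ M" "Suc N < 2 ^ M" "Suc N \<le> M" "4 < (2::nat) ^ M" "lg (3 * NW) \<le> M"
      using Mcount Mmore order.trans[OF lg(2), of "3 * NW" M] by (auto intro!: small)
  qed
  have f1: "sf h Dd M k (C 4 *. V ''n'') \<rho>" using b room e4 by simp
  have f2: "sf h Dd M k (C 3 *. (V ''N'' *. V ''N'' *. (V ''n'' +. C 1))) ?\<rho>1" using b room e4 by simp
  have f3: "sf h Dd M k (Pw (C 2) lg_ex) ?\<rho>2"
    using lgx e4 room le_less_trans[OF lg(2), of "3 * NW" M] Mmore(2) by (simp flip: W_def)
  have f4: "sf h Dd M k ((V ''N'' +. V ''k'' +. C 1) *. V ''W'') ?\<rho>3" using b room e4 by simp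
  have f5: "sf h Dd M k (C 2 *. Pw (C 2) (V ''k'') *. Pw (C 2) (V ''k'') *. Pw (C 2 *. V ''N'' *. Pw (C 2) (V ''k'')) (V ''N'')) ?\<rho>4"
    using b room kM p2 e2[OF B_parts(1)] e2[OF B_parts(2)] e2[OF B_parts(3)] e2[OF B_parts(4)] e2[OF B_parts(5)] e3(3) N_le(5) by simp
  have f6: "sf h Dd M k (Pw (C 2 *. V ''N'' *. (Pw (C 2) (V ''k'') *. Pw (V ''B'') (V ''W'' +. V ''k'' *. (V ''W'' +. V ''Z'')))) (V ''N'' +. C 1)) ?\<rho>5"
  proof -
    have "(2 * N * AM) ^ Suc N < 2 ^ M" using R_pow(2) by (simp add: R_def)
    then show ?thesis
      using b room kM p2 e1 e3 e4 B_pow Mcount(2) N_le(5) by (simp flip: E_def AM_def)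
  qed
  have f7: "sf h Dd M k (Pw (C 2) (V ''k'')) ?\<rho>6" using b p2 kM room by simp
  show "sf h Dd M k core_ex \<rho>"
    unfolding core_ex_def sf.simps(8) 1 2 3 4 5 6 7 using f1 f2 f3 f4 f5 f6 f7 s0 by blast
qed

text \<open>\<open>idx\<close> is a mixed radix number with digits below \<open>N\<close>,
  \<open>N\<close> and \<open>n + 1\<close>, from which the digits are recovered by division with
  remainder.\<close>

lemma test_locale:
  assumes "q \<le> l" "3 * q \<le> m"
  shows "isolated_test idx (vs q) k NW W Z wv"
proof
  have v: "vs q \<le> N" using vs[OF assms] by simp
  show "inj_on (\<lambda>(u, v, i). idx u v i) ({..<vs q} \<times> {..<vs q} \<times> {..k})"
  proof (rule inj_onI, clarsimp)
    fix u v i u' v' i'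
    assume a: "u < vs q" "v < vs q" "i \<le> k" "u' < vs q" "v' < vs q" "i' \<le> k" "idx u v i = idx u' v' i'"
    have i: "i < n + 1" "i' < n + 1" using a le by auto
    have "i = i'" using arg_cong[OF a(7), of "\<lambda>x. x mod (n + 1)"] i unfolding idx_def by (simp only: mod_mult_self3 mod_less)
    moreover have e: "u * N + v = u' * N + v'" using arg_cong[OF a(7), of "\<lambda>x. x div (n + 1)"] i unfolding idx_def by (simp only: div_mult_self3 div_less)
    moreover have "v = v'" using arg_cong[OF e, of "\<lambda>x. x mod N"] a v by simp
    moreover have "u = u'" using arg_cong[OF e, of "\<lambda>x. x div N"] a v by simp
    ultimately show "u = u' \<and> v = v' \<and> i = i'" by simp
  qed
  show "idx u w i < NW" if "u < vs q" "w < vs q" "i \<le> k" for u w i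
    using that v le by (intro idx_less) auto
  show "wv j < W" for j unfolding wv_def by (rule digit_less[OF pos(3)])
  have "(vs q + k) * W \<le> (N + k) * W" using v by (intro mult_le_mono1) simp
  then show "(vs q + k) * W < Z" using Z_large by (rule le_less_trans)
qed

text \<open>A single base \<open>B\<close> serves all guesses: the bound of \<open>sieve_nat\<close>
  is monotone in the number of vertices, and \<open>N\<close> exceeds or equals all of
  these.\<close>

lemma accept_iff: "accept \<longleftrightarrow> (\<exists>q\<le>l. 3 * q \<le> m \<and> isolated_test.accepts idx (vs q) k Z (al q) wv)"
proof -
  have "(\<exists>y<Z. odd (total q div B ^ (2 * (Z * k + y)))) \<longleftrightarrow> isolated_test.accepts idx (vs q) k Z (al q) wv"
    if q: "q \<le> l" "3 * q \<le> m" for q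
  proof -
    have v: "vs q > 0" "vs q \<le> N" using vs[OF q] by auto
    have ev: "even B" by (simp add: B_def)
    have "2 ^ k * (2 ^ k * (2 * vs q * 2 ^ k) ^ vs q) < B"
    proof -
      have "(2 * vs q * 2 ^ k) ^ vs q \<le> (2 * N * 2 ^ k) ^ vs q" using v by (intro power_mono) auto
      also have "\<dots> \<le> (2 * N * 2 ^ k) ^ N" using v by (intro power_increasing) auto
      finally have "2 ^ k * (2 ^ k * (2 * vs q * 2 ^ k) ^ vs q) \<le> 2 ^ k * (2 ^ k * (2 * N * 2 ^ k) ^ N)" by simp
      also have "\<dots> < 2 * (2 ^ k * (2 ^ k * (2 * N * 2 ^ k) ^ N))" using N_le by simp
      also have "\<dots> = B" by (simp add: B_def mult.assoc)
      finally show ?thesis .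
    qed
    from sieve_nat[OF v(1) ev this] show ?thesis
      unfolding isolated_test.accepts_def[OF test_locale[OF q]] total_def ep_def by simp
  qed
  then show ?thesis unfolding accept_def by blast
qed

end


section \<open>Reading the instance\<close>

text \<open>
  A bound on the bit lengths of all numbers and on all loop counts of the algorithm, for input
  size \<open>S\<close>; the exponents \<open>bB\<close> and \<open>bR\<close> bound the bit lengths of the bases \<open>B\<close> and \<open>R\<close>.
\<close>

definition room_for :: "nat \<Rightarrow> nat \<Rightarrow> nat \<Rightarrow> nat \<Rightarrow> nat" where
  "room_for S n k d =
     (let N = 4 * n; NW = N * N * (n + 1); W = 2 ^ lg (3 * NW); Z = (N + k + 1) * W; E = W + k * (W + Z);
          bB = 1 + k + k + (1 + N + k) * N; bR = (1 + N + (k + bB * E)) * (N + 1)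
      in k + bR * (N * N) + bB * (2 * (Z * (k + 1))) + 3 * NW * NW + (n + 1) * Z + 2 * (Z * (k + 1)) + E + 6 * NW + N
         + S * d * (N + k + 2) + k + S + d * (2 * S + 6) + 20)"

lemma mult_le_pow2: "x \<le> 2 ^ a \<Longrightarrow> y \<le> 2 ^ b \<Longrightarrow> x * y \<le> (2::nat) ^ (a + b)"
  by (simp add: power_add mult_le_mono)

lemma pow_le_pow2: "x \<le> 2 ^ a \<Longrightarrow> x ^ e \<le> (2::nat) ^ (a * e)"
  by (simp add: power_mult power_mono)

lemma le_pow2: "x \<le> (2::nat) ^ x" by (simp add: less_imp_le)

lemma less_pow2: "x \<le> 2 ^ a \<Longrightarrow> a < M \<Longrightarrow> x < (2::nat) ^ M"
  by (meson le_less_trans one_less_numeral_iff power_strict_increasing semiring_norm(76))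

text \<open>The exponents follow the factors in the definitions of \<open>B\<close>,
  \<open>AM\<close> and \<open>R\<close>, with the factor \<open>N\<close> estimated by
  \<open>2 ^ N\<close>. This is crude, but it keeps all bit lengths polynomial.\<close>

lemma room_for:
  fixes S n k d :: nat
  defines "N \<equiv> core.N n" and "NW \<equiv> core.NW n" and "M \<equiv> room_for S n k d"
  defines "W \<equiv> 2 ^ lg (3 * core.NW n)"
  defines "Z \<equiv> (core.N n + k + 1) * W"
  defines "E \<equiv> core.E k W Z" and "B \<equiv> core.B n k" and "R \<equiv> core.R n k W Z"
  shows "2 * (Z * (k + 1)) \<le> M" "E \<le> M" "3 * NW + N \<le> M" "d \<le> M" "4 * NW \<le> M" "10 \<le> M"
    "2 ^ k * R ^ (N * N) < 2 ^ M" "B ^ (2 * (Z * (k + 1))) < 2 ^ M" "W ^ NW < 2 ^ M"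
    "(n + 1) * Z \<le> M" "6 * NW + 10 \<le> M" "S * d * (N + k + 2) + k + 10 \<le> M" "S < M" "d * (2 * S + 6) + 10 \<le> M" "S * d < M"
proof -
  note defs = N_def NW_def M_def W_def Z_def E_def B_def R_def core.N_def core.NW_def core.E_def core.B_def core.R_def core.AM_def
  let ?bB = "1 + k + k + (1 + N + k) * N" and ?bA = "k + (1 + k + k + (1 + N + k) * N) * E"
  let ?bR = "(1 + N + ?bA) * (N + 1)"
  have NW: "NW = N * N * (n + 1)" by (simp add: defs)
  have M: "M = k + ?bR * (N * N) + ?bB * (2 * (Z * (k + 1))) + 3 * NW * NW + (n + 1) * Z + 2 * (Z * (k + 1)) + E + 6 * NW + N
         + S * d * (N + k + 2) + k + S + d * (2 * S + 6) + 20"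
    unfolding M_def room_for_def Let_def defs by simp
  have two: "(2::nat) \<le> 2 ^ 1" "(2::nat) ^ k \<le> 2 ^ k" by simp_all
  have B: "B \<le> 2 ^ ?bB"
    unfolding B_def core.B_def N_def[symmetric]
    by (intro mult_le_pow2 pow_le_pow2 two le_pow2)
  have AM: "core.AM n k W Z \<le> 2 ^ ?bA"
    unfolding core.AM_def B_def[symmetric] E_def[symmetric] by (intro mult_le_pow2 pow_le_pow2 two B)
  have R: "R \<le> 2 ^ ?bR"
    unfolding R_def core.R_def N_def[symmetric] by (intro mult_le_pow2 pow_le_pow2 two AM le_pow2)
  have "2 ^ k * R ^ (N * N) \<le> 2 ^ (k + ?bR * (N * N))" by (intro mult_le_pow2 pow_le_pow2 two R)
  then show "2 ^ k * R ^ (N * N) < 2 ^ M" by (rule less_pow2) (simp add: M)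
  have "B ^ (2 * (Z * (k + 1))) \<le> 2 ^ (?bB * (2 * (Z * (k + 1))))" by (intro pow_le_pow2 B)
  then show "B ^ (2 * (Z * (k + 1))) < 2 ^ M" by (rule less_pow2) (simp add: M)
  have "W \<le> 2 ^ (3 * NW)" using lg(2)[of "3 * NW"] by (simp add: W_def NW_def)
  then have "W ^ NW \<le> 2 ^ (3 * NW * NW)" by (rule pow_le_pow2)
  then show "W ^ NW < 2 ^ M" by (rule less_pow2) (simp add: M)
  show "S * d < M"
  proof -
    have "S * d * 1 \<le> S * d * (N + k + 2)" by (rule mult_le_mono2) simp
    then show ?thesis unfolding M by linarith
  qed
  show "d \<le> M"
  proof -
    have "d * 1 \<le> d * (2 * S + 6)" by (rule mult_le_mono2) simp
    then show ?thesis unfolding M by linarith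
  qed
qed (unfold M_def room_for_def Let_def N_def NW_def W_def Z_def E_def core.N_def core.NW_def core.E_def, simp_all)

section \<open>Scaling to integers and packing of vectors\<close>

definition num :: "rat \<Rightarrow> nat" where "num a = nat (fst (quotient_of a))"
definition den :: "rat \<Rightarrow> nat" where "den a = nat (snd (quotient_of a))"

lemma enc_rat: "enc_rat a = Tup (Num (num a)) (Num (den a))"
  by (simp add: enc_rat_def num_def den_def case_prod_unfold)

lemma den_pos: "0 < den a"
  using quotient_of_denom_pos'[of a] by (simp add: den_def)

lemma num_den: "0 \<le> a \<Longrightarrow> a = of_nat (num a) / of_nat (den a)"
proof -
  assume a: "0 \<le> a"
  obtain p q where pq: "quotient_of a = (p, q)" by fastforce
  have q: "q > 0" using quotient_of_denom_pos[OF pq] .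
  have eq: "a = of_int p / of_int q" using quotient_of_div[OF pq] .
  then have "0 \<le> p" using a q by (simp add: zero_le_divide_iff)
  then show ?thesis using eq q pq by (simp add: num_def den_def)
qed

lemma enc_rat_fraction:
  assumes D: "0 < D"
  shows "enc_rat (of_nat c / of_nat D) = Tup (Num (c div gcd c D)) (Num (D div gcd c D))"
proof -
  have "(of_nat c / of_nat D :: rat) = Fract (int c) (int D)" by (simp add: Fract_of_int_quotient)
  then have "quotient_of (of_nat c / of_nat D) = Rat.normalize (int c, int D)" by (simp add: quotient_of_Fract)
  also have "\<dots> = (int c div gcd (int c) (int D), int D div gcd (int c) (int D))" using D by (simp add: Rat.normalize_def Let_def)
  finally show ?thesis by (simp add: enc_rat num_def den_def nat_div_distrib)
qed

definition hval :: "nat \<Rightarrow> ('a \<Rightarrow> nat) \<Rightarrow> 'a list \<Rightarrow> nat" where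
  "hval R f ys = (\<Sum>a<length ys. f (ys ! a) * R ^ a)"

lemma hval_Cons: "hval R f (y # ys) = f y + hval R f ys * R"
  by (simp add: hval_def lessThan_Suc_eq_insert_0 sum.reindex zero_notin_Suc_image sum_distrib_right mult.assoc mult.commute[of R])

lemma hval_Nil [simp]: "hval R f [] = 0" by (simp add: hval_def)

lemma hval_less: "(\<And>y. y \<in> set ys \<Longrightarrow> f y < R) \<Longrightarrow> hval R f ys < R ^ length ys"
  unfolding hval_def by (rule digit_sum_less) auto

lemma hval_digit: "(\<And>y. y \<in> set ys \<Longrightarrow> f y < R) \<Longrightarrow> i < length ys \<Longrightarrow> digit R i (hval R f ys) = f (ys ! i)"
  unfolding hval_def digit_def by (rule digit_sum) auto

lemma hval_digit_0: "(\<And>y. y \<in> set ys \<Longrightarrow> f y < R) \<Longrightarrow> length ys \<le> i \<Longrightarrow> digit R i (hval R f ys) = 0"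
proof -
  assume a: "\<And>y. y \<in> set ys \<Longrightarrow> f y < R" "length ys \<le> i"
  show ?thesis
  proof (cases "R = 0")
    case True
    then have "ys = []" using a(1) by (cases ys) auto
    then show ?thesis by (simp add: digit_def)
  next
    case False
    then have "hval R f ys < R ^ i" using hval_less[of ys f R] a power_increasing[of "length ys" i R] by force
    then show ?thesis by (simp add: digit_def)
  qed
qed

text \<open>A pass from left to right makes the last element digit 0. This is the origin of the
  reversed lists \<open>sl\<close> and \<open>ll\<close>.\<close>

lemma fold_horner:
  "fold (\<lambda>x a. if p x then a * R + f x else a) xs 0 = hval R f (rev (filter p xs))"
  by (induction xs rule: rev_induct) (auto simp: hval_Cons)

lemma fold_add: "fold (\<lambda>x a. a + f x) xs (c::nat) = c + sum_list (map f xs)"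
  by (induction xs arbitrary: c) auto

lemma fold_mult: "fold (\<lambda>x a. a * f x) xs (c::nat) = c * prod_list (map f xs)"
  by (induction xs arbitrary: c) auto

text \<open>Reduces a fold with a numeric accumulator to a fold on natural numbers, for its value as
  well as for its safety.\<close>

lemma Fold_Num:
  assumes l: "list_of (ev h l \<rho>) = map e xs" and s: "ev h s \<rho> = Num c"
    and step: "\<And>y a. y \<in> set xs \<Longrightarrow> ev h b (\<rho>(z := Num a, x := e y)) = Num (g y a)"
  shows "ev h (Fold big x z l s b) \<rho> = Num (fold g xs c)"
    and "sf h D M k l \<rho> \<Longrightarrow> sf h D M k s \<rho> \<Longrightarrow> length xs \<le> (if big then 2 ^ k else M) \<Longrightarrow>
      (\<And>j. j < length xs \<Longrightarrow> sf h D M k b (\<rho>(z := Num (fold g (take j xs) c), x := e (xs ! j)))) \<Longrightarrow>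
      sf h D M k (Fold big x z l s b) \<rho>"
proof -
  have f: "fold (\<lambda>y a. ev h b (\<rho>(z := a, x := y))) (map e ys) (Num c) = Num (fold g ys c)" if "set ys \<subseteq> set xs" for ys
    using that
  proof (induction ys rule: rev_induct)
    case (snoc y ys)
    have IH: "fold (\<lambda>y a. ev h b (\<rho>(z := a, x := y))) (map e ys) (Num c) = Num (fold g ys c)"
      by (rule snoc.IH) (use snoc.prems in simp)
    have y: "y \<in> set xs" using snoc.prems by simp
    show ?case by (simp only: map_append list.map fold_append fold_simps o_apply IH step[OF y])
  qed simp
  show "ev h (Fold big x z l s b) \<rho> = Num (fold g xs c)" using f[of xs] by (simp add: l s)
  assume a: "sf h D M k l \<rho>" "sf h D M k s \<rho>" "length xs \<le> (if big then 2 ^ k else M)"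
      "\<And>j. j < length xs \<Longrightarrow> sf h D M k b (\<rho>(z := Num (fold g (take j xs) c), x := e (xs ! j)))"
  have t: "fold (\<lambda>y a. ev h b (\<rho>(z := a, x := y))) (take j (map e xs)) (Num c) = Num (fold g (take j xs) c)" for j
    using f[of "take j xs"] set_take_subset[of j xs] by (simp only: take_map)
  show "sf h D M k (Fold big x z l s b) \<rho>"
    unfolding sf.simps(10) l s length_map
  proof (intro conjI allI impI)
    show "sf h D M k b (\<rho>(z := fold (\<lambda>y a. ev h b (\<rho>(z := a, x := y))) (take j (map e xs)) (Num c), x := map e xs ! j))" if "j < length xs" for j
      unfolding t nth_map[OF that] by (rule a(4)[OF that])
  qed (use a in auto)
qed

lemma prod_list_take_le: "(\<And>x. x \<in> set xs \<Longrightarrow> 0 < x) \<Longrightarrow> prod_list (take j xs) \<le> prod_list (xs :: nat list)"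
proof -
  assume a: "\<And>x. x \<in> set xs \<Longrightarrow> 0 < x"
  have "0 < prod_list (drop j xs)" using a set_drop_subset[of j xs]
    by (metis gr0I in_mono less_irrefl prod_list_zero_iff)
  then have "prod_list (take j xs) * 1 \<le> prod_list (take j xs) * prod_list (drop j xs)" by (intro mult_le_mono2) simp
  then show ?thesis by (metis append_take_drop_id mult.right_neutral prod_list.append)
qed

lemma sum_list_take_le: "sum_list (take j xs) \<le> sum_list (xs :: nat list)"
  by (metis append_take_drop_id le_add1 sum_list.append)

lemma bits_enc_list: "bits (enc_list xs) = 1 + (\<Sum>x\<leftarrow>xs. 1 + bits x)"
  by (induction xs) (auto simp: floorlog_def)

lemma prod_list_le_pow2: "(\<And>x. x \<in> set xs \<Longrightarrow> f x \<le> 2 ^ g x) \<Longrightarrow> prod_list (map f xs) \<le> (2::nat) ^ sum_list (map g xs)"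
  by (induction xs) (auto intro!: mult_le_pow2)

text \<open>The summand 1 carries the induction, by
  \<open>a + b + 1 \<le> (a + 1) * (b + 1)\<close>; it also bounds the factor \<open>e + 1\<close>
  of \<open>R1\<close>.\<close>

lemma sum_list_le_pow2: "(\<And>x. x \<in> set xs \<Longrightarrow> f x + 1 \<le> 2 ^ g x) \<Longrightarrow> sum_list (map f xs) + 1 \<le> (2::nat) ^ sum_list (map g xs)"
proof (induction xs)
  case (Cons x xs)
  have "f x + sum_list (map f xs) + 1 \<le> (f x + 1) * (sum_list (map f xs) + 1)" by simp
  also have "\<dots> \<le> 2 ^ g x * 2 ^ sum_list (map g xs)" using Cons by (intro mult_le_mono) auto
  finally show ?case by (simp add: power_add)
qed simp

lemma floorlog2_less: "x < 2 ^ floorlog 2 x"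
  using floorlog_leD[of 2 x "floorlog 2 x"] by simp

lemma dvd_prod_list: "x \<in> set xs \<Longrightarrow> x dvd prod_list (xs :: nat list)"
  by (induction xs) auto

lemma den_neq_0: "den a \<noteq> 0"
  using den_pos[of a] by simp

locale instance_run =
  fixes P :: "rat list \<Rightarrow> bool" and I :: vbc and h :: "val \<Rightarrow> val" and Dd :: "nat \<Rightarrow> val \<Rightarrow> bool"
  assumes inst: "vbc_instance P I"
    and P_mono: "\<And>x y. nonneg_vec x \<Longrightarrow> nonneg_vec y \<Longrightarrow> list_all2 (\<le>) x y \<Longrightarrow> P x \<Longrightarrow> P y"
    and h: "\<And>x. nonneg_vec x \<Longrightarrow> h (enc_vec x) = enc_bool (P x)"
    and Dd: "\<And>x M. nonneg_vec x \<Longrightarrow> bits (enc_vec x) \<le> M \<Longrightarrow> Dd M (enc_vec x)"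
begin

definition "n = length (items I)"
definition "d = dim I"
definition "l = bins I"
definition "S = bits (enc_vbc I)"
definition "sl = rev (filter (\<lambda>i. i \<in> small I) [0..<n])"
definition "ll = rev (filter (\<lambda>i. i \<notin> small I) [0..<n])"
definition "k = length sl"
definition "m = length ll"
text \<open>The product of all denominators instead of their least common multiple: its length is
  still at most the input size. With \<open>e\<close> the sum of all numerators, a coordinate of any
  sum of scaled items is at most \<open>e * D < R1\<close>, so packed vectors are added without
  carries.\<close>

definition "D = prod_list (map (\<lambda>i. prod_list (map den (items I ! i))) [0..<n])"
definition "e = sum_list (map (\<lambda>i. sum_list (map num (items I ! i))) [0..<n])"
definition "R1 = D * (e + 1)"
definition "R2 = R1 ^ d"
definition sc :: "rat \<Rightarrow> nat" where "sc a = num a * (D div den a)"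
definition PV :: "nat \<Rightarrow> nat" where "PV i = hval R1 sc (rev (items I ! i))"
definition "SV = hval R2 PV sl"
definition "LV = hval R2 PV ll"
definition "M = room_for S n k d"

lemma item: "i < n \<Longrightarrow> length (items I ! i) = d" "i < n \<Longrightarrow> a \<in> set (items I ! i) \<Longrightarrow> 0 \<le> a"
  using inst by (auto simp: vbc_instance_def n_def d_def nonneg_vec_def)

lemma k_eq: "k = card (small I)"
proof -
  have "small I \<subseteq> {..<n}" using inst by (simp add: vbc_instance_def n_def)
  then have "set sl = small I" by (auto simp: sl_def)
  moreover have "distinct sl" by (simp add: sl_def)
  ultimately show ?thesis using distinct_card[of sl] by (simp add: k_def)
qed

lemma km: "k + m = n"
  using sum_length_filter_compl[of "\<lambda>i. i \<in> small I" "[0..<n]"] by (simp add: k_def m_def sl_def ll_def)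

lemma D_pos: "0 < D"
  unfolding D_def by (intro Nat.gr0I) (auto simp: prod_list_zero_iff den_neq_0)

text \<open>A product of denominators is as long as the denominators written side by side, and
  likewise for the sum of the numerators. Since both are part of the input, \<open>R1\<close> has no
  more than about \<open>S\<close> bits.\<close>

lemma sizes: "n \<le> S" "d \<le> S" "l < 2 ^ S" "R1 \<le> 2 ^ S"
proof -
  let ?it = "\<lambda>i. Tup (enc_bool (i \<in> small I)) (enc_vec (items I ! i))"
  have S: "S = 1 + (1 + floorlog 2 l) + (1 + (1 + 2 * d) + (1 + (\<Sum>i\<leftarrow>[0..<n]. 1 + bits (?it i))))"
  proof -
    have 1: "bits (enc_list (replicate d (Num 0))) = 1 + 2 * d"
      by (simp add: bits_enc_list sum_list_replicate floorlog_def)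
    have 2: "bits (enc_list (map ?it [0..<n])) = 1 + (\<Sum>i\<leftarrow>[0..<n]. 1 + bits (?it i))"
      by (simp only: bits_enc_list map_map o_def)
    have "S = bits (Tup (Num l) (Tup (enc_list (replicate d (Num 0))) (enc_list (map ?it [0..<n]))))"
      by (simp only: S_def enc_vbc_def l_def d_def n_def)
    then show ?thesis by (simp only: bits.simps(1) bits.simps(2)[of "Num l"] bits.simps(2)[of "enc_list (replicate d (Num 0))"] 1 2)
  qed
  have "(\<Sum>i\<leftarrow>[0..<n]. 1) \<le> (\<Sum>i\<leftarrow>[0..<n]. 1 + bits (?it i))" by (intro sum_list_mono) auto
  then show "n \<le> S" "d \<le> S" using S by (auto simp: sum_list_triv)
  have "l < 2 ^ floorlog 2 l" by (rule floorlog2_less)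
  also have "(2::nat) ^ floorlog 2 l \<le> 2 ^ S" using S by (intro power_increasing) auto
  finally show "l < 2 ^ S" .
  let ?a = "\<lambda>v. \<Sum>a\<leftarrow>v. floorlog 2 (den a)" and ?b = "\<lambda>v. \<Sum>a\<leftarrow>v. floorlog 2 (num a)"
  have "D \<le> 2 ^ (\<Sum>i\<leftarrow>[0..<n]. ?a (items I ! i))"
    unfolding D_def by (intro prod_list_le_pow2 less_imp_le[OF floorlog2_less])
  moreover have "e + 1 \<le> 2 ^ (\<Sum>i\<leftarrow>[0..<n]. ?b (items I ! i))"
    unfolding e_def by (intro sum_list_le_pow2) (simp add: Suc_le_eq floorlog2_less)
  ultimately have "R1 \<le> 2 ^ ((\<Sum>i\<leftarrow>[0..<n]. ?a (items I ! i)) + (\<Sum>i\<leftarrow>[0..<n]. ?b (items I ! i)))"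
    unfolding R1_def by (rule mult_le_pow2)
  also have "\<dots> \<le> 2 ^ S"
  proof (rule power_increasing)
    have "?a v + ?b v \<le> bits (enc_vec v)" for v
    proof -
      have "?a v + ?b v = (\<Sum>a\<leftarrow>v. floorlog 2 (den a) + floorlog 2 (num a))" by (simp add: sum_list_addf)
      also have "\<dots> \<le> (\<Sum>a\<leftarrow>v. 1 + bits (enc_rat a))" by (intro sum_list_mono) (simp add: enc_rat)
      also have "\<dots> \<le> bits (enc_vec v)" by (simp add: enc_vec_def bits_enc_list o_def)
      finally show ?thesis .
    qed
    then have "?a (items I ! i) + ?b (items I ! i) \<le> 1 + bits (?it i)" for i
      unfolding bits.simps by (meson le_add2 order.trans)
    then have "(\<Sum>i\<leftarrow>[0..<n]. ?a (items I ! i) + ?b (items I ! i)) \<le> (\<Sum>i\<leftarrow>[0..<n]. 1 + bits (?it i))"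
      by (intro sum_list_mono)
    also have "\<dots> \<le> S" using S by simp
    finally show "(\<Sum>i\<leftarrow>[0..<n]. ?a (items I ! i)) + (\<Sum>i\<leftarrow>[0..<n]. ?b (items I ! i)) \<le> S" by (simp add: sum_list_addf)
  qed simp
  finally show "R1 \<le> 2 ^ S" .
qed

lemma R1_bounds: "0 < R1" "D \<le> R1" "e < R1"
proof -
  show "0 < R1" "D \<le> R1" using D_pos by (auto simp: R1_def)
  have "1 * (e + 1) \<le> R1" unfolding R1_def using D_pos by (intro mult_le_mono1) simp
  then show "e < R1" by simp
qed

lemma den_dvd: "i < n \<Longrightarrow> a \<in> set (items I ! i) \<Longrightarrow> den a dvd D"
  by (rule dvd_trans[OF dvd_prod_list[of "den a" "map den (items I ! i)"]]) (auto simp: D_def intro!: dvd_prod_list)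

lemma den_le: "i < n \<Longrightarrow> a \<in> set (items I ! i) \<Longrightarrow> den a \<le> D"
  using den_dvd D_pos by (simp add: dvd_imp_le)

lemma num_le: "i < n \<Longrightarrow> a \<in> set (items I ! i) \<Longrightarrow> num a \<le> e"
proof -
  assume a: "i < n" "a \<in> set (items I ! i)"
  have "num a \<le> sum_list (map num (items I ! i))" using a by (intro member_le_sum_list) auto
  also have "\<dots> \<le> e" unfolding e_def using a by (intro member_le_sum_list) auto
  finally show ?thesis .
qed

lemma sc_less: "i < n \<Longrightarrow> a \<in> set (items I ! i) \<Longrightarrow> sc a < R1"
proof -
  assume a: "i < n" "a \<in> set (items I ! i)"
  have "sc a \<le> e * D" unfolding sc_def using num_le[OF a] by (intro mult_le_mono) auto
  also have "\<dots> < R1" using D_pos by (simp add: R1_def)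
  finally show ?thesis .
qed

lemma sc_rat: "i < n \<Longrightarrow> a \<in> set (items I ! i) \<Longrightarrow> a = of_nat (sc a) / of_nat D"
proof -
  assume a: "i < n" "a \<in> set (items I ! i)"
  obtain c where c: "D = den a * c" using den_dvd[OF a] by (auto elim: dvdE)
  have "D div den a = c" using c den_pos[of a] by simp
  moreover have "a = of_nat (num a) / of_nat (den a)" using num_den item(2)[OF a] .
  ultimately show ?thesis using c D_pos by (simp add: sc_def)
qed

lemma PV_less: "i < n \<Longrightarrow> PV i < R2"
  unfolding PV_def R2_def using hval_less[of "rev (items I ! i)" sc R1] sc_less[of i] item(1)[of i] by simp

definition c :: "nat set \<Rightarrow> nat \<Rightarrow> nat" where "c A j = (\<Sum>i\<in>A. sc (items I ! i ! j))"

lemma c_less: "A \<subseteq> {..<n} \<Longrightarrow> j < d \<Longrightarrow> c A j < R1"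
proof -
  assume A: "A \<subseteq> {..<n}" and j: "j < d"
  have "c A j \<le> (\<Sum>i\<in>A. sum_list (map num (items I ! i)) * D)"
  proof (unfold c_def, rule sum_mono)
    fix i assume "i \<in> A"
    then have "items I ! i ! j \<in> set (items I ! i)" using A j item(1)[of i] by auto
    then have "num (items I ! i ! j) \<le> sum_list (map num (items I ! i))" by (intro member_le_sum_list) auto
    then show "sc (items I ! i ! j) \<le> sum_list (map num (items I ! i)) * D" unfolding sc_def by (intro mult_le_mono) auto
  qed
  also have "\<dots> \<le> (\<Sum>i<n. sum_list (map num (items I ! i)) * D)" using A by (intro sum_mono2) auto
  also have "\<dots> = e * D" by (simp add: e_def interv_sum_list_conv_sum_set_nat atLeast0LessThan sum_distrib_right)
  also have "\<dots> < R1" using D_pos by (simp add: R1_def)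
  finally show ?thesis .
qed

text \<open>Coordinate \<open>j\<close> sits at digit \<open>d - 1 - j\<close>, the order in which
  \<open>unpack_ex\<close> consumes the digits.\<close>

lemma sum_PV: "A \<subseteq> {..<n} \<Longrightarrow> (\<Sum>i\<in>A. PV i) = (\<Sum>p<d. c A (d - 1 - p) * R1 ^ p)"
proof -
  assume A: "A \<subseteq> {..<n}"
  have "(\<Sum>i\<in>A. PV i) = (\<Sum>i\<in>A. \<Sum>p<d. sc (items I ! i ! (d - 1 - p)) * R1 ^ p)"
    unfolding PV_def hval_def using A item(1) by (intro sum.cong) (auto simp: rev_nth)
  also have "\<dots> = (\<Sum>p<d. \<Sum>i\<in>A. sc (items I ! i ! (d - 1 - p)) * R1 ^ p)" by (rule sum.swap)
  finally show ?thesis by (simp add: c_def sum_distrib_right)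
qed

lemma nonneg_vec_sum: "A \<subseteq> {..<n} \<Longrightarrow> nonneg_vec (vec_sum d (items I) A)"
  unfolding nonneg_vec_def vec_sum_def using item by (auto intro!: sum_nonneg simp: subset_iff)

abbreviation "cov A \<equiv> covers P d (items I) A"

lemma room: "S < M" "R1 < 2 ^ M" "D < 2 ^ M" "l < 2 ^ M" "R2 < 2 ^ M" "R1 ^ j < 2 ^ M" if "j \<le> d" for j
proof -
  have SM: "S < M" "S * d < M" unfolding M_def using room_for(13,15) by auto
  show "S < M" by (rule SM)
  show "R1 < 2 ^ M" using sizes(4) SM(1) by (rule less_pow2)
  then show "D < 2 ^ M" using R1_bounds by simp
  show "l < 2 ^ M" using sizes(3) SM(1) by (intro less_pow2[of l S]) auto
  have "R1 ^ j < 2 ^ M" if "j \<le> d" for j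
  proof (rule less_pow2[OF pow_le_pow2[OF sizes(4)]])
    show "S * j < M" using mult_le_mono2[OF that, of S] SM(2) by (rule le_less_trans)
  qed
  then show "R1 ^ j < 2 ^ M" "R2 < 2 ^ M" using that by (auto simp: R2_def)
qed

lemma unpack_ex:
  assumes A: "A \<subseteq> {..<n}" and st: "\<rho> ''X'' = Num (\<Sum>i\<in>A. PV i)" "\<rho> ''R1'' = Num R1" "\<rho> ''D'' = Num D" "\<rho> ''d'' = Num d"
  shows "ev h (Call unpack_ex) \<rho> = enc_bool (cov A)" "sf h Dd M k (Call unpack_ex) \<rho>"
proof -
  let ?X = "\<Sum>i\<in>A. PV i"
  let ?x = "\<lambda>j. \<Sum>i\<in>A. items I ! i ! j"
  let ?b = "Let ''c'' (digit_ex (V ''X'') (V ''R1'') (V ''j'')) (Let ''g'' (Gcd (V ''c'') (V ''D''))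
       (Pr (Pr (V ''c'' /. V ''g'') (V ''D'' /. V ''g'')) (V ''a'')))"
  let ?f = "\<lambda>j a. ev h ?b (\<rho>(''a'' := a, ''j'' := Num j))"
  have dig: "digit R1 j ?X = c A (d - 1 - j)" if "j < d" for j
    unfolding sum_PV[OF A] digit_def by (rule digit_sum) (use that c_less[OF A] in auto)
  have x: "?x j = of_nat (c A j) / of_nat D" if "j < d" for j
  proof -
    have "?x j = (\<Sum>i\<in>A. of_nat (sc (items I ! i ! j)) / of_nat D)"
    proof (rule sum.cong[OF refl])
      fix i assume i: "i \<in> A"
      then have "items I ! i ! j \<in> set (items I ! i)" using A that item(1)[of i] by auto
      then show "items I ! i ! j = of_nat (sc (items I ! i ! j)) / of_nat D" using sc_rat[of i] A i by blast
    qed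
    then show ?thesis by (simp add: c_def sum_divide_distrib)
  qed
  have step: "?f j a = Tup (enc_rat (?x (d - 1 - j))) a" if "j < d" for j a
    using that st dig[OF that] by (simp add: x enc_rat_fraction[OF D_pos])
  have it: "iter ?f j (Num 0) = enc_list (map (\<lambda>j. enc_rat (?x j)) [d - j..<d])" if "j \<le> d" for j
    using that
  proof (induction j)
    case (Suc j)
    then have j: "j < d" by simp
    have eq: "[d - Suc j..<d] = (d - 1 - j) # [d - j..<d]"
      using j upt_conv_Cons[of "d - Suc j" d] by (simp add: Suc_diff_Suc)
    show ?case unfolding iter.simps Suc.IH[OF less_imp_le[OF j]] step[OF j] eq by simp
  qed simp
  have nd: "nv h (V ''d'') \<rho> = d" using st by simp
  have u: "ev h unpack_ex \<rho> = enc_vec (vec_sum d (items I) A)"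
    unfolding unpack_ex_def ev.simps(9) nd ev.simps(2) it[OF order.refl] enc_vec_def vec_sum_def by (simp add: o_def)
  show "ev h (Call unpack_ex) \<rho> = enc_bool (cov A)"
    by (simp add: u h[OF nonneg_vec_sum[OF A]] covers_def)
  have cM: "c A j < 2 ^ M" if "j < d" for j using c_less[OF A that] room(2)[of 0] by simp
  have XM: "?X < 2 ^ M"
  proof -
    have "?X < R1 ^ d" unfolding sum_PV[OF A] by (rule digit_sum_less) (use c_less[OF A] in auto)
    then show ?thesis using room(6)[of d] by simp
  qed
  have dM: "d \<le> M" unfolding M_def by (rule room_for)
  have sfb: "sf h Dd M k ?b (\<rho>(''a'' := a, ''j'' := Num j))" if "j < d" for j a
  proof -
    have "gcd (c A (d - Suc j)) D \<le> D" using D_pos by (simp add: gcd_le2_nat)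
    then have g: "gcd (c A (d - Suc j)) D < 2 ^ M" using room(3)[of 0] by simp
    have "sf h Dd M k (digit_ex (V ''X'') (V ''R1'') (V ''j'')) (\<rho>(''a'' := a, ''j'' := Num j))"
      using that st XM dM room(2)[of 0] room(6)[of j] by (intro sf_digit) auto
    then show ?thesis using that st dig[OF that] cM[of "d - Suc j"] room(3)[of 0] g by simp
  qed
  have "sf h Dd M k unpack_ex \<rho>"
    unfolding unpack_ex_def sf.simps(9) nd ev.simps(2)
  proof (intro conjI allI impI)
    show "sf h Dd M k ?b (\<rho>(''a'' := iter ?f j (Num 0), ''j'' := Num j))" if "j < d" for j by (rule sfb[OF that])
  qed (use dM in simp_all)
  \<comment> \<open>The oracle is charged for the size of its query: each reduced fraction has
    numerator and denominator at most \<open>R1\<close>, hence about \<open>S\<close> bits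
    each.\<close>
  moreover have "Dd M (enc_vec (vec_sum d (items I) A))"
  proof (rule Dd[OF nonneg_vec_sum[OF A]])
    have "bits (enc_rat (?x j)) \<le> 2 * S + 5" if "j < d" for j
    proof -
      have "floorlog 2 y \<le> S + 1" if "y \<le> R1" for y
      proof -
        have "y < 2 ^ (S + 1)" using that sizes(4) less_pow2[of y S "S + 1"] by simp
        then show ?thesis by (simp add: floorlog_le_iff)
      qed
      moreover have "c A j div gcd (c A j) D \<le> R1" "D div gcd (c A j) D \<le> R1"
        using c_less[OF A that] R1_bounds(2) by (meson div_le_dividend less_imp_le order.trans)+
      ultimately have "floorlog 2 (c A j div gcd (c A j) D) \<le> S + 1" "floorlog 2 (D div gcd (c A j) D) \<le> S + 1" by blast+
      then show ?thesis unfolding x[OF that] enc_rat_fraction[OF D_pos] by simp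
    qed
    then have "1 + bits (enc_rat (?x j)) \<le> 2 * S + 6" if "j \<in> set [0..<d]" for j using that by (simp add: add.commute)
    then have "(\<Sum>j\<leftarrow>[0..<d]. 1 + bits (enc_rat (?x j))) \<le> (\<Sum>j\<leftarrow>[0..<d]. 2 * S + 6)" by (rule sum_list_mono)
    then have "bits (enc_vec (vec_sum d (items I) A)) \<le> 1 + d * (2 * S + 6)"
      by (simp add: enc_vec_def vec_sum_def bits_enc_list o_def sum_list_triv)
    also have "\<dots> \<le> M" unfolding M_def using room_for(14)[of d S n k] by linarith
    finally show "bits (enc_vec (vec_sum d (items I) A)) \<le> M" .
  qed
  ultimately show "sf h Dd M k (Call unpack_ex) \<rho>" by (simp add: u)
qed

sublocale BC: bin_cover n l cov sl ll
proof
  show "cov B" if "A \<subseteq> B" "B \<subseteq> {..<n}" "cov A" for A B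
  proof -
    have "list_all2 (\<le>) (vec_sum d (items I) A) (vec_sum d (items I) B)"
      unfolding vec_sum_def list_all2_map1 list_all2_map2
    proof (rule list_all2_all_nthI, simp, simp)
      fix j assume j: "j < d"
      have fin: "finite B" using that(2) finite_subset by blast
      show "(\<Sum>i\<in>A. items I ! i ! j) \<le> (\<Sum>i\<in>B. items I ! i ! j)"
        using that(1,2) item j fin by (intro sum_mono2) auto
    qed
    then show ?thesis using P_mono nonneg_vec_sum that unfolding covers_def by (meson order.trans)
  qed
  have "three_covering P d (items I) ({..<n} - small I)" using inst by (simp add: vbc_instance_def d_def n_def)
  then show "cov {a, b, c}" if "a \<in> set ll" "b \<in> set ll" "c \<in> set ll" "a \<noteq> b" "a \<noteq> c" "b \<noteq> c" for a b c
    using that unfolding three_covering_def ll_def by auto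
  show "l > 0" using inst by (simp add: vbc_instance_def l_def)
qed (auto simp: sl_def ll_def)

lemma solvable_iff: "BC.solvable \<longleftrightarrow> vbc_solvable P I"
  unfolding BC.solvable_def vbc_solvable_def by (simp add: n_def l_def d_def)

end

section \<open>Parsing the encoded instance\<close>

definition count_ex :: "string \<Rightarrow> ex" where
  "count_ex s = Fold False ''x'' ''a'' (V s) (C 0) (V ''a'' +. C 1)"

definition vec_ex :: ex where
  "vec_ex = Fold False ''y'' ''b'' (Tl (V ''x'')) (C 0) (V ''b'' *. V ''R1'' +. Hd (V ''y'') *. (V ''D'' /. Tl (V ''y'')))"

definition parse_ex :: "ex \<Rightarrow> ex" where
  "parse_ex body =
    Let ''r'' (Hd (V ''I''))
    (Let ''l'' (Hd (Tl (V ''I'')))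
    (Let ''o'' (Hd (Tl (Tl (V ''I''))))
    (Let ''s'' (Tl (Tl (Tl (V ''I''))))
    (Let ''d'' (count_ex ''o'')
    (Let ''n'' (count_ex ''s'')
    (Let ''k'' (Fold False ''x'' ''a'' (V ''s'') (C 0) (V ''a'' +. Hd (V ''x'')))
    (Let ''m'' (V ''n'' -. V ''k'')
    (Let ''D'' (Fold False ''x'' ''a'' (V ''s'') (C 1) (Fold False ''y'' ''b'' (Tl (V ''x'')) (V ''a'') (V ''b'' *. Tl (V ''y''))))
    (Let ''e'' (Fold False ''x'' ''a'' (V ''s'') (C 0) (Fold False ''y'' ''b'' (Tl (V ''x'')) (V ''a'') (V ''b'' +. Hd (V ''y''))))
    (Let ''R1'' (V ''D'' *. (V ''e'' +. C 1))
    (Let ''R2'' (Pw (V ''R1'') (V ''d''))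
    (Let ''SV'' (Fold False ''x'' ''a'' (V ''s'') (C 0) (If (Hd (V ''x'')) (V ''a'' *. V ''R2'' +. vec_ex) (V ''a'')))
    (Let ''LV'' (Fold False ''x'' ''a'' (V ''s'') (C 0) (If (Hd (V ''x'')) (V ''a'') (V ''a'' *. V ''R2'' +. vec_ex)))
      body)))))))))))))"

definition main_ex :: ex where
  "main_ex = parse_ex (If (V ''n'' <. V ''l'') (Let ''X'' (C 0) (Call unpack_ex)) core_ex)"

text \<open>Computes the number \<open>NB\<close> of coin tosses. It runs before the random number
  exists and therefore reads the bare instance.\<close>

definition pre_ex :: ex where
  "pre_ex = Let ''s'' (Tl (Tl (V ''I''))) (Let ''n'' (count_ex ''s'')
    (Let ''w'' (C 4 *. V ''n'' *. (C 4 *. V ''n'') *. (V ''n'' +. C 1)) (Let ''Q'' (C 3 *. V ''w'') (lg_ex *. V ''w''))))"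

lemma count_ex:
  assumes "list_of (\<rho> s) = map g xs"
  shows "ev h (count_ex s) \<rho> = Num (length xs)"
    and "length xs < M \<Longrightarrow> sf h D M k (count_ex s) \<rho>"
proof -
  have l: "list_of (ev h (V s) \<rho>) = map g xs" using assms by simp
  have f: "fold (\<lambda>y. Suc) ys (c::nat) = c + length ys" for ys :: "'a list" and c by (induction ys arbitrary: c) auto
  note F = Fold_Num[where h = h and \<rho> = \<rho> and l = "V s" and s = "C 0" and c = 0 and b = "V ''a'' +. C 1" and z = "''a''" and x = "''x''"
     and xs = xs and e = g and g = "\<lambda>y. Suc" and big = False, OF l]
  show "ev h (count_ex s) \<rho> = Num (length xs)" unfolding count_ex_def by (subst F(1)) (simp_all add: f)
  assume M: "length xs < M"
  show "sf h D M k (count_ex s) \<rho>" unfolding count_ex_def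
  proof (rule F(2))
    fix j assume "j < length xs"
    then have "j < 2 ^ M" "Suc 0 < 2 ^ M" using M less_trans[OF _ less_exp[of M]] by auto
    then show "sf h D M k (V ''a'' +. C 1) (\<rho>(''a'' := Num (fold (\<lambda>y. Suc) (take j xs) 0), ''x'' := g (xs ! j)))"
      using \<open>j < length xs\<close> by (simp add: f min_def)
  qed (use M in simp_all)
qed

context instance_run
begin

abbreviation "item_val i \<equiv> Tup (enc_bool (i \<in> small I)) (enc_vec (items I ! i))"

lemma coords: "list_of (enc_vec v) = map enc_rat v"
  by (simp add: enc_vec_def)

lemma counts: "n \<le> M" "d \<le> M" "Suc n \<le> M" "k \<le> n" "m \<le> n" "n < M" "d < M" "Suc 0 < 2 ^ M" "n < 2 ^ M"
proof -
  show "n \<le> M" "d \<le> M" "Suc n \<le> M" "n < M" "d < M" using sizes room(1)[of 0] by linarith+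
  then show "Suc 0 < 2 ^ M" "n < 2 ^ M" by (auto intro: less_pow2[of "Suc 0" 0] le_less_trans[OF _ less_exp])
qed (use km in linarith)+

lemma vec_ex:
  assumes i: "i < n" and st: "\<rho> ''x'' = item_val i" "\<rho> ''R1'' = Num R1" "\<rho> ''D'' = Num D"
  shows "ev h vec_ex \<rho> = Num (PV i)" "sf h Dd M k vec_ex \<rho>"
proof -
  let ?v = "items I ! i"
  let ?g = "\<lambda>y a. a * R1 + sc y"
  have l: "list_of (ev h (Tl (V ''x'')) \<rho>) = map enc_rat ?v" using st coords by simp
  have step: "ev h (V ''b'' *. V ''R1'' +. Hd (V ''y'') *. (V ''D'' /. Tl (V ''y''))) (\<rho>(''b'' := Num a, ''y'' := enc_rat y)) = Num (?g y a)" for a y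
    using st by (simp add: enc_rat sc_def)
  have hv: "fold ?g ys 0 = hval R1 sc (rev ys)" for ys
    using fold_horner[of "\<lambda>_. True" R1 sc ys] by simp
  note F = Fold_Num[where h = h and \<rho> = \<rho> and l = "Tl (V ''x'')" and s = "C 0" and c = 0 and z = "''b''" and x = "''y''"
     and xs = ?v and e = enc_rat and g = ?g and big = False, OF l _ step]
  show "ev h vec_ex \<rho> = Num (PV i)" unfolding vec_ex_def by (subst F(1)) (simp_all add: hv PV_def)
  show "sf h Dd M k vec_ex \<rho>" unfolding vec_ex_def
  proof (rule F(2))
    fix j assume j: "j < length ?v"
    then have y: "?v ! j \<in> set ?v" by simp
    have "hval R1 sc (rev (take j ?v)) < R1 ^ length (rev (take j ?v))"
      by (rule hval_less) (use sc_less[OF i] in \<open>auto dest: in_set_takeD\<close>)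
    then have a: "hval R1 sc (rev (take j ?v)) < R1 ^ j" using j by (simp add: min_def)
    have R: "R1 ^ Suc j < 2 ^ M" "R1 ^ j < 2 ^ M" using j item(1)[OF i] room(6)[of "Suc j"] room(6)[of j] by auto
    have a1: "hval R1 sc (rev (take j ?v)) < 2 ^ M" using a R by simp
    have "hval R1 sc (rev (take j ?v)) * R1 \<le> R1 ^ j * R1" using a by (intro mult_le_mono1) simp
    then have a2: "hval R1 sc (rev (take j ?v)) * R1 < 2 ^ M" by (rule le_less_trans) (use R in \<open>simp add: mult.commute\<close>)
    have "num (?v ! j) < 2 ^ M" "den (?v ! j) < 2 ^ M" "sc (?v ! j) < 2 ^ M"
      using num_le[OF i y] den_le[OF i y] sc_less[OF i y] R1_bounds room(2)[of 0] by linarith+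
    moreover have "D div den (?v ! j) < 2 ^ M" using room(3)[of 0] by (simp add: le_less_trans[OF div_le_dividend])
    ultimately show "sf h Dd M k (V ''b'' *. V ''R1'' +. Hd (V ''y'') *. (V ''D'' /. Tl (V ''y'')))
       (\<rho>(''b'' := Num (fold ?g (take j ?v) 0), ''y'' := enc_rat (?v ! j)))"
      unfolding hv using st a1 a2 room(2)[of 0] room(3)[of 0] by (simp add: enc_rat sc_def)
  qed (use item(1)[OF i] counts in simp_all)
qed

lemma list_fold_ex:
  assumes i: "i < n" and st: "\<rho> ''x'' = item_val i" "\<rho> ''a'' = Num a"
  shows "ev h (Fold False ''y'' ''b'' (Tl (V ''x'')) (V ''a'') (V ''b'' *. Tl (V ''y''))) \<rho> = Num (a * prod_list (map den (items I ! i)))"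
    "a * prod_list (map den (items I ! i)) \<le> D \<Longrightarrow> sf h Dd M k (Fold False ''y'' ''b'' (Tl (V ''x'')) (V ''a'') (V ''b'' *. Tl (V ''y''))) \<rho>"
    "ev h (Fold False ''y'' ''b'' (Tl (V ''x'')) (V ''a'') (V ''b'' +. Hd (V ''y''))) \<rho> = Num (a + sum_list (map num (items I ! i)))"
    "a + sum_list (map num (items I ! i)) \<le> e \<Longrightarrow> sf h Dd M k (Fold False ''y'' ''b'' (Tl (V ''x'')) (V ''a'') (V ''b'' +. Hd (V ''y''))) \<rho>"
proof -
  let ?v = "items I ! i"
  have l: "list_of (ev h (Tl (V ''x'')) \<rho>) = map enc_rat ?v" using st coords by simp
  have s: "ev h (V ''a'') \<rho> = Num a" using st by simp
  have step1: "ev h (V ''b'' *. Tl (V ''y'')) (\<rho>(''b'' := Num ini, ''y'' := enc_rat y)) = Num (ini * den y)" for ini y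
    by (simp add: enc_rat)
  have step2: "ev h (V ''b'' +. Hd (V ''y'')) (\<rho>(''b'' := Num ini, ''y'' := enc_rat y)) = Num (ini + num y)" for ini y
    by (simp add: enc_rat)
  note F = Fold_Num[where h = h and \<rho> = \<rho> and l = "Tl (V ''x'')" and c = a and z = "''b''" and x = "''y''"
     and xs = ?v and e = enc_rat and big = False, OF l s]
  show "ev h (Fold False ''y'' ''b'' (Tl (V ''x'')) (V ''a'') (V ''b'' *. Tl (V ''y''))) \<rho> = Num (a * prod_list (map den ?v))"
    by (subst F(1)[OF step1]) (simp add: fold_mult)
  show "ev h (Fold False ''y'' ''b'' (Tl (V ''x'')) (V ''a'') (V ''b'' +. Hd (V ''y''))) \<rho> = Num (a + sum_list (map num ?v))"
    by (subst F(1)[OF step2]) (simp add: fold_add)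
  show "sf h Dd M k (Fold False ''y'' ''b'' (Tl (V ''x'')) (V ''a'') (V ''b'' *. Tl (V ''y''))) \<rho>" if a: "a * prod_list (map den ?v) \<le> D"
  proof (rule F(2)[OF step1])
    fix j assume j: "j < length ?v"
    have "prod_list (take j (map den ?v)) \<le> prod_list (map den ?v)" by (rule prod_list_take_le) (auto simp: den_pos)
    then have "a * prod_list (map den (take j ?v)) \<le> a * prod_list (map den ?v)" by (simp add: take_map)
    from le_less_trans[OF order.trans[OF this a] room(3)[of 0]]
    have "a * prod_list (map den (take j ?v)) < 2 ^ M" by simp
    moreover have "den (?v ! j) < 2 ^ M" using den_le[OF i, of "?v ! j"] j room(3)[of 0] by simp
    ultimately show "sf h Dd M k (V ''b'' *. Tl (V ''y'')) (\<rho>(''b'' := Num (fold (\<lambda>y x. x * den y) (take j ?v) a), ''y'' := enc_rat (?v ! j)))"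
      by (simp add: fold_mult enc_rat)
  qed (use item(1)[OF i] counts in simp_all)
  show "sf h Dd M k (Fold False ''y'' ''b'' (Tl (V ''x'')) (V ''a'') (V ''b'' +. Hd (V ''y''))) \<rho>" if a: "a + sum_list (map num ?v) \<le> e"
  proof (rule F(2)[OF step2])
    fix j assume j: "j < length ?v"
    have "sum_list (take j (map num ?v)) \<le> sum_list (map num ?v)" by (rule sum_list_take_le)
    then have "a + sum_list (map num (take j ?v)) \<le> e" using a by (simp add: take_map)
    then have "a + sum_list (map num (take j ?v)) < 2 ^ M" using R1_bounds room(2)[of 0] by linarith
    moreover have "num (?v ! j) < 2 ^ M" using num_le[OF i, of "?v ! j"] j R1_bounds room(2)[of 0] by simp
    ultimately show "sf h Dd M k (V ''b'' +. Hd (V ''y'')) (\<rho>(''b'' := Num (fold (\<lambda>y x. x + num y) (take j ?v) a), ''y'' := enc_rat (?v ! j)))"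
      by (simp add: fold_add enc_rat)
  qed (use item(1)[OF i] counts in simp_all)
qed

lemma items_fold:
  assumes st: "\<rho> ''s'' = enc_list (map item_val [0..<n])" and s: "ev h s \<rho> = Num ini" "sf h Dd M k s \<rho>"
    and step: "\<And>i a. i < n \<Longrightarrow> ev h b (\<rho>(''a'' := Num a, ''x'' := item_val i)) = Num (g i a)"
    and sfb: "\<And>j. j < n \<Longrightarrow> sf h Dd M k b (\<rho>(''a'' := Num (fold g [0..<j] ini), ''x'' := item_val j))"
  shows "ev h (Fold False ''x'' ''a'' (V ''s'') s b) \<rho> = Num (fold g [0..<n] ini)"
    "sf h Dd M k (Fold False ''x'' ''a'' (V ''s'') s b) \<rho>"
proof -
  have l: "list_of (ev h (V ''s'') \<rho>) = map item_val [0..<n]" using st by simp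
  note F = Fold_Num[where h = h and \<rho> = \<rho> and l = "V ''s''" and c = ini and z = "''a''" and x = "''x''"
     and xs = "[0..<n]" and e = item_val and big = False, OF l s(1)]
  show "ev h (Fold False ''x'' ''a'' (V ''s'') s b) \<rho> = Num (fold g [0..<n] ini)"
    by (rule F(1)) (use step in simp)
  show "sf h Dd M k (Fold False ''x'' ''a'' (V ''s'') s b) \<rho>"
  proof (rule F(2))
    show "sf h Dd M k b (\<rho>(''a'' := Num (fold g (take j [0..<n]) ini), ''x'' := item_val ([0..<n] ! j)))" if "j < length [0..<n]" for j
      using sfb[of j] that by simp
  qed (use step s(2) counts in simp_all)
qed

definition parsed :: "nat \<Rightarrow> store \<Rightarrow> bool" where
  "parsed r \<rho> \<longleftrightarrow> (\<forall>(x, v) \<in> set [(''r'', r), (''l'', l), (''d'', d), (''n'', n), (''k'', k), (''m'', m), (''D'', D), (''R1'', R1), (''R2'', R2),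
     (''SV'', SV), (''LV'', LV)]. \<rho> x = Num v)"

lemma R2_pow: "j \<le> n + 1 \<Longrightarrow> R2 ^ j < 2 ^ M"
proof -
  assume j: "j \<le> n + 1"
  have R2: "R2 \<le> 2 ^ (S * d)" unfolding R2_def by (rule pow_le_pow2[OF sizes(4)])
  have "j \<le> core.N n + k + 2" using j by (simp add: core.N_def)
  then have "S * d * j \<le> S * d * (core.N n + k + 2)" by (rule mult_le_mono2)
  then have "S * d * j < M" using room_for(12)[of S d n k] unfolding M_def by linarith
  with pow_le_pow2[OF R2] show ?thesis by (rule less_pow2)
qed

text \<open>The store built by the bindings is hidden behind \<open>parsed\<close>, so that any
  \<open>body\<close> can be analysed from the values it finds there.\<close>

lemma parse_ex:
  assumes I: "\<rho> ''I'' = Tup (Num r) (enc_vbc I)"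
  shows "\<exists>\<rho>'. parsed r \<rho>' \<and> ev h (parse_ex body) \<rho> = ev h body \<rho>' \<and> (sf h Dd M k body \<rho>' \<longrightarrow> sf h Dd M k (parse_ex body) \<rho>)"
proof -
  let ?o = "enc_list (replicate d (Num 0))" and ?s = "enc_list (map item_val [0..<n])"
  have inp: "enc_vbc I = Tup (Num l) (Tup ?o ?s)" by (simp add: enc_vbc_def l_def d_def n_def)
  define \<rho>4 where "\<rho>4 = \<rho>(''r'' := Num r, ''l'' := Num l, ''o'' := ?o, ''s'' := ?s)"
  define \<rho>5 where "\<rho>5 = \<rho>4(''d'' := Num d)"
  define \<rho>6 where "\<rho>6 = \<rho>5(''n'' := Num n)"
  define \<rho>7 where "\<rho>7 = \<rho>6(''k'' := Num k)"
  define \<rho>8 where "\<rho>8 = \<rho>7(''m'' := Num m)"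
  define \<rho>9 where "\<rho>9 = \<rho>8(''D'' := Num D)"
  define \<rho>10 where "\<rho>10 = \<rho>9(''e'' := Num e)"
  define \<rho>11 where "\<rho>11 = \<rho>10(''R1'' := Num R1)"
  define \<rho>12 where "\<rho>12 = \<rho>11(''R2'' := Num R2)"
  define \<rho>13 where "\<rho>13 = \<rho>12(''SV'' := Num SV)"
  define \<rho>14 where "\<rho>14 = \<rho>13(''LV'' := Num LV)"
  note rhos = \<rho>4_def \<rho>5_def \<rho>6_def \<rho>7_def \<rho>8_def \<rho>9_def \<rho>10_def \<rho>11_def \<rho>12_def \<rho>13_def \<rho>14_def
  have s: "\<rho>4 ''s'' = ?s" "\<rho>5 ''s'' = ?s" "\<rho>6 ''s'' = ?s" "\<rho>8 ''s'' = ?s" "\<rho>9 ''s'' = ?s" "\<rho>12 ''s'' = ?s" "\<rho>13 ''s'' = ?s" by (simp_all add: rhos)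
  have o: "list_of (\<rho>4 ''o'') = map (\<lambda>_. Num 0) [0..<d]" by (simp add: rhos map_replicate_const)
  have 5: "ev h (count_ex ''o'') \<rho>4 = Num d" "sf h Dd M k (count_ex ''o'') \<rho>4"
    using count_ex[of \<rho>4 "''o''", OF o] counts by simp_all
  have 6: "ev h (count_ex ''s'') \<rho>5 = Num n" "sf h Dd M k (count_ex ''s'') \<rho>5"
    using count_ex[of \<rho>5 "''s''" item_val "[0..<n]"] s counts by simp_all
  have cnt: "fold (\<lambda>i a. a + of_bool (i \<in> small I)) [0..<j] 0 = length (filter (\<lambda>i. i \<in> small I) [0..<j])" for j
    by (induction j) auto
  have 7: "ev h (Fold False ''x'' ''a'' (V ''s'') (C 0) (V ''a'' +. Hd (V ''x''))) \<rho>6 = Num k"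
    "sf h Dd M k (Fold False ''x'' ''a'' (V ''s'') (C 0) (V ''a'' +. Hd (V ''x''))) \<rho>6"
  proof -
    have lt: "length (filter (\<lambda>i. i \<in> small I) [0..<j]) < 2 ^ M" if "j < n" for j
      using length_filter_le[of "\<lambda>i. i \<in> small I" "[0..<j]"] that counts(9) by simp
    note F = items_fold[where \<rho> = \<rho>6 and s = "C 0" and ini = 0 and b = "V ''a'' +. Hd (V ''x'')" and g = "\<lambda>i a. a + of_bool (i \<in> small I)", OF s(3)]
    show "ev h (Fold False ''x'' ''a'' (V ''s'') (C 0) (V ''a'' +. Hd (V ''x''))) \<rho>6 = Num k"
      by (subst F(1)) (use lt counts in \<open>simp_all add: cnt k_def sl_def\<close>)
    show "sf h Dd M k (Fold False ''x'' ''a'' (V ''s'') (C 0) (V ''a'' +. Hd (V ''x''))) \<rho>6"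
      by (rule F(2)) (use lt counts in \<open>simp_all add: cnt\<close>)
  qed
  have 8: "ev h (V ''n'' -. V ''k'') \<rho>7 = Num m" "sf h Dd M k (V ''n'' -. V ''k'') \<rho>7"
    using km counts by (auto simp: rhos)
  let ?Df = "Fold False ''y'' ''b'' (Tl (V ''x'')) (V ''a'') (V ''b'' *. Tl (V ''y''))"
  let ?ef = "Fold False ''y'' ''b'' (Tl (V ''x'')) (V ''a'') (V ''b'' +. Hd (V ''y''))"
  have 9: "ev h (Fold False ''x'' ''a'' (V ''s'') (C 1) ?Df) \<rho>8 = Num D" "sf h Dd M k (Fold False ''x'' ''a'' (V ''s'') (C 1) ?Df) \<rho>8"
  proof -
    have st: "ev h ?Df (\<rho>8(''a'' := Num a, ''x'' := item_val i)) = Num (a * prod_list (map den (items I ! i)))" if "i < n" for i a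
      by (rule list_fold_ex(1)[OF that]) simp_all
    have sfb: "sf h Dd M k ?Df (\<rho>8(''a'' := Num (fold (\<lambda>i a. a * prod_list (map den (items I ! i))) [0..<j] 1), ''x'' := item_val j))" if "j < n" for j
    proof (rule list_fold_ex(2)[OF that])
      have "fold (\<lambda>i a. a * prod_list (map den (items I ! i))) [0..<j] 1 * prod_list (map den (items I ! j))
        = prod_list (take (Suc j) (map (\<lambda>i. prod_list (map den (items I ! i))) [0..<n]))"
        using that by (simp add: fold_mult take_map take_upt)
      also have "\<dots> \<le> D" unfolding D_def
        by (rule prod_list_take_le) (auto simp: prod_list_zero_iff den_neq_0 intro!: Nat.gr0I)
      finally show "fold (\<lambda>i a. a * prod_list (map den (items I ! i))) [0..<j] 1 * prod_list (map den (items I ! j)) \<le> D" .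
    qed simp_all
    note F = items_fold[where \<rho> = \<rho>8 and s = "C 1" and ini = 1, OF s(4) _ _ st sfb]
    show "ev h (Fold False ''x'' ''a'' (V ''s'') (C 1) ?Df) \<rho>8 = Num D" by (subst F(1)) (simp_all add: fold_mult D_def)
    show "sf h Dd M k (Fold False ''x'' ''a'' (V ''s'') (C 1) ?Df) \<rho>8" by (rule F(2)) simp_all
  qed
  have 10: "ev h (Fold False ''x'' ''a'' (V ''s'') (C 0) ?ef) \<rho>9 = Num e" "sf h Dd M k (Fold False ''x'' ''a'' (V ''s'') (C 0) ?ef) \<rho>9"
  proof -
    have st: "ev h ?ef (\<rho>9(''a'' := Num a, ''x'' := item_val i)) = Num (a + sum_list (map num (items I ! i)))" if "i < n" for i a
      by (rule list_fold_ex(3)[OF that]) simp_all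
    have sfb: "sf h Dd M k ?ef (\<rho>9(''a'' := Num (fold (\<lambda>i a. a + sum_list (map num (items I ! i))) [0..<j] 0), ''x'' := item_val j))" if "j < n" for j
    proof (rule list_fold_ex(4)[OF that])
      have "fold (\<lambda>i a. a + sum_list (map num (items I ! i))) [0..<j] 0 + sum_list (map num (items I ! j))
        = sum_list (take (Suc j) (map (\<lambda>i. sum_list (map num (items I ! i))) [0..<n]))"
        using that by (simp add: fold_add take_map take_upt)
      also have "\<dots> \<le> e" unfolding e_def by (rule sum_list_take_le)
      finally show "fold (\<lambda>i a. a + sum_list (map num (items I ! i))) [0..<j] 0 + sum_list (map num (items I ! j)) \<le> e" .
    qed simp_all
    note F = items_fold[where \<rho> = \<rho>9 and s = "C 0" and ini = 0, OF s(5) _ _ st sfb]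
    show "ev h (Fold False ''x'' ''a'' (V ''s'') (C 0) ?ef) \<rho>9 = Num e" by (subst F(1)) (simp_all add: fold_add e_def)
    show "sf h Dd M k (Fold False ''x'' ''a'' (V ''s'') (C 0) ?ef) \<rho>9" by (rule F(2)) simp_all
  qed
  have 11: "ev h (V ''D'' *. (V ''e'' +. C 1)) \<rho>10 = Num R1" "sf h Dd M k (V ''D'' *. (V ''e'' +. C 1)) \<rho>10"
    using R1_bounds room(2,3)[of 0] counts by (auto simp: rhos R1_def)
  have 12: "ev h (Pw (V ''R1'') (V ''d'')) \<rho>11 = Num R2" "sf h Dd M k (Pw (V ''R1'') (V ''d'')) \<rho>11"
    using room(2,5)[of 0] counts by (auto simp: rhos R2_def)
  have vec: "ev h vec_ex (\<rho>'(''a'' := a, ''x'' := item_val i)) = Num (PV i)" "sf h Dd M k vec_ex (\<rho>'(''a'' := a, ''x'' := item_val i))"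
    if "i < n" "\<rho>' = \<rho>12 \<or> \<rho>' = \<rho>13" for i a \<rho>'
    using vec_ex[OF that(1), of "\<rho>'(''a'' := a, ''x'' := item_val i)"] that(2) by (auto simp: rhos)
  have hl: "hval R2 PV (rev (filter p [0..<j])) < 2 ^ M" "hval R2 PV (rev (filter p [0..<j])) * R2 < 2 ^ M" if "j < n" for p j
  proof -
    let ?len = "length (rev (filter p [0..<j]))"
    have a: "hval R2 PV (rev (filter p [0..<j])) < R2 ^ ?len"
      by (rule hval_less) (use PV_less that in auto)
    have len: "?len \<le> n" using length_filter_le[of p "[0..<j]"] that by simp
    show "hval R2 PV (rev (filter p [0..<j])) < 2 ^ M" using a R2_pow[of ?len] len by linarith
    have "hval R2 PV (rev (filter p [0..<j])) * R2 \<le> R2 ^ ?len * R2" using a by (intro mult_le_mono1) simp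
    also have "\<dots> = R2 ^ Suc ?len" by (simp add: mult.commute)
    also have "\<dots> < 2 ^ M" using len by (intro R2_pow) simp
    finally show "hval R2 PV (rev (filter p [0..<j])) * R2 < 2 ^ M" .
  qed
  have PM: "PV i < 2 ^ M" if "i < n" for i using PV_less[OF that] room(5)[of 0] by simp
  have 13: "ev h (Fold False ''x'' ''a'' (V ''s'') (C 0) (If (Hd (V ''x'')) (V ''a'' *. V ''R2'' +. vec_ex) (V ''a''))) \<rho>12 = Num SV"
    "sf h Dd M k (Fold False ''x'' ''a'' (V ''s'') (C 0) (If (Hd (V ''x'')) (V ''a'' *. V ''R2'' +. vec_ex) (V ''a''))) \<rho>12"
  proof -
    let ?b = "If (Hd (V ''x'')) (V ''a'' *. V ''R2'' +. vec_ex) (V ''a'')"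
    let ?g = "\<lambda>i a. if i \<in> small I then a * R2 + PV i else a"
    have r: "\<rho>12 ''R2'' = Num R2" by (simp add: rhos)
    have st: "ev h ?b (\<rho>12(''a'' := Num a, ''x'' := item_val i)) = Num (?g i a)" if "i < n" for i a
    proof -
      have "ev h vec_ex (\<rho>12(''a'' := Num a, ''x'' := item_val i)) = Num (PV i)" using vec(1)[OF that] by blast
      then show ?thesis using r by (cases "i \<in> small I") simp_all
    qed
    have sfb: "sf h Dd M k ?b (\<rho>12(''a'' := Num (fold ?g [0..<j] 0), ''x'' := item_val j))" if "j < n" for j
    proof -
      have "ev h vec_ex (\<rho>12(''a'' := Num (fold ?g [0..<j] 0), ''x'' := item_val j)) = Num (PV j)"
        "sf h Dd M k vec_ex (\<rho>12(''a'' := Num (fold ?g [0..<j] 0), ''x'' := item_val j))" using vec[OF that] by blast+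
      then show ?thesis unfolding fold_horner using hl[OF that] PM[OF that] room(5)[of 0] r by (cases "j \<in> small I") simp_all
    qed
    note F = items_fold[where \<rho> = \<rho>12 and s = "C 0" and ini = 0, OF s(6) _ _ st sfb]
    show "ev h (Fold False ''x'' ''a'' (V ''s'') (C 0) ?b) \<rho>12 = Num SV" by (subst F(1)) (simp_all add: fold_horner SV_def sl_def)
    show "sf h Dd M k (Fold False ''x'' ''a'' (V ''s'') (C 0) ?b) \<rho>12" by (rule F(2)) simp_all
  qed
  have 14: "ev h (Fold False ''x'' ''a'' (V ''s'') (C 0) (If (Hd (V ''x'')) (V ''a'') (V ''a'' *. V ''R2'' +. vec_ex))) \<rho>13 = Num LV"
    "sf h Dd M k (Fold False ''x'' ''a'' (V ''s'') (C 0) (If (Hd (V ''x'')) (V ''a'') (V ''a'' *. V ''R2'' +. vec_ex))) \<rho>13"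
  proof -
    let ?b = "If (Hd (V ''x'')) (V ''a'') (V ''a'' *. V ''R2'' +. vec_ex)"
    let ?g = "\<lambda>i a. if i \<notin> small I then a * R2 + PV i else a"
    have r: "\<rho>13 ''R2'' = Num R2" by (simp add: rhos)
    have st: "ev h ?b (\<rho>13(''a'' := Num a, ''x'' := item_val i)) = Num (?g i a)" if "i < n" for i a
    proof -
      have "ev h vec_ex (\<rho>13(''a'' := Num a, ''x'' := item_val i)) = Num (PV i)" using vec(1)[OF that] by blast
      then show ?thesis using r by (cases "i \<in> small I") simp_all
    qed
    have sfb: "sf h Dd M k ?b (\<rho>13(''a'' := Num (fold ?g [0..<j] 0), ''x'' := item_val j))" if "j < n" for j
    proof -
      have "ev h vec_ex (\<rho>13(''a'' := Num (fold ?g [0..<j] 0), ''x'' := item_val j)) = Num (PV j)"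
        "sf h Dd M k vec_ex (\<rho>13(''a'' := Num (fold ?g [0..<j] 0), ''x'' := item_val j))" using vec[OF that] by blast+
      then show ?thesis unfolding fold_horner using hl[OF that] PM[OF that] room(5)[of 0] r by (cases "j \<in> small I") simp_all
    qed
    note F = items_fold[where \<rho> = \<rho>13 and s = "C 0" and ini = 0, OF s(7) _ _ st sfb]
    show "ev h (Fold False ''x'' ''a'' (V ''s'') (C 0) ?b) \<rho>13 = Num LV" by (subst F(1)) (simp_all add: fold_horner LV_def ll_def)
    show "sf h Dd M k (Fold False ''x'' ''a'' (V ''s'') (C 0) ?b) \<rho>13" by (rule F(2)) simp_all
  qed
  have 1: "ev h (Hd (V ''I'')) \<rho> = Num r" using I by simp
  have 2: "ev h (Hd (Tl (V ''I''))) (\<rho>(''r'' := Num r)) = Num l" using I inp by simp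
  have 3: "ev h (Hd (Tl (Tl (V ''I'')))) (\<rho>(''r'' := Num r, ''l'' := Num l)) = ?o" using I inp by simp
  have 4: "ev h (Tl (Tl (Tl (V ''I'')))) (\<rho>(''r'' := Num r, ''l'' := Num l, ''o'' := ?o)) = ?s" using I inp by simp
  have p: "parsed r \<rho>14" by (simp add: parsed_def rhos)
  have "ev h (parse_ex body) \<rho> = ev h body \<rho>14"
    unfolding parse_ex_def ev.simps(8) 1 2 3 4 \<rho>4_def[symmetric] 5 \<rho>5_def[symmetric] 6 \<rho>6_def[symmetric] 7 \<rho>7_def[symmetric] 8 \<rho>8_def[symmetric]
      9 \<rho>9_def[symmetric] 10 \<rho>10_def[symmetric] 11 \<rho>11_def[symmetric] 12 \<rho>12_def[symmetric] 13 \<rho>13_def[symmetric] 14 \<rho>14_def[symmetric] ..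
  moreover have "sf h Dd M k (parse_ex body) \<rho>" if "sf h Dd M k body \<rho>14"
    unfolding parse_ex_def sf.simps(8) 1 2 3 4 \<rho>4_def[symmetric] 5 \<rho>5_def[symmetric] 6 \<rho>6_def[symmetric] 7 \<rho>7_def[symmetric] 8 \<rho>8_def[symmetric]
      9 \<rho>9_def[symmetric] 10 \<rho>10_def[symmetric] 11 \<rho>11_def[symmetric] 12 \<rho>12_def[symmetric] 13 \<rho>13_def[symmetric] 14 \<rho>14_def[symmetric]
    using that 5(2) 6(2) 7(2) 8(2) 9(2) 10(2) 11(2) 12(2) 13(2) 14(2) by (simp only: sf.simps(1,4,5) simp_thms)
  ultimately show ?thesis using p by blast
qed

section \<open>Correctness for a given random number\<close>

definition "Wn = (2::nat) ^ lg (3 * core.NW n)"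
definition "Zn = (core.N n + k + 1) * Wn"
definition cv :: "nat \<Rightarrow> nat \<Rightarrow> nat set \<Rightarrow> bool" where "cv u w T = cov (BC.chosen {u, w} T)"
definition "NB = lg (3 * core.NW n) * core.NW n"

lemma two_pow_NB: "2 ^ NB = Wn ^ core.NW n"
  by (simp add: NB_def Wn_def power_mult)

text \<open>Vertices from \<open>m\<close> on have digit 0 in \<open>LV\<close>, and
  \<open>u \<noteq> w\<close> keeps a large item from being counted twice. So the number given to
  the oracle call is the packed sum of the chosen items.\<close>

lemma csum:
  assumes "u \<noteq> w" "T \<subseteq> {..<k}"
  shows "core.csum R2 SV LV u w T = (\<Sum>i\<in>BC.chosen {u, w} T. PV i)"
proof -
  have set: "set sl \<subseteq> {..<n}" "set ll \<subseteq> {..<n}" by (auto simp: sl_def ll_def)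
  have S: "digit R2 i SV = PV (sl ! i)" if "i \<in> T" for i
    unfolding SV_def by (rule hval_digit) (use that assms(2) set PV_less in \<open>auto simp: k_def\<close>)
  have L: "digit R2 u LV = (if u < m then PV (ll ! u) else 0)" for u
  proof -
    have "PV y < R2" if "y \<in> set ll" for y using set that PV_less by auto
    then show ?thesis unfolding LV_def m_def using hval_digit[of ll PV R2 u] hval_digit_0[of ll PV R2 u] by simp
  qed
  have inj: "inj_on ((!) ll) ({u, w} \<inter> {..<m})" "inj_on ((!) sl) T"
    using assms(2) by (auto intro!: inj_on_nth simp: ll_def sl_def k_def m_def)
  have fin: "finite T" using assms(2) finite_subset by blast
  have disj: "(!) ll ` ({u, w} \<inter> {..<m}) \<inter> (!) sl ` T = {}"
  proof -
    have "(!) ll ` ({u, w} \<inter> {..<m}) \<subseteq> set ll" "(!) sl ` T \<subseteq> set sl" using assms(2) by (auto simp: m_def k_def)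
    moreover have "set ll \<inter> set sl = {}" by (auto simp: sl_def ll_def)
    ultimately show ?thesis by blast
  qed
  have "(\<Sum>i\<in>BC.chosen {u, w} T. PV i) = (\<Sum>x\<in>{u, w} \<inter> {..<m}. PV (ll ! x)) + (\<Sum>i\<in>T. PV (sl ! i))"
    unfolding BC.chosen_def m_def[symmetric] using fin by (subst sum.union_disjoint[OF _ _ disj]) (simp_all add: sum.reindex[OF inj(1)] sum.reindex[OF inj(2)])
  also have "(\<Sum>x\<in>{u, w} \<inter> {..<m}. PV (ll ! x)) = digit R2 u LV + digit R2 w LV"
    unfolding L using assms(1) by (simp add: Int_insert_left)
  also have "(\<Sum>i\<in>T. PV (sl ! i)) = (\<Sum>i\<in>T. digit R2 i SV)" using S by simp
  finally show ?thesis by (simp add: core.csum_def)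
qed

lemma run:
  assumes "l \<le> n" "r < 2 ^ NB"
  shows "core_run h Dd M r l d n k m D R1 R2 SV LV Wn Zn cv"
proof -
  note rf = room_for[where S = S and n = n and k = k and d = d, folded M_def Wn_def, folded Zn_def]
  have R2: "0 < R2" using R1_bounds by (simp add: R2_def)
  have n0: "0 < n" using assms(1) BC.l_pos by simp
  have W0: "0 < Wn" by (simp add: Wn_def)
  have set: "set sl \<subseteq> {..<n}" "set ll \<subseteq> {..<n}" by (auto simp: sl_def ll_def)
  have R2p: "R2 ^ core.N n < 2 ^ M" "(k + 2) * R2 < 2 ^ M"
  proof -
    have R2': "R2 \<le> 2 ^ (S * d)" unfolding R2_def by (rule pow_le_pow2[OF sizes(4)])
    have "S * d * core.N n \<le> S * d * (core.N n + k + 2)" by (rule mult_le_mono2) simp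
    then have "S * d * core.N n < M" using rf(12) by linarith
    with pow_le_pow2[OF R2'] show "R2 ^ core.N n < 2 ^ M" by (rule less_pow2)
    have "S * d * 1 \<le> S * d * (core.N n + k + 2)" by (rule mult_le_mono2) simp
    then have "k + 2 + S * d < M" using rf(12) by linarith
    with mult_le_pow2[OF le_pow2 R2'] show "(k + 2) * R2 < 2 ^ M" by (rule less_pow2)
  qed
  have SL: "SV < 2 ^ M" "LV < 2 ^ M"
  proof -
    have "SV < R2 ^ k" "LV < R2 ^ m" unfolding SV_def LV_def k_def m_def using set PV_less by (auto intro!: hval_less)
    moreover have "R2 ^ k < 2 ^ M" "R2 ^ m < 2 ^ M" using counts(4,5) by (auto intro: R2_pow)
    ultimately show "SV < 2 ^ M" "LV < 2 ^ M" by (auto intro: less_trans)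
  qed
  have Zl: "(core.N n + k) * Wn < Zn" using W0 by (simp add: Zn_def)
  have r: "r < 2 ^ M" using assms(2) rf(9) unfolding two_pow_NB by simp
  have cover: "ev h (Call unpack_ex) \<rho> = enc_bool (cv u w T) \<and> sf h Dd M k (Call unpack_ex) \<rho>"
    if "u < w" "T \<subseteq> {..<k}" "core.base r l d n k m D R1 R2 SV LV Wn Zn \<rho>" "\<rho> ''X'' = Num (core.csum R2 SV LV u w T)" for u w T \<rho>
  proof -
    have X: "\<rho> ''X'' = Num (\<Sum>i\<in>BC.chosen {u, w} T. PV i)" using that csum[of u w T] by simp
    have sub: "BC.chosen {u, w} T \<subseteq> {..<n}" using BC.chosen_subset[of T "{u, w}"] that(2) by (simp add: k_def)
    show ?thesis using unpack_ex[where \<rho> = \<rho>, OF sub X] core.baseD[OF that(3)] by (simp add: cv_def)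
  qed
  show ?thesis
    by unfold_locales (rule BC.l_pos n0 W0 R2 Zl counts(4,5) assms(1) rf(1-11) r R2p SL Wn_def Zn_def | (rule cover; assumption))+
qed

lemma core_al: "core.al m cv = BC.allowed"
  by (intro ext) (simp add: core.al_def BC.allowed_def cv_def m_def)

lemma core_vs: "core.vs l m = BC.verts"
  by (intro ext) (simp add: core.vs_def BC.verts_def m_def)

text \<open>Soundness holds for every \<open>r\<close> and every guess, so \<open>Bad\<close> only
  has to describe a failure of isolation for one fixed \<open>q\<close> that admits an exact
  configuration; no union bound over the guesses arises.\<close>

theorem main_correct:
  "\<exists>Bad. 3 * card {r \<in> {..<2 ^ NB}. r \<in> Bad} \<le> 2 ^ NB \<and> (\<forall>r < 2 ^ NB. \<forall>\<rho>. \<rho> ''I'' = Tup (Num r) (enc_vbc I) \<longrightarrow>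
     (\<exists>a. ev h main_ex \<rho> = enc_bool a \<and> sf h Dd M k main_ex \<rho> \<and> (a \<longrightarrow> vbc_solvable P I) \<and> (vbc_solvable P I \<longrightarrow> r \<notin> Bad \<longrightarrow> a)))"
proof (cases "n < l")
  case True
  have "\<exists>a. ev h main_ex \<rho> = enc_bool a \<and> sf h Dd M k main_ex \<rho> \<and> (a \<longleftrightarrow> vbc_solvable P I)" if I: "\<rho> ''I'' = Tup (Num r) (enc_vbc I)" for r \<rho>
  proof -
    let ?b = "If (V ''n'' <. V ''l'') (Let ''X'' (C 0) (Call unpack_ex)) core_ex"
    obtain \<rho>' where p: "parsed r \<rho>'" "ev h (parse_ex ?b) \<rho> = ev h ?b \<rho>'" "sf h Dd M k ?b \<rho>' \<longrightarrow> sf h Dd M k (parse_ex ?b) \<rho>"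
      using parse_ex[where \<rho> = \<rho> and r = r, OF I] by blast
    have v: "\<rho>' ''n'' = Num n" "\<rho>' ''l'' = Num l" "\<rho>' ''R1'' = Num R1" "\<rho>' ''D'' = Num D" "\<rho>' ''d'' = Num d"
      using p(1) by (simp_all add: parsed_def)
    note u = unpack_ex[of "{}" "\<rho>'(''X'' := Num 0)"]
    have "ev h ?b \<rho>' = enc_bool (cov {})" "sf h Dd M k ?b \<rho>'"
      using u v True counts room(4)[of 0] by (simp_all del: ev.simps(14) sf.simps(14))
    then have "ev h main_ex \<rho> = enc_bool (cov {})" "sf h Dd M k main_ex \<rho>"
      using trans[OF p(2)[folded main_ex_def]] p(3)[folded main_ex_def] by blast+
    moreover have "cov {} \<longleftrightarrow> vbc_solvable P I" using BC.many_bins[OF True] solvable_iff by blast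
    ultimately show ?thesis by blast
  qed
  then show ?thesis by (intro exI[of _ "{}"]) auto
next
  case False
  then have ln: "l \<le> n" by simp
  let ?idx = "core.idx n" and ?NW = "core.NW n"
  have runs: "\<exists>a. ev h main_ex \<rho> = enc_bool a \<and> sf h Dd M k main_ex \<rho> \<and>
      (a \<longleftrightarrow> (\<exists>q\<le>l. 3 * q \<le> m \<and> isolated_test.accepts ?idx (BC.verts q) k Zn (BC.allowed q) (core.wv r Wn)))"
    if r: "r < 2 ^ NB" and I: "\<rho> ''I'' = Tup (Num r) (enc_vbc I)" for r \<rho>
  proof -
    interpret CR: core_run h Dd M r l d n k m D R1 R2 SV LV Wn Zn cv by (rule run[OF ln r])
    let ?b = "If (V ''n'' <. V ''l'') (Let ''X'' (C 0) (Call unpack_ex)) core_ex"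
    obtain \<rho>' where p: "parsed r \<rho>'" "ev h (parse_ex ?b) \<rho> = ev h ?b \<rho>'" "sf h Dd M k ?b \<rho>' \<longrightarrow> sf h Dd M k (parse_ex ?b) \<rho>"
      using parse_ex[where \<rho> = \<rho> and r = r, OF I] by blast
    have v: "\<rho>' ''n'' = Num n" "\<rho>' ''l'' = Num l" using p(1) by (simp_all add: parsed_def)
    note c = CR.core_ex[OF p(1)[unfolded parsed_def, folded CR.input_vars_def]]
    have "ev h ?b \<rho>' = enc_bool CR.accept" "sf h Dd M k ?b \<rho>'"
      using c v ln counts room(4)[of 0] by simp_all
    then have "ev h main_ex \<rho> = enc_bool CR.accept" "sf h Dd M k main_ex \<rho>"
      using trans[OF p(2)[folded main_ex_def]] p(3)[folded main_ex_def] by blast+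
    then show ?thesis using CR.accept_iff[unfolded core_al core_vs] by blast
  qed
  have sound: "vbc_solvable P I" if r: "r < 2 ^ NB" and q: "q \<le> l" "3 * q \<le> m" and acc: "isolated_test.accepts ?idx (BC.verts q) k Zn (BC.allowed q) (core.wv r Wn)" for r q
  proof -
    interpret CR: core_run h Dd M r l d n k m D R1 R2 SV LV Wn Zn cv by (rule run[OF ln r])
    interpret T: isolated_test ?idx "BC.verts q" k ?NW Wn Zn "BC.allowed q" "core.wv r Wn"
      using CR.test_locale[OF q] unfolding core_vs .
    obtain c where "c \<in> configs (BC.allowed q) (BC.verts q) {..<k}" "exact (BC.verts q) k c" using T.accepts_sound[OF acc] by blast
    then show ?thesis using BC.solvable_if_config[of q c] q solvable_iff by (simp add: k_def m_def)
  qed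
  show ?thesis
  proof (cases "vbc_solvable P I")
    case False
    show ?thesis
    proof (intro exI[of _ "{}"] conjI allI impI)
      fix r \<rho> assume r: "r < 2 ^ NB" and I: "\<rho> ''I'' = Tup (Num r) (enc_vbc I)"
      obtain a where a: "ev h main_ex \<rho> = enc_bool a" "sf h Dd M k main_ex \<rho>"
        "a \<longleftrightarrow> (\<exists>q\<le>l. 3 * q \<le> m \<and> isolated_test.accepts ?idx (BC.verts q) k Zn (BC.allowed q) (core.wv r Wn))"
        using runs[OF r, where \<rho> = \<rho>, OF I] by blast
      have "\<not> a" unfolding a(3) using sound[OF r] False by blast
      then show "\<exists>a. ev h main_ex \<rho> = enc_bool a \<and> sf h Dd M k main_ex \<rho> \<and> (a \<longrightarrow> vbc_solvable P I) \<and> (vbc_solvable P I \<longrightarrow> r \<notin> {} \<longrightarrow> a)"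
        using a(1,2) False by (intro exI[of _ a]) (simp only: simp_thms)
    qed simp
  next
    case True
    then obtain q c where q: "q \<le> l" "3 * q \<le> m" and c: "c \<in> configs (BC.allowed q) (BC.verts q) {..<k}" "exact (BC.verts q) k c"
      using BC.config_if_solvable solvable_iff by (auto simp: k_def m_def)
    let ?F = "elements ?idx (BC.verts q) ` {c \<in> configs (BC.allowed q) (BC.verts q) {..<k}. exact (BC.verts q) k c}"
    define Bad where "Bad = {r. \<not> isolating (\<lambda>j. r div Wn ^ j mod Wn) ?F}"
    have W0: "0 < Wn" by (simp add: Wn_def)
    have n0: "0 < n" using ln BC.l_pos by simp
    have NW0: "0 < ?NW" using n0 by (simp add: core.NW_def core.N_def)
    have z: "0 < (2::nat) ^ NB" by simp
    have "?F \<subseteq> Pow {..<?NW}"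
    proof -
      interpret CR: core_run h Dd M 0 l d n k m D R1 R2 SV LV Wn Zn cv by (rule run[OF ln z])
      interpret T: isolated_test ?idx "BC.verts q" k ?NW Wn Zn "BC.allowed q" "core.wv 0 Wn"
        using CR.test_locale[OF q] unfolding core_vs .
      show ?thesis using T.elements_subset by blast
    qed
    moreover have "?F \<noteq> {}" using c by blast
    ultimately have "card {r \<in> {..<Wn ^ ?NW}. r \<in> Bad} \<le> ?NW * Wn ^ (?NW - 1)"
      unfolding Bad_def mem_Collect_eq by (intro isolation_digits W0)
    then have "3 * card {r \<in> {..<Wn ^ ?NW}. r \<in> Bad} \<le> (3 * ?NW) * Wn ^ (?NW - 1)" by simp
    \<comment> \<open>Here \<open>Wn\<close> is at least three times the number of weights, which
      makes the failure probability at most 1/3.\<close>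
    also have "\<dots> \<le> Wn * Wn ^ (?NW - 1)" using lg(1)[of "3 * ?NW"] by (intro mult_le_mono1) (simp add: Wn_def)
    also have "\<dots> = Wn ^ ?NW" using NW0 by (metis Suc_pred' power_Suc)
    finally have card: "3 * card {r \<in> {..<2 ^ NB}. r \<in> Bad} \<le> 2 ^ NB" unfolding two_pow_NB .
    have complete: "isolated_test.accepts ?idx (BC.verts q) k Zn (BC.allowed q) (core.wv r Wn)" if r: "r < 2 ^ NB" "r \<notin> Bad" for r
    proof -
      interpret CR: core_run h Dd M r l d n k m D R1 R2 SV LV Wn Zn cv by (rule run[OF ln r(1)])
      interpret T: isolated_test ?idx "BC.verts q" k ?NW Wn Zn "BC.allowed q" "core.wv r Wn"
        using CR.test_locale[OF q] unfolding core_vs .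
      have "core.wv r Wn = (\<lambda>j. r div Wn ^ j mod Wn)" by (simp add: fun_eq_iff core.wv_def digit_def)
      then show ?thesis using r(2) by (intro T.accepts_complete) (simp add: Bad_def)
    qed
    show ?thesis
    proof (intro exI[of _ Bad] conjI card allI impI)
      fix r \<rho> assume r: "r < 2 ^ NB" and I: "\<rho> ''I'' = Tup (Num r) (enc_vbc I)"
      obtain a where a: "ev h main_ex \<rho> = enc_bool a" "sf h Dd M k main_ex \<rho>"
        "a \<longleftrightarrow> (\<exists>q\<le>l. 3 * q \<le> m \<and> isolated_test.accepts ?idx (BC.verts q) k Zn (BC.allowed q) (core.wv r Wn))"
        using runs[OF r, where \<rho> = \<rho>, OF I] by blast
      have "a" if "r \<notin> Bad" unfolding a(3) using complete[OF r that] q by blast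
      then show "\<exists>a. ev h main_ex \<rho> = enc_bool a \<and> sf h Dd M k main_ex \<rho> \<and> (a \<longrightarrow> vbc_solvable P I) \<and> (vbc_solvable P I \<longrightarrow> r \<notin> Bad \<longrightarrow> a)"
        using a(1,2) True by blast
    qed
  qed
qed

lemma pre_ex:
  assumes I: "\<rho> ''I'' = enc_vbc I"
  shows "ev h pre_ex \<rho> = Num NB" "sf h Dd M k pre_ex \<rho>"
proof -
  let ?s = "enc_list (map item_val [0..<n])"
  have inp: "tail_of (tail_of (enc_vbc I)) = ?s" by (simp add: enc_vbc_def n_def)
  let ?\<rho>1 = "\<rho>(''s'' := ?s)"
  let ?\<rho>2 = "?\<rho>1(''n'' := Num n)"
  let ?\<rho>3 = "?\<rho>2(''w'' := Num (core.NW n))"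
  let ?\<rho>4 = "?\<rho>3(''Q'' := Num (3 * core.NW n))"
  have 1: "ev h (Tl (Tl (V ''I''))) \<rho> = ?s" using I inp by simp
  have 2: "ev h (count_ex ''s'') ?\<rho>1 = Num n" "sf h Dd M k (count_ex ''s'') ?\<rho>1"
    using count_ex[of ?\<rho>1 "''s''" item_val "[0..<n]"] counts by simp_all
  have 3: "ev h (C 4 *. V ''n'' *. (C 4 *. V ''n'') *. (V ''n'' +. C 1)) ?\<rho>2 = Num (core.NW n)" by (simp add: core.NW_def core.N_def)
  have 4: "ev h (C 3 *. V ''w'') ?\<rho>3 = Num (3 * core.NW n)" by simp
  have rf: "6 * core.NW n + 10 \<le> M" unfolding M_def by (rule room_for)
  have sm: "x < 2 ^ M" if "x \<le> M" for x using le_less_trans[OF that less_exp] .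
  have lge: "ev h lg_ex ?\<rho>4 = Num (lg (3 * core.NW n))" "sf h Dd M k lg_ex ?\<rho>4"
    by (rule lg_ex[where \<rho> = ?\<rho>4 and Q = "3 * core.NW n" and M = M]; use rf in simp)+
  have nn: "4 * n * (4 * n) \<le> core.NW n" unfolding core.NW_def core.N_def by simp
  have "4 * n \<le> 4 * n * (4 * n)" by (cases "n = 0") simp_all
  then have nn2: "4 * n \<le> core.NW n" using nn by (rule order.trans)
  have lt: "4 < (2::nat) ^ M" "3 < (2::nat) ^ M" "4 * n < 2 ^ M" "4 * n * (4 * n) < 2 ^ M" "core.NW n < 2 ^ M" "lg (3 * core.NW n) < 2 ^ M" "Suc n < 2 ^ M"
  proof -
    have "4 \<le> M" "3 \<le> M" "4 * n \<le> M" "4 * n * (4 * n) \<le> M" "core.NW n \<le> M" "lg (3 * core.NW n) \<le> M" "Suc n \<le> M"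
      using rf nn nn2 lg(2)[of "3 * core.NW n"] counts(3) by linarith+
    then show "4 < (2::nat) ^ M" "3 < (2::nat) ^ M" "4 * n < 2 ^ M" "4 * n * (4 * n) < 2 ^ M" "core.NW n < 2 ^ M" "lg (3 * core.NW n) < 2 ^ M" "Suc n < 2 ^ M"
      by (simp_all only: sm)
  qed
  show "ev h pre_ex \<rho> = Num NB" unfolding pre_ex_def ev.simps(8) 1 2 3 4 by (simp add: lge NB_def)
  have "sf h Dd M k (lg_ex *. V ''w'') ?\<rho>4" using lge lt by simp
  moreover have "sf h Dd M k (C 4 *. V ''n'' *. (C 4 *. V ''n'') *. (V ''n'' +. C 1)) ?\<rho>2" using lt counts by simp
  moreover have "sf h Dd M k (C 3 *. V ''w'') ?\<rho>3" using lt by simp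
  ultimately show "sf h Dd M k pre_ex \<rho>" unfolding pre_ex_def sf.simps(8) 1 2 3 4 using 2(2) by simp
qed

end


section \<open>Random bits and the final algorithm\<close>

text \<open>The randomized counterpart of \<open>yields\<close>: the output has distribution
  \<open>\<mu>\<close>, while the bound on the cost holds for every outcome.\<close>

definition draws :: "(val \<times> nat) spmf \<Rightarrow> val spmf \<Rightarrow> nat \<Rightarrow> bool" where
  "draws D \<mu> T \<longleftrightarrow> map_spmf fst D = \<mu> \<and> lossless_spmf D \<and> (\<forall>r \<in> set_spmf D. snd r \<le> T)"

lemma draws_mono: "draws D \<mu> T \<Longrightarrow> T \<le> T' \<Longrightarrow> draws D \<mu> T'"
  unfolding draws_def by fastforce

lemma draws_return: "t \<le> T \<Longrightarrow> draws (return_spmf (w, t)) (return_spmf w) T"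
  unfolding draws_def by simp

lemma draws_bind:
  assumes D: "draws D \<mu> S" and F: "\<And>w s. w \<in> set_spmf \<mu> \<Longrightarrow> s \<le> S \<Longrightarrow> draws (F (w, s)) (\<nu> w) T"
  shows "draws (bind_spmf D F) (bind_spmf \<mu> \<nu>) T"
proof -
  have F': "draws (F r) (\<nu> (fst r)) T" if "r \<in> set_spmf D" for r
  proof -
    have "fst r \<in> set_spmf \<mu>" "snd r \<le> S" using that D unfolding draws_def by auto
    from F[OF this] show ?thesis by simp
  qed
  have "map_spmf fst (bind_spmf D F) = bind_spmf D (\<lambda>r. map_spmf fst (F r))"
    by (simp add: map_spmf_bind_spmf o_def)
  also have "\<dots> = bind_spmf D (\<lambda>r. \<nu> (fst r))"
    by (rule bind_spmf_cong[OF refl]) (use F' in \<open>simp add: draws_def\<close>)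
  also have "\<dots> = bind_spmf \<mu> \<nu>" using D by (auto simp: draws_def bind_map_spmf o_def)
  finally show ?thesis
    using D F' unfolding draws_def by (auto simp only: lossless_bind_spmf set_bind_spmf bind_UNION o_apply)
qed

lemma draws_computes: assumes "computes p v w T" shows "draws (run p v) (return_spmf w) T"
proof -
  have "map_spmf fst (run p v) = map_spmf (\<lambda>_. w) (run p v)"
    by (rule map_spmf_cong[OF refl]) (use assms in \<open>auto simp: computes_def yields_def\<close>)
  then show ?thesis using assms
    by (simp add: computes_def yields_def draws_def map_spmf_conv_bind_spmf bind_spmf_const lossless_weight_spmfD)
qed

lemma draws_Coin: "draws (run Coin v) (map_spmf enc_bool coin_spmf) 1"
proof -
  have "draws (bind_spmf coin_spmf (\<lambda>b. return_spmf (enc_bool b, 1))) (map_spmf enc_bool coin_spmf) 1"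
    unfolding draws_def by (auto simp: map_spmf_bind_spmf o_def map_spmf_conv_bind_spmf set_bind_spmf bind_UNION)
  then show ?thesis by simp
qed

lemma draws_Comp:
  assumes "draws (run p v) \<mu> S" "\<And>w. w \<in> set_spmf \<mu> \<Longrightarrow> draws (run q w) (\<nu> w) T"
  shows "draws (run (Comp p q) v) (bind_spmf \<mu> \<nu>) (1 + S + T)"
proof -
  have "draws (case r of (w, s) \<Rightarrow> bind_spmf (run q w) (\<lambda>(u, t). return_spmf (u, 1 + s + t))) (\<nu> (fst r)) (1 + S + T)"
    if "fst r \<in> set_spmf \<mu>" "snd r \<le> S" for r
  proof -
    have "draws (bind_spmf (run q (fst r)) (\<lambda>(u, t). return_spmf (u, 1 + snd r + t))) (bind_spmf (\<nu> (fst r)) return_spmf) (1 + S + T)"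
      by (rule draws_bind[OF assms(2)[OF that(1)]]) (use that(2) in \<open>auto intro!: draws_return\<close>)
    then show ?thesis by (simp add: case_prod_unfold)
  qed
  then show ?thesis unfolding run.simps
    by (intro draws_bind[OF assms(1)]) auto
qed

lemma draws_Both:
  assumes "draws (run p v) \<mu> S" "draws (run q v) \<nu> T"
  shows "draws (run (Both p q) v) (bind_spmf \<mu> (\<lambda>w. map_spmf (Tup w) \<nu>)) (1 + S + T)"
proof -
  have "draws (bind_spmf (run q v) (\<lambda>(u, t). return_spmf (Tup w u, 1 + s + t))) (map_spmf (Tup w) \<nu>) (1 + S + T)"
    if "s \<le> S" for w s
    unfolding map_spmf_conv_bind_spmf
    by (rule draws_bind[OF assms(2)]) (use that in \<open>auto intro!: draws_return\<close>)
  then show ?thesis unfolding run.simps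
    by (intro draws_bind[OF assms(1)]) auto
qed

lemma draws_Cond_Coin:
  assumes "\<And>b. computes (if b then p else q) v (f b) T"
  shows "draws (run (Cond Coin p q) v) (map_spmf f coin_spmf) (2 + T)"
proof -
  have "draws (bind_spmf (if truth (enc_bool b) then run p v else run q v) (\<lambda>(u, t). return_spmf (u, 1 + r + t))) (return_spmf (f b)) (2 + T)"
    if "r \<le> 1" for b r
  proof -
    have "draws (bind_spmf (run (if b then p else q) v) (\<lambda>(u, t). return_spmf (u, 1 + r + t))) (bind_spmf (return_spmf (f b)) return_spmf) (2 + T)"
      by (rule draws_bind[OF draws_computes[OF assms]]) (use that in \<open>auto intro!: draws_return\<close>)
    then show ?thesis by (cases b) simp_all
  qed
  then have "draws (run (Cond Coin p q) v) (bind_spmf (map_spmf enc_bool coin_spmf) (\<lambda>b. return_spmf (f (truth b)))) (2 + T)"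
    unfolding run.simps(10) by (intro draws_bind[OF draws_Coin]) (auto simp del: run.simps)
  then show ?thesis by (simp add: bind_map_spmf o_def map_spmf_conv_bind_spmf)
qed

lemma draws_Loop_step:
  assumes "computes c v b R" "truth b" "draws (run p v) \<mu> S" "\<And>w. w \<in> set_spmf \<mu> \<Longrightarrow> draws (run (Loop c p) w) (\<nu> w) T"
  shows "draws (run (Loop c p) v) (bind_spmf \<mu> \<nu>) (1 + R + S + T)"
proof -
  have 1: "draws (bind_spmf (run_loop (run c) (run p) w) (\<lambda>(u, t). return_spmf (u, 1 + r + s + t))) (\<nu> w) (1 + R + S + T)"
    if "w \<in> set_spmf \<mu>" "s \<le> S" "r \<le> R" for w s r
  proof -
    have "draws (bind_spmf (run_loop (run c) (run p) w) (\<lambda>(u, t). return_spmf (u, 1 + r + s + t))) (bind_spmf (\<nu> w) return_spmf) (1 + R + S + T)"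
      by (rule draws_bind[OF assms(4)[OF that(1), simplified]]) (use that in \<open>auto intro!: draws_return\<close>)
    then show ?thesis by simp
  qed
  have 2: "draws (bind_spmf (run p v) (\<lambda>(w, s). bind_spmf (run_loop (run c) (run p) w) (\<lambda>(u, t). return_spmf (u, 1 + r + s + t)))) (bind_spmf \<mu> \<nu>) (1 + R + S + T)"
    if "r \<le> R" for r
    by (rule draws_bind[OF assms(3)]) (use 1[OF _ _ that] in auto)
  have "draws (run (Loop c p) v) (bind_spmf (return_spmf b) (\<lambda>_. bind_spmf \<mu> \<nu>)) (1 + R + S + T)"
    unfolding run.simps by (subst run_loop.simps, rule draws_bind[OF draws_computes[OF assms(1)]]) (use 2 assms(2) in auto)
  then show ?thesis by simp
qed

section \<open>Uniform random numbers from coin tosses\<close>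

lemma spmf_bind_coin: "spmf (bind_spmf coin_spmf f) y = (spmf (f True) y + spmf (f False) y) / 2"
  by (simp add: spmf_bind integral_spmf_of_set UNIV_bool)

primrec toss :: "nat \<Rightarrow> nat \<Rightarrow> nat spmf" where
  "toss 0 x = return_spmf x"
| "toss (Suc c) x = bind_spmf coin_spmf (\<lambda>b. toss c (2 * x + of_bool b))"

text \<open>From \<open>x\<close> exactly one sequence of \<open>c\<close> bits leads to
  \<open>y\<close>, namely the low bits of \<open>y\<close>, provided that the rest of
  \<open>y\<close> is \<open>x\<close>.\<close>

lemma spmf_toss: "spmf (toss c x) y = of_bool (y div 2 ^ c = x) / 2 ^ c"
proof (induction c arbitrary: x)
  case (Suc c)
  have e: "y div 2 ^ Suc c = y div 2 ^ c div 2" unfolding power_Suc2 by (rule div_mult2_eq)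
  have "of_bool (y div 2 ^ c = 2 * x + 1) + of_bool (y div 2 ^ c = 2 * x) = (of_bool (y div 2 ^ Suc c = x) :: real)"
    unfolding e by (cases "even (y div 2 ^ c)") (auto elim!: evenE oddE)
  then show ?case unfolding toss.simps spmf_bind_coin Suc.IH by (simp flip: add_divide_distrib)
qed (auto simp: indicator_def)

lemma toss_uniform: "toss c 0 = spmf_of_set {..<2 ^ c}"
proof (rule spmf_eqI)
  fix y :: nat
  have "y div 2 ^ c = 0 \<longleftrightarrow> y < 2 ^ c" by (simp add: div_eq_0_iff)
  then show "spmf (toss c 0) y = spmf (spmf_of_set {..<2 ^ c}) y"
    by (simp add: spmf_toss spmf_of_set indicator_def)
qed

definition shift_in :: "nat \<Rightarrow> prog" where
  "shift_in b = Both (Comp (Both Head (Lit 1)) (Arith Sub)) (Comp (Both (Comp (Both Tail (Lit 2)) (Arith Mul)) (Lit b)) (Arith Add))"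

definition sampler :: prog where
  "sampler = Comp (Loop Head (Cond Coin (shift_in 1) (shift_in 0))) Tail"

lemma computes_shift_in:
  assumes "floorlog 2 c \<le> L" "floorlog 2 (2 * x) \<le> L" "b \<le> 1"
  shows "computes (shift_in b) (Tup (Num c) (Num x)) (Tup (Num (c - 1)) (Num (2 * x + b))) (23 + 3 * L)"
proof -
  let ?s = "Tup (Num c) (Num x)"
  have fx: "floorlog 2 x \<le> L" using assms(2) floorlog_mono[of x "2 * x" 2] by simp
  have b: "floorlog 2 b \<le> 1" using floorlog_mono[OF assms(3), of 2] by (simp add: floorlog_def)
  have h: "computes Head ?s (Num c) 1" using computes_Head[of ?s] by simp
  have t: "computes Tail ?s (Num x) 1" using computes_Tail[of ?s] by simp
  have l1: "computes (Lit 1) ?s (Num 1) 2" by (rule computes_mono[OF computes_Lit]) (simp add: floorlog_def)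
  have l2: "computes (Lit 2) ?s (Num 2) 3" by (rule computes_mono[OF computes_Lit]) (use floorlog2_le[of 2] in simp)
  have lb: "computes (Lit b) ?s (Num b) 2" by (rule computes_mono[OF computes_Lit]) (use b in simp)
  have s: "computes (Arith Sub) (Tup (Num c) (Num 1)) (Num (c - 1)) (2 + L)"
    using computes_mono[OF computes_Arith[of Sub c 1], of "2 + L"] assms(1) by (simp add: floorlog_def)
  have m: "computes (Arith Mul) (Tup (Num x) (Num 2)) (Num (2 * x)) (3 + L)"
    using computes_mono[OF computes_Arith[of Mul x 2], of "3 + L"] fx floorlog2_le[of 2] by (simp add: mult.commute)
  have a: "computes (Arith Add) (Tup (Num (2 * x)) (Num b)) (Num (2 * x + b)) (2 + L)"
    using computes_mono[OF computes_Arith[of Add "2 * x" b], of "2 + L"] assms(2) b by simp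
  show ?thesis unfolding shift_in_def
    by (rule computes_mono[OF computes_Both[OF computes_Comp[OF computes_Both[OF h l1] s]
      computes_Comp[OF computes_Both[OF computes_Comp[OF computes_Both[OF t l2] m] lb] a]]]) simp
qed

text \<open>\<open>i\<close> counts the tosses already made. The sum \<open>c + i\<close> does not
  change, so \<open>L\<close> bounds the length of all intermediate numbers.\<close>

lemma draws_sampler_loop:
  assumes "x < 2 ^ i" "c + i \<le> L"
  shows "draws (run (Loop Head (Cond Coin (shift_in 1) (shift_in 0))) (Tup (Num c) (Num x)))
    (map_spmf (\<lambda>y. Tup (Num 0) (Num y)) (toss c x)) ((c + 1) * (3 * L + 27))"
  using assms
proof (induction c arbitrary: x i)
  case 0
  have h: "computes Head (Tup (Num 0) (Num x)) (Num 0) 1" using computes_Head[of "Tup (Num 0) (Num x)"] by simp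
  show ?case
    using draws_computes[OF computes_mono[OF computes_Loop_exit[OF h], of "3 * L + 27"]] by (simp del: run.simps)
next
  case (Suc c)
  let ?p = "Cond Coin (shift_in 1) (shift_in 0)"
  let ?s = "Tup (Num (Suc c)) (Num x)"
  let ?f = "\<lambda>b. Tup (Num c) (Num (2 * x + of_bool b))"
  have h: "computes Head ?s (Num (Suc c)) 1" using computes_Head[of ?s] by simp
  have fl: "floorlog 2 (Suc c) \<le> L" "floorlog 2 (2 * x) \<le> L"
  proof -
    show "floorlog 2 (Suc c) \<le> L" by (rule order.trans[OF floorlog2_le]) (use Suc.prems in simp)
    have "2 * x < 2 ^ Suc i" using Suc.prems by simp
    also have "(2::nat) ^ Suc i \<le> 2 ^ L" by (rule power_increasing) (use Suc.prems in simp_all)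
    finally show "floorlog 2 (2 * x) \<le> L" by (simp add: floorlog_le_iff)
  qed
  have bd: "draws (run ?p ?s) (map_spmf ?f coin_spmf) (2 + (23 + 3 * L))"
  proof (rule draws_Cond_Coin)
    fix b
    show "computes (if b then shift_in 1 else shift_in 0) ?s (?f b) (23 + 3 * L)"
      using computes_shift_in[OF fl, of "of_bool b"] by (cases b) simp_all
  qed
  have IH: "draws (run (Loop Head ?p) (?f b)) (map_spmf (\<lambda>y. Tup (Num 0) (Num y)) (toss c (2 * x + of_bool b))) ((c + 1) * (3 * L + 27))" for b
    by (rule Suc.IH[where i = "Suc i"]) (use Suc.prems in \<open>auto simp: of_bool_def\<close>)
  have "draws (run (Loop Head ?p) ?s) (bind_spmf (map_spmf ?f coin_spmf) (\<lambda>w. map_spmf (\<lambda>y. Tup (Num 0) (Num y)) (toss c (unN (tail_of w)))))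
    (1 + 1 + (2 + (23 + 3 * L)) + (c + 1) * (3 * L + 27))"
    by (rule draws_Loop_step[OF h _ bd]) (use IH in \<open>auto simp del: run.simps\<close>)
  moreover have "1 + 1 + (2 + (23 + 3 * L)) + (c + 1) * (3 * L + 27) \<le> (Suc c + 1) * (3 * L + 27)" by simp
  ultimately show ?case
    by (simp add: bind_map_spmf o_def map_spmf_bind_spmf draws_mono del: run.simps)
qed

lemma draws_sampler:
  assumes "c \<le> L"
  shows "draws (run sampler (Tup (Num c) (Num 0))) (map_spmf Num (spmf_of_set {..<2 ^ c})) ((L + 1) * (3 * L + 27) + 2)"
proof -
  have le: "(c + 1) * (3 * L + 27) \<le> (L + 1) * (3 * L + 27)" by (rule mult_le_mono1) (use assms in simp)
  have 1: "draws (run (Loop Head (Cond Coin (shift_in 1) (shift_in 0))) (Tup (Num c) (Num 0)))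
    (map_spmf (\<lambda>y. Tup (Num 0) (Num y)) (toss c 0)) ((L + 1) * (3 * L + 27))"
    by (rule draws_mono[OF draws_sampler_loop[where i = 0] le]) (use assms in simp_all)
  have "draws (run sampler (Tup (Num c) (Num 0))) (bind_spmf (map_spmf (\<lambda>y. Tup (Num 0) (Num y)) (toss c 0)) (\<lambda>w. return_spmf (tail_of w)))
     (1 + (L + 1) * (3 * L + 27) + 1)"
    unfolding sampler_def by (rule draws_Comp[OF 1 draws_computes[OF computes_Tail]])
  then show ?thesis by (simp add: bind_map_spmf o_def toss_uniform map_spmf_conv_bind_spmf)
qed

text \<open>The only exponential in \<open>room_for\<close> is \<open>2 ^ lg Q\<close>, which is
  linear in \<open>Q\<close>. What remains is a polynomial in \<open>S\<close>, recognized by the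
  closure rules of \<open>tb\<close> for the exponent 0.\<close>

lemma room_for_bound: "\<exists>K c. \<forall>S n k d. 1 \<le> S \<longrightarrow> n \<le> S \<longrightarrow> k \<le> S \<longrightarrow> d \<le> S \<longrightarrow> room_for S n k d \<le> K * S ^ c"
proof -
  let ?N = "\<lambda>S. 4 * S"
  let ?Q = "\<lambda>S. ?N S * ?N S * (S + 1)"
  let ?W = "\<lambda>S. 2 * (3 * ?Q S) + 1"
  let ?Z = "\<lambda>S. (?N S + S + 1) * ?W S"
  let ?E = "\<lambda>S. ?W S + S * (?W S + ?Z S)"
  let ?B = "\<lambda>S. 1 + S + S + (1 + ?N S + S) * ?N S"
  let ?R = "\<lambda>S. (1 + ?N S + (S + ?B S * ?E S)) * (?N S + 1)"
  let ?T = "\<lambda>S. S + ?R S * (?N S * ?N S) + ?B S * (2 * (?Z S * (S + 1))) + 3 * ?Q S * ?Q S + (S + 1) * ?Z S + 2 * (?Z S * (S + 1)) + ?E S + 6 * ?Q S + ?N S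
         + S * S * (?N S + S + 2) + S + S + S * (2 * S + 6) + 20"
  have "tb 0 (\<lambda>S k. ?T S)" by (intro tb_intros)
  then obtain K c where Kc: "\<And>S :: nat. 1 \<le> S \<Longrightarrow> ?T S \<le> K * S ^ c" unfolding tb_def mult_0_right power_0 mult_1_right by blast
  have "room_for S n k d \<le> ?T S" if "n \<le> S" "k \<le> S" "d \<le> S" for S n k d
  proof -
    have Q: "4 * n * (4 * n) * (n + 1) \<le> ?Q S" using that by (intro add_mono mult_le_mono order.refl)
    \<comment> \<open>The summand 1 in \<open>?W\<close> covers the instance without items, where
      the power is \<open>2 ^ 0\<close>.\<close>
    have W: "2 ^ lg (3 * (4 * n * (4 * n) * (n + 1))) \<le> ?W S"
    proof (cases "3 * (4 * n * (4 * n) * (n + 1)) = 0")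
      case True
      then show ?thesis unfolding True using lg(2)[of 0] by simp
    next
      case False
      then have "2 ^ lg (3 * (4 * n * (4 * n) * (n + 1))) \<le> 2 * (3 * (4 * n * (4 * n) * (n + 1)))" by (intro lg(3)) simp
      also have "\<dots> \<le> 2 * (3 * ?Q S)" by (intro mult_le_mono order.refl Q)
      finally show ?thesis by simp
    qed
    show ?thesis unfolding room_for_def Let_def
      using that by (intro add_mono mult_le_mono order.refl Q W)
  qed
  then show ?thesis using Kc by (meson order.trans)
qed

text \<open>Marked loops occur one after the other and never inside each other. This is the point at
  which the running time gets a single factor \<open>2 ^ k\<close>.\<close>

lemma nest_main: "nest main_ex \<le> 1" and nest_pre: "nest pre_ex \<le> 1"
  by (simp_all add: main_ex_def pre_ex_def parse_ex_def core_ex_def lg_ex_def count_ex_def vec_ex_def test_ex_def matrix_ex_def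
    edge_ex_def weight_ex_def allowed_ex_def cov_ex_def bit_ex_def unpack_ex_def zeta_ex_def bird_ex_def step_ex_def entry_ex_def digit_ex_def)


text \<open>The pair of \<open>NB\<close> and 0 is the initial state of the sampler: tosses left and
  bits so far. The drawn number is then paired with the untouched input.\<close>

definition decider :: "prog \<Rightarrow> prog" where
  "decider q = Comp (Both (Comp (Both (Comp (Both Ident (Lit 0)) (compile q pre_ex [''I''])) (Lit 0)) sampler) Ident)
     (Comp (Both Ident (Lit 0)) (compile q main_ex [''I'']))"

lemma computes_compile1:
  assumes "cmp_ok h D q e [x] T" "1 \<le> M" "k < M" "sf h D M k e (lookup [(x, v)])"
  shows "computes (Comp (Both Ident (Lit 0)) (compile q e [x])) v (ev h e (lookup [(x, v)])) (4 + T M k)"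
proof -
  have "computes (compile q e [x]) (pack_env [(x, v)]) (ev h e (lookup [(x, v)])) (T M k)"
    by (rule cmp_okD[OF assms(1) _ assms(2-4)]) simp
  then have 1: "computes (compile q e [x]) (Tup v (Num 0)) (ev h e (lookup [(x, v)])) (T M k)" by simp
  have "computes (Lit 0) v (Num 0) 1" by (rule computes_mono[OF computes_Lit]) (simp add: floorlog_def)
  from computes_Comp[OF computes_Both[OF computes_Ident this] 1] show ?thesis
    by (rule computes_mono) simp
qed

lemma draws_decider:
  assumes pre: "cmp_ok h D q pre_ex [''I''] T\<^sub>1" and main: "cmp_ok h D q main_ex [''I''] T\<^sub>2"
    and M: "1 \<le> M" "k < M" "NB \<le> M"
    and pre_ev: "ev h pre_ex (lookup [(''I'', v)]) = Num NB" "sf h D M k pre_ex (lookup [(''I'', v)])"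
    and main_ev: "\<And>r. r < 2 ^ NB \<Longrightarrow> ev h main_ex (lookup [(''I'', Tup (Num r) v)]) = enc_bool (a r)"
      "\<And>r. r < 2 ^ NB \<Longrightarrow> sf h D M k main_ex (lookup [(''I'', Tup (Num r) v)])"
  shows "draws (run (decider q) v) (map_spmf (\<lambda>r. enc_bool (a r)) (spmf_of_set {..<2 ^ NB}))
    (T\<^sub>1 M k + T\<^sub>2 M k + (M + 1) * (3 * M + 27) + 16)"
proof -
  let ?pre = "Comp (Both Ident (Lit 0)) (compile q pre_ex [''I''])"
  let ?main = "Comp (Both Ident (Lit 0)) (compile q main_ex [''I''])"
  let ?U = "spmf_of_set {..<2 ^ NB} :: nat spmf"
  let ?S = "(M + 1) * (3 * M + 27) + 2"
  have "computes ?pre v (Num NB) (4 + T\<^sub>1 M k)"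
    using computes_compile1[OF pre M(1,2) pre_ev(2)] unfolding pre_ev(1) .
  moreover have "computes (Lit 0) v (Num 0) 1" by (rule computes_mono[OF computes_Lit]) (simp add: floorlog_def)
  ultimately have 1: "computes (Both ?pre (Lit 0)) v (Tup (Num NB) (Num 0)) (1 + (4 + T\<^sub>1 M k) + 1)" by (rule computes_Both)
  have 2: "draws (run (Comp (Both ?pre (Lit 0)) sampler) v) (map_spmf Num ?U) (1 + (1 + (4 + T\<^sub>1 M k) + 1) + ?S)"
    using draws_Comp[OF draws_computes[OF 1], of sampler "\<lambda>_. map_spmf Num ?U" ?S] draws_sampler[OF M(3)]
    by (simp del: run.simps)
  have 3: "draws (run (Both (Comp (Both ?pre (Lit 0)) sampler) Ident) v) (map_spmf (\<lambda>r. Tup (Num r) v) ?U)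
      (1 + (1 + (1 + (4 + T\<^sub>1 M k) + 1) + ?S) + 1)"
    using draws_Both[OF 2 draws_computes[OF computes_Ident]]
    by (simp add: bind_map_spmf o_def map_spmf_conv_bind_spmf del: run.simps)
  have "draws (run ?main w) (return_spmf (enc_bool (a (unN (head_of w))))) (4 + T\<^sub>2 M k)"
    if w: "w \<in> set_spmf (map_spmf (\<lambda>r. Tup (Num r) v) ?U)" for w
  proof -
    obtain r where r: "w = Tup (Num r) v" "r < 2 ^ NB" using w by auto
    have "computes ?main w (enc_bool (a r)) (4 + T\<^sub>2 M k)"
      using computes_compile1[OF main M(1,2) main_ev(2)[OF r(2)]] unfolding r(1) main_ev(1)[OF r(2)] .
    from draws_computes[OF this] show ?thesis unfolding r(1) by (simp only: head_of.simps unN.simps)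
  qed
  from draws_Comp[OF 3 this]
  have "draws (run (decider q) v) (bind_spmf (map_spmf (\<lambda>r. Tup (Num r) v) ?U) (\<lambda>w. return_spmf (enc_bool (a (unN (head_of w))))))
     (1 + (1 + (1 + (1 + (4 + T\<^sub>1 M k) + 1) + ?S) + 1) + (4 + T\<^sub>2 M k))" unfolding decider_def .
  then have "draws (run (decider q) v) (map_spmf (\<lambda>r. enc_bool (a r)) ?U)
     (1 + (1 + (1 + (1 + (4 + T\<^sub>1 M k) + 1) + ?S) + 1) + (4 + T\<^sub>2 M k))"
    by (simp add: bind_map_spmf o_def map_spmf_conv_bind_spmf del: run.simps)
  then show ?thesis by (rule draws_mono) simp
qed

lemma spmf_map_enc_bool:
  assumes "3 * card {r \<in> {..<2 ^ N}. a r \<noteq> b} \<le> 2 ^ N"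
  shows "spmf (map_spmf (\<lambda>r. enc_bool (a r)) (spmf_of_set {..<2 ^ N :: nat})) (enc_bool b) \<ge> 2 / 3"
proof -
  let ?G = "{r \<in> {..<2 ^ N}. a r = b}" and ?F = "{r \<in> {..<2 ^ N}. a r \<noteq> b}"
  have G: "{..<2 ^ N} \<inter> (\<lambda>r. enc_bool (a r)) -` {enc_bool b} = ?G" by (auto simp: of_bool_def split: if_splits)
  have "card ?G + card ?F = card (?G \<union> ?F)" by (rule card_Un_disjoint[symmetric]) auto
  also have "?G \<union> ?F = {..<2 ^ N}" by auto
  finally have "card ?G + card ?F = 2 ^ N" by simp
  then have "2 * 2 ^ N \<le> 3 * card ?G" using assms by linarith
  then have "real (2 * 2 ^ N) \<le> real (3 * card ?G)" by (rule of_nat_mono)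
  then show ?thesis unfolding spmf_map measure_spmf_of_set G by (simp add: pos_le_divide_eq)
qed

text \<open>Reading the oracle \<open>h\<close> off the output of \<open>q\<close> avoids proving that \<open>enc_vec\<close> is injective.\<close>

lemma decision_oracle:
  assumes "poly_time_decidable enc_vec {x. nonneg_vec x} P"
  shows "\<exists>q C c h. (\<forall>x. nonneg_vec x \<longrightarrow> h (enc_vec x) = enc_bool (P x)) \<and>
    (\<forall>M w. (\<exists>x. nonneg_vec x \<and> w = enc_vec x \<and> bits w \<le> M) \<longrightarrow> computes q w (h w) (C * M ^ c))"
proof -
  obtain q C c where q: "\<And>x. nonneg_vec x \<Longrightarrow> runs_within q (enc_vec x) (real C * real (bits (enc_vec x)) ^ c)"
      "\<And>x. nonneg_vec x \<Longrightarrow> fst ` set_spmf (run q (enc_vec x)) = {enc_bool (P x)}"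
    using assms unfolding poly_time_decidable_def by blast
  define h where "h w = the_elem (fst ` set_spmf (run q w))" for w
  have h: "h (enc_vec x) = enc_bool (P x)" if "nonneg_vec x" for x
    unfolding h_def q(2)[OF that] by simp
  have "computes q w (h w) (C * M ^ c)" if ex: "\<exists>x. nonneg_vec x \<and> w = enc_vec x \<and> bits w \<le> M" for M w
  proof -
    obtain x where x: "nonneg_vec x" "w = enc_vec x" "bits w \<le> M" using ex by blast
    have o: "fst ` set_spmf (run q w) = {h w}" unfolding x(2) h[OF x(1)] by (rule q(2)[OF x(1)])
    have "t \<le> C * M ^ c" if "(u, t) \<in> set_spmf (run q w)" for u t
    proof -
      have "real t \<le> real C * real (bits w) ^ c" using q(1)[OF x(1)] that x(2) unfolding runs_within_def by blast
      then have "real t \<le> real (C * bits w ^ c)" by simp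
      then have "t \<le> C * bits w ^ c" by (simp only: of_nat_le_iff)
      also have "\<dots> \<le> C * M ^ c" using x(3) by (intro mult_le_mono power_mono order.refl) simp_all
      finally show ?thesis .
    qed
    moreover have "fst r = h w" if "r \<in> set_spmf (run q w)" for r using o that by blast
    moreover have "lossless_spmf (run q w)" using q(1)[OF x(1)] x(2) unfolding runs_within_def by blast
    ultimately show ?thesis unfolding computes_def yields_def by fastforce
  qed
  then show ?thesis
    by (intro exI[of _ q] exI[of _ C] exI[of _ c] exI[of _ h] conjI allI impI h)
qed

theorem theorem7:
  fixes P :: "rat list \<Rightarrow> bool"
  assumes "covering_property P"
  shows "\<exists>(p :: prog) (C :: nat) (c :: nat).
    monte_carlo_decides p enc_vbc {I. vbc_instance P I} (vbc_solvable P)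
      (\<lambda>I. real C * 2 ^ card (small I) * real (bits (enc_vbc I)) ^ c)"
proof -
  have decidable: "poly_time_decidable enc_vec {x. nonneg_vec x} P"
    and P_mono: "\<And>x y. nonneg_vec x \<Longrightarrow> nonneg_vec y \<Longrightarrow> list_all2 (\<le>) x y \<Longrightarrow> P x \<Longrightarrow> P y"
    using assms unfolding covering_property_def by blast+
  obtain q Cq cq h where h: "\<forall>x. nonneg_vec x \<longrightarrow> h (enc_vec x) = enc_bool (P x)"
    and q: "\<forall>M w. (\<exists>x. nonneg_vec x \<and> w = enc_vec x \<and> bits w \<le> M) \<longrightarrow> computes q w (h w) (Cq * M ^ cq)"
    using decision_oracle[OF decidable] by (elim exE conjE) (rule that)
  \<comment> \<open>Only well-formed queries are permitted, because the program for the covering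
    property promises nothing on other inputs.\<close>
  define Dd where "Dd M w \<longleftrightarrow> (\<exists>x. nonneg_vec x \<and> w = enc_vec x \<and> bits w \<le> M)" for M w
  have q': "computes q w (h w) (Cq * M ^ cq)" if "1 \<le> M" "Dd M w" for M w
    using q[rule_format, of w M] that(2) unfolding Dd_def .
  obtain T\<^sub>1 where T1: "tb (nest pre_ex) T\<^sub>1" and pre: "cmp_ok h Dd q pre_ex [''I''] T\<^sub>1"
    using compile_correct[where h = h and D = Dd and q = q and Kq = Cq and dq = cq and e = pre_ex and c = "[''I'']", OF q'] by blast
  obtain T\<^sub>2 where T2: "tb (nest main_ex) T\<^sub>2" and main: "cmp_ok h Dd q main_ex [''I''] T\<^sub>2"
    using compile_correct[where h = h and D = Dd and q = q and Kq = Cq and dq = cq and e = main_ex and c = "[''I'']", OF q'] by blast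
  let ?T = "\<lambda>M k. T\<^sub>1 M k + T\<^sub>2 M k + (M + 1) * (3 * M + 27) + 16"
  have "tb 0 (\<lambda>M k. (M + 1) * (3 * M + 27))" by (intro tb_intros)
  then have "tb 1 (\<lambda>M k. (M + 1) * (3 * M + 27))" by (rule tb_le) simp
  then have "tb 1 ?T" by (intro tb_add tb_const tb_le[OF T1 nest_pre] tb_le[OF T2 nest_main])
  then obtain K e where Ke: "\<And>M k. 1 \<le> M \<Longrightarrow> ?T M k \<le> K * 2 ^ k * M ^ e" unfolding tb_def mult_1_right by blast
  obtain K' e' where K': "\<And>S n k d. 1 \<le> S \<Longrightarrow> n \<le> S \<Longrightarrow> k \<le> S \<Longrightarrow> d \<le> S \<Longrightarrow> room_for S n k d \<le> K' * S ^ e'"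
    using room_for_bound by blast
  have run: "runs_within (decider q) (enc_vbc I) (real (K * K' ^ e) * 2 ^ card (small I) * real (bits (enc_vbc I)) ^ (e' * e)) \<and>
      spmf (map_spmf fst (run (decider q) (enc_vbc I))) (enc_bool (vbc_solvable P I)) \<ge> 2 / 3"
    if inst: "vbc_instance P I" for I
  proof -
    interpret IR: instance_run P I h Dd
    proof
      show "vbc_instance P I" by (rule inst)
      show "P y" if "nonneg_vec x" "nonneg_vec y" "list_all2 (\<le>) x y" "P x" for x y
        by (rule P_mono[OF that])
      show "h (enc_vec x) = enc_bool (P x)" if "nonneg_vec x" for x by (rule h[rule_format, OF that])
      show "Dd M (enc_vec x)" if "nonneg_vec x" "bits (enc_vec x) \<le> M" for x M
        using that unfolding Dd_def by blast
    qed
    obtain Bad where bad: "3 * card {r \<in> {..<2 ^ IR.NB}. r \<in> Bad} \<le> 2 ^ IR.NB"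
      and ans: "\<forall>r<2 ^ IR.NB. \<forall>\<rho>. \<rho> ''I'' = Tup (Num r) (enc_vbc I) \<longrightarrow>
        (\<exists>a. ev h main_ex \<rho> = enc_bool a \<and> sf h Dd IR.M IR.k main_ex \<rho> \<and>
           (a \<longrightarrow> vbc_solvable P I) \<and> (vbc_solvable P I \<longrightarrow> r \<notin> Bad \<longrightarrow> a))"
      using IR.main_correct by blast
    let ?\<rho> = "\<lambda>r. lookup [(''I'', Tup (Num r) (enc_vbc I))]"
    have "\<forall>r. \<exists>a. r < 2 ^ IR.NB \<longrightarrow> ev h main_ex (?\<rho> r) = enc_bool a \<and> sf h Dd IR.M IR.k main_ex (?\<rho> r) \<and>
           (a \<longrightarrow> vbc_solvable P I) \<and> (vbc_solvable P I \<longrightarrow> r \<notin> Bad \<longrightarrow> a)"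
    proof (rule allI)
      fix r
      have "?\<rho> r ''I'' = Tup (Num r) (enc_vbc I)" by simp
      from ans[rule_format, where \<rho> = "?\<rho> r" and r = r, OF _ this] show "\<exists>a. r < 2 ^ IR.NB \<longrightarrow> ev h main_ex (?\<rho> r) = enc_bool a \<and> sf h Dd IR.M IR.k main_ex (?\<rho> r) \<and>
           (a \<longrightarrow> vbc_solvable P I) \<and> (vbc_solvable P I \<longrightarrow> r \<notin> Bad \<longrightarrow> a)"
        by (cases "r < 2 ^ IR.NB") (simp_all only: simp_thms)
    qed
    from choice[OF this] obtain a where A: "\<forall>r. r < 2 ^ IR.NB \<longrightarrow> ev h main_ex (?\<rho> r) = enc_bool (a r) \<and> sf h Dd IR.M IR.k main_ex (?\<rho> r) \<and>
           (a r \<longrightarrow> vbc_solvable P I) \<and> (vbc_solvable P I \<longrightarrow> r \<notin> Bad \<longrightarrow> a r)" ..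
    note a = A[THEN spec, THEN mp, THEN conjunct1] A[THEN spec, THEN mp, THEN conjunct2, THEN conjunct1]
    have sound: "vbc_solvable P I" if "r < 2 ^ IR.NB" "a r" for r
      using A[THEN spec, THEN mp, OF that(1), THEN conjunct2, THEN conjunct2, THEN conjunct1] that(2) by (rule mp)
    have complete: "a r" if "r < 2 ^ IR.NB" "vbc_solvable P I" "r \<notin> Bad" for r
      using A[THEN spec, THEN mp, OF that(1), THEN conjunct2, THEN conjunct2, THEN conjunct2] that(2,3) by (simp only: simp_thms)
    have S: "IR.S < IR.M" by (rule IR.room(1)[of 0]) simp
    have nkd: "IR.n \<le> IR.S" "IR.k \<le> IR.S" "IR.d \<le> IR.S"
      using IR.sizes(1,2) IR.km by linarith+
    have M: "1 \<le> IR.M" "IR.k < IR.M" using S nkd by linarith+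
    have NB: "IR.NB \<le> IR.M"
    proof -
      have "IR.NB = lg (3 * core.NW IR.n) * core.NW IR.n" by (simp add: IR.NB_def)
      also have "\<dots> \<le> 3 * core.NW IR.n * core.NW IR.n" by (intro mult_le_mono lg(2) order.refl)
      also have "\<dots> \<le> room_for IR.S IR.n IR.k IR.d"
        unfolding room_for_def Let_def core.NW_def core.N_def by (simp only: trans_le_add1 trans_le_add2 order.refl)
      finally show ?thesis by (simp only: IR.M_def)
    qed
    have I: "lookup [(''I'', enc_vbc I)] ''I'' = enc_vbc I" by simp
    have D: "draws (run (decider q) (enc_vbc I)) (map_spmf (\<lambda>r. enc_bool (a r)) (spmf_of_set {..<2 ^ IR.NB})) (?T IR.M IR.k)"
      by (rule draws_decider[OF pre main M NB IR.pre_ex[where \<rho> = "lookup [(''I'', enc_vbc I)]", OF I] a])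
    have "?T IR.M IR.k \<le> K * 2 ^ IR.k * IR.M ^ e" by (rule Ke[OF M(1)])
    \<comment> \<open>The bound \<open>M\<close> is replaced by a polynomial in the input size; the
      factor \<open>2 ^ k\<close> is not touched, as it depends on \<open>k\<close> alone.\<close>
    also have "\<dots> \<le> K * 2 ^ IR.k * (K' * IR.S ^ e') ^ e"
    proof (intro mult_le_mono power_mono order.refl)
      have "1 \<le> IR.S" unfolding IR.S_def by (simp add: enc_vbc_def)
      from K'[OF this nkd] show "IR.M \<le> K' * IR.S ^ e'" by (simp only: IR.M_def)
    qed simp_all
    also have "\<dots> = (K * K' ^ e) * 2 ^ card (small I) * bits (enc_vbc I) ^ (e' * e)"
      by (simp add: IR.k_eq IR.S_def power_mult_distrib power_mult)
    finally have T: "real (?T IR.M IR.k) \<le> real ((K * K' ^ e) * 2 ^ card (small I) * bits (enc_vbc I) ^ (e' * e))"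
      by (rule of_nat_mono)
    have "3 * card {r \<in> {..<2 ^ IR.NB}. a r \<noteq> vbc_solvable P I} \<le> 2 ^ IR.NB"
    proof -
      have "card {r \<in> {..<2 ^ IR.NB}. a r \<noteq> vbc_solvable P I} \<le> card {r \<in> {..<2 ^ IR.NB}. r \<in> Bad}"
        using sound complete by (intro card_mono) auto
      then show ?thesis using bad by linarith
    qed
    from spmf_map_enc_bool[OF this]
    have "spmf (map_spmf fst (run (decider q) (enc_vbc I))) (enc_bool (vbc_solvable P I)) \<ge> 2 / 3"
      using D unfolding draws_def by (simp only:)
    moreover have "runs_within (decider q) (enc_vbc I) (real (K * K' ^ e) * 2 ^ card (small I) * real (bits (enc_vbc I)) ^ (e' * e))"
    proof -
      have "real t \<le> real (K * K' ^ e) * 2 ^ card (small I) * real (bits (enc_vbc I)) ^ (e' * e)"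
        if "(w, t) \<in> set_spmf (run (decider q) (enc_vbc I))" for w t
      proof -
        have "t \<le> ?T IR.M IR.k" using D that unfolding draws_def by fastforce
        then have "real t \<le> real (?T IR.M IR.k)" by (rule of_nat_mono)
        from order.trans[OF this T] show ?thesis by (simp only: of_nat_mult of_nat_power of_nat_numeral)
      qed
      then show ?thesis using D unfolding draws_def runs_within_def by blast
    qed
    ultimately show ?thesis by (rule conjI[rotated])
  qed
  show ?thesis
    by (intro exI[of _ "decider q"] exI[of _ "K * K' ^ e"] exI[of _ "e' * e"])
      (use run in \<open>simp add: monte_carlo_decides_def\<close>)
qed

end
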